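(* Let $G$ be a graph (with $n$ vertices and $m$ edges) that is not skeletal. Then there is a skeletal subgraph $G'$ of $G$ such that: (1) if $G$ is quasi-line (resp. claw-free) then $G'$ is also quasi-line (resp. claw-free); (2) $\chi(G')=\chi(G)$ and $\chi_f(G')=\chi_f(G)$; (3) if $\chi(\overline{G})=3$ then $\chi(\overline{G'})=3$. Furthermore $G'$ can be found in $O(m(m^2+n^{5/2}))$ time, and given a $k$-colouring of $G'$ one can construct a $k$-colouring of $G$ in $O(mn^{5/2})$ time.
   Context: A homogeneous pair of cliques in $G$ is a pair $(A,B)$ of disjoint nonempty cliques with $|A\cup B|\geq 3$ such that every vertex outside $A\cup B$ is adjacent to all or none of $A$, and to all or none of $B$. It is skeletal if no edge between $A$ and $B$ can be removed without changing the clique number of $G[A\cup B]$. A graph is skeletal if it contains no nonskeletal homogeneous pair of cliques. A graph is quasi-line if the neighbourhood of every vertex is the union of two cliques; claw-free means no vertex has three mutually nonadjacent neighbours. $\chi_f$ denotes fractional chromatic number and $\overline G$ the complement. *)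

theory Defs
  imports Complex_Main
begin

section \<open>Finite simple graphs\<close>

record 'a graph =
  verts :: "'a set"
  edges :: "'a set set"

definition fin_graph :: "'a graph \<Rightarrow> bool" where
  "fin_graph G \<longleftrightarrow> finite (verts G) \<and>
     (\<forall>e\<in>edges G. \<exists>u\<in>verts G. \<exists>v\<in>verts G. u \<noteq> v \<and> e = {u, v})"

definition adj :: "'a graph \<Rightarrow> 'a \<Rightarrow> 'a \<Rightarrow> bool" where
  "adj G u v \<longleftrightarrow> {u, v} \<in> edges G"

definition nbhd :: "'a graph \<Rightarrow> 'a \<Rightarrow> 'a set" where
  "nbhd G v = {u \<in> verts G. adj G v u}"

definition subgraph :: "'a graph \<Rightarrow> 'a graph \<Rightarrow> bool" where
  "subgraph H G \<longleftrightarrow> fin_graph H \<and> verts H \<subseteq> verts G \<and> edges H \<subseteq> edges G"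

definition induced :: "'a graph \<Rightarrow> 'a set \<Rightarrow> 'a graph" where
  "induced G S = \<lparr>verts = verts G \<inter> S, edges = {e \<in> edges G. e \<subseteq> S}\<rparr>"

definition delete_edge :: "'a graph \<Rightarrow> 'a \<Rightarrow> 'a \<Rightarrow> 'a graph" where
  "delete_edge G u v = \<lparr>verts = verts G, edges = edges G - {{u, v}}\<rparr>"

definition complement :: "'a graph \<Rightarrow> 'a graph" where
  "complement G = \<lparr>verts = verts G,
     edges = {{u, v} | u v. u \<in> verts G \<and> v \<in> verts G \<and> u \<noteq> v \<and> \<not> adj G u v}\<rparr>"

definition clique :: "'a graph \<Rightarrow> 'a set \<Rightarrow> bool" where
  "clique G K \<longleftrightarrow> K \<subseteq> verts G \<and> (\<forall>u\<in>K. \<forall>v\<in>K. u \<noteq> v \<longrightarrow> adj G u v)"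

definition stable :: "'a graph \<Rightarrow> 'a set \<Rightarrow> bool" where
  "stable G S \<longleftrightarrow> S \<subseteq> verts G \<and> (\<forall>u\<in>S. \<forall>v\<in>S. \<not> adj G u v)"

definition clique_number :: "'a graph \<Rightarrow> nat" where
  "clique_number G = Max (card ` {K. clique G K})"

definition quasi_line :: "'a graph \<Rightarrow> bool" where
  "quasi_line G \<longleftrightarrow>
     (\<forall>v\<in>verts G. \<exists>K L. clique G K \<and> clique G L \<and> nbhd G v = K \<union> L)"

definition claw_free :: "'a graph \<Rightarrow> bool" where
  "claw_free G \<longleftrightarrow> \<not> (\<exists>v\<in>verts G. \<exists>S. S \<subseteq> nbhd G v \<and> card S = 3 \<and> stable G S)"

section \<open>Colourings\<close>

definition k_colouring :: "'a graph \<Rightarrow> nat \<Rightarrow> ('a \<Rightarrow> nat) \<Rightarrow> bool" where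
  "k_colouring G k f \<longleftrightarrow> (\<forall>v\<in>verts G. f v < k) \<and>
     (\<forall>u\<in>verts G. \<forall>v\<in>verts G. adj G u v \<longrightarrow> f u \<noteq> f v)"

definition chromatic_number :: "'a graph \<Rightarrow> nat" where
  "chromatic_number G = (LEAST k. \<exists>f. k_colouring G k f)"

definition fractional_colouring :: "'a graph \<Rightarrow> ('a set \<Rightarrow> real) \<Rightarrow> bool" where
  "fractional_colouring G w \<longleftrightarrow> (\<forall>S. stable G S \<longrightarrow> w S \<ge> 0) \<and>
     (\<forall>v\<in>verts G. (\<Sum>S | stable G S \<and> v \<in> S. w S) \<ge> 1)"

definition fractional_chromatic_number :: "'a graph \<Rightarrow> real" where
  "fractional_chromatic_number G =
     Inf {(\<Sum>S | stable G S. w S) | w. fractional_colouring G w}"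

section \<open>Skeletal graphs\<close>

definition homogeneous_pair :: "'a graph \<Rightarrow> 'a set \<Rightarrow> 'a set \<Rightarrow> bool" where
  "homogeneous_pair G A B \<longleftrightarrow>
     clique G A \<and> clique G B \<and> A \<noteq> {} \<and> B \<noteq> {} \<and> A \<inter> B = {} \<and> card (A \<union> B) \<ge> 3 \<and>
     (\<forall>v\<in>verts G - (A \<union> B).
        ((\<forall>a\<in>A. adj G v a) \<or> (\<forall>a\<in>A. \<not> adj G v a)) \<and>
        ((\<forall>b\<in>B. adj G v b) \<or> (\<forall>b\<in>B. \<not> adj G v b)))"

definition skeletal_pair :: "'a graph \<Rightarrow> 'a set \<Rightarrow> 'a set \<Rightarrow> bool" where
  "skeletal_pair G A B \<longleftrightarrow>
     (\<forall>a\<in>A. \<forall>b\<in>B. adj G a b \<longrightarrow>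
        clique_number (induced (delete_edge G a b) (A \<union> B)) \<noteq>
        clique_number (induced G (A \<union> B)))"

definition skeletal :: "'a graph \<Rightarrow> bool" where
  "skeletal G \<longleftrightarrow> (\<forall>A B. homogeneous_pair G A B \<longrightarrow> skeletal_pair G A B)"

section \<open>Random access machine with words of bounded size\<close>

text \<open>
  Running times are measured on a unit-cost random access machine, presented as a while language
  over scalar variables and arrays of natural numbers. Every value that occurs, including
  intermediate results and array indices, has to be at most a bound \<open>W\<close>; a computation that
  exceeds the bound is stuck. With \<open>W\<close> polynomial in the size of the input this is the usual
  word RAM with words of logarithmic length.
\<close>

datatype binop = Plus | Minus | Times | Less | Equal

datatype expr = Const nat | Var string | Read string expr | Bin binop expr expr

datatype com =
    Skip
  | Assign string expr
  | Write string expr expr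
  | Seq com com
  | If expr com com
  | While expr com

record store =
  vars :: "string \<Rightarrow> nat"
  arrays :: "string \<Rightarrow> nat \<Rightarrow> nat"

definition word :: "nat \<Rightarrow> nat \<Rightarrow> nat option" where
  "word W x = (if x \<le> W then Some x else None)"

text \<open>Subtraction is truncated at \<open>0\<close>; comparisons return \<open>0\<close> or \<open>1\<close>.\<close>

fun binop_val :: "binop \<Rightarrow> nat \<Rightarrow> nat \<Rightarrow> nat" where
  "binop_val Plus x y = x + y"
| "binop_val Minus x y = x - y"
| "binop_val Times x y = x * y"
| "binop_val Less x y = of_bool (x < y)"
| "binop_val Equal x y = of_bool (x = y)"

fun expr_val :: "nat \<Rightarrow> store \<Rightarrow> expr \<Rightarrow> nat option" where
  "expr_val W s (Const x) = word W x"
| "expr_val W s (Var x) = word W (vars s x)"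
| "expr_val W s (Read a e) = Option.bind (expr_val W s e) (\<lambda>i. word W (arrays s a i))"
| "expr_val W s (Bin b e1 e2) =
     Option.bind (expr_val W s e1)
       (\<lambda>x. Option.bind (expr_val W s e2) (\<lambda>y. word W (binop_val b x y)))"

text \<open>
  \<open>exec W c s t s'\<close>: started in \<open>s\<close>, the program \<open>c\<close> terminates in \<open>s'\<close> after \<open>t\<close> steps. Every
  assignment and every evaluation of a guard is one step. This agrees up to a constant factor,
  depending on the program only, with charging for each operation inside an expression.
\<close>

inductive exec :: "nat \<Rightarrow> com \<Rightarrow> store \<Rightarrow> nat \<Rightarrow> store \<Rightarrow> bool" for W where
  Skip: "exec W Skip s 1 s"
| Assign: "expr_val W s e = Some x \<Longrightarrow>
     exec W (Assign v e) s 1 (s\<lparr>vars := (vars s)(v := x)\<rparr>)"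
| Write: "expr_val W s i = Some j \<Longrightarrow> expr_val W s e = Some x \<Longrightarrow>
     exec W (Write a i e) s 1
       (s\<lparr>arrays := (arrays s)(a := (arrays s a)(j := x))\<rparr>)"
| Seq: "exec W c1 s t1 s1 \<Longrightarrow> exec W c2 s1 t2 s2 \<Longrightarrow> exec W (Seq c1 c2) s (t1 + t2) s2"
| IfTrue: "expr_val W s e = Some x \<Longrightarrow> x \<noteq> 0 \<Longrightarrow> exec W c1 s t s1 \<Longrightarrow>
     exec W (If e c1 c2) s (1 + t) s1"
| IfFalse: "expr_val W s e = Some 0 \<Longrightarrow> exec W c2 s t s1 \<Longrightarrow>
     exec W (If e c1 c2) s (1 + t) s1"
| WhileFalse: "expr_val W s e = Some 0 \<Longrightarrow> exec W (While e c) s 1 s"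
| WhileTrue: "expr_val W s e = Some x \<Longrightarrow> x \<noteq> 0 \<Longrightarrow> exec W c s t1 s1 \<Longrightarrow>
     exec W (While e c) s1 t2 s2 \<Longrightarrow> exec W (While e c) s (1 + t1 + t2) s2"

section \<open>Input and output of graphs and colourings\<close>

text \<open>
  A graph is passed to a program by means of an enumeration \<open>vs\<close> of its vertices, as the number
  \<open>n\<close> of vertices and the adjacency matrix, row by row; all other memory is initially \<open>0\<close>.
\<close>

definition graph_input :: "'a list \<Rightarrow> 'a graph \<Rightarrow> store" where
  "graph_input vs G =
     \<lparr>vars = (\<lambda>_. 0)(''n'' := length vs),
      arrays = (\<lambda>_ _. 0)(''adj'' := (\<lambda>p. of_bool (p < length vs * length vs \<and>
        adj G (vs ! (p div length vs)) (vs ! (p mod length vs)))))\<rparr>"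

text \<open>A subgraph \<open>H\<close> of the input graph is returned as its vertex set and its adjacency matrix,
  with respect to the same enumeration \<open>vs\<close>.\<close>

definition subgraph_output :: "'a list \<Rightarrow> 'a graph \<Rightarrow> store \<Rightarrow> bool" where
  "subgraph_output vs H s \<longleftrightarrow>
     (\<forall>i<length vs. arrays s ''subverts'' i = of_bool (vs ! i \<in> verts H)) \<and>
     (\<forall>i<length vs. \<forall>j<length vs.
        arrays s ''subadj'' (i * length vs + j) = of_bool (adj H (vs ! i) (vs ! j)))"

text \<open>The number \<open>k\<close> and a colouring \<open>f\<close> of \<open>H\<close> are loaded into the memory \<open>s\<close>, whose remaining
  contents are kept.\<close>

definition load_colouring :: "'a list \<Rightarrow> 'a graph \<Rightarrow> nat \<Rightarrow> ('a \<Rightarrow> nat) \<Rightarrow> store \<Rightarrow> store" where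
  "load_colouring vs H k f s =
     s\<lparr>vars := (vars s)(''k'' := k),
       arrays := (arrays s)(''subcol'' :=
         (\<lambda>i. if i < length vs \<and> vs ! i \<in> verts H then f (vs ! i) else 0))\<rparr>"

definition colouring_output :: "'a list \<Rightarrow> ('a \<Rightarrow> nat) \<Rightarrow> store \<Rightarrow> bool" where
  "colouring_output vs f s \<longleftrightarrow> (\<forall>i<length vs. arrays s ''col'' i = f (vs ! i))"

end

(*
  Let (A, B) be a homogeneous pair with a nonadjacent pair between A and B. Koenig's theorem for the
  bipartite graph of nonadjacent pairs yields a maximum matching, of size mu say, and a clique Q in
  the union of A and B with card Q + mu = card A + card B. Delete every edge between A and B that
  does not lie inside Q. Any colouring of the reduced graph uses at least card Q colours on the pair,
  so at most mu colours are shared by A and B; since vertices outside see A and B uniformly, the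
  colours can be permuted inside A and inside B until shared colours sit on matched vertices, which
  are nonadjacent in the old graph. The same redistribution applied to weights of stable sets handles
  fractional colourings.

  To find a reducible pair, each adjacent ordered pair (x, a) is tried as a seed: the least homogeneous
  pair whose first side contains x and the twins of a is grown by forced additions. If some homogeneous
  pair is nonskeletal, then for some seed this least pair is reducible. A pair of s vertices consists of
  two cliques, hence s^2 = O(m), so that augmenting paths found in O(s^3) time are fast enough. The
  reduced pairs and their matchings are recorded, and colourings are extended over them in reverse order.
*)
theory Submission
  imports Defs
begin

section \<open>Cost semantics, total-correctness rules with time, and transfer to bounded
  words\<close>

section \<open>Executions without a word bound\<close>

text \<open>Neither does the search look for nonskeletal pairs, nor is a single reduction shown to
  make its pair skeletal. Instead \<open>flagged\<close> is a cheap condition under which a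
  reduction deletes at least one edge, and the combinatorial core is that a nonskeletal pair forces
  some seed whose least pair is flagged. This is why the twins of \<open>a\<close> belong to the
  seed: nothing forces them into the least pair around \<open>x\<close> and \<open>a\<close>, and
  without them there may be too few vertices anticomplete to the second side to guarantee a
  deletion. When the class of twins is too small on one side, exchanging the sides helps.

  A pass tries O(m) seeds at O(n + m) each but runs the matching at most once, and every pass except
  the last deletes an edge. With two cliques of total size s and s^2 = O(m) a pass costs O(n^2 +
  m^2), so n^2 takes the place of n^(5/2) and plain augmentation suffices.

  The word bound is handled apart from all this: programs are analysed over unbounded numbers, and
  stored values are shown to grow at most linearly with time.\<close>

fun val :: "store \<Rightarrow> expr \<Rightarrow> nat" where
  "val s (Const x) = x"
| "val s (Var x) = vars s x"
| "val s (Read a e) = arrays s a (val s e)"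
| "val s (Bin b e1 e2) = binop_val b (val s e1) (val s e2)"

definition setv :: "string \<Rightarrow> nat \<Rightarrow> store \<Rightarrow> store" where
  "setv x k s = s\<lparr>vars := (vars s)(x := k)\<rparr>"

definition seta :: "string \<Rightarrow> nat \<Rightarrow> nat \<Rightarrow> store \<Rightarrow> store" where
  "seta a i k s = s\<lparr>arrays := (arrays s)(a := (arrays s a)(i := k))\<rparr>"

lemma setv_simps [simp]:
  "vars (setv x k s) y = (if y = x then k else vars s y)"
  "arrays (setv x k s) = arrays s"
  by (auto simp: setv_def)

lemma seta_simps [simp]:
  "vars (seta a i k s) = vars s"
  "arrays (seta a i k s) b j = (if b = a \<and> j = i then k else arrays s b j)"
  by (auto simp: seta_def)

text \<open>Words of any size are allowed here, so that the correctness proofs need not bound every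
  intermediate value; \<open>run_exec\<close> brings the bound back once and for all.\<close>

inductive run :: "com \<Rightarrow> store \<Rightarrow> nat \<Rightarrow> store \<Rightarrow> bool" where
  Skip: "run Skip s 1 s"
| Assign: "run (Assign v e) s 1 (setv v (val s e) s)"
| Write: "run (Write a i e) s 1 (seta a (val s i) (val s e) s)"
| Seq: "run c1 s t1 s1 \<Longrightarrow> run c2 s1 t2 s2 \<Longrightarrow> run (Seq c1 c2) s (t1 + t2) s2"
| IfTrue: "val s e \<noteq> 0 \<Longrightarrow> run c1 s t s1 \<Longrightarrow> run (If e c1 c2) s (1 + t) s1"
| IfFalse: "val s e = 0 \<Longrightarrow> run c2 s t s1 \<Longrightarrow> run (If e c1 c2) s (1 + t) s1"
| WhileFalse: "val s e = 0 \<Longrightarrow> run (While e c) s 1 s"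
| WhileTrue: "val s e \<noteq> 0 \<Longrightarrow> run c s t1 s1 \<Longrightarrow> run (While e c) s1 t2 s2 \<Longrightarrow>
     run (While e c) s (1 + t1 + t2) s2"

inductive_cases run_SkipE: "run Skip s t s'"
inductive_cases run_AssignE: "run (Assign v e) s t s'"
inductive_cases run_WriteE: "run (Write a i e) s t s'"
inductive_cases run_SeqE: "run (Seq c1 c2) s t s'"
inductive_cases run_IfE: "run (If e c1 c2) s t s'"

fun modv :: "com \<Rightarrow> string set" where
  "modv Skip = {}"
| "modv (Assign x e) = {x}"
| "modv (Write a i e) = {}"
| "modv (Seq c1 c2) = modv c1 \<union> modv c2"
| "modv (If e c1 c2) = modv c1 \<union> modv c2"
| "modv (While e c) = modv c"

fun moda :: "com \<Rightarrow> string set" where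
  "moda Skip = {}"
| "moda (Assign x e) = {}"
| "moda (Write a i e) = {a}"
| "moda (Seq c1 c2) = moda c1 \<union> moda c2"
| "moda (If e c1 c2) = moda c1 \<union> moda c2"
| "moda (While e c) = moda c"

text \<open>The frame condition. The loop rules below supply it at every iteration, so that an
  invariant only has to speak about what the loop body changes.\<close>

definition agree :: "string set \<Rightarrow> string set \<Rightarrow> store \<Rightarrow> store \<Rightarrow> bool" where
  "agree X Y s s' \<longleftrightarrow> (\<forall>x. x \<notin> X \<longrightarrow> vars s' x = vars s x) \<and> (\<forall>a. a \<notin> Y \<longrightarrow> arrays s' a = arrays s a)"

lemma agree_refl [simp]: "agree X Y s s"
  by (simp add: agree_def)

lemma agree_trans: "agree X Y s s' \<Longrightarrow> agree X Y s' s'' \<Longrightarrow> agree X Y s s''"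
  by (simp add: agree_def)

lemma agree_mono: "agree X Y s s' \<Longrightarrow> X \<subseteq> X' \<Longrightarrow> Y \<subseteq> Y' \<Longrightarrow> agree X' Y' s s'"
  by (auto simp: agree_def)

lemma agree_setv: "agree X Y s s' \<Longrightarrow> x \<in> X \<Longrightarrow> agree X Y s (setv x k s')"
  by (auto simp: agree_def)

lemma run_agree: "run c s t s' \<Longrightarrow> agree (modv c) (moda c) s s'"
proof (induction rule: run.induct)
  case (Write a i e s)
  then show ?case by (auto simp: agree_def seta_def)
qed (auto simp: agree_def)

definition wp :: "com \<Rightarrow> store \<Rightarrow> (store \<Rightarrow> nat \<Rightarrow> bool) \<Rightarrow> bool" where
  "wp c s P \<longleftrightarrow> (\<exists>t s'. run c s t s' \<and> P s' t)"

lemma wp_conseq: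
  assumes "wp c s P" "\<And>s' t. agree (modv c) (moda c) s s' \<Longrightarrow> P s' t \<Longrightarrow> Q s' t"
  shows "wp c s Q"
  using assms run_agree unfolding wp_def by blast

lemma wp_Skip [simp]: "wp Skip s P \<longleftrightarrow> P s 1"
  unfolding wp_def by (metis run_SkipE run.Skip)

lemma wp_Assign [simp]: "wp (Assign x e) s P \<longleftrightarrow> P (setv x (val s e) s) 1"
  unfolding wp_def by (metis run_AssignE run.Assign)

lemma wp_Write [simp]: "wp (Write a i e) s P \<longleftrightarrow> P (seta a (val s i) (val s e) s) 1"
  unfolding wp_def by (metis run_WriteE run.Write)

lemma wp_Seq [simp]: "wp (Seq c1 c2) s P \<longleftrightarrow> wp c1 s (\<lambda>s1 t1. wp c2 s1 (\<lambda>s2 t2. P s2 (t1 + t2)))"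
  unfolding wp_def by (fastforce elim: run_SeqE intro: run.Seq)

lemma wp_If [simp]: "wp (If e c1 c2) s P \<longleftrightarrow>
    (if val s e \<noteq> 0 then wp c1 s (\<lambda>s' t. P s' (1 + t)) else wp c2 s (\<lambda>s' t. P s' (1 + t)))"
  unfolding wp_def
  by (auto elim!: run_IfE) (metis run.IfTrue run.IfFalse plus_1_eq_Suc not_gr0)+

text \<open>The potential \<open>\<Phi>\<close> bounds the remaining running time, which makes the rule one for total
  correctness.\<close>

lemma wp_While:
  assumes inv: "I s"
    and step: "\<And>s'. I s' \<Longrightarrow> val s' e \<noteq> 0 \<Longrightarrow> agree (modv c) (moda c) s s' \<Longrightarrow>
      wp c s' (\<lambda>s'' t. I s'' \<and> 1 + t + \<Phi> s'' \<le> \<Phi> s')"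
    and fin: "\<And>s' t. I s' \<Longrightarrow> val s' e = 0 \<Longrightarrow> agree (modv c) (moda c) s s' \<Longrightarrow>
      t + \<Phi> s' \<le> \<Phi> s + 1 \<Longrightarrow> P s' t"
  shows "wp (While e c) s P"
proof -
  \<comment> \<open>Strong induction on the potential, which strictly drops because each iteration
    pays one unit for its guard. The \<open>+ 1\<close> on the right is the last guard, the one that
    fails.\<close>
  have "\<exists>t s''. run (While e c) s' t s'' \<and> I s'' \<and> val s'' e = 0 \<and> t + \<Phi> s'' \<le> \<Phi> s' + 1"
    if "I s'" "agree (modv c) (moda c) s s'" for s'
    using that
  proof (induction "\<Phi> s'" arbitrary: s' rule: less_induct)
    case less
    show ?case
    proof (cases "val s' e = 0")
      case True
      then show ?thesis using less.prems run.WhileFalse[OF True] by (intro exI[of _ 1] exI[of _ s']) auto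
    next
      case False
      obtain t1 s1 where 1: "run c s' t1 s1" "I s1" "1 + t1 + \<Phi> s1 \<le> \<Phi> s'"
        using step[OF less.prems(1) False less.prems(2)] unfolding wp_def by auto
      have "agree (modv c) (moda c) s s1"
        using run_agree[OF 1(1)] less.prems(2) agree_trans by blast
      then obtain t2 s2 where 2: "run (While e c) s1 t2 s2" "I s2" "val s2 e = 0" "t2 + \<Phi> s2 \<le> \<Phi> s1 + 1"
        using less.hyps[of s1] 1 by auto
      have "run (While e c) s' (1 + t1 + t2) s2"
        by (rule run.WhileTrue[OF False 1(1) 2(1)])
      then show ?thesis using 1 2 by (intro exI[of _ "1 + t1 + t2"] exI[of _ s2]) auto
    qed
  qed
  then obtain t s'' where *: "run (While e c) s t s''" "I s''" "val s'' e = 0" "t + \<Phi> s'' \<le> \<Phi> s + 1"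
    using inv agree_refl by blast
  then show ?thesis
    using fin[of s'' t] run_agree[OF *(1)] unfolding wp_def by auto
qed

definition For :: "string \<Rightarrow> expr \<Rightarrow> com \<Rightarrow> com" where
  "For i e c = Seq (Assign i (Const 0))
     (While (Bin Less (Var i) e) (Seq c (Assign i (Bin Plus (Var i) (Const 1)))))"

lemma modv_For [simp]: "modv (For i e c) = insert i (modv c)"
  and moda_For [simp]: "moda (For i e c) = moda c"
  by (auto simp: For_def)

text \<open>The third argument of the invariant is the time elapsed since the start of the loop.\<close>

lemma wp_For:
  assumes i: "i \<notin> modv c"
    and e: "\<And>s'. agree (insert i (modv c)) (moda c) s s' \<Longrightarrow> val s' e = N"
    and init: "I 0 (setv i 0 s) 0"
    and step: "\<And>k s' \<tau>. k < N \<Longrightarrow> I k s' \<tau> \<Longrightarrow> vars s' i = k \<Longrightarrow>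
      agree (insert i (modv c)) (moda c) s s' \<Longrightarrow>
      wp c s' (\<lambda>s'' t. agree (insert i (modv c)) (moda c) s s'' \<longrightarrow> I (Suc k) (setv i (Suc k) s'') (\<tau> + t + 2))"
    and fin: "\<And>s' \<tau>. I N s' \<tau> \<Longrightarrow> vars s' i = N \<Longrightarrow> agree (insert i (modv c)) (moda c) s s' \<Longrightarrow> P s' (\<tau> + 2)"
  shows "wp (For i e c) s P"
proof -
  let ?w = "While (Bin Less (Var i) e) (Seq c (Assign i (Bin Plus (Var i) (Const 1))))"
  let ?ag = "agree (insert i (modv c)) (moda c) s"
  have "\<exists>t s''. run ?w s' t s'' \<and> I N s'' (\<tau> + t - 1) \<and> vars s'' i = N \<and> ?ag s'' \<and> t \<ge> 1"
    if "k \<le> N" "I k s' \<tau>" "vars s' i = k" "?ag s'" for k s' \<tau>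
    using that
  proof (induction k arbitrary: s' \<tau> rule: inc_induct)
    case base
    have "val s' e = N" using e base by blast
    then have "run ?w s' 1 s'" using base by (intro run.WhileFalse) auto
    then show ?case using base by fastforce
  next
    case (step k)
    have ve: "val s' e = N" using e step by blast
    then have g: "val s' (Bin Less (Var i) e) \<noteq> 0" using step by auto
    obtain t1 s1 where 1: "run c s' t1 s1" "?ag s1 \<longrightarrow> I (Suc k) (setv i (Suc k) s1) (\<tau> + t1 + 2)"
      using assms(4)[of k s' \<tau>] step unfolding wp_def by blast
    have ag1: "?ag s1"
      using run_agree[OF 1(1)] step.prems(3)
      by (meson agree_mono agree_trans subset_insertI subset_refl)
    have "vars s1 i = k"
      using run_agree[OF 1(1)] i step.prems(2) by (simp add: agree_def)
    then have 2: "run (Seq c (Assign i (Bin Plus (Var i) (Const 1)))) s' (t1 + 1) (setv i (Suc k) s1)"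
      using run.Seq[OF 1(1) run.Assign[of i "Bin Plus (Var i) (Const 1)" s1]] by simp
    obtain t2 s2 where 3: "run ?w (setv i (Suc k) s1) t2 s2" "I N s2 (\<tau> + t1 + 2 + t2 - 1)"
       "vars s2 i = N" "?ag s2" "t2 \<ge> 1"
      using step.IH[of "setv i (Suc k) s1" "\<tau> + t1 + 2"] 1(2) ag1
      by (auto simp: agree_setv)
    have "run ?w s' (1 + (t1 + 1) + t2) s2"
      by (rule run.WhileTrue[OF g 2 3(1)])
    then show ?case using 3
      by (intro exI[of _ "1 + (t1 + 1) + t2"] exI[of _ s2]) (simp add: add.assoc)
  qed
  from this[of 0 "setv i 0 s" 0] init
  obtain t s'' where *: "run ?w (setv i 0 s) t s''" "I N s'' (t - 1)" "vars s'' i = N" "?ag s''" "t \<ge> 1"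
    by (auto simp: agree_setv)
  have "run (For i e c) s (1 + t) s''"
    unfolding For_def using run.Seq[OF run.Assign[of i "Const 0" s]] *(1) by simp
  moreover have "P s'' (1 + t)" using fin[OF *(2,3,4)] *(5) by (simp add: eval_nat_numeral)
  ultimately show ?thesis unfolding wp_def by blast
qed

text \<open>The common case of a uniform bound \<open>T\<close> per round. A round adds two steps
  for guard and increment; the final two are the initial assignment and the failing guard.\<close>

lemma wp_For_bound:
  assumes i: "i \<notin> modv c"
    and e: "\<And>s'. agree (insert i (modv c)) (moda c) s s' \<Longrightarrow> val s' e = N"
    and init: "I 0 (setv i 0 s)"
    and step: "\<And>k s'. k < N \<Longrightarrow> I k s' \<Longrightarrow> vars s' i = k \<Longrightarrow>
      agree (insert i (modv c)) (moda c) s s' \<Longrightarrow>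
      wp c s' (\<lambda>s'' t. agree (insert i (modv c)) (moda c) s s'' \<longrightarrow> I (Suc k) (setv i (Suc k) s'') \<and> t \<le> T)"
    and fin: "\<And>s' t. I N s' \<Longrightarrow> vars s' i = N \<Longrightarrow> agree (insert i (modv c)) (moda c) s s' \<Longrightarrow>
      t \<le> N * (T + 2) + 2 \<Longrightarrow> P s' t"
  shows "wp (For i e c) s P"
proof (rule wp_For[where I = "\<lambda>k s' \<tau>. I k s' \<and> \<tau> \<le> k * (T + 2)" and N = N, OF i e])
  show "I 0 (setv i 0 s) \<and> 0 \<le> 0 * (T + 2)" using init by simp
next
  fix k s' \<tau>
  assume "k < N" "I k s' \<and> \<tau> \<le> k * (T + 2)" "vars s' i = k" "agree (insert i (modv c)) (moda c) s s'"
  then show "wp c s' (\<lambda>s'' t. agree (insert i (modv c)) (moda c) s s'' \<longrightarrow>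
      I (Suc k) (setv i (Suc k) s'') \<and> \<tau> + t + 2 \<le> Suc k * (T + 2))"
    by (intro wp_conseq[OF step[of k s']]) auto
qed (use fin in auto)

section \<open>Slowly growing programs respect the word bound\<close>

text \<open>A constant counts with its value, so that \<open>expr_size\<close> also bounds by how
  much a slow expression can exceed the stored values.\<close>

fun expr_size :: "expr \<Rightarrow> nat" where
  "expr_size (Const x) = Suc x"
| "expr_size (Var x) = 1"
| "expr_size (Read a e) = Suc (expr_size e)"
| "expr_size (Bin b e1 e2) = Suc (expr_size e1 + expr_size e2)"

text \<open>A slow expression exceeds the largest stored value at most by a constant; hence the stored
  values grow at most linearly with the running time. Array indices are not restricted.\<close>

fun slow :: "expr \<Rightarrow> bool" where
  "slow (Bin Plus e (Const x)) = slow e"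
| "slow (Bin Plus e e') = False"
| "slow (Bin Times e e') = False"
| "slow (Bin Minus e e') = slow e"
| "slow e = True"

fun com_size :: "com \<Rightarrow> nat" where
  "com_size Skip = 0"
| "com_size (Assign x e) = expr_size e"
| "com_size (Write a i e) = expr_size i + expr_size e"
| "com_size (Seq c1 c2) = com_size c1 + com_size c2"
| "com_size (If e c1 c2) = expr_size e + com_size c1 + com_size c2"
| "com_size (While e c) = expr_size e + com_size c"

fun tame :: "com \<Rightarrow> bool" where
  "tame Skip = True"
| "tame (Assign x e) = slow e"
| "tame (Write a i e) = slow e"
| "tame (Seq c1 c2) = (tame c1 \<and> tame c2)"
| "tame (If e c1 c2) = (tame c1 \<and> tame c2)"
| "tame (While e c) = tame c"

lemma tame_For [simp]: "tame (For i e c) = tame c"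
  by (simp add: For_def)

definition bounded :: "nat \<Rightarrow> store \<Rightarrow> bool" where
  "bounded M s \<longleftrightarrow> (\<forall>x. vars s x \<le> M) \<and> (\<forall>a i. arrays s a i \<le> M)"

lemma bounded_mono: "bounded M s \<Longrightarrow> M \<le> M' \<Longrightarrow> bounded M' s"
  unfolding bounded_def using order_trans by blast

lemma val_slow:
  assumes "bounded M s" "slow e"
  shows "val s e \<le> M + expr_size e"
  using assms(2)
proof (induction e rule: slow.induct)
  case (1 e x)
  then show ?case by simp
qed (use assms(1) in \<open>auto simp: bounded_def trans_le_add1 of_bool_def le_diff_conv intro: le_SucI\<close>)

text \<open>Array indices are built with products, so intermediate results are only polynomial in
  the stored values. A base of at least 2 lets one extra factor absorb the sum of two
  subterms.\<close>

lemma val_le_power: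
  assumes "bounded M s"
  shows "val s e \<le> (M + 2) ^ expr_size e"
proof (induction e)
  case (Const x)
  have "x < 2 ^ x" by simp
  also have "2 ^ x \<le> (M + 2) ^ x" by (rule power_mono) auto
  also have "\<dots> \<le> (M + 2) ^ Suc x" by simp
  finally show ?case by simp
next
  case (Var x)
  then show ?case using assms by (auto simp: bounded_def intro: le_SucI)
next
  case (Read a e)
  have "arrays s a (val s e) \<le> M" using assms by (simp add: bounded_def)
  also have "M \<le> (M + 2) ^ Suc (expr_size e)"
    using self_le_power[of "M + 2" "Suc (expr_size e)"] by simp
  finally show ?case by simp
next
  case (Bin b e1 e2)
  let ?B = "M + 2"
  have B: "1 \<le> ?B ^ k" for k by simp
  have 1: "val s e1 \<le> ?B ^ (expr_size e1 + expr_size e2)" "val s e2 \<le> ?B ^ (expr_size e1 + expr_size e2)"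
    using Bin.IH power_increasing[of "expr_size e1" "expr_size e1 + expr_size e2" ?B]
      power_increasing[of "expr_size e2" "expr_size e1 + expr_size e2" ?B] by linarith+
  have 2: "2 * ?B ^ (expr_size e1 + expr_size e2) \<le> ?B ^ Suc (expr_size e1 + expr_size e2)"
    by simp
  have 3: "val s e1 * val s e2 \<le> ?B ^ (expr_size e1 + expr_size e2)"
    unfolding power_add by (rule mult_mono) (use Bin.IH in auto)
  have 4: "1 \<le> ?B ^ Suc (expr_size e1 + expr_size e2)" by (rule one_le_power) simp
  show ?case
    using 1 2 3 4 by (cases b) (auto simp del: power_Suc simp: of_bool_def)
qed

lemma expr_val_eq:
  assumes "bounded M s" "(M + 2) ^ expr_size e \<le> W"
  shows "expr_val W s e = Some (val s e)"
  using assms(2)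
proof (induction e)
  case (Const x)
  then show ?case using val_le_power[OF assms(1), of "Const x"] by (simp add: word_def)
next
  case (Var x)
  then show ?case using val_le_power[OF assms(1), of "Var x"] by (simp add: word_def)
next
  case (Read a e)
  have "(M + 2) ^ expr_size e \<le> W"
    using Read.prems power_increasing[of "expr_size e" "Suc (expr_size e)" "M + 2"] by simp
  with Read show ?case
    using val_le_power[OF assms(1), of "Read a e"] by (simp add: word_def)
next
  case (Bin b e1 e2)
  have "(M + 2) ^ expr_size e1 \<le> W" "(M + 2) ^ expr_size e2 \<le> W"
    using Bin.prems power_increasing[of "expr_size e1" "Suc (expr_size e1 + expr_size e2)" "M + 2"]
      power_increasing[of "expr_size e2" "Suc (expr_size e1 + expr_size e2)" "M + 2"] by auto
  with Bin show ?case
    using val_le_power[OF assms(1), of "Bin b e1 e2"] by (simp add: word_def)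
qed

lemma setv_bounded: "bounded M s \<Longrightarrow> k \<le> M' \<Longrightarrow> M \<le> M' \<Longrightarrow> bounded M' (setv x k s)"
  and seta_bounded: "bounded M s \<Longrightarrow> k \<le> M' \<Longrightarrow> M \<le> M' \<Longrightarrow> bounded M' (seta a i k s)"
  unfolding bounded_def by (auto intro: order_trans)

text \<open>Every step of a tame program raises the largest stored value by at most
  \<open>K\<close>. Stored values therefore stay within \<open>M + K * t\<close> and intermediate
  ones within \<open>(M + K * t + 2) ^ K\<close>, so the word bound is never hit.\<close>

lemma run_exec:
  assumes "run c s t s'" "tame c" "com_size c \<le> K" "bounded M s" "(M + K * t + 2) ^ K \<le> W"
  shows "exec W c s t s' \<and> bounded (M + K * t) s'"
  using assms
proof (induction arbitrary: M rule: run.induct)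
  have ev: "expr_val W s e = Some (val s e)"
    if "bounded M s" "expr_size e \<le> K" "(M + K * t + 2) ^ K \<le> W" for s e t M
  proof -
    have "(M + 2) ^ expr_size e \<le> (M + 2) ^ K" by (rule power_increasing) (use that in auto)
    also have "\<dots> \<le> (M + K * t + 2) ^ K" by (rule power_mono) auto
    finally show ?thesis using expr_val_eq[OF that(1)] that(3) by simp
  qed
  have mon: "(M + K * t + 2) ^ K \<le> (M + K * t' + 2) ^ K" if "t \<le> t'" for M t t'
    by (rule power_mono) (use that in auto)
  {
    case (Skip s)
    then show ?case using exec.Skip[of W s] by (auto intro: bounded_mono)
  next
    case (Assign v e s)
    have "expr_val W s e = Some (val s e)"
      using ev[of M s e 1] Assign by simp
    then have "exec W (Assign v e) s 1 (setv v (val s e) s)"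
      unfolding setv_def by (rule exec.Assign)
    moreover have "val s e \<le> M + K * 1"
      using val_slow[of M s e] Assign by simp
    ultimately show ?case using setv_bounded[of M s] Assign by auto
  next
    case (Write a i e s)
    have "expr_val W s e = Some (val s e)" "expr_val W s i = Some (val s i)"
      using ev[of M s e 1] ev[of M s i 1] Write by simp_all
    then have "exec W (Write a i e) s 1 (seta a (val s i) (val s e) s)"
      unfolding seta_def by (intro exec.Write)
    moreover have "val s e \<le> M + K * 1"
      using val_slow[of M s e] Write by simp
    ultimately show ?case using seta_bounded[of M s] Write by auto
  next
    case (Seq c1 s t1 s1 c2 t2 s2)
    have 1: "exec W c1 s t1 s1 \<and> bounded (M + K * t1) s1"
      using Seq mon[of t1 "t1 + t2" M] by simp
    have 2: "exec W c2 s1 t2 s2 \<and> bounded (M + K * t1 + K * t2) s2"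
      using Seq.IH(2)[of "M + K * t1"] Seq.prems 1 by (simp add: algebra_simps)
    show ?case using 1 2 exec.Seq by (auto simp: algebra_simps)
  next
    case (IfTrue s e c1 t s1 c2)
    have "exec W c1 s t s1 \<and> bounded (M + K * t) s1"
      using IfTrue mon[of t "1 + t" M] by simp
    moreover have "expr_val W s e = Some (val s e)"
      using ev[of M s e "1 + t"] IfTrue by simp
    ultimately show ?case
      using exec.IfTrue[of W s e "val s e"] IfTrue by (auto elim: bounded_mono)
  next
    case (IfFalse s e c2 t s1 c1)
    have "exec W c2 s t s1 \<and> bounded (M + K * t) s1"
      using IfFalse mon[of t "1 + t" M] by simp
    moreover have "expr_val W s e = Some 0"
      using ev[of M s e "1 + t"] IfFalse by simp
    ultimately show ?case
      using exec.IfFalse[of W s e] IfFalse by (auto elim: bounded_mono)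
  next
    case (WhileFalse s e c)
    then have "expr_val W s e = Some 0"
      using ev[of M s e 1] by simp
    then show ?case
      using exec.WhileFalse[of W s e c] WhileFalse by (auto elim: bounded_mono)
  next
    case (WhileTrue s e c t1 s1 t2 s2)
    have 0: "expr_val W s e = Some (val s e)"
      using ev[of M s e "1 + t1 + t2"] WhileTrue by simp
    have 1: "exec W c s t1 s1 \<and> bounded (M + K * t1) s1"
      using WhileTrue mon[of t1 "1 + t1 + t2" M] by simp
    have "M + K * t1 + K * t2 + 2 \<le> M + K * (1 + t1 + t2) + 2"
      by (simp add: algebra_simps)
    then have "(M + K * t1 + K * t2 + 2) ^ K \<le> W"
      using WhileTrue.prems(4) power_mono[of "M + K * t1 + K * t2 + 2" _ K] le_trans by blast
    then have 2: "exec W (While e c) s1 t2 s2 \<and> bounded (M + K * t1 + K * t2) s2"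
      using WhileTrue.IH(2)[of "M + K * t1"] WhileTrue.prems 1 by simp
    have "bounded (M + K * (1 + t1 + t2)) s2"
      using 2 by (auto elim: bounded_mono simp: algebra_simps)
    then show ?case using exec.WhileTrue[OF 0 WhileTrue.hyps(1)] 1 2 by blast
  }
qed

section \<open>The reduction and the extension algorithm as while programs\<close>

section \<open>The programs\<close>

notation Seq (infixr ";;" 60)

abbreviation add_expr (infixl "\<oplus>" 65) where "e \<oplus> e' \<equiv> Bin Plus e e'"
abbreviation sub_expr (infixl "\<ominus>" 65) where "e \<ominus> e' \<equiv> Bin Minus e e'"
abbreviation mul_expr (infixl "\<otimes>" 70) where "e \<otimes> e' \<equiv> Bin Times e e'"
abbreviation less_expr (infix "\<prec>" 50) where "e \<prec> e' \<equiv> Bin Less e e'"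
abbreviation eq_expr (infix "\<doteq>" 50) where "e \<doteq> e' \<equiv> Bin Equal e e'"
abbreviation assign (infix "\<longleftarrow>" 61) where "x \<longleftarrow> e \<equiv> Assign x e"
abbreviation whenever :: "expr \<Rightarrow> com \<Rightarrow> com" where "whenever e c \<equiv> If e c Skip"
abbreviation incr :: "string \<Rightarrow> com" where "incr x \<equiv> Assign x (Var x \<oplus> Const 1)"
abbreviation cell :: "string \<Rightarrow> expr \<Rightarrow> expr \<Rightarrow> expr" where
  "cell a i j \<equiv> Read a (i \<otimes> Var ''n'' \<oplus> j)"
abbreviation wcell :: "string \<Rightarrow> expr \<Rightarrow> expr \<Rightarrow> expr \<Rightarrow> com" where
  "wcell a i j e \<equiv> Write a (i \<otimes> Var ''n'' \<oplus> j) e"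
abbreviation V :: "string \<Rightarrow> expr" where "V \<equiv> Var"
abbreviation N :: "nat \<Rightarrow> expr" where "N \<equiv> Const"

definition copy_prog :: com where
  "copy_prog = For ''i'' (V ''n'') (Write ''subverts'' (V ''i'') (N 1) ;;
     For ''j'' (V ''n'') (wcell ''subadj'' (V ''i'') (V ''j'') (cell ''adj'' (V ''i'') (V ''j''))))"

definition lists_prog :: com where
  "lists_prog = For ''i'' (V ''n'') (''d'' \<longleftarrow> N 0 ;;
     For ''j'' (V ''n'') (whenever (cell ''subadj'' (V ''i'') (V ''j''))
       (wcell ''lst'' (V ''i'') (V ''d'') (V ''j'') ;; incr ''d'')) ;;
     Write ''deg'' (V ''i'') (V ''d''))"

definition push :: "expr \<Rightarrow> com" where
  "push c = wcell ''q'' c (Read ''len'' c) (V ''v'') ;;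
     Write ''len'' c (Read ''len'' c \<oplus> N 1) ;; Write ''used'' (V ''v'') (N 1)"

text \<open>The vertex \<open>v\<close> has been forced into the side \<open>od\<close>. A
  non-neighbour in that side refutes the whole closure, which is recorded by clearing
  \<open>ok\<close>.\<close>

definition tryadd :: com where
  "tryadd = For ''i'' (Read ''len'' (V ''od'')) (
       ''w'' \<longleftarrow> cell ''q'' (V ''od'') (V ''i'') ;;
       whenever (cell ''subadj'' (V ''v'') (V ''w'') \<doteq> N 0) (''ok'' \<longleftarrow> N 0)) ;;
     whenever (V ''ok'') (push (V ''od''))"

text \<open>Both vertices lie in the same side. A vertex outside the pair that sees the first but
  not the second breaks homogeneity, so it has to join the other side.\<close>

definition scan :: "string \<Rightarrow> string \<Rightarrow> com" where
  "scan r1 r2 = For ''p'' (Read ''deg'' (V r1)) (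
     ''v'' \<longleftarrow> cell ''lst'' (V r1) (V ''p'') ;;
     whenever (V ''ok'' \<otimes> (Read ''used'' (V ''v'') \<doteq> N 0) \<otimes> (cell ''subadj'' (V r2) (V ''v'') \<doteq> N 0)) tryadd)"

text \<open>The lists start afresh for every seed; clearing \<open>used\<close> is the origin of the
  summand \<open>3 * n\<close> in \<open>seed_time\<close>.\<close>

definition twins_prog :: com where
  "twins_prog = For ''i'' (V ''n'') (Write ''used'' (V ''i'') (N 0)) ;;
     Write ''len'' (N 0) (N 0) ;; Write ''len'' (N 1) (N 0) ;;
     ''v'' \<longleftarrow> V ''a'' ;; push (N 0) ;;
     For ''p'' (Read ''deg'' (V ''a'')) (
       ''v'' \<longleftarrow> cell ''lst'' (V ''a'') (V ''p'') ;;
       whenever (Read ''deg'' (V ''v'') \<doteq> Read ''deg'' (V ''a''))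
         (''tw'' \<longleftarrow> N 1 ;;
          For ''j'' (Read ''deg'' (V ''v'')) (
            ''w'' \<longleftarrow> cell ''lst'' (V ''v'') (V ''j'') ;;
            whenever ((cell ''subadj'' (V ''a'') (V ''w'') \<doteq> N 0) \<otimes> ((V ''w'' \<doteq> V ''a'') \<doteq> N 0)) (''tw'' \<longleftarrow> N 0)) ;;
          whenever (V ''tw'') (push (N 0)))) ;;
     whenever (Read ''used'' (V ''x'') \<doteq> N 0) (''v'' \<longleftarrow> V ''x'' ;; push (N 0))"

text \<open>Each side is a queue that shares its storage with the list of members. A dequeued vertex
  is compared, in both directions, with the first vertex of its side only: agreement with one
  representative already makes every outside vertex uniform to the side. After a failure the queues
  are merely drained.\<close>

definition closure_prog :: com where
  "closure_prog = ''ok'' \<longleftarrow> N 1 ;; Write ''hd'' (N 0) (N 0) ;; Write ''hd'' (N 1) (N 0) ;;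
     While ((Read ''hd'' (N 0) \<prec> Read ''len'' (N 0)) \<oplus> (Read ''hd'' (N 1) \<prec> Read ''len'' (N 1))) (
       If (Read ''hd'' (N 0) \<prec> Read ''len'' (N 0)) (''c'' \<longleftarrow> N 0) (''c'' \<longleftarrow> N 1) ;;
       ''od'' \<longleftarrow> N 1 \<ominus> V ''c'' ;;
       whenever (V ''ok'') (
         ''u'' \<longleftarrow> cell ''q'' (V ''c'') (Read ''hd'' (V ''c'')) ;;
         ''r'' \<longleftarrow> cell ''q'' (V ''c'') (N 0) ;;
         scan ''u'' ''r'' ;; scan ''r'' ''u'') ;;
       Write ''hd'' (V ''c'') (Read ''hd'' (V ''c'') \<oplus> N 1))"

abbreviation "LA i \<equiv> cell ''q'' (N 0) i"
abbreviation "LB i \<equiv> cell ''q'' (N 1) i"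
abbreviation "NA \<equiv> Read ''len'' (N 0)"
abbreviation "NB \<equiv> Read ''len'' (N 1)"

definition test_prog :: com where
  "test_prog = ''fl'' \<longleftarrow> N 0 ;; ''z'' \<longleftarrow> N 0 ;;
     For ''i'' NA (''u'' \<longleftarrow> LA (V ''i'') ;; ''d'' \<longleftarrow> N 0 ;;
       For ''j'' NB (whenever (cell ''subadj'' (V ''u'') (LB (V ''j''))) (incr ''d'')) ;;
       If (V ''d'' \<doteq> N 0) (incr ''z'') (whenever (V ''d'' \<prec> NB) (''fl'' \<longleftarrow> N 1))) ;;
     If (V ''z'' \<prec> NB) Skip (''fl'' \<longleftarrow> N 1) ;;
     whenever (NB \<doteq> N 0) (''fl'' \<longleftarrow> N 0)"

text \<open>Mates and parents are stored with an offset of one, so that zero means none. A vertex of the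
  second clique is reached by an alternating path from an unmatched one iff it is unmatched itself
  or its mate has a parent.\<close>

abbreviation "reached b \<equiv> N 0 \<prec> ((Read ''mb'' b \<doteq> N 0) \<oplus> Read ''par'' (Read ''mb'' b \<ominus> N 1))"

text \<open>Whole sweeps over all pairs, repeated until nothing changes. A forest thus costs cubic
  time instead of the quadratic time of a queue, which the budget allows.\<close>

definition reach_prog :: com where
  "reach_prog = For ''i'' (V ''n'') (Write ''par'' (V ''i'') (N 0)) ;; ''ch'' \<longleftarrow> N 1 ;;
     While (V ''ch'') (''ch'' \<longleftarrow> N 0 ;;
       For ''i'' NB (''b'' \<longleftarrow> LB (V ''i'') ;;
         For ''j'' NA (''w'' \<longleftarrow> LA (V ''j'') ;;
           whenever ((Read ''par'' (V ''w'') \<doteq> N 0) \<otimes> (cell ''subadj'' (V ''b'') (V ''w'') \<doteq> N 0) \<otimes> reached (V ''b''))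
             (Write ''par'' (V ''w'') (V ''b'' \<oplus> N 1) ;; ''ch'' \<longleftarrow> N 1))))"

definition find_prog :: com where
  "find_prog = ''fnd'' \<longleftarrow> N 0 ;;
     For ''j'' NA (''w'' \<longleftarrow> LA (V ''j'') ;;
       whenever ((N 0 \<prec> Read ''par'' (V ''w'')) \<otimes> (Read ''ma'' (V ''w'') \<doteq> N 0)) (''fnd'' \<longleftarrow> N 1 ;; ''fa'' \<longleftarrow> V ''w''))"

definition flip_prog :: com where
  "flip_prog = ''g'' \<longleftarrow> N 1 ;;
     While (V ''g'') (''b'' \<longleftarrow> Read ''par'' (V ''fa'') \<ominus> N 1 ;; ''w'' \<longleftarrow> Read ''mb'' (V ''b'') ;;
       Write ''mb'' (V ''b'') (V ''fa'' \<oplus> N 1) ;; Write ''ma'' (V ''fa'') (V ''b'' \<oplus> N 1) ;;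
       If (V ''w'' \<doteq> N 0) (''g'' \<longleftarrow> N 0) (''fa'' \<longleftarrow> V ''w'' \<ominus> N 1))"

definition match_prog :: com where
  "match_prog = For ''i'' (V ''n'') (Write ''ma'' (V ''i'') (N 0) ;; Write ''mb'' (V ''i'') (N 0)) ;;
     ''fnd'' \<longleftarrow> N 1 ;;
     While (V ''fnd'') (reach_prog ;; find_prog ;; whenever (V ''fnd'') flip_prog)"

text \<open>Both recorded lists start with the matched vertices, partner beside partner, and
  continue with the free ones. The position of a matched vertex thus encodes its mate.\<close>

definition record_prog :: com where
  "record_prog = ''d'' \<longleftarrow> N 0 ;;
     For ''j'' NB (''b'' \<longleftarrow> LB (V ''j'') ;; whenever (Read ''mb'' (V ''b''))
       (wcell ''pa'' (V ''rec'') (V ''d'') (Read ''mb'' (V ''b'') \<ominus> N 1) ;;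
        wcell ''pb'' (V ''rec'') (V ''d'') (V ''b'') ;; incr ''d'')) ;;
     ''z'' \<longleftarrow> V ''d'' ;;
     For ''j'' NA (''w'' \<longleftarrow> LA (V ''j'') ;; whenever (Read ''ma'' (V ''w'') \<doteq> N 0)
       (wcell ''pa'' (V ''rec'') (V ''d'') (V ''w'') ;; incr ''d'')) ;;
     For ''j'' NB (''b'' \<longleftarrow> LB (V ''j'') ;; whenever (Read ''mb'' (V ''b'') \<doteq> N 0)
       (wcell ''pb'' (V ''rec'') (V ''z'') (V ''b'') ;; incr ''z'')) ;;
     Write ''rna'' (V ''rec'') NA ;; Write ''rnb'' (V ''rec'') NB ;; incr ''rec''"

text \<open>The surviving clique consists of the unreached vertices of the first side and the
  reached ones of the second; an edge between the sides goes as soon as one end is outside.\<close>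

definition delete_prog :: com where
  "delete_prog = For ''i'' NA (''u'' \<longleftarrow> LA (V ''i'') ;;
     For ''j'' NB (''b'' \<longleftarrow> LB (V ''j'') ;;
       whenever (Read ''par'' (V ''u'') \<oplus> (N 1 \<ominus> reached (V ''b'')))
         (wcell ''subadj'' (V ''u'') (V ''b'') (N 0) ;; wcell ''subadj'' (V ''b'') (V ''u'') (N 0))))"

definition pair_prog :: com where
  "pair_prog = match_prog ;; record_prog ;; delete_prog ;; ''go'' \<longleftarrow> N 1"

definition seed_prog :: com where
  "seed_prog = twins_prog ;; closure_prog ;;
     whenever (V ''ok'') (test_prog ;;
       whenever (V ''fl'') pair_prog)"

text \<open>The neighbour lists are computed once per pass. They stay correct as long as they are
  read, because the first reduction sets \<open>go\<close>, after which the remaining seeds are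
  skipped.\<close>

definition pass_prog :: com where
  "pass_prog = ''go'' \<longleftarrow> N 0 ;; lists_prog ;;
     For ''x'' (V ''n'') (For ''y'' (Read ''deg'' (V ''x'')) (
       whenever (V ''go'' \<doteq> N 0) (''a'' \<longleftarrow> cell ''lst'' (V ''x'') (V ''y'') ;; seed_prog)))"

definition reduce_prog :: com where
  "reduce_prog = copy_prog ;; ''rec'' \<longleftarrow> N 0 ;; ''go'' \<longleftarrow> N 1 ;; While (V ''go'') pass_prog"

definition member_prog :: "string \<Rightarrow> string \<Rightarrow> com" where
  "member_prog b m = ''e'' \<longleftarrow> N 0 ;;
     For ''j'' (Read m (V ''rec'')) (whenever (Read ''col'' (cell b (V ''rec'') (V ''j'')) \<doteq> Read ''col'' (V ''u'')) (''e'' \<longleftarrow> N 1))"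

text \<open>\<open>ca\<close> and \<open>cb\<close> receive the shared colours first, at equal
  positions, and the private colours after them. Written back along the recorded lists, the shared
  colours land on matched pairs.\<close>

definition extend_step :: com where
  "extend_step = ''d'' \<longleftarrow> N 0 ;;
     For ''i'' (Read ''rna'' (V ''rec'')) (''u'' \<longleftarrow> cell ''pa'' (V ''rec'') (V ''i'') ;; member_prog ''pb'' ''rnb'' ;;
       whenever (V ''e'') (Write ''ca'' (V ''d'') (Read ''col'' (V ''u'')) ;; Write ''cb'' (V ''d'') (Read ''col'' (V ''u'')) ;; incr ''d'')) ;;
     ''z'' \<longleftarrow> V ''d'' ;;
     For ''i'' (Read ''rna'' (V ''rec'')) (''u'' \<longleftarrow> cell ''pa'' (V ''rec'') (V ''i'') ;; member_prog ''pb'' ''rnb'' ;;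
       whenever (V ''e'' \<doteq> N 0) (Write ''ca'' (V ''d'') (Read ''col'' (V ''u'')) ;; incr ''d'')) ;;
     For ''i'' (Read ''rnb'' (V ''rec'')) (''u'' \<longleftarrow> cell ''pb'' (V ''rec'') (V ''i'') ;; member_prog ''pa'' ''rna'' ;;
       whenever (V ''e'' \<doteq> N 0) (Write ''cb'' (V ''z'') (Read ''col'' (V ''u'')) ;; incr ''z'')) ;;
     For ''i'' (Read ''rna'' (V ''rec'')) (Write ''col'' (cell ''pa'' (V ''rec'') (V ''i'')) (Read ''ca'' (V ''i''))) ;;
     For ''i'' (Read ''rnb'' (V ''rec'')) (Write ''col'' (cell ''pb'' (V ''rec'') (V ''i'')) (Read ''cb'' (V ''i'')))"

definition extend_prog :: com where
  "extend_prog = For ''i'' (V ''n'') (Write ''col'' (V ''i'') (Read ''subcol'' (V ''i''))) ;;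
     While (V ''rec'') (''rec'' \<longleftarrow> V ''rec'' \<ominus> N 1 ;; extend_step)"

lemmas prog_defs = copy_prog_def lists_prog_def push_def tryadd_def scan_def twins_prog_def closure_prog_def
  test_prog_def reach_prog_def find_prog_def flip_prog_def match_prog_def record_prog_def delete_prog_def
  pair_prog_def seed_prog_def pass_prog_def reduce_prog_def member_prog_def extend_step_def extend_prog_def

lemma tame_reduce: "tame reduce_prog" and tame_extend: "tame extend_prog"
  by (simp_all add: prog_defs)

section \<open>Verification of the search: neighbour lists, twins, and the closure of a seed\<close>

section \<open>Adjacency data in memory\<close>

definition is_graph :: "nat \<Rightarrow> (nat \<Rightarrow> nat \<Rightarrow> bool) \<Rightarrow> bool" where
  "is_graph n R \<longleftrightarrow> (\<forall>i j. R i j \<longrightarrow> i < n \<and> j < n \<and> i \<noteq> j \<and> R j i)"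

definition nbrs :: "nat \<Rightarrow> (nat \<Rightarrow> nat \<Rightarrow> bool) \<Rightarrow> nat \<Rightarrow> nat list" where
  "nbrs n R i = filter (R i) [0..<n]"

definition matrix_stored :: "nat \<Rightarrow> (nat \<Rightarrow> nat \<Rightarrow> bool) \<Rightarrow> store \<Rightarrow> bool" where
  "matrix_stored n R s \<longleftrightarrow> vars s ''n'' = n \<and> (\<forall>i<n. \<forall>j<n. arrays s ''subadj'' (i * n + j) = of_bool (R i j))"

definition lists_stored :: "nat \<Rightarrow> (nat \<Rightarrow> nat \<Rightarrow> bool) \<Rightarrow> store \<Rightarrow> bool" where
  "lists_stored n R s \<longleftrightarrow> (\<forall>i<n. arrays s ''deg'' i = length (nbrs n R i) \<and>
     (\<forall>p<length (nbrs n R i). arrays s ''lst'' (i * n + p) = nbrs n R i ! p))"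

lemma matrix_storedD:
  assumes "matrix_stored n R s"
  shows "vars s ''n'' = n" "i < n \<Longrightarrow> j < n \<Longrightarrow> arrays s ''subadj'' (i * n + j) = of_bool (R i j)"
  using assms by (auto simp: matrix_stored_def)

lemma lists_storedD:
  assumes "lists_stored n R s" "i < n"
  shows "arrays s ''deg'' i = length (nbrs n R i)"
    "p < length (nbrs n R i) \<Longrightarrow> arrays s ''lst'' (i * n + p) = nbrs n R i ! p"
  using assms by (auto simp: lists_stored_def)

lemma matrix_stored_agree: "agree X Y s s' \<Longrightarrow> ''n'' \<notin> X \<Longrightarrow> ''subadj'' \<notin> Y \<Longrightarrow> matrix_stored n R s \<Longrightarrow> matrix_stored n R s'"
  by (simp add: matrix_stored_def agree_def)

lemma lists_stored_agree: "agree X Y s s' \<Longrightarrow> ''deg'' \<notin> Y \<Longrightarrow> ''lst'' \<notin> Y \<Longrightarrow> lists_stored n R s \<Longrightarrow> lists_stored n R s'"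
  by (simp add: lists_stored_def agree_def)

lemma is_graphD:
  assumes "is_graph n R" "R i j"
  shows "i < n" "j < n" "i \<noteq> j" "R j i"
  using assms by (auto simp: is_graph_def)

lemma is_graph_sym: "is_graph n R \<Longrightarrow> R i j = R j i"
  by (auto simp: is_graph_def)

lemma is_graph_irrefl: "is_graph n R \<Longrightarrow> \<not> R i i"
  by (auto simp: is_graph_def)

lemma set_nbrs: "is_graph n R \<Longrightarrow> set (nbrs n R i) = {j. R i j}"
  by (auto simp: nbrs_def is_graph_def)

lemma distinct_nbrs [simp]: "distinct (nbrs n R i)"
  by (simp add: nbrs_def)

lemma length_nbrs: "is_graph n R \<Longrightarrow> length (nbrs n R i) = card {j. R i j}"
  using distinct_card[OF distinct_nbrs[of n R i]] set_nbrs by metis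

lemma length_nbrs_le: "length (nbrs n R i) \<le> n"
  using length_filter_le[of "R i" "[0..<n]"] by (simp add: nbrs_def)

lemma nbrs_nth:
  assumes "is_graph n R" "p < length (nbrs n R i)"
  shows "R i (nbrs n R i ! p)" "nbrs n R i ! p < n"
  using nth_mem[OF assms(2)] set_nbrs[OF assms(1)] is_graphD[OF assms(1)] by blast+

lemma cell_eq_iff [simp]:
  fixes i j i' j' n :: nat
  assumes "j < n" "j' < n"
  shows "i * n + j = i' * n + j' \<longleftrightarrow> i = i' \<and> j = j'"
proof
  assume *: "i * n + j = i' * n + j'"
  have "(i * n + j) div n = (i' * n + j') div n" "(i * n + j) mod n = (i' * n + j') mod n"
    using * by simp_all
  then show "i = i' \<and> j = j'" using assms by simp
qed simp

lemma wp_copy: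
  assumes n: "vars s ''n'' = n"
    and R: "\<And>i j. i < n \<Longrightarrow> j < n \<Longrightarrow> arrays s ''adj'' (i * n + j) = of_bool (R i j)"
  shows "wp copy_prog s (\<lambda>s' t. matrix_stored n R s' \<and> (\<forall>i<n. arrays s' ''subverts'' i = 1) \<and> t \<le> n * (3 * n + 5) + 2)"
  unfolding copy_prog_def
proof (rule wp_For_bound[where N = n and T = "3 * n + 3" and
      I = "\<lambda>k s'. (\<forall>i<k. arrays s' ''subverts'' i = 1) \<and>
             (\<forall>i<k. \<forall>j<n. arrays s' ''subadj'' (i * n + j) = of_bool (R i j))"], goal_cases)
  case (4 k s')
  have n': "vars s' ''n'' = n" and adj': "arrays s' ''adj'' = arrays s ''adj''"
    using 4(4) n by (simp_all add: agree_def)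
  show ?case
    apply simp
    apply (rule wp_For_bound[where N = n and T = 1 and
      I = "\<lambda>l s''. (\<forall>i<k. \<forall>j<n. arrays s'' ''subadj'' (i * n + j) = of_bool (R i j)) \<and>
         (\<forall>j<l. arrays s'' ''subadj'' (k * n + j) = of_bool (R k j))"])
    using n' adj' 4 R by (auto simp: agree_def less_Suc_eq)
qed (use n in \<open>auto simp: matrix_stored_def agree_def algebra_simps\<close>)

lemma wp_lists:
  assumes matrix_stored: "matrix_stored n R s"
  shows "wp lists_prog s (\<lambda>s' t. lists_stored n R s' \<and> t \<le> n * (5 * n + 6) + 2)"
  unfolding lists_prog_def
proof (rule wp_For_bound[where N = n and T = "5 * n + 4" and
      I = "\<lambda>k s'. (\<forall>i<k. arrays s' ''deg'' i = length (nbrs n R i) \<and>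
         (\<forall>p<length (nbrs n R i). arrays s' ''lst'' (i * n + p) = nbrs n R i ! p))"], goal_cases)
  case (4 k s')
  let ?F = "\<lambda>j. filter (R k) [0..<j]"
  have n': "vars s' ''n'' = n" using 4(4) matrix_storedD(1)[OF matrix_stored] by (simp add: agree_def)
  have sub: "arrays s' ''subadj'' (i * n + j) = of_bool (R i j)" if "i < n" "j < n" for i j
    using 4(4) matrix_storedD(2)[OF matrix_stored that] by (simp add: agree_def)
  have lF: "length (?F j) \<le> j" for j
    using length_filter_le[of "R k" "[0..<j]"] by simp
  have lt: "p < n" if "p < length (nbrs n R i)" for p i
    using that length_nbrs_le[of n R i] by linarith
  show ?case
    apply simp
    apply (rule wp_For_bound[where N = n and T = 3 and
      I = "\<lambda>j s''. vars s'' ''d'' = length (?F j) \<and> (\<forall>p<length (?F j). arrays s'' ''lst'' (k * n + p) = ?F j ! p) \<and>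
          (\<forall>i<k. \<forall>p<length (nbrs n R i). arrays s'' ''lst'' (i * n + p) = nbrs n R i ! p)"])
    subgoal by simp
    subgoal using n' by (simp add: agree_def)
    subgoal using 4 by simp
    subgoal premises prems for j s''
    proof -
      have "length (?F j) < n" using lF[of j] prems(1) by linarith
      moreover have "vars s'' ''n'' = n" "vars s'' ''i'' = k" "arrays s'' ''subadj'' = arrays s' ''subadj''"
        using prems(4) n' 4(3) by (simp_all add: agree_def)
      ultimately show ?thesis
        using prems(1-3) sub[OF 4(1) prems(1)] 4(1) lt by (auto simp: nth_append less_Suc_eq)
    qed
    subgoal using 4 by (auto simp: agree_def nbrs_def less_Suc_eq)
    done
qed (use matrix_storedD(1)[OF matrix_stored] in \<open>auto simp: lists_stored_def agree_def algebra_simps\<close>)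

section \<open>Closing a pair of cliques\<close>

definition is_clique :: "('b \<Rightarrow> 'b \<Rightarrow> bool) \<Rightarrow> 'b set \<Rightarrow> bool" where
  "is_clique R K \<longleftrightarrow> (\<forall>u\<in>K. \<forall>v\<in>K. u \<noteq> v \<longrightarrow> R u v)"

definition uniform_to :: "('b \<Rightarrow> 'b \<Rightarrow> bool) \<Rightarrow> 'b \<Rightarrow> 'b set \<Rightarrow> bool" where
  "uniform_to R v K \<longleftrightarrow> (\<forall>u\<in>K. R v u) \<or> (\<forall>u\<in>K. \<not> R v u)"

text \<open>Weaker than \<open>homogeneous_pair\<close>: sides may be empty and there is no lower
  bound on the size, since the closure of a seed may have an empty second side. Stated for a bare
  relation, it serves indices as well as vertices.\<close>

definition homog :: "'b set \<Rightarrow> ('b \<Rightarrow> 'b \<Rightarrow> bool) \<Rightarrow> 'b set \<Rightarrow> 'b set \<Rightarrow> bool" where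
  "homog X R A B \<longleftrightarrow> A \<subseteq> X \<and> B \<subseteq> X \<and> A \<inter> B = {} \<and> is_clique R A \<and> is_clique R B \<and>
     (\<forall>v\<in>X - (A \<union> B). uniform_to R v A \<and> uniform_to R v B)"

lemma homog_swap: "homog X R A B \<longleftrightarrow> homog X R B A"
  by (auto simp: homog_def)

text \<open>The sides form a family indexed by 0 and 1, which lets one piece of code and one proof
  serve both.\<close>

definition sides_stored :: "nat \<Rightarrow> (nat \<Rightarrow> nat list) \<Rightarrow> store \<Rightarrow> bool" where
  "sides_stored n L s \<longleftrightarrow> (\<forall>c<2. arrays s ''len'' c = length (L c) \<and>
       (\<forall>i<length (L c). arrays s ''q'' (c * n + i) = L c ! i) \<and> set (L c) \<subseteq> {..<n} \<and> distinct (L c)) \<and>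
     (\<forall>v<n. arrays s ''used'' v = of_bool (v \<in> set (L 0) \<union> set (L 1))) \<and> set (L 0) \<inter> set (L 1) = {}"

lemma sides_storedD:
  assumes "sides_stored n L s" "c < 2"
  shows "arrays s ''len'' c = length (L c)"
    "i < length (L c) \<Longrightarrow> arrays s ''q'' (c * n + i) = L c ! i"
    "set (L c) \<subseteq> {..<n}" "distinct (L c)"
  using assms by (auto simp: sides_stored_def)

lemma sides_stored_used: "sides_stored n L s \<Longrightarrow> v < n \<Longrightarrow> arrays s ''used'' v = of_bool (v \<in> set (L 0) \<union> set (L 1))"
  by (auto simp: sides_stored_def)

lemma sides_stored_agree: "agree X Y s s' \<Longrightarrow> ''len'' \<notin> Y \<Longrightarrow> ''q'' \<notin> Y \<Longrightarrow> ''used'' \<notin> Y \<Longrightarrow> sides_stored n L s \<Longrightarrow> sides_stored n L s'"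
  by (simp add: sides_stored_def agree_def)

lemma length_less_bound:
  assumes "set xs \<subseteq> {..<n::nat}" "distinct xs" "v < n" "v \<notin> set xs"
  shows "length xs < n"
proof -
  have "insert v (set xs) \<subseteq> {..<n}" using assms by auto
  then have "card (insert v (set xs)) \<le> n" using card_mono[of "{..<n}"] by fastforce
  then show ?thesis using assms distinct_card[OF assms(2)] by simp
qed

lemma length_le_bound:
  assumes "set xs \<subseteq> {..<n::nat}" "distinct xs"
  shows "length xs \<le> n"
  using card_mono[of "{..<n}" "set xs"] assms distinct_card[OF assms(2)] by simp

lemma less_2_cases': "(c::nat) < 2 \<Longrightarrow> c = 0 \<or> c = 1" by auto

lemma wp_push:
  assumes sides_stored: "sides_stored n L s" and n: "vars s ''n'' = n" and c: "c < 2" "\<And>s'. vars s' = vars s \<Longrightarrow> val s' e = c"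
    and v: "vars s ''v'' = v" "v < n" "v \<notin> set (L 0) \<union> set (L 1)"
  shows "wp (push e) s (\<lambda>s' t. sides_stored n (L(c := L c @ [v])) s' \<and> t = 3)"
proof -
  have len: "length (L c) < n" if "c < 2" for c
    using length_less_bound[OF sides_storedD(3,4)[OF sides_stored that] v(2)] v(3) less_2_cases'[OF that] by auto
  have le: "i < n" if "i < length (L c)" "c < 2" for i c
    using len[OF that(2)] that(1) by simp
  note vs = c(2)[OF refl] c(2)[of "seta _ _ _ s", simplified] c(2)[of "seta _ _ _ (seta _ _ _ s)", simplified]
  have "sides_stored n (L(c := L c @ [v])) (seta ''used'' v 1 (seta ''len'' c (Suc (length (L c)))
     (seta ''q'' (c * n + length (L c)) v s)))"
    unfolding sides_stored_def
  proof (intro conjI allI impI)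
    fix d i assume d: "(d::nat) < 2" and i: "i < length ((L(c := L c @ [v])) d)"
    show "arrays (seta ''used'' v 1 (seta ''len'' c (Suc (length (L c)))
     (seta ''q'' (c * n + length (L c)) v s))) ''q'' (d * n + i) = (L(c := L c @ [v])) d ! i"
    proof (cases "d = c")
      case True
      then show ?thesis using i sides_storedD(2)[OF sides_stored c(1)] by (auto simp: nth_append less_Suc_eq)
    next
      case False
      then have "d * n + i \<noteq> c * n + length (L c)"
        using cell_eq_iff[of i n "length (L c)" d c] le[of i d] len[OF c(1)] i d by simp
      then show ?thesis using False i sides_storedD(2)[OF sides_stored d] by auto
    qed
  next
    fix d assume d: "(d::nat) < 2"
    show "distinct ((L(c := L c @ [v])) d)"
      using sides_storedD(4)[OF sides_stored d] v(3) less_2_cases'[OF c(1)] by auto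
    show "set ((L(c := L c @ [v])) d) \<subseteq> {..<n}"
      using sides_storedD(3)[OF sides_stored d] v(2) by (auto split: if_splits)
  qed (use sides_storedD[OF sides_stored] sides_stored_used[OF sides_stored] sides_stored less_2_cases'[OF c(1)] v in \<open>auto simp: sides_stored_def\<close>)
  then show ?thesis
    using c(1) v n sides_storedD(1)[OF sides_stored c(1)] by (simp add: push_def vs)
qed

lemma wp_tryadd:
  assumes sides_stored: "sides_stored n L s" and matrix_stored: "matrix_stored n R s" and od: "vars s ''od'' = od" "od < 2"
    and v: "vars s ''v'' = v" "v < n" "v \<notin> set (L 0) \<union> set (L 1)" and ok: "vars s ''ok'' = 1"
  shows "wp tryadd s (\<lambda>s' t. t \<le> 5 * length (L od) + 10 \<and>
    (if \<forall>w\<in>set (L od). R v w then vars s' ''ok'' = 1 \<and> sides_stored n (L(od := L od @ [v])) s'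
     else vars s' ''ok'' = 0 \<and> sides_stored n L s'))"
  unfolding tryadd_def wp_Seq
proof (rule wp_For_bound[where N = "length (L od)" and T = 3 and
      I = "\<lambda>k s'. vars s' ''ok'' = of_bool (\<forall>i<k. R v (L od ! i))"], goal_cases)
  case 2
  then show ?case using od sides_storedD(1)[OF sides_stored od(2)] by (simp add: agree_def)
next
  case (4 k s')
  have w: "L od ! k < n" using sides_storedD(3)[OF sides_stored od(2)] nth_mem[OF 4(1)] by blast
  have "vars s' ''n'' = n" "vars s' ''od'' = od" "vars s' ''v'' = v"
    "arrays s' ''subadj'' (v * n + (L od ! k)) = of_bool (R v (L od ! k))"
    "arrays s' ''q'' (od * n + k) = L od ! k"
    using 4(4) matrix_storedD[OF matrix_stored] od v sides_storedD(2)[OF sides_stored od(2) 4(1)] w by (simp_all add: agree_def)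
  then show ?case using 4 by (auto simp: less_Suc_eq)
next
  case (5 s' t)
  have cst': "sides_stored n L s'" using sides_stored_agree[OF 5(3) _ _ _ sides_stored] by simp
  have *: "vars s' ''n'' = n" "vars s' ''od'' = od" "vars s' ''v'' = v"
    using 5(3) matrix_storedD[OF matrix_stored] od v by (simp_all add: agree_def)
  have all: "(\<forall>i<length (L od). R v (L od ! i)) \<longleftrightarrow> (\<forall>w\<in>set (L od). R v w)"
    by (metis in_set_conv_nth)
  show ?case
  proof (cases "\<forall>w\<in>set (L od). R v w")
    case True
    then have ok': "vars s' ''ok'' = 1" using 5(1) all by simp
    show ?thesis
      using ok' apply simp
      apply (rule wp_conseq[OF wp_push[OF cst' *(1) od(2), of "V ''od''" v]])
      using * v True 5(4) by (auto simp: agree_def push_def)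
  next
    case False
    then show ?thesis using 5 all cst' by auto
  qed
qed (use ok in simp_all)

text \<open>The lists \<open>L 0\<close> and \<open>L 1\<close> are contained in the two sides of every homogeneous pair whose
  first side contains the seed \<open>A0\<close>; when \<open>ok\<close> is \<open>False\<close> there is no such pair.\<close>

definition closure_inv :: "nat \<Rightarrow> (nat \<Rightarrow> nat \<Rightarrow> bool) \<Rightarrow> nat set \<Rightarrow> bool \<Rightarrow> (nat \<Rightarrow> nat list) \<Rightarrow> bool" where
  "closure_inv n R A0 ok L \<longleftrightarrow> A0 \<subseteq> set (L 0) \<and> is_clique R (set (L 0)) \<and> is_clique R (set (L 1)) \<and>
     (\<forall>b\<in>set (L 1). (\<exists>u\<in>set (L 0). R u b) \<and> (\<exists>u\<in>set (L 0). \<not> R u b)) \<and>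
     (\<forall>A B. homog {..<n} R A B \<longrightarrow> A0 \<subseteq> A \<longrightarrow> ok \<and> set (L 0) \<subseteq> A \<and> set (L 1) \<subseteq> B)"

text \<open>In a homogeneous pair that contains the lists, \<open>v\<close> cannot lie in the side
  of \<open>r1\<close> and \<open>r2\<close>, being nonadjacent to \<open>r2\<close>, nor outside
  the pair, being adjacent to one of the two only. So it belongs to the other side, and if it misses
  a vertex there, no such pair exists.\<close>

lemma closure_inv_add:
  assumes "is_graph n R" and inv: "closure_inv n R A0 True L" and c: "c < 2"
    and r: "r1 \<in> set (L c)" "r2 \<in> set (L c)" "R r1 v" "\<not> R r2 v" and v: "v < n" "v \<notin> set (L 0) \<union> set (L 1)"
  shows "if \<forall>w\<in>set (L (1 - c)). R v w then closure_inv n R A0 True (L(1 - c := L (1 - c) @ [v]))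
     else closure_inv n R A0 False L"
proof -
  note sym = is_graph_sym[OF assms(1)]
  have side: "v \<in> (if c = 0 then B else A)" if "homog {..<n} R A B" "A0 \<subseteq> A" for A B
  proof -
    have *: "set (L 0) \<subseteq> A" "set (L 1) \<subseteq> B" using inv that unfolding closure_inv_def by blast+
    let ?S = "if c = 0 then A else B"
    have "r1 \<in> ?S" "r2 \<in> ?S" using r * less_2_cases'[OF c] by auto
    moreover have "is_clique R ?S" "v \<notin> A \<union> B \<longrightarrow> uniform_to R v ?S"
      using that(1) v(1) unfolding homog_def by auto
    moreover have "v \<noteq> r2" using r(2) v(2) less_2_cases'[OF c] by auto
    ultimately have "v \<notin> ?S" "v \<in> A \<union> B"
      using r(3,4) sym unfolding is_clique_def uniform_to_def by metis+
    then show ?thesis by auto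
  qed
  show ?thesis
  proof (cases "\<forall>w\<in>set (L (1 - c)). R v w")
    case True
    have "is_clique R (set (L (1 - c)) \<union> {v})"
      using True inv sym less_2_cases'[OF c] unfolding closure_inv_def is_clique_def by auto
    moreover have "homog {..<n} R A B \<longrightarrow> A0 \<subseteq> A \<longrightarrow> set ((L(1 - c := L (1 - c) @ [v])) 0) \<subseteq> A \<and>
        set ((L(1 - c := L (1 - c) @ [v])) 1) \<subseteq> B" for A B
      using side[of A B] inv less_2_cases'[OF c] unfolding closure_inv_def by auto
    moreover have "\<exists>u\<in>set (L 0). R u v" "\<exists>u\<in>set (L 0). \<not> R u v" if "c = 0"
      using r that by auto
    ultimately show ?thesis
      using True inv less_2_cases'[OF c] unfolding closure_inv_def by auto
  next
    case False
    then obtain w where w: "w \<in> set (L (1 - c))" "\<not> R v w" by blast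
    have False if h: "homog {..<n} R A B" "A0 \<subseteq> A" for A B
    proof -
      have *: "set (L 0) \<subseteq> A" "set (L 1) \<subseteq> B" using inv h unfolding closure_inv_def by blast+
      let ?S = "if c = 0 then B else A"
      have "w \<in> ?S" using w * less_2_cases'[OF c] by auto
      moreover have "v \<in> ?S" using side[OF h] .
      moreover have "is_clique R ?S" using h unfolding homog_def by auto
      moreover have "v \<noteq> w" using w v less_2_cases'[OF c] by auto
      ultimately show False using w(2) unfolding is_clique_def by blast
    qed
    then show ?thesis using False inv unfolding closure_inv_def by auto
  qed
qed

text \<open>The size parameter of the running times. It survives the deletion of edges, so one value
  found for the input graph serves every later pass.\<close>

definition clique_pair_bound :: "nat \<Rightarrow> (nat \<Rightarrow> nat \<Rightarrow> bool) \<Rightarrow> nat \<Rightarrow> bool" where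
  "clique_pair_bound n R B \<longleftrightarrow> (\<forall>K K'. K \<subseteq> {..<n} \<longrightarrow> K' \<subseteq> {..<n} \<longrightarrow> is_clique R K \<longrightarrow> is_clique R K' \<longrightarrow> card K + card K' \<le> B)"

lemma closure_inv_length:
  assumes "clique_pair_bound n R B" "sides_stored n L s" "closure_inv n R A0 ok L"
  shows "length (L 0) + length (L 1) \<le> B"
proof -
  have "length (L c) = card (set (L c))" "set (L c) \<subseteq> {..<n}" if "c < 2" for c
    using distinct_card[OF sides_storedD(4)[OF assms(2) that]] sides_storedD(3)[OF assms(2) that] by simp_all
  then have "length (L 0) = card (set (L 0))" "length (L 1) = card (set (L 1))"
     "set (L 0) \<subseteq> {..<n}" "set (L 1) \<subseteq> {..<n}" by simp_all
  then show ?thesis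
    using assms(1,3) unfolding clique_pair_bound_def closure_inv_def by presburger
qed

definition ext :: "nat \<Rightarrow> (nat \<Rightarrow> nat list) \<Rightarrow> nat list \<Rightarrow> (nat \<Rightarrow> nat list)" where
  "ext d L xs = L(d := L d @ xs)"

lemma ext_simps [simp]: "ext d L [] = L" "ext d L xs d = L d @ xs" "e \<noteq> d \<Longrightarrow> ext d L xs e = L e"
  "ext d (ext d L xs) ys = ext d L (xs @ ys)"
  by (auto simp: ext_def)

lemma set_ext: "set (L e) \<subseteq> set (ext d L xs e)"
  by (auto simp: ext_def)

text \<open>Each inspected neighbour costs constant time. The linear cost of \<open>tryadd\<close>
  is charged to the vertex that it appends, or to the single event that \<open>ok\<close> becomes
  false.\<close>

lemma wp_scan:
  assumes gr: "is_graph n R" and matrix_stored: "matrix_stored n R s" and lists_stored: "lists_stored n R s" and sides_stored: "sides_stored n L s"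
    and bnd: "clique_pair_bound n R B"
    and x: "x1 \<notin> {''p'', ''v'', ''i'', ''w'', ''ok''}" "x2 \<notin> {''p'', ''v'', ''i'', ''w'', ''ok''}"
    and r: "vars s x1 = r1" "vars s x2 = r2" "r1 \<in> set (L c)" "r2 \<in> set (L c)" and c: "c < 2"
    and od: "vars s ''od'' = 1 - c" and ok: "vars s ''ok'' = of_bool ok" and inv: "closure_inv n R A0 ok L"
  shows "wp (scan x1 x2) s (\<lambda>s' t. \<exists>xs ok'. sides_stored n (ext (1 - c) L xs) s' \<and> vars s' ''ok'' = of_bool ok' \<and>
     closure_inv n R A0 ok' (ext (1 - c) L xs) \<and> (ok' \<longrightarrow> ok) \<and>
     (ok' \<longrightarrow> (\<forall>v. R r1 v \<longrightarrow> R r2 v \<or> v \<in> set (ext (1 - c) L xs 0) \<union> set (ext (1 - c) L xs 1))) \<and>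
     t \<le> 5 * length (nbrs n R r1) + 2 + (5 * B + 10) * (length xs + of_bool (ok \<and> \<not> ok')))"
proof -
  define J where "J = (\<lambda>k s' \<tau>. \<exists>xs ok'. sides_stored n (ext (1 - c) L xs) s' \<and> vars s' ''ok'' = of_bool ok' \<and>
     closure_inv n R A0 ok' (ext (1 - c) L xs) \<and> (ok' \<longrightarrow> ok) \<and>
     (ok' \<longrightarrow> (\<forall>p<k. R r2 (nbrs n R r1 ! p) \<or> nbrs n R r1 ! p \<in> set (ext (1 - c) L xs 0) \<union> set (ext (1 - c) L xs 1))) \<and>
     \<tau> \<le> 5 * k + (5 * B + 10) * (length xs + of_bool (ok \<and> \<not> ok')))"
  show ?thesis
    unfolding scan_def
  proof (rule wp_For[where N = "length (nbrs n R r1)" and I = J], goal_cases)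
  case 1
  then show ?case using x by (auto simp: tryadd_def push_def)
next
  case (2 s')
  have "r1 < n" using sides_storedD(3)[OF sides_stored c] r by auto
  then have "arrays s ''deg'' r1 = length (nbrs n R r1)" by (rule lists_storedD(1)[OF lists_stored])
  moreover have "vars s' x1 = vars s x1" using 2 x by (simp add: agree_def tryadd_def push_def)
  moreover have "arrays s' ''deg'' = arrays s ''deg''" using 2 by (simp add: agree_def tryadd_def push_def)
  ultimately show ?case using r by simp
next
  case 3
  have "sides_stored n L (setv ''p'' 0 s)"
    by (rule sides_stored_agree[OF _ _ _ _ sides_stored, of "{''p''}" "{}"]) (auto simp: agree_def)
  then show ?case unfolding J_def using inv ok by (intro exI[of _ "[]"] exI[of _ ok]) auto
next
  case (4 k s' \<tau>)
  obtain xs ok' where I: "sides_stored n (ext (1 - c) L xs) s'" "vars s' ''ok'' = of_bool ok'"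
     "closure_inv n R A0 ok' (ext (1 - c) L xs)" "ok' \<longrightarrow> ok"
     "ok' \<longrightarrow> (\<forall>p<k. R r2 (nbrs n R r1 ! p) \<or> nbrs n R r1 ! p \<in> set (ext (1 - c) L xs 0) \<union> set (ext (1 - c) L xs 1))"
     "\<tau> \<le> 5 * k + (5 * B + 10) * (length xs + of_bool (ok \<and> \<not> ok'))"
    using 4(2) unfolding J_def by blast
  define v where "v = nbrs n R r1 ! k"
  let ?L = "ext (1 - c) L xs"
  have rn: "r1 < n" "r2 < n" using sides_storedD(3)[OF sides_stored c] r by auto
  have v: "v < n" "R r1 v" using nbrs_nth[OF gr 4(1)] by (simp_all add: v_def)
  have mat': "matrix_stored n R s'" using matrix_stored_agree[OF 4(4) _ _ matrix_stored] by (simp add: tryadd_def push_def)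
  have adl': "lists_stored n R s'" using lists_stored_agree[OF 4(4) _ _ lists_stored] by (simp add: tryadd_def push_def)
  have st: "vars s' ''n'' = n" "vars s' x1 = r1" "vars s' x2 = r2" "vars s' ''od'' = 1 - c"
    using 4(4) r(1,2) od matrix_storedD(1)[OF matrix_stored] x by (simp_all add: agree_def tryadd_def push_def)
  have lst: "arrays s' ''lst'' (r1 * n + k) = v"
    using lists_storedD(2)[OF adl' rn(1) 4(1)] by (simp add: v_def)
  have used: "arrays s' ''used'' v = of_bool (v \<in> set (?L 0) \<union> set (?L 1))"
    by (rule sides_stored_used[OF I(1) v(1)])
  have sub: "arrays s' ''subadj'' (r2 * n + v) = of_bool (R r2 v)"
    by (rule matrix_storedD(2)[OF mat' rn(2) v(1)])
  show ?case
  proof (cases "ok' \<and> v \<notin> set (?L 0) \<union> set (?L 1) \<and> \<not> R r2 v")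
    case False
    have cst2: "sides_stored n ?L (setv ''p'' (Suc k) (setv ''v'' v s'))"
      by (rule sides_stored_agree[OF _ _ _ _ I(1), of "{''p'', ''v''}" "{}"]) (auto simp: agree_def)
    have z: "vars s' ''ok'' * (of_bool (arrays s' ''used'' v = 0) * of_bool (arrays s' ''subadj'' (r2 * n + v) = 0)) = 0"
      using False I(2) used sub by auto
    have "\<forall>p<Suc k. R r2 (nbrs n R r1 ! p) \<or> nbrs n R r1 ! p \<in> set (?L 0) \<union> set (?L 1)" if ok'
      using I(5) that False by (auto simp: less_Suc_eq v_def)
    then have "J (Suc k) (setv ''p'' (Suc k) (setv ''v'' v s')) \<tau>'" if "\<tau>' \<le> \<tau> + 5" for \<tau>'
      unfolding J_def using I cst2 that by (intro exI[of _ xs] exI[of _ ok']) auto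
    then show ?thesis using z st(1-3) x 4(3) lst by auto
  next
    case True
    let ?s = "setv ''v'' v s'"
    have s: "sides_stored n ?L ?s" "matrix_stored n R ?s"
      using sides_stored_agree[OF _ _ _ _ I(1), of "{''v''}" "{}"] matrix_stored_agree[OF _ _ _ mat', of "{''v''}" "{}"]
      by (auto simp: agree_def)
    have rs: "r1 \<in> set (?L c)" "r2 \<in> set (?L c)" using r set_ext by blast+
    have add: "if \<forall>w\<in>set (?L (1 - c)). R v w then closure_inv n R A0 True (?L(1 - c := ?L (1 - c) @ [v]))
      else closure_inv n R A0 False ?L"
      by (rule closure_inv_add[where L = "ext (1 - c) L xs", OF gr _ c rs v(2) _ v(1)]) (use I(3) True in auto)
    have ext: "?L(1 - c := ?L (1 - c) @ [v]) = ext (1 - c) L (xs @ [v])"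
      by (simp add: ext_def)
    have len: "length (?L (1 - c)) \<le> B"
      using closure_inv_length[OF bnd I(1,3)] c by (cases "c = 0") auto
    have ok1: "ok" "vars s' ''ok'' = 1" using I(2,4) True by auto
    have vv: "v \<notin> set (?L 0)" "v \<notin> set (?L 1)" "\<not> R r2 v" using True by auto
    have w: "wp tryadd ?s (\<lambda>s'' t. t \<le> 5 * length (?L (1 - c)) + 10 \<and>
      (if \<forall>w\<in>set (?L (1 - c)). R v w then vars s'' ''ok'' = 1 \<and> sides_stored n (?L(1 - c := ?L (1 - c) @ [v])) s''
       else vars s'' ''ok'' = 0 \<and> sides_stored n ?L s''))"
      by (rule wp_tryadd[OF s(1) s(2)]) (use st v vv ok1 in auto)
    show ?thesis
      using lst used sub vv ok1 st(1-3) x 4(3)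
      apply simp
    proof (rule wp_conseq[OF w], intro impI, goal_cases)
      case (1 s'' t)
      have cst3: "sides_stored n L' (setv ''p'' (Suc k) s'')" if "sides_stored n L' s''" for L'
        by (rule sides_stored_agree[OF _ _ _ _ that, of "{''p''}" "{}"]) (auto simp: agree_def)
      have D: "t \<le> 5 * length (?L (1 - c)) + 10 \<and>
        (if \<forall>w\<in>set (?L (1 - c)). R v w then vars s'' ''ok'' = 1 \<and> sides_stored n (?L(1 - c := ?L (1 - c) @ [v])) s''
         else vars s'' ''ok'' = 0 \<and> sides_stored n ?L s'')" by (rule 1)
      have t: "t \<le> 5 * B + 10" using D len by linarith
      have "J (Suc k) (setv ''p'' (Suc k) s'') \<tau>'" if \<tau>': "\<tau>' \<le> \<tau> + t + 4" for \<tau>'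
      proof (cases "\<forall>w\<in>set (?L (1 - c)). R v w")
        case True
        have "closure_inv n R A0 True (ext (1 - c) L (xs @ [v]))" "sides_stored n (ext (1 - c) L (xs @ [v])) s''" "vars s'' ''ok'' = 1"
          using add[unfolded if_P[OF True]] D[THEN conjunct2, unfolded if_P[OF True]] unfolding ext by blast+
        moreover have "v \<in> set (ext (1 - c) L (xs @ [v]) 0) \<union> set (ext (1 - c) L (xs @ [v]) 1)"
          using less_2_cases'[OF c] by auto
        moreover have "set (ext (1 - c) L xs d) \<subseteq> set (ext (1 - c) L (xs @ [v]) d)" for d
          by (auto simp: ext_def)
        moreover have "\<forall>p<k. R r2 (nbrs n R r1 ! p) \<or> nbrs n R r1 ! p \<in> set (?L 0) \<union> set (?L 1)"
          using I(5) \<open>ok' \<and> _\<close> by blast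
        ultimately have "\<forall>p<Suc k. R r2 (nbrs n R r1 ! p) \<or> nbrs n R r1 ! p \<in>
            set (ext (1 - c) L (xs @ [v]) 0) \<union> set (ext (1 - c) L (xs @ [v]) 1)"
          unfolding less_Suc_eq v_def by blast
        moreover have "\<tau>' \<le> 5 * Suc k + (5 * B + 10) * (length (xs @ [v]) + of_bool (ok \<and> \<not> True))"
          using I(6) \<open>ok' \<and> _\<close> t \<tau>' ok1 by (simp add: algebra_simps)
        ultimately show ?thesis
          unfolding J_def using cst3 ok1 \<open>closure_inv n R A0 True _\<close> \<open>sides_stored n _ s''\<close> \<open>vars s'' ''ok'' = 1\<close>
          by (intro exI[of _ "xs @ [v]"] exI[of _ True]) simp
      next
        case False
        have "closure_inv n R A0 False ?L" "sides_stored n ?L s''" "vars s'' ''ok'' = 0"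
          using add[unfolded if_not_P[OF False]] D[THEN conjunct2, unfolded if_not_P[OF False]] by blast+
        moreover have "\<tau>' \<le> 5 * Suc k + (5 * B + 10) * (length xs + of_bool (ok \<and> \<not> False))"
          using I(6) \<open>ok' \<and> _\<close> t \<tau>' ok1 by (simp add: algebra_simps)
        ultimately show ?thesis
          unfolding J_def using cst3
          by (intro exI[of _ xs] exI[of _ False]) simp
      qed
      then show ?case by simp
    qed
  qed
next
  case (5 s' \<tau>)
  then obtain xs ok' where I: "sides_stored n (ext (1 - c) L xs) s'" "vars s' ''ok'' = of_bool ok'"
     "closure_inv n R A0 ok' (ext (1 - c) L xs)" "ok' \<longrightarrow> ok"
     "ok' \<longrightarrow> (\<forall>p<length (nbrs n R r1). R r2 (nbrs n R r1 ! p) \<or> nbrs n R r1 ! p \<in> set (ext (1 - c) L xs 0) \<union> set (ext (1 - c) L xs 1))"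
     "\<tau> \<le> 5 * length (nbrs n R r1) + (5 * B + 10) * (length xs + of_bool (ok \<and> \<not> ok'))"
    unfolding J_def by blast
  have "R r2 v \<or> v \<in> set (ext (1 - c) L xs 0) \<union> set (ext (1 - c) L xs 1)" if "ok'" "R r1 v" for v
  proof -
    have "v \<in> set (nbrs n R r1)" using that set_nbrs[OF gr] by auto
    then show ?thesis using I(5) that(1) by (auto simp: in_set_conv_nth)
  qed
  then show ?case using I by (intro exI[of _ xs] exI[of _ ok']) auto
qed
qed

lemma Setcompr2_cong:
  assumes "\<And>c i. Q c i \<Longrightarrow> f c i = g c i"
  shows "{f c i | c i. Q c i} = {g c i | c i. Q c i}"
  using assms by (metis (mono_tags))

text \<open>Comparing every dequeued \<open>u\<close> with the representative \<open>r\<close> seems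
  to cost the degree of \<open>r\<close> each time. But once both scans have succeeded, the two
  neighbourhoods differ only inside the lists, so this degree exceeds that of \<open>u\<close> by at
  most \<open>B\<close> and can be charged to \<open>u\<close>; degrees of distinct vertices add up
  to at most \<open>M\<close>.\<close>

lemma wp_closure:
  assumes gr: "is_graph n R" and matrix_stored: "matrix_stored n R s" and lists_stored: "lists_stored n R s" and sides_stored: "sides_stored n L0 s"
    and bnd: "clique_pair_bound n R B" and M: "M = (\<Sum>v<n. length (nbrs n R v))"
    and inv: "closure_inv n R A0 True L0"
  shows "wp closure_prog s (\<lambda>s' t. \<exists>L ok. sides_stored n L s' \<and> vars s' ''ok'' = of_bool ok \<and> closure_inv n R A0 ok L \<and>
     (ok \<longrightarrow> homog {..<n} R (set (L 0)) (set (L 1))) \<and> t \<le> 15 * M + (10 * B + 40) * B + 5 * B + 30)"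
proof -
  define dg where "dg v = length (nbrs n R v)" for v
  define P where "P s' = {arrays s' ''q'' (c * n + i) | c i. c < 2 \<and> i < arrays s' ''hd'' c}" for s' :: store
  \<comment> \<open>Two scans at 5 per neighbour for each vertex not yet dequeued, where the excess
    \<open>5 * B\<close> of the second scan sits in the next summand; one \<open>tryadd\<close> per
    vertex still to be appended; and while \<open>ok\<close> holds, a reserve for one failing
    \<open>tryadd\<close> and for one scan of degree up to \<open>M\<close>.\<close>
  define \<Phi> where "\<Phi> s' = 10 * (\<Sum>v\<in>{..<n} - P s'. dg v) +
      (5 * B + 30) * (B - (arrays s' ''hd'' 0 + arrays s' ''hd'' 1)) +
      (5 * B + 10) * (B - (arrays s' ''len'' 0 + arrays s' ''len'' 1)) + (5 * B + 10 + 5 * M) * vars s' ''ok''" for s' :: store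
  define J where "J s' \<longleftrightarrow> (\<exists>L ok. sides_stored n L s' \<and> vars s' ''ok'' = of_bool ok \<and> closure_inv n R A0 ok L \<and>
      (\<forall>c<2. arrays s' ''hd'' c \<le> length (L c)) \<and>
      (ok \<longrightarrow> (\<forall>c<2. \<forall>i<arrays s' ''hd'' c. \<forall>v<n. v \<notin> set (L 0) \<union> set (L 1) \<longrightarrow> R (L c ! i) v = R (L c ! 0) v)))" for s' :: store
  note sym = is_graph_sym[OF gr]
  let ?s0 = "seta ''hd'' 1 0 (seta ''hd'' 0 0 (setv ''ok'' 1 s))"
  have cst0: "sides_stored n L0 ?s0"
    by (rule sides_stored_agree[OF _ _ _ _ sides_stored, of "{''ok''}" "{''hd''}"]) (auto simp: agree_def seta_def)
  have J0: "J ?s0"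
    unfolding J_def using cst0 inv less_2_cases' by (intro exI[of _ L0] exI[of _ True]) auto
  have MdgL: "(\<Sum>v\<in>X. dg v) \<le> M" if "X \<subseteq> {..<n}" for X
    unfolding M dg_def by (rule sum_mono2) (use that in auto)
  have dg: "dg v \<le> M" if "v < n" for v
    using MdgL[of "{v}"] that by simp
  have P0: "P ?s0 = {}"
    unfolding P_def using less_2_cases' by auto
  have "10 * (\<Sum>v\<in>{..<n}. dg v) \<le> 10 * M"
    using MdgL[of "{..<n}"] by simp
  moreover have "(5 * B + 10) * (B - (arrays ?s0 ''len'' 0 + arrays ?s0 ''len'' 1)) \<le> (5 * B + 10) * B"
    by (rule mult_le_mono2) simp
  ultimately have \<Phi>0: "\<Phi> ?s0 \<le> 15 * M + (10 * B + 40) * B + 5 * B + 10"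
    unfolding \<Phi>_def P0 by (simp add: algebra_simps)
  define body where "body = (If (Read ''hd'' (N 0) \<prec> Read ''len'' (N 0)) (''c'' \<longleftarrow> N 0) (''c'' \<longleftarrow> N 1) ;;
       ''od'' \<longleftarrow> N 1 \<ominus> V ''c'' ;;
       whenever (V ''ok'') (
         ''u'' \<longleftarrow> cell ''q'' (V ''c'') (Read ''hd'' (V ''c'')) ;;
         ''r'' \<longleftarrow> cell ''q'' (V ''c'') (N 0) ;;
         scan ''u'' ''r'' ;; scan ''r'' ''u'') ;;
       Write ''hd'' (V ''c'') (Read ''hd'' (V ''c'') \<oplus> N 1))"
  let ?g = "(Read ''hd'' (N 0) \<prec> Read ''len'' (N 0)) \<oplus> (Read ''hd'' (N 1) \<prec> Read ''len'' (N 1))"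
  have step: "wp body s' (\<lambda>s'' t. J s'' \<and> 1 + t + \<Phi> s'' \<le> \<Phi> s')"
    if J: "J s'" and g: "val s' ?g \<noteq> 0" and ag: "agree (modv body) (moda body) ?s0 s'" for s'
  proof -
    define h where "h c = arrays s' ''hd'' c" for c
    obtain L ok where I: "sides_stored n L s'" "vars s' ''ok'' = of_bool ok" "closure_inv n R A0 ok L"
       "\<forall>c<2. h c \<le> length (L c)"
       "ok \<longrightarrow> (\<forall>c<2. \<forall>i<h c. \<forall>v<n. v \<notin> set (L 0) \<union> set (L 1) \<longrightarrow> R (L c ! i) v = R (L c ! 0) v)"
      using J unfolding J_def h_def by blast
    have lenL: "arrays s' ''len'' 0 = length (L 0)" "arrays s' ''len'' 1 = length (L 1)"
      using sides_storedD(1)[OF I(1)] by simp_all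
    define c :: nat where "c = (if h 0 < length (L 0) then 0 else 1)"
    have c: "c < 2" "h c < length (L c)"
      using g lenL unfolding c_def h_def by (auto split: if_splits)
    have mat': "matrix_stored n R s'" using matrix_stored_agree[OF ag] matrix_stored by (auto simp: matrix_stored_def body_def scan_def tryadd_def push_def)
    have adl': "lists_stored n R s'" using lists_stored_agree[OF ag] lists_stored by (auto simp: lists_stored_def body_def scan_def tryadd_def push_def)
    have lB: "length (L 0) + length (L 1) \<le> B" by (rule closure_inv_length[OF bnd I(1,3)])
    have hB: "h 0 + h 1 < length (L 0) + length (L 1)"
      using c I(4)[rule_format, of 0] I(4)[rule_format, of 1] unfolding c_def by (auto split: if_splits)
    define u where "u = L c ! h c"
    define r where "r = L c ! 0"
    have "0 < length (L c)" using c(2) by linarith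
    then have ur: "u \<in> set (L c)" "r \<in> set (L c)" using c unfolding u_def r_def by auto
    have urn: "u < n" "r < n" using ur sides_storedD(3)[OF I(1) c(1)] by auto
    have q: "arrays s' ''q'' (c * n + h c) = u" "arrays s' ''q'' (c * n) = r"
      using sides_storedD(2)[OF I(1) c(1), of "h c"] sides_storedD(2)[OF I(1) c(1), of 0] c \<open>0 < length (L c)\<close> unfolding u_def r_def by auto
    have Pin: "P s' = {L d ! i | d i. d < 2 \<and> i < h d}"
    proof -
      have "arrays s' ''q'' (d * n + i) = L d ! i" if "d < 2" "i < h d" for d i
        using sides_storedD(2)[OF I(1) that(1)] I(4) that by (meson order_less_le_trans)
      then show ?thesis unfolding P_def h_def[symmetric] by (intro Setcompr2_cong) blast
    qed
    \<comment> \<open>The lists are free of repetitions and disjoint, so \<open>u\<close> was not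
      dequeued before and its degree is still available in the sum.\<close>
    have uP: "u \<notin> P s'"
    proof
      assume "u \<in> P s'"
      then obtain d i where di: "d < 2" "i < h d" "u = L d ! i" unfolding Pin by blast
      then have il: "i < length (L d)" using I(4) by (meson order_less_le_trans)
      show False
      proof (cases "d = c")
        case True
        then show False
          using di c(2) il sides_storedD(4)[OF I(1) c(1)] unfolding u_def by (simp add: nth_eq_iff_index_eq)
      next
        case False
        have "u \<in> set (L d)" using il di by simp
        moreover have "set (L 0) \<inter> set (L 1) = {}" using I(1) by (simp add: sides_stored_def)
        ultimately show False using ur False less_2_cases'[OF c(1)] less_2_cases'[OF di(1)] by auto
      qed
    qed
    define S where "S = {..<n} - P s'"
    have sumS: "(\<Sum>v\<in>S. dg v) = dg u + (\<Sum>v\<in>S - {u}. dg v)"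
      by (rule sum.remove) (use urn uP in \<open>auto simp: S_def\<close>)
    define fin where "fin = (\<lambda>(L' :: nat \<Rightarrow> nat list) ok' s'' t. sides_stored n L' s'' \<and> vars s'' ''ok'' = of_bool ok' \<and> closure_inv n R A0 ok' L' \<and>
       (\<forall>d. \<exists>xs. L' d = L d @ xs) \<and>
       (ok' \<longrightarrow> ok \<and> (\<forall>v<n. v \<notin> set (L' 0) \<union> set (L' 1) \<longrightarrow> R u v = R r v)) \<and>
       (t + (5 * B + 10) * (length (L 0) + length (L 1)) + (5 * B + 10 + 5 * M) * of_bool ok' \<le> (5 * B + 10) * (length (L' 0) + length (L' 1)) +
         10 * dg u + 5 * B + 20 + (5 * B + 10 + 5 * M) * of_bool ok))"
    have finish: "J (seta ''hd'' c (Suc (h c)) s'') \<and> 8 + t + \<Phi> (seta ''hd'' c (Suc (h c)) s'') \<le> \<Phi> s'"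
      if f: "fin L' ok' s'' t" and ag2: "agree {''p'', ''v'', ''i'', ''w'', ''ok'', ''c'', ''od'', ''u'', ''r''} {''q'', ''len'', ''used''} s' s''" for L' ok' s'' t
    proof -
      define s3 where "s3 = seta ''hd'' c (Suc (h c)) s''"
      have F: "sides_stored n L' s''" "vars s'' ''ok'' = of_bool ok'" "closure_inv n R A0 ok' L'" "\<forall>d. \<exists>xs. L' d = L d @ xs"
       "ok' \<longrightarrow> ok \<and> (\<forall>v<n. v \<notin> set (L' 0) \<union> set (L' 1) \<longrightarrow> R u v = R r v)"
       "t + (5 * B + 10) * (length (L 0) + length (L 1)) + (5 * B + 10 + 5 * M) * of_bool ok' \<le> (5 * B + 10) * (length (L' 0) + length (L' 1)) +
         10 * dg u + 5 * B + 20 + (5 * B + 10 + 5 * M) * of_bool ok"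
        using f unfolding fin_def by blast+
      have cst3: "sides_stored n L' s3"
        unfolding s3_def by (rule sides_stored_agree[OF _ _ _ _ F(1), of "{}" "{''hd''}"]) (auto simp: agree_def seta_def)
      have hd3: "arrays s3 ''hd'' d = (if d = c then Suc (h c) else h d)" for d
        using ag2 by (simp add: s3_def agree_def h_def)
      have nth: "L' d ! i = L d ! i" if "i < length (L d)" for d i
        using F(4)[rule_format, of d] that by (auto simp: nth_append)
      have le: "length (L d) \<le> length (L' d)" "set (L d) \<subseteq> set (L' d)" for d
        using F(4)[rule_format, of d] by auto
      have h_le: "i < length (L d)" if "d < 2" "i < (if d = c then Suc (h c) else h d)" for d i
        using I(4)[rule_format, OF that(1)] c(2) that(2) by (auto split: if_splits)
      have "R (L' d ! i) v = R (L' d ! 0) v"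
        if "ok'" "d < 2" "i < (if d = c then Suc (h c) else h d)" "v < n" "v \<notin> set (L' 0) \<union> set (L' 1)" for d i v
      proof -
        have il: "i < length (L d)" using h_le that(2,3) by blast
        then have "0 < length (L d)" by linarith
        then have nn: "L' d ! i = L d ! i" "L' d ! 0 = L d ! 0" using nth il by blast+
        have v: "v \<notin> set (L 0) \<union> set (L 1)" using that(5) le by auto
        show ?thesis
        proof (cases "d = c \<and> i = h c")
          case True
          then have "L d ! i = u" "L d ! 0 = r" unfolding u_def r_def by simp_all
          then show ?thesis using F(5) that(1,4,5) by (simp only: nn) blast
        next
          case False
          then have "i < h d" using that(3) by (auto split: if_splits)
          moreover have ok using F(5) that(1) by blast
          ultimately have "R (L d ! i) v = R (L d ! 0) v" using I(5) that(2,4) v by blast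
          then show ?thesis by (simp only: nn)
        qed
      qed
      moreover have "(if d = c then Suc (h c) else h d) \<le> length (L' d)" if "d < 2" for d
        using I(4)[rule_format, OF that] c(2) le(1)[of d] by auto
      moreover have vs3: "vars s3 ''ok'' = of_bool ok'" using F(2) by (simp add: s3_def)
      ultimately have "J s3"
        unfolding J_def hd3 using cst3 F(3) by (intro exI[of _ L'] exI[of _ ok'] conjI) blast+
      moreover
      have "P s3 = insert u (P s')"
      proof -
        have "arrays s3 ''q'' (d * n + i) = L d ! i" if "d < 2" "i < (if d = c then Suc (h c) else h d)" for d i
        proof -
          have "i < length (L d)" using h_le that by blast
          then show ?thesis using sides_storedD(2)[OF cst3 that(1), of i] nth[of i d] le(1)[of d] by simp
        qed
        then have "P s3 = {L d ! i | d i. d < 2 \<and> i < (if d = c then Suc (h c) else h d)}"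
          unfolding P_def hd3 by (intro Setcompr2_cong) blast
        also have "\<dots> = insert u (P s')"
        proof -
          have "i < (if d = c then Suc (h c) else h d) \<longleftrightarrow> i < h d \<or> (d = c \<and> i = h c)" for d i by auto
          then show ?thesis unfolding Pin u_def using c(1) by (simp only:) blast
        qed
        finally show ?thesis .
      qed
      then have S3: "{..<n} - P s3 = S - {u}" by (auto simp: S_def)
      have len3: "arrays s3 ''len'' 0 = length (L' 0)" "arrays s3 ''len'' 1 = length (L' 1)"
        using sides_storedD(1)[OF cst3] by simp_all
      have lB': "length (L' 0) + length (L' 1) \<le> B" by (rule closure_inv_length[OF bnd F(1,3)])
      have hs: "arrays s3 ''hd'' 0 + arrays s3 ''hd'' 1 = Suc (h 0 + h 1)"
        unfolding hd3 using less_2_cases'[OF c(1)] by auto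
      have ll: "length (L 0) + length (L 1) \<le> length (L' 0) + length (L' 1)" using le(1) by (simp add: add_mono)
      have "Suc (h 0 + h 1) \<le> B" using hB lB by linarith
      then obtain y where y: "B = Suc (h 0 + h 1) + y" using le_Suc_ex by blast
      obtain z where z: "B = length (L' 0) + length (L' 1) + z" using lB' le_Suc_ex by blast
      obtain x where x: "length (L' 0) + length (L' 1) = length (L 0) + length (L 1) + x" using ll le_Suc_ex by blast
      have 1: "B - Suc (h 0 + h 1) = y" "B - (h 0 + h 1) = Suc y" using y by simp_all
      have 2: "B - (length (L' 0) + length (L' 1)) = z" "B - (length (L 0) + length (L 1)) = z + x"
        using z x by simp_all
      have "(5 * B + 10) * (length (L' 0) + length (L' 1)) = (5 * B + 10) * (length (L 0) + length (L 1)) + (5 * B + 10) * x"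
        unfolding x by (simp add: algebra_simps)
      then have t: "t + (5 * B + 10 + 5 * M) * of_bool ok' \<le> (5 * B + 10) * x +
         10 * dg u + 5 * B + 20 + (5 * B + 10 + 5 * M) * of_bool ok" using F(6) by linarith
      have "\<Phi> s3 = 10 * (\<Sum>v\<in>S - {u}. dg v) + (5 * B + 30) * y + (5 * B + 10) * z + (5 * B + 10 + 5 * M) * of_bool ok'"
        unfolding \<Phi>_def hs len3 S3 1 2 vs3 ..
      moreover have "\<Phi> s' = 10 * (dg u + (\<Sum>v\<in>S - {u}. dg v)) + (5 * B + 30) * Suc y + (5 * B + 10) * (z + x) + (5 * B + 10 + 5 * M) * of_bool ok"
        unfolding \<Phi>_def lenL h_def[symmetric] 1 2 I(2) S_def[symmetric] sumS ..
      moreover have "(5 * B + 30) * Suc y = (5 * B + 30) * y + 5 * B + 30" by simp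
      moreover have "(5 * B + 10) * (z + x) = (5 * B + 10) * z + (5 * B + 10) * x" by (simp add: algebra_simps)
      ultimately have "8 + t + \<Phi> s3 \<le> \<Phi> s'" using t unfolding add_mult_distrib2[of 10] by linarith
      with \<open>J s3\<close> show ?thesis unfolding s3_def by blast
    qed
    define rest where "rest = (''od'' \<longleftarrow> N 1 \<ominus> V ''c'' ;;
       whenever (V ''ok'') (
         ''u'' \<longleftarrow> cell ''q'' (V ''c'') (Read ''hd'' (V ''c'')) ;;
         ''r'' \<longleftarrow> cell ''q'' (V ''c'') (N 0) ;;
         scan ''u'' ''r'' ;; scan ''r'' ''u'') ;;
       Write ''hd'' (V ''c'') (Read ''hd'' (V ''c'') \<oplus> N 1))"
    have key: "wp rest (setv ''c'' c s') (\<lambda>s'' t. J s'' \<and> 3 + t + \<Phi> s'' \<le> \<Phi> s')"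
    proof (cases ok)
      case False
      let ?s = "setv ''od'' (Suc 0 - c) (setv ''c'' c s')"
      have "sides_stored n L ?s"
        by (rule sides_stored_agree[OF _ _ _ _ I(1), of "{''c'',''od''}" "{}"]) (auto simp: agree_def)
      then have "fin L False ?s 0" unfolding fin_def using I False by simp
      from finish[OF this] have "J (seta ''hd'' c (Suc (h c)) ?s)" "8 + \<Phi> (seta ''hd'' c (Suc (h c)) ?s) \<le> \<Phi> s'"
        by (auto simp: agree_def)
      then show ?thesis using I(2) False by (simp add: rest_def h_def)
    next
      case True
      let ?s = "setv ''r'' r (setv ''u'' u (setv ''od'' (Suc 0 - c) (setv ''c'' c s')))"
      have ag1: "agree {''c'',''od'',''u'',''r''} {} s' ?s" by (auto simp: agree_def)
      have 1: "matrix_stored n R ?s" "lists_stored n R ?s" "sides_stored n L ?s"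
        using matrix_stored_agree[OF ag1 _ _ mat'] lists_stored_agree[OF ag1 _ _ adl'] sides_stored_agree[OF ag1 _ _ _ I(1)] by simp_all
      have sc1: "wp (scan ''u'' ''r'') ?s (\<lambda>s' t. \<exists>xs ok'. sides_stored n (ext (1 - c) L xs) s' \<and> vars s' ''ok'' = of_bool ok' \<and>
         closure_inv n R A0 ok' (ext (1 - c) L xs) \<and> (ok' \<longrightarrow> True) \<and>
         (ok' \<longrightarrow> (\<forall>v. R u v \<longrightarrow> R r v \<or> v \<in> set (ext (1 - c) L xs 0) \<union> set (ext (1 - c) L xs 1))) \<and>
         t \<le> 5 * length (nbrs n R u) + 2 + (5 * B + 10) * (length xs + of_bool (True \<and> \<not> ok')))"
        by (rule wp_scan[OF gr 1 bnd]) (use ur c I True in simp_all)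
      have goal: "wp (scan ''u'' ''r'' ;; scan ''r'' ''u'') ?s (\<lambda>s'' t. \<exists>L' ok'. fin L' ok' s'' t)"
        unfolding wp_Seq
      proof (rule wp_conseq[OF sc1], elim exE conjE, goal_cases)
        case (1 s1 t1 xs ok1)
        let ?L = "ext (1 - c) L xs"
        have ag3: "agree {''p'',''v'',''i'',''w'',''ok''} {''q'',''len'',''used''} ?s s1"
          using 1(1) by (rule agree_mono) (auto simp: scan_def tryadd_def push_def)
        have 2: "matrix_stored n R s1" "lists_stored n R s1"
          using matrix_stored_agree[OF ag3 _ _ \<open>matrix_stored n R ?s\<close>] lists_stored_agree[OF ag3 _ _ \<open>lists_stored n R ?s\<close>] by simp_all
        have v1: "vars s1 ''u'' = u" "vars s1 ''r'' = r" "vars s1 ''od'' = 1 - c"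
          using ag3 by (simp_all add: agree_def)
        have ur': "u \<in> set (?L c)" "r \<in> set (?L c)" using ur set_ext by blast+
        have sc2: "wp (scan ''r'' ''u'') s1 (\<lambda>s' t. \<exists>ys ok'. sides_stored n (ext (1 - c) ?L ys) s' \<and> vars s' ''ok'' = of_bool ok' \<and>
           closure_inv n R A0 ok' (ext (1 - c) ?L ys) \<and> (ok' \<longrightarrow> ok1) \<and>
           (ok' \<longrightarrow> (\<forall>v. R r v \<longrightarrow> R u v \<or> v \<in> set (ext (1 - c) ?L ys 0) \<union> set (ext (1 - c) ?L ys 1))) \<and>
           t \<le> 5 * length (nbrs n R r) + 2 + (5 * B + 10) * (length ys + of_bool (ok1 \<and> \<not> ok')))"
          by (rule wp_scan[OF gr 2 1(2) bnd]) (use ur' c v1 1 in simp_all)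
        show ?case
        proof (rule wp_conseq[OF sc2], elim exE conjE, goal_cases)
          case A': (1 s2 t2 ys ok2)
          let ?L2 = "ext (1 - c) L (xs @ ys)"
          note A = A'[unfolded ext_simps]
          have l2: "length (?L2 0) + length (?L2 1) = length (L 0) + length (L 1) + length xs + length ys"
            using less_2_cases'[OF c(1)] by (auto simp: ext_def)
          have l2B: "length (?L2 0) + length (?L2 1) \<le> B"
            by (rule closure_inv_length[OF bnd A(2,4)])
          have sub: "set (?L 0) \<subseteq> set (?L2 0)" "set (?L 1) \<subseteq> set (?L2 1)" by (auto simp: ext_def)
          have eq: "R u v = R r v" if "ok2" "v \<notin> set (?L2 0) \<union> set (?L2 1)" for v
            using \<open>ok1 \<longrightarrow> (\<forall>v. R u v \<longrightarrow> _ v)\<close> A(5,6) that sub by blast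
          \<comment> \<open>If the closure fails this bound is lost; the reserve
            \<open>5 * M\<close> pays for the scan in that case, which happens only once.\<close>
          have dr: "dg r \<le> dg u + B" if ok2
          proof -
            have "set (nbrs n R r) \<subseteq> set (nbrs n R u) \<union> (set (?L2 0) \<union> set (?L2 1))"
              using A(6) that set_nbrs[OF gr] by auto
            then have "card (set (nbrs n R r)) \<le> card (set (nbrs n R u) \<union> (set (?L2 0) \<union> set (?L2 1)))"
              by (rule card_mono[rotated]) simp
            also have "\<dots> \<le> card (set (nbrs n R u)) + (card (set (?L2 0)) + card (set (?L2 1)))"
              using card_Un_le[of "set (nbrs n R u)" "set (?L2 0) \<union> set (?L2 1)"] card_Un_le[of "set (?L2 0)" "set (?L2 1)"] by linarith
            also have "\<dots> \<le> dg u + (length (?L2 0) + length (?L2 1))"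
              unfolding dg_def by (intro add_mono card_length)
            also have "\<dots> \<le> dg u + B" using l2B by simp
            finally show ?thesis unfolding dg_def using distinct_card[OF distinct_nbrs, of n R r] by simp
          qed
          define X where "X = 5 * B + 10"
          have "t1 \<le> 5 * dg u + 2 + X * (length xs + of_bool (\<not> ok1))"
            using 1(7) unfolding dg_def X_def by simp
          moreover have "t2 \<le> 5 * dg r + 2 + X * (length ys + of_bool (ok1 \<and> \<not> ok2))"
            using A(7) unfolding dg_def X_def by simp
          moreover have "dg r \<le> M" using dg urn by simp
          moreover have "ok2 \<longrightarrow> ok1" using A(5) .
          ultimately have T: "t1 + t2 + X * (length (L 0) + length (L 1)) + (X + 5 * M) * of_bool ok2 \<le> X * (length (?L2 0) + length (?L2 1)) +
             10 * dg u + 5 * B + 20 + (X + 5 * M) * of_bool True"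
            unfolding l2 using dr by (cases ok1; cases ok2) (simp_all add: algebra_simps)
          have "\<forall>d. \<exists>xs'. ?L2 d = L d @ xs'" by (simp add: ext_def)
          then have "fin ?L2 ok2 s2 (t1 + t2)"
            unfolding fin_def using A(2,3,4) eq True T[unfolded X_def] by simp
          then show ?case by blast
        qed
      qed
      show ?thesis
        unfolding rest_def using I(2) True q c matrix_storedD(1)[OF mat']
        apply (simp del: wp_Seq add: wp_Seq[of "''od'' \<longleftarrow> _"] wp_Seq[of "whenever _ _"] wp_Seq[of "''u'' \<longleftarrow> _"] wp_Seq[of "''r'' \<longleftarrow> _"] h_def[symmetric])
      proof (rule wp_conseq[OF goal], elim exE, goal_cases)
        case (1 s2 t L' ok')
        have "agree (modv (scan ''u'' ''r'' ;; scan ''r'' ''u'')) (moda (scan ''u'' ''r'' ;; scan ''r'' ''u'')) ?s s2"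
          using 1 by simp
        then have ag2: "agree {''p'',''v'',''i'',''w'',''ok''} {''q'',''len'',''used''} ?s s2"
          by (rule agree_mono) (auto simp: scan_def tryadd_def push_def)
        have "agree {''p'', ''v'', ''i'', ''w'', ''ok'', ''c'', ''od'', ''u'', ''r''} {''q'', ''len'', ''used''} s' s2"
          by (rule agree_trans[OF agree_mono[OF ag1] agree_mono[OF ag2]]) auto
        from finish[OF \<open>fin L' ok' s2 t\<close> this] have "J (seta ''hd'' c (Suc (h c)) s2)" "8 + t + \<Phi> (seta ''hd'' c (Suc (h c)) s2) \<le> \<Phi> s'"
          by auto
        moreover have "vars s2 ''c'' = c" "arrays s2 ''hd'' c = h c"
          using ag2 by (simp_all add: agree_def h_def)
        ultimately show ?case by simp
      qed
    qed
    have "body = (If (Read ''hd'' (N 0) \<prec> Read ''len'' (N 0)) (''c'' \<longleftarrow> N 0) (''c'' \<longleftarrow> N 1) ;; rest)"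
      unfolding body_def rest_def ..
    moreover have "(arrays s' ''hd'' 0 < arrays s' ''len'' 0) = (h 0 < length (L 0))"
      using lenL by (simp add: h_def)
    ultimately show ?thesis
      using key lenL unfolding c_def numeral_3_eq_3 by (auto simp add: h_def[symmetric])
  qed
  have "wp (While ?g body) ?s0
     (\<lambda>s' t. \<exists>L ok. sides_stored n L s' \<and> vars s' ''ok'' = of_bool ok \<and> closure_inv n R A0 ok L \<and>
     (ok \<longrightarrow> homog {..<n} R (set (L 0)) (set (L 1))) \<and> t \<le> 15 * M + (10 * B + 40) * B + 5 * B + 20)"
  proof (rule wp_While[where I = J and \<Phi> = \<Phi>])
    show "J ?s0" by (rule J0)
  next
    fix s' assume "J s'" "val s' ?g \<noteq> 0" "agree (modv body) (moda body) ?s0 s'"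
    then show "wp body s' (\<lambda>s'' t. J s'' \<and> 1 + t + \<Phi> s'' \<le> \<Phi> s')" by (rule step)
  next
    fix s' t assume J: "J s'" and g: "val s' ?g = 0" and t: "t + \<Phi> s' \<le> \<Phi> ?s0 + 1"
    obtain L ok where I: "sides_stored n L s'" "vars s' ''ok'' = of_bool ok" "closure_inv n R A0 ok L"
       "\<forall>c<2. arrays s' ''hd'' c \<le> length (L c)"
       "ok \<longrightarrow> (\<forall>c<2. \<forall>i<arrays s' ''hd'' c. \<forall>v<n. v \<notin> set (L 0) \<union> set (L 1) \<longrightarrow> R (L c ! i) v = R (L c ! 0) v)"
      using J unfolding J_def by blast
    have "length (L 0) \<le> arrays s' ''hd'' 0" "length (L 1) \<le> arrays s' ''hd'' 1"
      using g sides_storedD(1)[OF I(1), of 0] sides_storedD(1)[OF I(1), of 1] by simp_all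
    then have len: "length (L c) \<le> arrays s' ''hd'' c" if "c < 2" for c
      using less_2_cases'[OF that] by blast
    then have un: "\<forall>c<2. \<forall>u\<in>set (L c). \<forall>v<n. v \<notin> set (L 0) \<union> set (L 1) \<longrightarrow> R u v = R (L c ! 0) v" if ok
    proof (intro allI ballI impI)
      fix c u v assume *: "c < (2::nat)" "u \<in> set (L c)" "v < n" "v \<notin> set (L 0) \<union> set (L 1)"
      from *(2) obtain i where i: "i < length (L c)" "u = L c ! i" unfolding in_set_conv_nth by blast
      have "i < arrays s' ''hd'' c" using i(1) len[OF *(1)] by linarith
      then show "R u v = R (L c ! 0) v" unfolding i(2) using I(5) that * by blast
    qed
    have "homog {..<n} R (set (L 0)) (set (L 1))" if ok
    proof -
      have "uniform_to R v (set (L c))" if "c < 2" "v < n" "v \<notin> set (L 0) \<union> set (L 1)" for c v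
      proof -
        have "R v u \<longleftrightarrow> R (L c ! 0) v" if "u \<in> set (L c)" for u
          using un[OF \<open>ok\<close>] that \<open>c < 2\<close> \<open>v < n\<close> \<open>v \<notin> _\<close> sym by blast
        then show ?thesis unfolding uniform_to_def by blast
      qed
      from this[of 0] this[of 1] show ?thesis
        using I(1,3) unfolding homog_def closure_inv_def sides_stored_def by auto
    qed
    moreover have "t \<le> 15 * M + (10 * B + 40) * B + 5 * B + 20" using t \<Phi>0 by linarith
    ultimately show "\<exists>L ok. sides_stored n L s' \<and> vars s' ''ok'' = of_bool ok \<and> closure_inv n R A0 ok L \<and>
     (ok \<longrightarrow> homog {..<n} R (set (L 0)) (set (L 1))) \<and> t \<le> 15 * M + (10 * B + 40) * B + 5 * B + 20"
      using I(1-3) by blast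
  qed
  then show ?thesis
    unfolding closure_prog_def body_def[symmetric] by (simp, elim wp_conseq) fastforce
qed

text \<open>Equal closed neighbourhoods. A vertex counts as its own twin, so that \<open>a\<close>
  itself is in the seed.\<close>

definition twin :: "('b \<Rightarrow> 'b \<Rightarrow> bool) \<Rightarrow> 'b \<Rightarrow> 'b \<Rightarrow> bool" where
  "twin R a v \<longleftrightarrow> v = a \<or> (R a v \<and> (\<forall>w. w \<noteq> a \<longrightarrow> w \<noteq> v \<longrightarrow> R v w = R a w))"

text \<open>An inclusion between closed neighbourhoods of equal finite size is an equality. The
  program can therefore decide the question by reading the list of \<open>v\<close> only.\<close>

lemma twin_test:
  assumes gr: "is_graph n R" and av: "R a v"
  shows "twin R a v \<longleftrightarrow> length (nbrs n R v) = length (nbrs n R a) \<and> (\<forall>w. R v w \<longrightarrow> R a w \<or> w = a)"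
proof -
  have fin: "finite {w. R u w}" for u
    using finite_subset[of "{w. R u w}" "{..<n}"] is_graphD[OF gr] by auto
  have va: "R v a" "v \<noteq> a" using is_graphD[OF gr av] by auto
  have c: "card {w. R v w} = Suc (card ({w. R v w} - {a}))" "card {w. R a w} = Suc (card ({w. R a w} - {v}))"
    using card.remove[OF fin, of a v] card.remove[OF fin, of v a] av va by simp_all
  have sub: "{w. R v w} - {a} \<subseteq> {w. R a w} - {v}" if "\<forall>w. R v w \<longrightarrow> R a w \<or> w = a"
    using that is_graph_irrefl[OF gr] by auto
  show ?thesis unfolding length_nbrs[OF gr]
  proof
    assume t: "twin R a v"
    then have "{w. R v w} - {a} = {w. R a w} - {v}"
      using va is_graph_irrefl[OF gr] unfolding twin_def by (auto; metis)
    then show "card {w. R v w} = card {w. R a w} \<and> (\<forall>w. R v w \<longrightarrow> R a w \<or> w = a)" using c by auto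
  next
    assume *: "card {w. R v w} = card {w. R a w} \<and> (\<forall>w. R v w \<longrightarrow> R a w \<or> w = a)"
    have "{w. R v w} - {a} = {w. R a w} - {v}"
      by (rule card_subset_eq[OF _ sub]) (use * c fin in auto)
    then show "twin R a v" using av unfolding twin_def by auto
  qed
qed

lemma sum_nth_distinct:
  assumes "distinct xs" "finite X" "set xs \<subseteq> X"
  shows "(\<Sum>p<length xs. f (xs ! p)) \<le> (\<Sum>v\<in>X. f v :: nat)"
proof -
  have "(\<Sum>p<length xs. f (xs ! p)) = sum_list (map f xs)"
    by (simp add: sum_list_sum_nth atLeast0LessThan)
  also have "\<dots> = sum f (set xs)" using assms(1) by (rule sum_list_distinct_conv_sum_set)
  also have "\<dots> \<le> sum f X" by (rule sum_mono2) (use assms in auto)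
  finally show ?thesis .
qed

lemma length_nbrs_le_sum:
  assumes "is_graph n R" "v < n"
  shows "length (nbrs n R v) \<le> (\<Sum>v<n. length (nbrs n R v))"
  using assms(2) by (intro member_le_sum) auto

lemma wp_twins:
  assumes gr: "is_graph n R" and matrix_stored: "matrix_stored n R s" and lists_stored: "lists_stored n R s"
    and xa: "vars s ''x'' = x" "vars s ''a'' = a" "R x a"
    and M: "M = (\<Sum>v<n. length (nbrs n R v))"
  shows "wp twins_prog s (\<lambda>s' t. \<exists>L. sides_stored n L s' \<and> set (L 0) = insert x {v. twin R a v} \<and> L 1 = [] \<and>
     t \<le> 3 * n + 17 * M + 20)"
  unfolding twins_prog_def wp_Seq
proof (rule wp_For_bound[where N = n and T = 1 and I = "\<lambda>k s'. \<forall>i<k. arrays s' ''used'' i = 0"], goal_cases)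
  case (5 s1 t1)
  have xan: "a < n" "x < n" "R a x" "a \<noteq> x" using is_graphD[OF gr xa(3)] by auto
  let ?xs = "nbrs n R a"
  let ?s2 = "setv ''v'' a (seta ''len'' 1 0 (seta ''len'' 0 0 s1))"
  have ag: "agree {''i'',''v''} {''used'',''len''} s ?s2"
    using 5(3) by (auto simp: agree_def seta_def)
  have cst2: "sides_stored n (\<lambda>_. []) ?s2"
    using 5(1) less_2_cases' by (auto simp: sides_stored_def)
  have n2: "vars ?s2 ''n'' = n" using matrix_storedD(1)[OF matrix_stored] ag by (simp add: agree_def)
  define L1 :: "nat \<Rightarrow> nat list" where "L1 = (\<lambda>_. [])(0 := [] @ [a])"
  define sel where "sel k = filter (twin R a) (take k ?xs)" for k
  define ptw where "ptw = ''v'' \<longleftarrow> cell ''lst'' (V ''a'') (V ''p'') ;;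
       whenever (Read ''deg'' (V ''v'') \<doteq> Read ''deg'' (V ''a''))
         (''tw'' \<longleftarrow> N 1 ;;
          For ''j'' (Read ''deg'' (V ''v'')) (
            ''w'' \<longleftarrow> cell ''lst'' (V ''v'') (V ''j'') ;;
            whenever ((cell ''subadj'' (V ''a'') (V ''w'') \<doteq> N 0) \<otimes> ((V ''w'' \<doteq> V ''a'') \<doteq> N 0)) (''tw'' \<longleftarrow> N 0)) ;;
          whenever (V ''tw'') (push (N 0)))"
  have loop: "wp (For ''p'' (Read ''deg'' (V ''a'')) ptw) s3 (\<lambda>s' t. sides_stored n (ext 0 L1 (sel (length ?xs))) s' \<and> t \<le> 17 * M + 2)"
    if cst3: "sides_stored n L1 s3" and ag3: "agree {''i'',''v''} {''used'',''len'',''q''} s s3" for s3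
  proof (rule wp_For[where N = "length ?xs" and I = "\<lambda>k s' \<tau>. sides_stored n (ext 0 L1 (sel k)) s' \<and>
        \<tau> \<le> (\<Sum>p<k. 5 * length (nbrs n R (?xs ! p)) + 12)"], goal_cases)
    case 1
    then show ?case by (simp add: ptw_def push_def)
  next
    case (2 s')
    then show ?case using ag3 xa(2) lists_storedD(1)[OF lists_stored xan(1)] by (simp add: agree_def ptw_def push_def)
  next
    case 3
    show ?case using sides_stored_agree[OF _ _ _ _ cst3, of "{''p''}" "{}"] by (simp add: agree_def sel_def)
  next
    case (4 k s' \<tau>)
    define v where "v = ?xs ! k"
    have v: "R a v" "v < n" using nbrs_nth[OF gr 4(1)] by (simp_all add: v_def)
    have ag4: "agree {''i'',''v'',''p'',''tw'',''j'',''w''} {''used'',''len'',''q''} s s'"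
      by (rule agree_trans[OF agree_mono[OF ag3] agree_mono[OF 4(4)]]) (auto simp: ptw_def push_def)
    have st: "vars s' ''n'' = n" "vars s' ''a'' = a" using ag4 xa matrix_storedD(1)[OF matrix_stored] by (simp_all add: agree_def)
    have mat4: "matrix_stored n R s'" and adl4: "lists_stored n R s'"
      using matrix_stored_agree[OF ag4 _ _ matrix_stored] lists_stored_agree[OF ag4 _ _ lists_stored] by simp_all
    have lst: "arrays s' ''lst'' (a * n + k) = v" using lists_storedD(2)[OF adl4 xan(1) 4(1)] by (simp add: v_def)
    have deg: "arrays s' ''deg'' a = length ?xs" "arrays s' ''deg'' v = length (nbrs n R v)"
      using lists_storedD(1)[OF adl4] xan v by simp_all
    have selS: "sel (Suc k) = sel k @ (if twin R a v then [v] else [])"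
      unfolding sel_def v_def using 4(1) by (simp add: take_Suc_conv_app_nth)
    have vnot: "v \<notin> set (ext 0 L1 (sel k) 0) \<union> set (ext 0 L1 (sel k) 1)"
    proof -
      have "v \<notin> set (take k ?xs)"
        unfolding v_def using 4(1) distinct_nbrs[of n R a]
        by (metis distinct_take distinct_append id_take_nth_drop not_distinct_conv_prefix take_Suc_conv_app_nth)
      moreover have "v \<noteq> a" using v(1) is_graph_irrefl[OF gr] by auto
      ultimately show ?thesis by (auto simp: sel_def L1_def)
    qed
    show ?case
    proof (cases "length (nbrs n R v) = length ?xs")
      case False
      then have "\<not> twin R a v" using twin_test[OF gr v(1)] by simp
      moreover have "sides_stored n L (setv ''p'' (Suc k) (setv ''v'' v s'))" if "sides_stored n L s'" for L
        using sides_stored_agree[OF _ _ _ _ that, of "{''p'',''v''}" "{}"] by (simp add: agree_def)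
      ultimately show ?thesis
        unfolding ptw_def using 4(2,3) st lst deg False selS by (simp add: v_def[symmetric])
    next
      case True
      let ?s5 = "setv ''tw'' 1 (setv ''v'' v s')"
      have ag5: "agree {''v'',''tw''} {} s' ?s5" by (auto simp: agree_def)
      have mat5: "matrix_stored n R ?s5" and adl5: "lists_stored n R ?s5" and cst5: "sides_stored n (ext 0 L1 (sel k)) ?s5"
        using matrix_stored_agree[OF ag5 _ _ mat4] lists_stored_agree[OF ag5 _ _ adl4] sides_stored_agree[OF ag5 _ _ _ ] 4(2) by simp_all
      have inner: "wp (For ''j'' (Read ''deg'' (V ''v'')) (
            ''w'' \<longleftarrow> cell ''lst'' (V ''v'') (V ''j'') ;;
            whenever ((cell ''subadj'' (V ''a'') (V ''w'') \<doteq> N 0) \<otimes> ((V ''w'' \<doteq> V ''a'') \<doteq> N 0)) (''tw'' \<longleftarrow> N 0))) ?s5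
          (\<lambda>s6 t. vars s6 ''tw'' = of_bool (twin R a v) \<and> t \<le> 5 * length (nbrs n R v) + 2)"
      proof (rule wp_For_bound[where N = "length (nbrs n R v)" and T = 3 and
            I = "\<lambda>j s6. vars s6 ''tw'' = of_bool (\<forall>i<j. R a (nbrs n R v ! i) \<or> nbrs n R v ! i = a)"], goal_cases)
        case 2
        then show ?case using deg by (simp add: agree_def)
      next
        case (4 j s6)
        have w: "nbrs n R v ! j < n" using nbrs_nth[OF gr 4(1)] by simp
        have "arrays s6 ''lst'' (v * n + j) = nbrs n R v ! j" "vars s6 ''v'' = v" "vars s6 ''n'' = n" "vars s6 ''a'' = a"
          "arrays s6 ''subadj'' (a * n + (nbrs n R v ! j)) = of_bool (R a (nbrs n R v ! j))"
          using 4(4) lists_storedD(2)[OF adl5 v(2) 4(1)] matrix_storedD(2)[OF mat5 xan(1) w] st by (simp_all add: agree_def)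
        then show ?case using 4 by (auto simp: less_Suc_eq)
      next
        case (5 s6 t)
        have "(\<forall>i<length (nbrs n R v). R a (nbrs n R v ! i) \<or> nbrs n R v ! i = a) \<longleftrightarrow> (\<forall>w\<in>set (nbrs n R v). R a w \<or> w = a)"
          by (metis in_set_conv_nth)
        then show ?case
          using 5 True twin_test[OF gr v(1)] set_nbrs[OF gr, of v] by (simp add: mult.commute)
      qed simp_all
      show ?thesis
        unfolding ptw_def using st lst deg True 4(3)
        apply (simp add: One_nat_def[symmetric] del: One_nat_def)
      proof (rule wp_conseq[OF inner], goal_cases)
        case (1 s6 t)
        have ag6: "agree {''j'',''w'',''tw''} {} ?s5 s6" by (rule agree_mono) (use 1 in auto)
        have cst6: "sides_stored n (ext 0 L1 (sel k)) s6" and n6: "vars s6 ''n'' = n" and v6: "vars s6 ''v'' = v"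
          using sides_stored_agree[OF ag6 _ _ _ cst5] ag6 st by (simp_all add: agree_def)
        have T: "\<tau> + t + 9 \<le> (\<Sum>p<Suc k. 5 * length (nbrs n R (?xs ! p)) + 12)"
          using 1 4(2) by (simp add: v_def)
        have p: "sides_stored n L (setv ''p'' (Suc k) s')" if "sides_stored n L s'" for L s'
          using sides_stored_agree[OF _ _ _ _ that, of "{''p''}" "{}"] by (simp add: agree_def)
        have tw6: "vars s6 ''tw'' = of_bool (twin R a v)" using 1 by simp
        show ?case
        proof (cases "twin R a v")
          case False
          then show ?thesis using p[OF cst6] tw6 T selS 4(3) by (simp add: add.assoc)
        next
          case True
          have "wp (push (N 0)) s6 (\<lambda>s' t. sides_stored n ((ext 0 L1 (sel k))(0 := ext 0 L1 (sel k) 0 @ [v])) s' \<and> t = 3)"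
            by (rule wp_push[OF cst6 n6 _ _ v6 v(2) vnot]) simp_all
          moreover have "(ext 0 L1 (sel k))(0 := ext 0 L1 (sel k) 0 @ [v]) = ext 0 L1 (sel (Suc k))"
            using selS True by (auto simp: ext_def)
          ultimately have w: "wp (push (N 0)) s6 (\<lambda>s' t. sides_stored n (ext 0 L1 (sel (Suc k))) s' \<and> t = 3)" by simp
          show ?thesis
            using True tw6 4(3) by simp (rule wp_conseq[OF w], use p T in simp)
        qed
      qed
    qed
  next
    case (5 s' \<tau>)
    \<comment> \<open>The neighbours of \<open>a\<close> are distinct, so their degrees sum up to at
      most \<open>M\<close>, and there are at most \<open>M\<close> of them: this gives the factor
      17 = 5 + 12.\<close>
    have "(\<Sum>p<length ?xs. 5 * length (nbrs n R (?xs ! p)) + 12) = 5 * (\<Sum>p<length ?xs. length (nbrs n R (?xs ! p))) + 12 * length ?xs"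
      by (simp add: sum.distrib sum_distrib_left)
    also have "\<dots> \<le> 5 * M + 12 * M"
      using sum_nth_distinct[OF distinct_nbrs[of n R a], of "{..<n}" "\<lambda>v. length (nbrs n R v)"]
        length_nbrs_le_sum[OF gr xan(1)] set_nbrs[OF gr, of a] is_graphD[OF gr] unfolding M by fastforce
    finally show ?case using 5 by simp
  qed
  have setL: "set (ext 0 L1 (sel (length ?xs)) 0) = {v. twin R a v}" "ext 0 L1 (sel (length ?xs)) 1 = []"
    using set_nbrs[OF gr, of a] by (auto simp: sel_def L1_def twin_def)
  have p1: "wp (push (N 0)) ?s2 (\<lambda>s' t. sides_stored n L1 s' \<and> t = 3)"
    unfolding L1_def by (rule wp_push[OF cst2 n2]) (use xan in simp_all)
  have a2: "vars s1 ''a'' = a" using 5(3) xa(2) by (simp add: agree_def)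
  show ?case
    using a2
    apply (simp add: ptw_def[symmetric] One_nat_def[symmetric] del: One_nat_def)
  proof (rule wp_conseq[OF p1], goal_cases)
    case (1 s3 t3)
    have ag3: "agree {''i'',''v''} {''used'',''len'',''q''} s s3"
      by (rule agree_trans[OF agree_mono[OF ag] agree_mono[of "modv (push (N 0))" "moda (push (N 0))"]])
        (use 1 in \<open>auto simp: push_def\<close>)
    have cst3: "sides_stored n L1 s3" using 1 by simp
    show ?case
    proof (rule wp_conseq[OF loop[OF cst3 ag3]], goal_cases)
      case (1 s4 t4)
      define Lf where "Lf = ext 0 L1 (sel (length ?xs))"
      note setLf = setL[folded Lf_def] and 1 = 1[folded Lf_def]
      have "agree {''i'',''v'',''p'',''tw'',''j'',''w''} {''used'',''len'',''q''} s s4"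
        by (rule agree_trans[OF agree_mono[OF ag3] agree_mono[OF 1(1)]]) (auto simp: ptw_def push_def)
      then have st: "vars s4 ''n'' = n" "vars s4 ''x'' = x" using xa matrix_storedD(1)[OF matrix_stored] by (simp_all add: agree_def)
      have cst4: "sides_stored n Lf s4" using 1 by simp
      have used: "arrays s4 ''used'' x = of_bool (twin R a x)"
        using sides_stored_used[OF cst4 xan(2)] unfolding setLf by simp
      show ?case
      proof (cases "twin R a x")
        case True
        then have "set (Lf 0) = insert x {v. twin R a v}" using setLf by auto
        then show ?thesis using cst4 setLf used st True 1 5(4) \<open>_ \<and> t3 = 3\<close> by (simp; intro exI[of _ Lf]) simp
      next
        case False
        let ?s5 = "setv ''v'' x s4"
        have cst5: "sides_stored n Lf ?s5" using sides_stored_agree[OF _ _ _ _ cst4, of "{''v''}" "{}"] by (simp add: agree_def)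
        have "wp (push (N 0)) ?s5 (\<lambda>s' t. sides_stored n (Lf(0 := Lf 0 @ [x])) s' \<and> t = 3)"
          by (rule wp_push[OF cst5]) (use st xan setLf False in simp_all)
        then have w: "wp (push (N 0)) ?s5 (\<lambda>s' t. \<exists>L. sides_stored n L s' \<and> set (L 0) = insert x {v. twin R a v} \<and> L 1 = [] \<and> t = 3)"
          by (rule wp_conseq) (rule exI[of _ "Lf(0 := Lf 0 @ [x])"], use setLf in simp)
        show ?thesis using used False st
          apply simp
          apply (rule wp_conseq[OF w])
          using 1 5(4) \<open>_ \<and> t3 = 3\<close> by auto
      qed
    qed
  qed
qed (use matrix_storedD(1)[OF matrix_stored] in \<open>auto simp: agree_def less_Suc_eq\<close>)

text \<open>For such a pair, the deletion along a maximum matching of nonadjacent vertices removes at least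
  one edge.\<close>

definition flagged :: "('b \<Rightarrow> 'b \<Rightarrow> bool) \<Rightarrow> 'b set \<Rightarrow> 'b set \<Rightarrow> bool" where
  "flagged R A B \<longleftrightarrow> B \<noteq> {} \<and>
     ((\<exists>u\<in>A. \<exists>b\<in>B. \<exists>b'\<in>B. R u b \<and> \<not> R u b') \<or> card B \<le> card {u\<in>A. \<forall>b\<in>B. \<not> R u b})"

lemma wp_test:
  assumes matrix_stored: "matrix_stored n R s" and sides_stored: "sides_stored n L s" and B: "length (L 0) \<le> B" "length (L 1) \<le> B"
  shows "wp test_prog s (\<lambda>s' t. vars s' ''fl'' = of_bool (flagged R (set (L 0)) (set (L 1))) \<and>
     t \<le> B * (4 * B + 11) + 9)"
proof -
  define la lb where "la = L 0" and "lb = L 1"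
  have len: "arrays s ''len'' 0 = length la" "arrays s ''len'' 1 = length lb"
    and q: "\<And>i. i < length la \<Longrightarrow> arrays s ''q'' i = la ! i" "\<And>i. i < length lb \<Longrightarrow> arrays s ''q'' (n + i) = lb ! i"
    and sub: "set la \<subseteq> {..<n}" "set lb \<subseteq> {..<n}" and dis: "distinct la" "distinct lb"
    using sides_storedD[OF sides_stored, of 0] sides_storedD[OF sides_stored, of 1] unfolding la_def lb_def by simp_all
  define anti where "anti u \<longleftrightarrow> (\<forall>b\<in>set lb. \<not> R u b)" for u
  define mix where "mix u \<longleftrightarrow> (\<exists>b\<in>set lb. R u b) \<and> (\<exists>b\<in>set lb. \<not> R u b)" for u
  let ?s0 = "setv ''z'' 0 (setv ''fl'' 0 s)"
  define I where "I k s' \<longleftrightarrow> vars s' ''z'' = length (filter anti (take k la)) \<and>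
     vars s' ''fl'' = of_bool (\<exists>u\<in>set (take k la). mix u)" for k and s' :: store
  have loop: "wp (For ''i'' NA (''u'' \<longleftarrow> LA (V ''i'') ;; ''d'' \<longleftarrow> N 0 ;;
       For ''j'' NB (whenever (cell ''subadj'' (V ''u'') (LB (V ''j''))) (incr ''d'')) ;;
       If (V ''d'' \<doteq> N 0) (incr ''z'') (whenever (V ''d'' \<prec> NB) (''fl'' \<longleftarrow> N 1)))) ?s0
     (\<lambda>s' t. vars s' ''z'' = length (filter anti la) \<and> vars s' ''fl'' = of_bool (\<exists>u\<in>set la. mix u) \<and>
        t \<le> length la * (4 * length lb + 11) + 2)"
  proof (rule wp_For_bound[where N = "length la" and T = "4 * length lb + 9" and I = I], goal_cases)
    case (4 k s')
    define u where "u = la ! k"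
    have u: "u < n" "arrays s ''q'' k = u" using q(1)[OF 4(1)] sub(1) nth_mem[OF 4(1)] by (auto simp: u_def)
    have ag: "agree {''i'',''u'',''d'',''j'',''z'',''fl''} {} s s'"
      using 4(4) by (simp add: agree_def)
    have st: "vars s' ''n'' = n" "arrays s' = arrays s"
      using ag matrix_storedD(1)[OF matrix_stored] by (auto simp: agree_def)
    let ?s1 = "setv ''d'' 0 (setv ''u'' u s')"
    have inner: "wp (For ''j'' NB (whenever (cell ''subadj'' (V ''u'') (LB (V ''j''))) (incr ''d''))) ?s1
      (\<lambda>s2 t. vars s2 ''d'' = length (filter (R u) lb) \<and> t \<le> 4 * length lb + 2)"
    proof (rule wp_For_bound[where N = "length lb" and T = 2 and
        I = "\<lambda>j s2. vars s2 ''d'' = length (filter (R u) (take j lb))"], goal_cases)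
      case (4 j s2)
      have b: "lb ! j < n" using sub(2) nth_mem[OF 4(1)] by auto
      have "arrays s2 ''subadj'' (u * n + (lb ! j)) = of_bool (R u (lb ! j))" "vars s2 ''n'' = n" "vars s2 ''u'' = u"
         "arrays s2 ''q'' (n + j) = lb ! j"
        using 4(4) st q(2)[OF 4(1)] matrix_storedD(2)[OF matrix_stored u(1) b] by (simp_all add: agree_def)
      then show ?case using 4 by (simp add: take_Suc_conv_app_nth)
    qed (use len st in \<open>simp_all add: agree_def\<close>)
    have anti: "length (filter (R u) lb) = 0 \<longleftrightarrow> anti u" by (simp add: anti_def filter_empty_conv)
    have mix: "mix u \<longleftrightarrow> length (filter (R u) lb) \<noteq> 0 \<and> length (filter (R u) lb) < length lb"
    proof -
      have "length (filter (R u) lb) < length lb \<longleftrightarrow> (\<exists>b\<in>set lb. \<not> R u b)"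
        using length_filter_less[of _ lb "R u"] filter_id_conv[of "R u" lb] by (metis nat_neq_iff length_filter_le leD)
      then show ?thesis by (auto simp: mix_def filter_empty_conv)
    qed
    have tk: "take (Suc k) la = take k la @ [u]" using 4(1) by (simp add: take_Suc_conv_app_nth u_def)
    show ?case
      using 4(3) u(2) st apply (simp add: One_nat_def[symmetric] del: One_nat_def)
    proof (rule wp_conseq[OF inner], goal_cases)
      case (1 s2 t)
      have a2: "arrays s2 ''len'' (Suc 0) = length lb" "vars s2 ''z'' = vars s' ''z''" "vars s2 ''fl'' = vars s' ''fl''"
        using 1 st len by (simp_all add: agree_def)
      show ?case
      proof (cases "anti u")
        case True
        then have "\<not> mix u" unfolding anti_def mix_def by blast
        then show ?thesis using True anti 1 a2 4(2) tk by (auto simp: I_def)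
      next
        case False
        then show ?thesis using mix anti 1 a2 4(2) tk by (cases "mix u") (auto simp: I_def)
      qed
    qed
  qed (use len in \<open>simp_all add: agree_def I_def algebra_simps\<close>)
  have zc: "length (filter anti la) = card {u \<in> set la. anti u}"
    using distinct_card[of "filter anti la"] dis(1) by simp
  have cl: "card (set lb) = length lb" using dis(2) distinct_card by blast
  have nn: "flagged R (set la) (set lb) \<longleftrightarrow> lb \<noteq> [] \<and> ((\<exists>u\<in>set la. mix u) \<or> length lb \<le> length (filter anti la))"
    unfolding flagged_def zc anti_def mix_def cl by auto
  have T: "length la * (4 * length lb + 11) \<le> B * (4 * B + 11)"
    by (rule mult_le_mono) (use B in \<open>simp_all add: la_def lb_def\<close>)
  show ?thesis
    unfolding test_prog_def la_def[symmetric] lb_def[symmetric]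
    apply (simp add: One_nat_def[symmetric] del: One_nat_def split del: split_of_bool)
  proof (rule wp_conseq[OF loop], goal_cases)
    case (1 s2 t)
    have "arrays s2 ''len'' 1 = length lb" using 1(1) len by (simp add: agree_def)
    then show ?case using 1 T nn by auto
  qed
qed

section \<open>Koenig's theorem for nonadjacent pairs, by alternating forests\<close>

section \<open>Maximum matchings between two cliques in the complement\<close>

definition enc :: "nat option \<Rightarrow> nat" where
  "enc x = (case x of None \<Rightarrow> 0 | Some a \<Rightarrow> Suc a)"

lemma enc_simps [simp]: "enc None = 0" "enc (Some a) = Suc a" "enc x = 0 \<longleftrightarrow> x = None" "enc x = Suc a \<longleftrightarrow> x = Some a"
  by (auto simp: enc_def split: option.splits)

definition comatching :: "(nat \<Rightarrow> nat \<Rightarrow> bool) \<Rightarrow> nat set \<Rightarrow> nat set \<Rightarrow> (nat \<Rightarrow> nat option) \<Rightarrow> bool" where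
  "comatching R A B m \<longleftrightarrow> (\<forall>b a. m b = Some a \<longrightarrow> b \<in> B \<and> a \<in> A \<and> \<not> R b a) \<and>
     (\<forall>b b' a. m b = Some a \<longrightarrow> m b' = Some a \<longrightarrow> b = b')"

text \<open>\<open>H\<close> collects vertices of the first side whose \<open>ma\<close> entry may
  be stale. While a path is being flipped this is the vertex that waits for a new mate; otherwise
  \<open>H\<close> is empty.\<close>

definition matching_stored :: "nat \<Rightarrow> nat set \<Rightarrow> (nat \<Rightarrow> nat option) \<Rightarrow> store \<Rightarrow> bool" where
  "matching_stored n H m s \<longleftrightarrow> (\<forall>b<n. arrays s ''mb'' b = enc (m b)) \<and>
     (\<forall>a<n. a \<notin> H \<longrightarrow> (\<forall>b. m b = Some a \<longrightarrow> arrays s ''ma'' a = Suc b) \<and>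
        ((\<forall>b. m b \<noteq> Some a) \<longrightarrow> arrays s ''ma'' a = 0))"

text \<open>The rank decreases strictly along an alternating path towards its root, which excludes
  cycles; bounding it by the number of reached vertices limits the length of a path.\<close>

definition forest :: "nat \<Rightarrow> (nat \<Rightarrow> nat \<Rightarrow> bool) \<Rightarrow> nat set \<Rightarrow> nat set \<Rightarrow> (nat \<Rightarrow> nat option) \<Rightarrow> (nat \<Rightarrow> nat) \<Rightarrow> (nat \<Rightarrow> nat) \<Rightarrow> bool" where
  "forest n R A B m par rk \<longleftrightarrow> (\<forall>a<n. par a \<noteq> 0 \<longrightarrow> a \<in> A \<and> rk a < card {a\<in>A. par a \<noteq> 0} \<and>
     (\<exists>b. par a = Suc b \<and> b \<in> B \<and> \<not> R b a \<and>
        (m b = None \<or> (\<exists>a'. m b = Some a' \<and> par a' \<noteq> 0 \<and> rk a' < rk a))))"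

definition breached :: "(nat \<Rightarrow> nat option) \<Rightarrow> (nat \<Rightarrow> nat) \<Rightarrow> nat \<Rightarrow> bool" where
  "breached m par b \<longleftrightarrow> m b = None \<or> (\<exists>a. m b = Some a \<and> par a \<noteq> 0)"

lemma val_reached:
  assumes "arrays s ''mb'' (val s e) = enc (m (val s e))"
  shows "val s (reached e) = of_bool (breached m (arrays s ''par'') (val s e))"
  using assms by (cases "m (val s e)") (auto simp: breached_def)

definition pair_stored :: "nat \<Rightarrow> (nat \<Rightarrow> nat \<Rightarrow> bool) \<Rightarrow> nat list \<Rightarrow> nat list \<Rightarrow> store \<Rightarrow> bool" where
  "pair_stored n R la lb s \<longleftrightarrow> matrix_stored n R s \<and> sides_stored n (\<lambda>c. if c = 0 then la else lb) s"

lemma pair_stored_agree: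
  assumes "agree X Y s s'" "''n'' \<notin> X" "Y \<inter> {''subadj'', ''len'', ''q'', ''used''} = {}" "pair_stored n R la lb s"
  shows "pair_stored n R la lb s'"
  using matrix_stored_agree[OF assms(1,2)] sides_stored_agree[OF assms(1)] assms(3,4) unfolding pair_stored_def by simp

lemma pair_storedD:
  assumes "pair_stored n R la lb s"
  shows "vars s ''n'' = n" "arrays s ''len'' 0 = length la" "arrays s ''len'' (Suc 0) = length lb"
    "i < length la \<Longrightarrow> arrays s ''q'' i = la ! i" "i < length lb \<Longrightarrow> arrays s ''q'' (n + i) = lb ! i"
    "set la \<subseteq> {..<n}" "set lb \<subseteq> {..<n}" "distinct la" "distinct lb" "set la \<inter> set lb = {}"
    "i < n \<Longrightarrow> j < n \<Longrightarrow> arrays s ''subadj'' (i * n + j) = of_bool (R i j)"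
    "matrix_stored n R s"
  using assms sides_storedD[of n "\<lambda>c. if c = 0 then la else lb" s 0] sides_storedD[of n "\<lambda>c. if c = 0 then la else lb" s 1]
  unfolding pair_stored_def by (auto simp: sides_stored_def matrix_stored_def)

text \<open>The new vertex is ranked just above the mate of its parent. This respects the bound on
  ranks because the count of reached vertices goes up by one as well.\<close>

lemma forest_extend:
  assumes f: "forest n R A B m par rk" and A: "A \<subseteq> {..<n}" and w: "w \<in> A" "par w = 0"
    and b: "b \<in> B" "\<not> R b w" "breached m par b" and m: "\<And>a. m b = Some a \<Longrightarrow> a \<in> A"
  shows "\<exists>rk'. forest n R A B m (par(w := Suc b)) rk'"
proof -
  have fin: "finite A" using A finite_subset by blast
  let ?p = "par(w := Suc b)" and ?r = "case m b of None \<Rightarrow> 0 | Some a' \<Rightarrow> Suc (rk a')"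
  let ?k = "rk(w := ?r)"
  have c: "card {a\<in>A. ?p a \<noteq> 0} = Suc (card {a\<in>A. par a \<noteq> 0})"
  proof -
    have "{a\<in>A. ?p a \<noteq> 0} = insert w {a\<in>A. par a \<noteq> 0}" using w by auto
    then show ?thesis using fin w by simp
  qed
  have r: "?r < Suc (card {a\<in>A. par a \<noteq> 0})"
    using b(3) f m A unfolding breached_def forest_def by (auto split: option.splits)
  have "forest n R A B m ?p ?k"
    unfolding forest_def
  proof (intro allI impI)
    fix a assume a: "a < n" "?p a \<noteq> 0"
    show "a \<in> A \<and> ?k a < card {a\<in>A. ?p a \<noteq> 0} \<and> (\<exists>b. ?p a = Suc b \<and> b \<in> B \<and> \<not> R b a \<and>
        (m b = None \<or> (\<exists>a'. m b = Some a' \<and> ?p a' \<noteq> 0 \<and> ?k a' < ?k a)))"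
    proof (cases "a = w")
      case True
      have "m b = None \<or> (\<exists>a'. m b = Some a' \<and> ?p a' \<noteq> 0 \<and> ?k a' < ?k w)"
      proof (cases "m b")
        case (Some a')
        then have "par a' \<noteq> 0" using b(3) unfolding breached_def by simp
        moreover from this have "a' \<noteq> w" using w(2) by auto
        ultimately show ?thesis using Some by simp
      qed simp
      then show ?thesis using True w b c r by auto
    next
      case False
      then have "par a \<noteq> 0" using a by simp
      then obtain b' where *: "a \<in> A" "rk a < card {a\<in>A. par a \<noteq> 0}" "par a = Suc b'" "b' \<in> B" "\<not> R b' a"
        "m b' = None \<or> (\<exists>a'. m b' = Some a' \<and> par a' \<noteq> 0 \<and> rk a' < rk a)"
        using f a unfolding forest_def by blast
      have nw: "?p a' = par a'" "?k a' = rk a'" if "par a' \<noteq> 0" for a'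
        using that w(2) by auto
      have 1: "m b' = None \<or> (\<exists>a'. m b' = Some a' \<and> ?p a' \<noteq> 0 \<and> ?k a' < ?k a)"
        using *(6) nw nw[OF \<open>par a \<noteq> 0\<close>] by force
      have "?p a = Suc b'" "?k a < card {a\<in>A. ?p a \<noteq> 0}" unfolding c using *(2,3) False by simp_all
      then show ?thesis using *(1,4,5) 1 by blast
    qed
  qed
  then show ?thesis by blast
qed

lemma wp_reach:
  assumes ps: "pair_stored n R la lb s" and m: "comatching R (set la) (set lb) m" "matching_stored n {} m s"
    and B: "length la \<le> B" "length lb \<le> B"
  shows "wp reach_prog s (\<lambda>s' t. (\<exists>rk. forest n R (set la) (set lb) m (arrays s' ''par'') rk) \<and>
     (\<forall>b\<in>set lb. \<forall>a\<in>set la. breached m (arrays s' ''par'') b \<longrightarrow> \<not> R b a \<longrightarrow> arrays s' ''par'' a \<noteq> 0) \<and>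
     t \<le> 3 * n + (B + 1) * (B * (6 * B + 5) + 6) + 10)"
proof -
  let ?A = "set la" and ?B = "set lb"
  define unv where "unv s' = card {a\<in>?A. arrays s' ''par'' a = 0}" for s' :: store
  define RI where "RI u0 s' \<longleftrightarrow> (\<exists>rk. forest n R ?A ?B m (arrays s' ''par'') rk) \<and>
     (vars s' ''ch'' = 0 \<and> unv s' = u0 \<or> vars s' ''ch'' = 1 \<and> unv s' < u0)" for u0 and s' :: store
  \<comment> \<open>Guarded by \<open>ch\<close> being 0: a later write may make \<open>b\<close>
    reached, but it also sets \<open>ch\<close>, and the next sweep looks again. After a sweep
    without writes all pairs are covered at once.\<close>
  define cov where "cov b a s' \<longleftrightarrow> (vars s' ''ch'' = 0 \<longrightarrow> breached m (arrays s' ''par'') b \<longrightarrow> \<not> R b a \<longrightarrow> arrays s' ''par'' a \<noteq> 0)"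
    for b a and s' :: store
  let ?X = "{''i'',''ch'',''b'',''j'',''w''}" and ?Y = "{''par''}"
  have An: "?A \<subseteq> {..<n}" "?B \<subseteq> {..<n}" using pair_storedD[OF ps] by simp_all
  have inner: "wp (whenever ((Read ''par'' (V ''w'') \<doteq> N 0) \<otimes> (cell ''subadj'' (V ''b'') (V ''w'') \<doteq> N 0) \<otimes> reached (V ''b''))
             (Write ''par'' (V ''w'') (V ''b'' \<oplus> N 1) ;; ''ch'' \<longleftarrow> N 1)) s'
         (\<lambda>s2 t. t \<le> 3 \<and> RI u0 s2 \<and> cov b w s2 \<and> (vars s2 ''ch'' = 0 \<longrightarrow> s2 = s'))"
    if ag: "agree ?X ?Y s s'" and bw: "vars s' ''b'' = b" "vars s' ''w'' = w" "b \<in> ?B" "w \<in> ?A" and I: "RI u0 s'" for s' b w u0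
  proof -
    have bn: "b < n" "w < n" using bw An by auto
    have sub: "arrays s' ''subadj'' (b * n + w) = of_bool (R b w)" "vars s' ''n'' = n"
      using pair_storedD(1,11)[OF pair_stored_agree[OF ag _ _ ps]] bn by simp_all
    have mb: "arrays s' ''mb'' b = enc (m b)" using m(2) ag bn by (simp add: matching_stored_def agree_def)
    have vr: "val s' (reached (V ''b'')) = of_bool (breached m (arrays s' ''par'') b)"
      using val_reached[of s' "V ''b''" m] mb bw by simp
    show ?thesis
    proof (cases "arrays s' ''par'' w = 0 \<and> \<not> R b w \<and> breached m (arrays s' ''par'') b")
      case False
      then show ?thesis using sub vr bw I by (auto simp del: val.simps(4) simp: val.simps(4)[of _ Times] val.simps(4)[of _ Equal] val.simps(4)[of _ Plus] cov_def)
    next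
      case True
      let ?s2 = "setv ''ch'' 1 (seta ''par'' w (Suc b) s')"
      obtain rk where "forest n R ?A ?B m (arrays s' ''par'') rk" using I unfolding RI_def by blast
      then have "\<exists>rk'. forest n R ?A ?B m ((arrays s' ''par'')(w := Suc b)) rk'"
        by (rule forest_extend[OF _ An(1) bw(4) _ bw(3)]) (use True m(1) in \<open>auto simp: comatching_def\<close>)
      moreover have "arrays ?s2 ''par'' = (arrays s' ''par'')(w := Suc b)" by auto
      moreover have "unv ?s2 < unv s'"
        unfolding unv_def by (rule psubset_card_mono) (use True bw in auto)
      ultimately have "RI u0 ?s2" using I unfolding RI_def by auto
      then show ?thesis using True sub vr bw by (auto simp del: val.simps(4) simp: val.simps(4)[of _ Times] val.simps(4)[of _ Equal] val.simps(4)[of _ Plus] cov_def)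
    qed
  qed
  define body where "body = (''b'' \<longleftarrow> LB (V ''i'') ;;
         For ''j'' NA (''w'' \<longleftarrow> LA (V ''j'') ;;
           whenever ((Read ''par'' (V ''w'') \<doteq> N 0) \<otimes> (cell ''subadj'' (V ''b'') (V ''w'') \<doteq> N 0) \<otimes> reached (V ''b''))
             (Write ''par'' (V ''w'') (V ''b'' \<oplus> N 1) ;; ''ch'' \<longleftarrow> N 1)))"
  have modb: "modv body = {''b'',''j'',''w'',''ch''}" "moda body = {''par''}" by (auto simp: body_def)
  have row: "wp body s' (\<lambda>s2 t. t \<le> 6 * length la + 3 \<and> RI u0 s2 \<and> (\<forall>a\<in>?A. cov b a s2) \<and>
       (vars s2 ''ch'' = 0 \<longrightarrow> arrays s2 = arrays s' \<and> vars s' ''ch'' = 0))"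
    if ag: "agree ?X ?Y s s'" and i: "vars s' ''i'' = i" "i < length lb" and b: "b = lb ! i" and I: "RI u0 s'" for s' i b u0
  proof -
    let ?s1 = "setv ''b'' b s'"
    have q: "arrays s' ''q'' (n + i) = b" "vars s' ''n'' = n"
      using pair_storedD(1,5)[OF pair_stored_agree[OF ag _ _ ps]] i b by simp_all
    have vb: "val s' (LB (V ''i'')) = b" using q i by simp
    define LI where "LI j s2 \<longleftrightarrow> RI u0 s2 \<and> (\<forall>i<j. cov b (la ! i) s2) \<and>
           (vars s2 ''ch'' = 0 \<longrightarrow> arrays s2 = arrays s' \<and> vars s' ''ch'' = 0)" for j and s2 :: store
    have "wp (For ''j'' NA (''w'' \<longleftarrow> LA (V ''j'') ;;
           whenever ((Read ''par'' (V ''w'') \<doteq> N 0) \<otimes> (cell ''subadj'' (V ''b'') (V ''w'') \<doteq> N 0) \<otimes> reached (V ''b''))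
             (Write ''par'' (V ''w'') (V ''b'' \<oplus> N 1) ;; ''ch'' \<longleftarrow> N 1))) ?s1
        (\<lambda>s2 t. t \<le> 6 * length la + 2 \<and> RI u0 s2 \<and> (\<forall>a\<in>?A. cov b a s2) \<and>
       (vars s2 ''ch'' = 0 \<longrightarrow> arrays s2 = arrays s' \<and> vars s' ''ch'' = 0))"
    proof (rule wp_For_bound[where N = "length la" and T = 4 and I = LI], goal_cases)
      case (2 s2)
      then show ?case using pair_storedD(2)[OF pair_stored_agree[OF ag _ _ ps]] by (simp add: agree_def)
    next
      case 3
      then show ?case using I unfolding LI_def RI_def unv_def by simp
    next
      case (4 j s2)
      define w where "w = la ! j"
      have ag2: "agree ?X ?Y s s2" using ag 4(4) by (auto simp: agree_def)
      let ?s3 = "setv ''w'' w s2"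
      have ag3: "agree ?X ?Y s ?s3" using ag2 by (auto simp: agree_def)
      have qw: "arrays s2 ''q'' j = w" using pair_storedD(4)[OF pair_stored_agree[OF ag2 _ _ ps]] 4(1) by (simp add: w_def)
      have vw: "val s2 (LA (V ''j'')) = w" using qw 4(3) by simp
      have I2: "RI u0 s2" "\<forall>i<j. cov b (la ! i) s2" "vars s2 ''ch'' = 0 \<longrightarrow> arrays s2 = arrays s' \<and> vars s' ''ch'' = 0"
        using 4(2) unfolding LI_def by simp_all
      have I3: "RI u0 ?s3" using I2(1) unfolding RI_def unv_def by simp
      have w4: "wp (whenever ((Read ''par'' (V ''w'') \<doteq> N 0) \<otimes> (cell ''subadj'' (V ''b'') (V ''w'') \<doteq> N 0) \<otimes> reached (V ''b''))
             (Write ''par'' (V ''w'') (V ''b'' \<oplus> N 1) ;; ''ch'' \<longleftarrow> N 1)) ?s3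
           (\<lambda>s2 t. t \<le> 3 \<and> RI u0 s2 \<and> cov b w s2 \<and> (vars s2 ''ch'' = 0 \<longrightarrow> s2 = ?s3))"
        by (rule inner[OF ag3 _ _ _ _ I3]) (use 4 i b in \<open>auto simp: w_def agree_def\<close>)
      show ?case
        unfolding wp_Seq wp_Assign vw
      proof (rule wp_conseq[OF w4], goal_cases)
        case (1 s4 t)
        have "LI (Suc j) (setv ''j'' (Suc j) s4)"
          unfolding LI_def
        proof (intro conjI allI impI)
          show "RI u0 (setv ''j'' (Suc j) s4)" using 1 unfolding RI_def unv_def by simp
          show "cov b (la ! i) (setv ''j'' (Suc j) s4)" if "i < Suc j" for i
          proof (cases "i = j")
            case True
            then show ?thesis using 1 unfolding cov_def w_def by simp
          next
            case False
            then have "cov b (la ! i) s2" using I2(2) that by simp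
            then show ?thesis using 1 unfolding cov_def by auto
          qed
          show "arrays (setv ''j'' (Suc j) s4) = arrays s'" "vars s' ''ch'' = 0" if "vars (setv ''j'' (Suc j) s4) ''ch'' = 0"
            using 1 that I2(3) by auto
        qed
        then show ?case using 1 by simp
      qed
    next
      case (5 s2 t)
      then have "\<forall>a\<in>?A. cov b a s2" unfolding LI_def by (metis in_set_conv_nth)
      then show ?case using 5 unfolding LI_def by (simp add: mult.commute)
    qed simp_all
    then show ?thesis
      unfolding body_def wp_Seq wp_Assign vb by (elim wp_conseq) auto
  qed
  define T where "T = length lb * (6 * length la + 5) + 5"
  have pass: "wp (''ch'' \<longleftarrow> N 0 ;; For ''i'' NB body) s'
     (\<lambda>s2 t. t \<le> T \<and> RI (unv s') s2 \<and> (\<forall>b\<in>?B. \<forall>a\<in>?A. cov b a s2))"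
    if ag: "agree ?X ?Y s s'" and f: "\<exists>rk. forest n R ?A ?B m (arrays s' ''par'') rk" for s'
  proof -
    let ?s1 = "setv ''ch'' 0 s'"
    define LI where "LI k s2 \<longleftrightarrow> RI (unv s') s2 \<and> (\<forall>i<k. \<forall>a\<in>?A. cov (lb ! i) a s2)" for k and s2 :: store
    have "wp (For ''i'' NB body) ?s1 (\<lambda>s2 t. t \<le> length lb * (6 * length la + 5) + 2 \<and> RI (unv s') s2 \<and> (\<forall>b\<in>?B. \<forall>a\<in>?A. cov b a s2))"
    proof (rule wp_For_bound[where N = "length lb" and T = "6 * length la + 3" and I = LI], goal_cases)
      case (2 s2)
      then show ?case using pair_storedD(3)[OF pair_stored_agree[OF ag _ _ ps]] by (simp add: agree_def modb)
    next
      case 3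
      then show ?case using f unfolding LI_def RI_def unv_def by simp
    next
      case (4 k s2)
      have ag2: "agree ?X ?Y s s2" using ag 4(4) by (auto simp: agree_def modb)
      have I2: "RI (unv s') s2" "\<forall>i<k. \<forall>a\<in>?A. cov (lb ! i) a s2" using 4(2) unfolding LI_def by simp_all
      show ?case
      proof (rule wp_conseq[OF row[OF ag2 4(3,1) refl I2(1)]], goal_cases)
        case (1 s3 t)
        have "LI (Suc k) (setv ''i'' (Suc k) s3)"
          unfolding LI_def
        proof (intro conjI allI impI ballI)
          show "RI (unv s') (setv ''i'' (Suc k) s3)" using 1 unfolding RI_def unv_def by simp
          show "cov (lb ! i) a (setv ''i'' (Suc k) s3)" if "i < Suc k" "a \<in> ?A" for i a
          proof (cases "i = k")
            case True
            have "cov (lb ! k) a s3" using 1 that(2) by blast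
            then show ?thesis unfolding cov_def True by simp
          next
            case False
            then have "cov (lb ! i) a s2" using I2(2) that by simp
            then show ?thesis using 1 unfolding cov_def by auto
          qed
        qed
        then show ?case using 1 by simp
      qed
    next
      case (5 s2 t)
      then have "\<forall>b\<in>?B. \<forall>a\<in>?A. cov b a s2" unfolding LI_def by (metis in_set_conv_nth)
      then show ?case using 5 unfolding LI_def by (simp add: algebra_simps)
    qed (simp_all add: modb)
    then show ?thesis by (simp, elim wp_conseq) (auto simp: T_def)
  qed
  \<comment> \<open>A sweep that sets \<open>ch\<close> has reached a new vertex, and a sweep that
    does not set it is the last one.\<close>
  define \<Phi> where "\<Phi> s' = (unv s' + vars s' ''ch'') * (T + 1)" for s' :: store
  have loop: "wp (While (V ''ch'') (''ch'' \<longleftarrow> N 0 ;; For ''i'' NB body)) s1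
      (\<lambda>s' t. (\<exists>rk. forest n R ?A ?B m (arrays s' ''par'') rk) \<and>
     (\<forall>b\<in>?B. \<forall>a\<in>?A. breached m (arrays s' ''par'') b \<longrightarrow> \<not> R b a \<longrightarrow> arrays s' ''par'' a \<noteq> 0) \<and> t \<le> (length la + 1) * (T + 1) + 1)"
    if ag: "agree ?X ?Y s s1" and z: "\<forall>a<n. arrays s1 ''par'' a = 0" and ch: "vars s1 ''ch'' = 1" for s1
  proof (rule wp_While[where \<Phi> = \<Phi> and I = "\<lambda>s'. (\<exists>rk. forest n R ?A ?B m (arrays s' ''par'') rk) \<and> vars s' ''ch'' \<le> 1 \<and>
      (\<forall>b\<in>?B. \<forall>a\<in>?A. cov b a s')"], goal_cases)
    case 1
    then show ?case using z ch unfolding forest_def cov_def by simp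
  next
    case (2 s')
    have ag2: "agree ?X ?Y s s'"
      by (rule agree_trans[OF ag agree_mono[OF 2(3)]]) (auto simp: modb)
    have "vars s' ''ch'' = 1" using 2 by auto
    show ?case
    proof (rule wp_conseq[OF pass[OF ag2]], goal_cases)
      case (2 s2 t)
      have "unv s2 + vars s2 ''ch'' \<le> unv s'" using 2 unfolding RI_def by auto
      then have "\<Phi> s2 \<le> unv s' * (T + 1)" unfolding \<Phi>_def by (rule mult_le_mono1)
      then show ?case using 2 \<open>vars s' ''ch'' = 1\<close> unfolding \<Phi>_def RI_def by auto
    qed (use 2 in blast)
  next
    case (3 s' t)
    have "unv s1 \<le> card ?A" unfolding unv_def by (rule card_mono) auto
    then have "unv s1 \<le> length la" using card_length le_trans by blast
    then have "\<Phi> s1 \<le> (length la + 1) * (T + 1)" unfolding \<Phi>_def ch by (intro mult_le_mono1) simp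
    then show ?case using 3 unfolding cov_def by auto
  qed
  have TB: "(length la + 1) * (T + 1) \<le> (B + 1) * (B * (6 * B + 5) + 6)"
  proof -
    have "length lb * (6 * length la + 5) \<le> B * (6 * B + 5)" using B by (intro mult_le_mono) simp_all
    then show ?thesis unfolding T_def using B by (intro mult_le_mono) simp_all
  qed
  show ?thesis
    unfolding reach_prog_def body_def[symmetric] wp_Seq
  proof (rule wp_For_bound[where N = n and T = 1 and I = "\<lambda>k s'. \<forall>a<k. arrays s' ''par'' a = 0"], goal_cases)
    case (5 s1 t1)
    have "agree ?X ?Y s (setv ''ch'' 1 s1)" using 5(3) by (simp add: agree_def)
    note wl = loop[OF this]
    show ?case
      unfolding wp_Assign val.simps
      by (rule wp_conseq[OF wl]) (use 5 TB in auto)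
  qed (use pair_storedD(1)[OF ps] in \<open>auto simp: agree_def less_Suc_eq\<close>)
qed

lemma wp_find:
  assumes ps: "pair_stored n R la lb s" and m: "matching_stored n {} m s"
  shows "wp find_prog s (\<lambda>s' t. t \<le> 6 * length la + 3 \<and>
     (vars s' ''fnd'' = 1 \<and> (\<exists>a\<in>set la. vars s' ''fa'' = a \<and> arrays s ''par'' a \<noteq> 0 \<and> (\<forall>b. m b \<noteq> Some a)) \<or>
      vars s' ''fnd'' = 0 \<and> (\<forall>a\<in>set la. arrays s ''par'' a \<noteq> 0 \<longrightarrow> (\<exists>b. m b = Some a))))"
proof -
  have free: "arrays s ''ma'' a = 0 \<longleftrightarrow> (\<forall>b. m b \<noteq> Some a)" if "a < n" for a
  proof -
    have "(\<forall>b. m b = Some a \<longrightarrow> arrays s ''ma'' a = Suc b) \<and> ((\<forall>b. m b \<noteq> Some a) \<longrightarrow> arrays s ''ma'' a = 0)"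
      using m that unfolding matching_stored_def by blast
    then show ?thesis by (cases "\<forall>b. m b \<noteq> Some a") auto
  qed
  define I where "I k s' \<longleftrightarrow> vars s' ''fnd'' = 1 \<and> (\<exists>a\<in>set la. vars s' ''fa'' = a \<and> arrays s ''par'' a \<noteq> 0 \<and> (\<forall>b. m b \<noteq> Some a)) \<or>
      vars s' ''fnd'' = 0 \<and> (\<forall>i<k. arrays s ''par'' (la ! i) \<noteq> 0 \<longrightarrow> (\<exists>b. m b = Some (la ! i)))" for k and s' :: store
  have "wp (For ''j'' NA (''w'' \<longleftarrow> LA (V ''j'') ;;
       whenever ((N 0 \<prec> Read ''par'' (V ''w'')) \<otimes> (Read ''ma'' (V ''w'') \<doteq> N 0)) (''fnd'' \<longleftarrow> N 1 ;; ''fa'' \<longleftarrow> V ''w''))) (setv ''fnd'' 0 s)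
     (\<lambda>s' t. t \<le> 6 * length la + 2 \<and> I (length la) s')"
  proof (rule wp_For_bound[where N = "length la" and T = 4 and I = I], goal_cases)
    case (2 s')
    then show ?case using pair_storedD(2)[OF ps] by (simp add: agree_def)
  next
    case (4 k s')
    have ar: "arrays s' = arrays s" "vars s' ''n'' = n" using 4(4) pair_storedD(1)[OF ps] by (auto simp: agree_def)
    have w: "la ! k \<in> set la" "la ! k < n" "arrays s ''q'' k = la ! k"
      using pair_storedD(4)[OF ps 4(1)] pair_storedD(6)[OF ps] nth_mem[OF 4(1)] by (blast, blast, simp)
    show ?case using 4(2,3) ar w free[OF w(2)] by (auto simp: I_def less_Suc_eq)
  qed (simp_all add: I_def mult.commute)
  then show ?thesis
    unfolding find_prog_def wp_Seq wp_Assign val.simps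
    by (rule wp_conseq) (auto simp: I_def all_set_conv_all_nth)
qed

text \<open>Giving \<open>b\<close> to the current free vertex frees the former mate of
  \<open>b\<close>, whose rank is smaller. The matching still agrees with \<open>m0\<close> wherever
  the mate has smaller rank than the current vertex, so the parents computed for \<open>m0\<close>
  stay valid for the rest of the path. The size grows only at the end, when an unmatched
  \<open>b\<close> is met.\<close>

lemma wp_flip:
  assumes ps: "pair_stored n R la lb s" and m0: "comatching R (set la) (set lb) m0" "matching_stored n {} m0 s"
    and f: "forest n R (set la) (set lb) m0 (arrays s ''par'') rk"
    and a: "vars s ''fa'' = a0" "a0 \<in> set la" "arrays s ''par'' a0 \<noteq> 0" "\<forall>b. m0 b \<noteq> Some a0"
  shows "wp flip_prog s (\<lambda>s' t. t \<le> 8 * length la + 10 \<and> (\<exists>m. comatching R (set la) (set lb) m \<and> matching_stored n {} m s' \<and>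
     card (dom m) = Suc (card (dom m0))))"
proof -
  let ?A = "set la" and ?B = "set lb"
  have An: "?A \<subseteq> {..<n}" "?B \<subseteq> {..<n}" using pair_storedD[OF ps] by simp_all
  have fdom: "finite (dom m)" if "comatching R ?A ?B m" for m
    using that finite_subset[of "dom m" ?B] unfolding comatching_def by auto
  define J where "J s' \<longleftrightarrow> (\<exists>m. comatching R ?A ?B m \<and>
     (vars s' ''g'' = 0 \<and> matching_stored n {} m s' \<and> card (dom m) = Suc (card (dom m0)) \<or>
      vars s' ''g'' = 1 \<and> (\<exists>a\<in>?A. vars s' ''fa'' = a \<and> matching_stored n {a} m s' \<and> card (dom m) = card (dom m0) \<and>
         arrays s ''par'' a \<noteq> 0 \<and> (\<forall>b. m b \<noteq> Some a) \<and>
         (\<forall>b. (m0 b = None \<or> (\<exists>a'. m0 b = Some a' \<and> rk a' < rk a)) \<longrightarrow> m b = m0 b))))" for s' :: store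
  define \<Phi> where "\<Phi> s' = vars s' ''g'' * (8 * rk (vars s' ''fa'') + 8)" for s' :: store
  define body where "body = (''b'' \<longleftarrow> Read ''par'' (V ''fa'') \<ominus> N 1 ;; ''w'' \<longleftarrow> Read ''mb'' (V ''b'') ;;
       Write ''mb'' (V ''b'') (V ''fa'' \<oplus> N 1) ;; Write ''ma'' (V ''fa'') (V ''b'' \<oplus> N 1) ;;
       If (V ''w'' \<doteq> N 0) (''g'' \<longleftarrow> N 0) (''fa'' \<longleftarrow> V ''w'' \<ominus> N 1))"
  have "wp (While (V ''g'') body) (setv ''g'' 1 s) (\<lambda>s' t. t \<le> 8 * length la + 9 \<and>
     (\<exists>m. comatching R ?A ?B m \<and> matching_stored n {} m s' \<and> card (dom m) = Suc (card (dom m0))))"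
  proof (rule wp_While[where I = J and \<Phi> = \<Phi>], goal_cases)
    case 1
    have "matching_stored n {a0} m0 (setv ''g'' 1 s)" using m0(2) unfolding matching_stored_def by simp
    then show ?case unfolding J_def using m0(1) a by (intro exI[of _ m0]) auto
  next
    case (2 s')
    have par: "arrays s' ''par'' = arrays s ''par''"
      using 2(3) by (simp add: agree_def body_def)
    obtain m a where m: "comatching R ?A ?B m" "vars s' ''g'' = 1" "a \<in> ?A" "vars s' ''fa'' = a" "matching_stored n {a} m s'"
      "card (dom m) = card (dom m0)" "arrays s ''par'' a \<noteq> 0" "\<forall>b. m b \<noteq> Some a"
      "\<forall>b. (m0 b = None \<or> (\<exists>a'. m0 b = Some a' \<and> rk a' < rk a)) \<longrightarrow> m b = m0 b"
      using 2(1,2) unfolding J_def by auto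
    have an: "a < n" using m(3) An by auto
    obtain b where b: "arrays s ''par'' a = Suc b" "b \<in> ?B" "\<not> R b a"
       "m0 b = None \<or> (\<exists>a'. m0 b = Some a' \<and> arrays s ''par'' a' \<noteq> 0 \<and> rk a' < rk a)"
      using f an m(7) unfolding forest_def by blast
    have bn: "b < n" using b(2) An by auto
    have mb: "m b = m0 b" using m(9) b(4) by blast
    have w: "arrays s' ''mb'' b = enc (m b)" using m(5) bn unfolding matching_stored_def by blast
    define m' where "m' = m(b := Some a)"
    have com': "comatching R ?A ?B m'"
      using m(1,3,8) b(2,3) unfolding comatching_def m'_def by auto
    define s1 where "s1 = seta ''ma'' a (Suc b) (seta ''mb'' b (Suc a) (setv ''w'' (enc (m b)) (setv ''b'' b s')))"
    have mst': "matching_stored n (case m b of None \<Rightarrow> {} | Some a' \<Rightarrow> {a'}) m' s1"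
      using m(1,5,8) an bn unfolding matching_stored_def s1_def m'_def comatching_def
      by (auto split: option.splits; metis option.distinct(1) option.inject)
    have exec: "wp body s' P \<longleftrightarrow> (if m b = None then P (setv ''g'' 0 s1) 6 else P (setv ''fa'' (the (m b)) s1) 6)" for P
      unfolding body_def using b(1) w m(2,4) par by (cases "m b") (simp_all add: s1_def eval_nat_numeral)
    show ?case
    proof (cases "m b")
      case None
      have "card (dom m') = Suc (card (dom m))"
        unfolding m'_def using None fdom[OF m(1)] by (simp add: domIff)
      moreover have "matching_stored n {} m' (setv ''g'' 0 s1)" using mst' None by (simp add: matching_stored_def)
      ultimately have "J (setv ''g'' 0 s1)" unfolding J_def using com' m(6) by (intro exI[of _ m']) simp
      then show ?thesis unfolding exec using None m(2) by (simp add: \<Phi>_def)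
    next
      case (Some a')
      have a': "m0 b = Some a'" "arrays s ''par'' a' \<noteq> 0" "rk a' < rk a" using b(4) mb Some by auto
      have "dom m' = dom m" unfolding m'_def using Some by auto
      moreover have "matching_stored n {a'} m' (setv ''fa'' a' s1)" using mst' Some by (simp add: matching_stored_def)
      moreover have "\<forall>b'. m' b' \<noteq> Some a'"
        using m(1,8) Some unfolding m'_def comatching_def by auto
      moreover have "m' b' = m0 b'" if "m0 b' = None \<or> (\<exists>a''. m0 b' = Some a'' \<and> rk a'' < rk a')" for b'
      proof -
        have "b' \<noteq> b" using that a' by auto
        moreover have "m0 b' = None \<or> (\<exists>a''. m0 b' = Some a'' \<and> rk a'' < rk a)"
          using that a'(3) by (meson less_trans)
        ultimately have "m b' = m0 b'" using m(9) by blast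
        then show ?thesis using \<open>b' \<noteq> b\<close> unfolding m'_def by simp
      qed
      moreover have "a' \<in> ?A" using m(1) Some unfolding comatching_def by blast
      moreover have "vars (setv ''fa'' a' s1) ''g'' = 1" using m(2) by (simp add: s1_def)
      ultimately have "J (setv ''fa'' a' s1)"
        unfolding J_def using com' m(6) a'(2) by (intro exI[of _ m']) simp
      then show ?thesis unfolding exec using Some a'(3) m(2,4) by (simp add: \<Phi>_def s1_def)
    qed
  next
    case (3 s' t)
    have "rk a0 < card {a\<in>?A. arrays s ''par'' a \<noteq> 0}" using f a An unfolding forest_def by blast
    also have "\<dots> \<le> card ?A" by (rule card_mono) auto
    also have "\<dots> \<le> length la" by (rule card_length)
    finally have "\<Phi> (setv ''g'' 1 s) \<le> 8 * length la + 8" using a(1) unfolding \<Phi>_def by simp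
    then show ?case using 3 unfolding J_def by auto
  qed
  then show ?thesis
    unfolding flip_prog_def body_def[symmetric] wp_Seq wp_Assign val.simps by (rule wp_conseq) auto
qed

lemma matching_stored_agree: "agree X Y s s' \<Longrightarrow> ''ma'' \<notin> Y \<Longrightarrow> ''mb'' \<notin> Y \<Longrightarrow> matching_stored n H m s \<Longrightarrow> matching_stored n H m s'"
  unfolding matching_stored_def agree_def by simp

definition round_time :: "nat \<Rightarrow> nat \<Rightarrow> nat" where
  "round_time n B = 3 * n + (B + 1) * (B * (6 * B + 5) + 6) + 14 * B + 40"

definition match_time :: "nat \<Rightarrow> nat \<Rightarrow> nat" where
  "match_time n B = 4 * n + 10 + (B + 1) * round_time n B"

text \<open>The matching \<open>m\<close> is maximum: the alternating forest rooted at the unmatched vertices of the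
  second side is closed and contains no unmatched vertex of the first side.\<close>

definition maximum :: "(nat \<Rightarrow> nat \<Rightarrow> bool) \<Rightarrow> nat set \<Rightarrow> nat set \<Rightarrow> (nat \<Rightarrow> nat option) \<Rightarrow> (nat \<Rightarrow> nat) \<Rightarrow> bool" where
  "maximum R A B m par \<longleftrightarrow> comatching R A B m \<and>
     (\<forall>b\<in>B. \<forall>a\<in>A. breached m par b \<longrightarrow> \<not> R b a \<longrightarrow> par a \<noteq> 0) \<and>
     (\<forall>a\<in>A. par a \<noteq> 0 \<longrightarrow> (\<exists>b\<in>B. m b = Some a \<and> breached m par b)) \<and>
     ((\<exists>a\<in>A. par a \<noteq> 0) \<longrightarrow> (\<exists>b\<in>B. m b = None))"

text \<open>Alternating from parent to mate lowers the rank, so the path ends, and it can only end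
  in an unmatched vertex. This free place is what the counting in
  \<open>maximum_edge_outside\<close> relies on.\<close>

lemma forest_root:
  assumes "forest n R A B m par rk" "A \<subseteq> {..<n}" "a \<in> A" "par a \<noteq> 0" "comatching R A B m"
  shows "\<exists>b\<in>B. m b = None"
  using assms(3,4)
proof (induction "rk a" arbitrary: a rule: less_induct)
  case less
  then have "a < n" using assms(2) by auto
  then obtain b where b: "b \<in> B" "m b = None \<or> (\<exists>a'. m b = Some a' \<and> par a' \<noteq> 0 \<and> rk a' < rk a)"
    using assms(1) less.prems(2) unfolding forest_def by blast
  from b(2) show ?case
  proof
    assume "\<exists>a'. m b = Some a' \<and> par a' \<noteq> 0 \<and> rk a' < rk a"
    then obtain a' where a': "m b = Some a'" "par a' \<noteq> 0" "rk a' < rk a" by blast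
    then show ?thesis using less.hyps assms(5) unfolding comatching_def by blast
  qed (use b(1) in blast)
qed

text \<open>A round either enlarges the matching or certifies that it is maximum, and a matching has
  at most \<open>B\<close> edges; hence the factor \<open>B + 1\<close> in
  \<open>match_time\<close>.\<close>

lemma wp_match:
  assumes ps: "pair_stored n R la lb s" and B: "length la \<le> B" "length lb \<le> B"
  shows "wp match_prog s (\<lambda>s' t. t \<le> match_time n B \<and>
     (\<exists>m. maximum R (set la) (set lb) m (arrays s' ''par'') \<and> matching_stored n {} m s'))"
proof -
  let ?A = "set la" and ?B = "set lb"
  have An: "?A \<subseteq> {..<n}" "?B \<subseteq> {..<n}" using pair_storedD[OF ps] by simp_all
  \<comment> \<open>The size of the matching, read off the memory, because the potential has to be a
    function of the store.\<close>
  define c where "c s' = card {b. b < n \<and> arrays s' ''mb'' b \<noteq> 0}" for s' :: store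
  have cm: "c s' = card (dom m) \<and> card (dom m) \<le> length lb" if "comatching R ?A ?B m" "matching_stored n {} m s'" for m s'
  proof -
    have sub: "dom m \<subseteq> ?B" using that(1) unfolding comatching_def by auto
    have "b < n \<and> arrays s' ''mb'' b \<noteq> 0 \<longleftrightarrow> m b \<noteq> None" for b
    proof (cases "b < n")
      case True
      then show ?thesis using that(2) unfolding matching_stored_def by simp
    next
      case False
      then show ?thesis using sub An by auto
    qed
    then have "{b. b < n \<and> arrays s' ''mb'' b \<noteq> 0} = dom m" by (simp add: dom_def)
    moreover have "card (dom m) \<le> card ?B" by (rule card_mono[OF _ sub]) simp
    ultimately show ?thesis unfolding c_def using card_length[of lb] by simp
  qed
  define C where "C = round_time n B"
  define body where "body = (reach_prog ;; find_prog ;; whenever (V ''fnd'') flip_prog)"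
  let ?X = "{''i'',''ch'',''b'',''j'',''w'',''fnd'',''fa'',''g''}" and ?Y = "{''par'',''ma'',''mb''}"
  have modb: "modv body \<subseteq> ?X" "moda body \<subseteq> ?Y"
    by (auto simp: body_def reach_prog_def find_prog_def flip_prog_def)
  define J where "J s' \<longleftrightarrow> (\<exists>m. comatching R ?A ?B m \<and> matching_stored n {} m s' \<and>
     (vars s' ''fnd'' = 1 \<or> vars s' ''fnd'' = 0 \<and> maximum R ?A ?B m (arrays s' ''par'')))" for s' :: store
  define \<Phi> where "\<Phi> s' = vars s' ''fnd'' * C + (length lb - c s') * C" for s' :: store
  have loop: "wp (While (V ''fnd'') body) s1 (\<lambda>s' t. t \<le> (B + 1) * C + 1 \<and>
     (\<exists>m. maximum R ?A ?B m (arrays s' ''par'') \<and> matching_stored n {} m s'))"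
    if ag1: "agree ?X ?Y s s1" and m1: "matching_stored n {} (\<lambda>_. None) s1" and f1: "vars s1 ''fnd'' = 1" for s1
  proof (rule wp_While[where I = J and \<Phi> = \<Phi>], goal_cases)
    case 1
    then show ?case using m1 f1 unfolding J_def by (intro exI[of _ "\<lambda>_. None"]) (simp add: comatching_def)
  next
    case (2 s2)
    have ag2: "agree ?X ?Y s s2" using agree_trans[OF ag1 agree_mono[OF 2(3) modb]] .
    have ps2: "pair_stored n R la lb s2" by (rule pair_stored_agree[OF ag2 _ _ ps]) auto
    obtain m where m: "comatching R ?A ?B m" "matching_stored n {} m s2" "vars s2 ''fnd'' = 1"
      using 2(1,2) unfolding J_def by auto
    show ?case
      unfolding body_def wp_Seq
    proof (rule wp_conseq[OF wp_reach[OF ps2 m(1,2) B]], elim conjE exE, goal_cases)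
      case (1 s3 t3 rk)
      have ag3: "agree ?X {''par''} s2 s3"
        by (rule agree_mono[OF 1(1)]) (auto simp: reach_prog_def)
      have ps3: "pair_stored n R la lb s3" by (rule pair_stored_agree[OF ag3 _ _ ps2]) auto
      have m3: "matching_stored n {} m s3" by (rule matching_stored_agree[OF ag3 _ _ m(2)]) auto
      have c3: "c s3 = c s2" using ag3 unfolding c_def by (simp add: agree_def)
      show ?case
      proof (rule wp_conseq[OF wp_find[OF ps3 m3]], elim conjE, goal_cases)
        case (1 s4 t4)
        have ag4: "agree ?X {} s3 s4"
          by (rule agree_mono[OF 1(1)]) (auto simp: find_prog_def)
        have ps4: "pair_stored n R la lb s4" by (rule pair_stored_agree[OF ag4 _ _ ps3]) auto
        have m4: "matching_stored n {} m s4" by (rule matching_stored_agree[OF ag4 _ _ m3]) auto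
        have c4: "c s4 = c s2" using ag4 c3 unfolding c_def by (simp add: agree_def)
        have p4: "arrays s4 = arrays s3" using ag4 by (auto simp: agree_def)
        have t: "t3 + t4 + (8 * length la + 10) + 8 \<le> C"
          using 1(2) \<open>t3 \<le> _\<close> B unfolding C_def round_time_def by simp
        note cc = cm[OF m(1,2)]
        from 1(3) show ?case
        proof (elim disjE conjE bexE)
          fix a assume a: "vars s4 ''fnd'' = 1" "a \<in> ?A" "vars s4 ''fa'' = a" "arrays s3 ''par'' a \<noteq> 0" "\<forall>b. m b \<noteq> Some a"
          have "wp flip_prog s4 (\<lambda>s' t. t \<le> 8 * length la + 10 \<and> (\<exists>m'. comatching R ?A ?B m' \<and> matching_stored n {} m' s' \<and>
            card (dom m') = Suc (card (dom m))))"
            by (rule wp_flip[OF ps4 m(1) m4]) (use a p4 \<open>forest _ _ _ _ _ _ _\<close> in simp_all)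
          then have "wp flip_prog s4 (\<lambda>s5 t5. J s5 \<and> 1 + (t3 + (t4 + (1 + t5))) + \<Phi> s5 \<le> \<Phi> s2)"
          proof (rule wp_conseq, elim conjE exE, goal_cases)
            case (1 s5 t5 m')
            have "vars s5 ''fnd'' = 1" using a(1) 1(1) by (simp add: agree_def flip_prog_def)
            moreover have "c s5 = Suc (c s2)" "c s5 \<le> length lb" using cm[OF 1(4,5)] cc 1(6) by simp_all
            moreover from this have "length lb - c s2 = Suc (length lb - c s5)" by simp
            ultimately show ?case using 1 t m(3) unfolding J_def \<Phi>_def by auto
          qed
          then show ?thesis using a(1) by simp
        next
          assume a: "vars s4 ''fnd'' = 0" "\<forall>a\<in>?A. arrays s3 ''par'' a \<noteq> 0 \<longrightarrow> (\<exists>b. m b = Some a)"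
          have "\<forall>a\<in>?A. arrays s3 ''par'' a \<noteq> 0 \<longrightarrow> (\<exists>b\<in>?B. m b = Some a \<and> breached m (arrays s3 ''par'') b)"
            using a(2) m(1) unfolding breached_def comatching_def by blast
          moreover have "(\<exists>a\<in>?A. arrays s3 ''par'' a \<noteq> 0) \<longrightarrow> (\<exists>b\<in>?B. m b = None)"
            using forest_root[OF \<open>forest _ _ _ _ _ _ rk\<close> An(1) _ _ m(1)] by blast
          moreover have "\<forall>b\<in>?B. \<forall>a\<in>?A. breached m (arrays s3 ''par'') b \<longrightarrow> \<not> R b a \<longrightarrow> arrays s3 ''par'' a \<noteq> 0" by fact
          ultimately have "maximum R ?A ?B m (arrays s4 ''par'')"
            unfolding maximum_def p4 using m(1) by (intro conjI)
          then have "J s4" unfolding J_def using m(1) m4 a(1) by blast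
          moreover have "1 + (t3 + (t4 + 2)) + \<Phi> s4 \<le> \<Phi> s2" using t a(1) m(3) c4 unfolding \<Phi>_def by simp
          ultimately show ?thesis using a(1) by simp
        qed
      qed
    qed
  next
    case (3 s2 t)
    have "\<Phi> s1 = (1 + (length lb - c s1)) * C" unfolding \<Phi>_def f1 by simp
    also have "\<dots> \<le> (B + 1) * C" using B by (intro mult_le_mono1) simp
    finally show ?case using 3 unfolding J_def by auto
  qed
  show ?thesis
    unfolding match_prog_def body_def[symmetric] wp_Seq
  proof (rule wp_For_bound[where N = n and T = 2 and I = "\<lambda>k s'. \<forall>i<k. arrays s' ''ma'' i = 0 \<and> arrays s' ''mb'' i = 0"], goal_cases)
    case (5 s1 t1)
    have 1: "agree ?X ?Y s (setv ''fnd'' 1 s1)" using 5(3) by (simp add: agree_def)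
    have 2: "matching_stored n {} (\<lambda>_. None) (setv ''fnd'' 1 s1)" using 5(1) by (simp add: matching_stored_def)
    show ?case
      unfolding wp_Assign val.simps
      by (rule wp_conseq[OF loop[OF 1 2]]) (use 5 in \<open>auto simp: match_time_def C_def\<close>)
  qed (use pair_storedD(1)[OF ps] in \<open>auto simp: agree_def less_Suc_eq\<close>)
qed

section \<open>Recording a matching\<close>

definition arr :: "store \<Rightarrow> string \<Rightarrow> nat \<Rightarrow> nat list \<Rightarrow> bool" where
  "arr s a base xs \<longleftrightarrow> (\<forall>i<length xs. arrays s a (base + i) = xs ! i)"

lemma arr_setv [simp]: "arr (setv x k s) a base xs \<longleftrightarrow> arr s a base xs"
  by (simp add: arr_def)

lemma arr_Nil [simp]: "arr s a base []"
  by (simp add: arr_def)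

lemma arr_other [simp]: "b \<noteq> a \<Longrightarrow> arr (seta b i k s) a base xs \<longleftrightarrow> arr s a base xs"
  by (simp add: arr_def)

lemma arr_snoc: "arr s a base xs \<Longrightarrow> i = base + length xs \<Longrightarrow> arr (seta a i v s) a base (xs @ [v])"
  by (auto simp: arr_def nth_append less_Suc_eq)

text \<open>Each reduction fills one row of length \<open>n\<close> in the record arrays; the cells
  below the current row belong to earlier reductions.\<close>

definition low :: "nat \<Rightarrow> store \<Rightarrow> store \<Rightarrow> bool" where
  "low k s s' \<longleftrightarrow> (\<forall>i<k. arrays s' ''pa'' i = arrays s ''pa'' i \<and> arrays s' ''pb'' i = arrays s ''pb'' i)"

lemma wp_record:
  assumes ps: "pair_stored n R la lb s" and com: "comatching R (set la) (set lb) m" and m: "matching_stored n {} m s"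
    and r: "vars s ''rec'' = r"
  shows "wp record_prog s (\<lambda>s' t. t \<le> 8 * length la + 16 * length lb + 12 \<and> vars s' ''rec'' = Suc r \<and> low (r * n) s s' \<and>
     (\<forall>j<r. arrays s' ''rna'' j = arrays s ''rna'' j \<and> arrays s' ''rnb'' j = arrays s ''rnb'' j) \<and>
     (\<exists>PA PB \<mu>. arr s' ''pa'' (r * n) PA \<and> arr s' ''pb'' (r * n) PB \<and>
        arrays s' ''rna'' r = length PA \<and> arrays s' ''rnb'' r = length PB \<and>
        set PA = set la \<and> set PB = set lb \<and> distinct PA \<and> distinct PB \<and> \<mu> = card (dom m) \<and>
        \<mu> \<le> length PA \<and> \<mu> \<le> length PB \<and> (\<forall>i<\<mu>. \<not> R (PB ! i) (PA ! i))))"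
proof -
  let ?A = "set la" and ?B = "set lb"
  define M where "M b \<longleftrightarrow> m b \<noteq> None" for b
  define F where "F a \<longleftrightarrow> (\<forall>b. m b \<noteq> Some a)" for a
  define ra where "ra k = map (\<lambda>b. the (m b)) (filter M (take k lb))" for k
  define rb where "rb k = filter M (take k lb)" for k
  define PA where "PA k = ra (length lb) @ filter F (take k la)" for k
  define PB where "PB k = rb (length lb) @ filter (\<lambda>b. \<not> M b) (take k lb)" for k
  have mem: "m b = Some a \<Longrightarrow> b \<in> ?B \<and> a \<in> ?A \<and> \<not> R b a" for a b
    using com unfolding comatching_def by blast
  have inj: "m b = Some a \<Longrightarrow> m b' = Some a \<Longrightarrow> b = b'" for a b b'
    using com unfolding comatching_def by blast
  have An: "?A \<subseteq> {..<n}" "?B \<subseteq> {..<n}" using pair_storedD[OF ps] by simp_all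
  have dis: "distinct la" "distinct lb" using pair_storedD[OF ps] by simp_all
  have mb: "arrays s ''mb'' b = enc (m b)" if "b \<in> ?B" for b
    using m An that unfolding matching_stored_def by auto
  have ma: "arrays s ''ma'' a = 0 \<longleftrightarrow> F a" if "a \<in> ?A" for a
  proof -
    have "(\<forall>b. m b = Some a \<longrightarrow> arrays s ''ma'' a = Suc b) \<and> ((\<forall>b. m b \<noteq> Some a) \<longrightarrow> arrays s ''ma'' a = 0)"
      using m An that unfolding matching_stored_def by auto
    then show ?thesis unfolding F_def by (cases "\<forall>b. m b \<noteq> Some a") auto
  qed
  have setPA: "set (PA (length la)) = ?A"
    unfolding PA_def ra_def F_def M_def using mem by (auto simp: image_iff; metis option.sel option.distinct(1))
  have setPB: "set (PB (length lb)) = ?B"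
    unfolding PB_def rb_def by auto
  have disPA: "distinct (PA (length la))"
    unfolding PA_def ra_def F_def M_def using dis inj by (auto simp: distinct_map inj_on_def)
  have disPB: "distinct (PB (length lb))"
    unfolding PB_def rb_def using dis by auto
  have lens: "length (PA (length la)) = length la" "length (PB (length lb)) = length lb"
    using distinct_card[OF disPA] distinct_card[OF disPB] distinct_card[OF dis(1)] distinct_card[OF dis(2)] setPA setPB by simp_all
  have lra: "length (ra k) = length (rb k)" for k by (simp add: ra_def rb_def)
  have dom: "length (rb (length lb)) = card (dom m)"
  proof -
    have "set (rb (length lb)) = dom m" unfolding rb_def M_def using mem by auto
    then show ?thesis using distinct_card[of "rb (length lb)"] dis(2) by (simp add: rb_def)
  qed
  let ?X = "{''d'',''j'',''b'',''w'',''z'',''rec''}" and ?Y = "{''pa'',''pb'',''rna'',''rnb''}"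
  define c1 where "c1 = (For ''j'' NB (''b'' \<longleftarrow> LB (V ''j'') ;; whenever (Read ''mb'' (V ''b''))
       (wcell ''pa'' (V ''rec'') (V ''d'') (Read ''mb'' (V ''b'') \<ominus> N 1) ;;
        wcell ''pb'' (V ''rec'') (V ''d'') (V ''b'') ;; incr ''d'')))"
  define c2 where "c2 = (For ''j'' NA (''w'' \<longleftarrow> LA (V ''j'') ;; whenever (Read ''ma'' (V ''w'') \<doteq> N 0)
       (wcell ''pa'' (V ''rec'') (V ''d'') (V ''w'') ;; incr ''d'')))"
  define c3 where "c3 = (For ''j'' NB (''b'' \<longleftarrow> LB (V ''j'') ;; whenever (Read ''mb'' (V ''b'') \<doteq> N 0)
       (wcell ''pb'' (V ''rec'') (V ''z'') (V ''b'') ;; incr ''z'')))"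
  have st: "vars s' ''n'' = n" "arrays s' ''len'' 0 = length la" "arrays s' ''len'' (Suc 0) = length lb"
    "\<And>i. i < length la \<Longrightarrow> arrays s' ''q'' i = la ! i" "\<And>i. i < length lb \<Longrightarrow> arrays s' ''q'' (n + i) = lb ! i"
    "arrays s' ''mb'' = arrays s ''mb''" "arrays s' ''ma'' = arrays s ''ma''"
    if "agree ?X ?Y s s'" for s'
    using that pair_storedD(1-5)[OF ps] by (simp_all add: agree_def)
  have w1: "wp c1 s1 (\<lambda>s' t. t \<le> 7 * length lb + 2 \<and> vars s' ''d'' = length (rb (length lb)) \<and>
      arr s' ''pa'' (r * n) (ra (length lb)) \<and> arr s' ''pb'' (r * n) (rb (length lb)) \<and> low (r * n) s s')"
    if ag: "agree ?X ?Y s s1" and d: "vars s1 ''d'' = 0" and rc: "vars s1 ''rec'' = r" and l: "low (r * n) s s1" for s1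
    unfolding c1_def
  proof (rule wp_For_bound[where N = "length lb" and T = 5 and I = "\<lambda>k s'. vars s' ''d'' = length (rb k) \<and>
      arr s' ''pa'' (r * n) (ra k) \<and> arr s' ''pb'' (r * n) (rb k) \<and> low (r * n) s s'"], goal_cases)
    case (2 s')
    then show ?case using st(3)[OF ag] by (simp add: agree_def)
  next
    case 3
    then show ?case using d l by (simp add: ra_def rb_def low_def)
  next
    case (4 k s')
    have ag2: "agree ?X ?Y s s'" using ag 4(4) by (simp add: agree_def)
    have rc2: "vars s' ''rec'' = r" using rc 4(4) by (simp add: agree_def)
    have b: "lb ! k \<in> ?B" using 4(1) by simp
    have S: "rb (Suc k) = rb k @ (if M (lb ! k) then [lb ! k] else [])"
      "ra (Suc k) = ra k @ (if M (lb ! k) then [the (m (lb ! k))] else [])"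
      using 4(1) by (simp_all add: rb_def ra_def take_Suc_conv_app_nth)
    show ?case
    proof (cases "m (lb ! k)")
      case None
      then show ?thesis using 4(1-3) st(1,5,6)[OF ag2] mb[OF b] rc2 S by (simp add: M_def low_def)
    next
      case (Some a)
      then show ?thesis using 4(1-3) st(1,5,6)[OF ag2] mb[OF b] rc2 S
        by (auto simp: M_def low_def lra intro!: arr_snoc)
    qed
  qed (simp_all add: mult.commute)
  have w2: "wp c2 s1 (\<lambda>s' t. t \<le> 6 * length la + 2 \<and>
      arr s' ''pa'' (r * n) (PA (length la)) \<and> arr s' ''pb'' (r * n) (rb (length lb)) \<and> low (r * n) s s')"
    if ag: "agree ?X ?Y s s1" and d: "vars s1 ''d'' = length (rb (length lb))" and rc: "vars s1 ''rec'' = r"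
      and l: "low (r * n) s s1" "arr s1 ''pa'' (r * n) (ra (length lb))" "arr s1 ''pb'' (r * n) (rb (length lb))" for s1
    unfolding c2_def
  proof (rule wp_For_bound[where N = "length la" and T = 4 and I = "\<lambda>k s'. vars s' ''d'' = length (PA k) \<and>
      arr s' ''pa'' (r * n) (PA k) \<and> arr s' ''pb'' (r * n) (rb (length lb)) \<and> low (r * n) s s'"], goal_cases)
    case (2 s')
    then show ?case using st(2)[OF ag] by (simp add: agree_def)
  next
    case 3
    then show ?case using d l by (simp add: PA_def low_def lra)
  next
    case (4 k s')
    have ag2: "agree ?X ?Y s s'" using ag 4(4) by (simp add: agree_def)
    have rc2: "vars s' ''rec'' = r" using rc 4(4) by (simp add: agree_def)
    have b: "la ! k \<in> ?A" using 4(1) by simp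
    have S: "PA (Suc k) = PA k @ (if F (la ! k) then [la ! k] else [])"
      using 4(1) by (simp add: PA_def take_Suc_conv_app_nth)
    show ?case
      using 4(1-3) st(1,4,7)[OF ag2] ma[OF b] rc2 S by (auto simp: low_def intro!: arr_snoc)
  qed (simp_all add: mult.commute)
  have w3: "wp c3 s1 (\<lambda>s' t. t \<le> 6 * length lb + 2 \<and>
      arr s' ''pa'' (r * n) (PA (length la)) \<and> arr s' ''pb'' (r * n) (PB (length lb)) \<and> low (r * n) s s')"
    if ag: "agree ?X ?Y s s1" and d: "vars s1 ''z'' = length (rb (length lb))" and rc: "vars s1 ''rec'' = r"
      and l: "low (r * n) s s1" "arr s1 ''pa'' (r * n) (PA (length la))" "arr s1 ''pb'' (r * n) (rb (length lb))" for s1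
    unfolding c3_def
  proof (rule wp_For_bound[where N = "length lb" and T = 4 and I = "\<lambda>k s'. vars s' ''z'' = length (PB k) \<and>
      arr s' ''pa'' (r * n) (PA (length la)) \<and> arr s' ''pb'' (r * n) (PB k) \<and> low (r * n) s s'"], goal_cases)
    case (2 s')
    then show ?case using st(3)[OF ag] by (simp add: agree_def)
  next
    case 3
    then show ?case using d l by (simp add: PB_def low_def lra)
  next
    case (4 k s')
    have ag2: "agree ?X ?Y s s'" using ag 4(4) by (simp add: agree_def)
    have rc2: "vars s' ''rec'' = r" using rc 4(4) by (simp add: agree_def)
    have b: "lb ! k \<in> ?B" using 4(1) by simp
    have S: "PB (Suc k) = PB k @ (if M (lb ! k) then [] else [lb ! k])"
      using 4(1) by (simp add: PB_def take_Suc_conv_app_nth)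
    show ?case
      using 4(1-3) st(1,5,6)[OF ag2] mb[OF b] rc2 S by (auto simp: low_def M_def intro!: arr_snoc)
  qed (simp_all add: mult.commute)
  have matched: "\<not> R (PB (length lb) ! i) (PA (length la) ! i)" if "i < card (dom m)" for i
  proof -
    have i: "i < length (rb (length lb))" "i < length (ra (length lb))" using that dom lra by simp_all
    then have "PB (length lb) ! i = rb (length lb) ! i" "PA (length la) ! i = the (m (rb (length lb) ! i))"
      by (simp_all add: PA_def PB_def nth_append) (simp add: ra_def rb_def)
    moreover have "M (rb (length lb) ! i)" using nth_mem[OF i(1)] by (simp add: rb_def)
    ultimately show ?thesis using mem unfolding M_def by auto
  qed
  have ag0: "agree ?X ?Y s (setv ''d'' 0 s)" by (simp add: agree_def)
  have le: "card (dom m) \<le> length la" "card (dom m) \<le> length lb"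
    using lens dom lra by (metis PA_def length_append le_add1, metis PB_def length_append le_add1)
  show ?thesis
    unfolding record_prog_def c1_def[symmetric] c2_def[symmetric] c3_def[symmetric] wp_Seq wp_Assign val.simps
  proof (rule wp_conseq[OF w1[OF ag0]], goal_cases)
    case (4 s1 t1)
    have ag1: "agree ?X ?Y s (setv ''z'' (vars s1 ''d'') s1)"
      using agree_trans[OF ag0 agree_mono[OF 4(1)]] by (auto simp: c1_def agree_def)
    have r1: "vars s1 ''rec'' = r" using 4(1) r by (simp add: agree_def c1_def)
    show ?case
    proof (rule wp_conseq[OF w2[OF ag1]], goal_cases)
      case (6 s2 t2)
      have ag2: "agree ?X ?Y s s2"
        using agree_trans[OF ag1 agree_mono[OF 6(1)]] by (auto simp: c2_def agree_def)
      have r2: "vars s2 ''rec'' = r" "vars s2 ''z'' = length (rb (length lb))"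
        using 6(1) r1 4(2) by (simp_all add: agree_def c2_def)
      show ?case
      proof (rule wp_conseq[OF w3[OF ag2]], goal_cases)
        case (6 s3 t3)
        have ag3: "agree ?X ?Y s s3"
          using agree_trans[OF ag2 agree_mono[OF 6(1)]] by (auto simp: c3_def agree_def)
        have r3: "vars s3 ''rec'' = r" "arrays s3 ''rna'' = arrays s ''rna''" "arrays s3 ''rnb'' = arrays s ''rnb''"
          using 6(1) r2 \<open>agree (modv c2) _ _ _\<close> \<open>agree (modv c1) _ _ _\<close> by (simp_all add: agree_def c3_def c2_def c1_def)
        have E: "\<exists>PA PB \<mu>. arr s3 ''pa'' (r * n) PA \<and> arr s3 ''pb'' (r * n) PB \<and>
            length la = length PA \<and> length lb = length PB \<and>
            set PA = set la \<and> set PB = set lb \<and> distinct PA \<and> distinct PB \<and> \<mu> = card (dom m) \<and>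
            \<mu> \<le> length PA \<and> \<mu> \<le> length PB \<and> (\<forall>i<\<mu>. \<not> R (PB ! i) (PA ! i))"
          by (rule exI[of _ "PA (length la)"], rule exI[of _ "PB (length lb)"], rule exI[of _ "card (dom m)"])
            (use 6(2) lens setPA setPB disPA disPB matched le in simp)
        have L: "low (r * n) s s3" using 6(2) by blast
        have T: "t1 + t2 + t3 \<le> 7 * length lb + 6 * length la + 6 * length lb + 6"
          using 4(2) \<open>t2 \<le> _ \<and> _\<close> 6(2) by linarith
        show ?case
          using E L T r3 st(2,3)[OF ag3] by (simp add: low_def)
      qed (use 6 r2 4 in simp_all)
    qed (use 4 r1 in \<open>simp_all add: low_def\<close>)
  qed (use r in \<open>simp_all add: low_def\<close>)
qed

section \<open>A single reduction, the passes over all seeds, and the reduction loop\<close>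

section \<open>One reduction\<close>

text \<open>A reached vertex of the second side has only reached non-neighbours, which makes
  \<open>Q\<close> a clique. Outside \<open>Q\<close> are the unreached vertices of
  \<open>B\<close>, all of them matched, and the reached vertices of \<open>A\<close>, all of them
  mates of reached vertices. Together they are as many as the matched pairs.\<close>

lemma maximum_clique:
  assumes mx: "maximum R A B m par" and fin: "finite A" "finite B" and cl: "is_clique R A" "is_clique R B" and dis: "A \<inter> B = {}"
    and sym: "\<And>u v. R u v = R v u" and Q: "Q = {b\<in>B. breached m par b} \<union> {a\<in>A. par a = 0}"
  shows "is_clique R Q" "card Q + card (dom m) = card A + card B"
proof -
  have com: "\<And>b a. m b = Some a \<Longrightarrow> b \<in> B \<and> a \<in> A" "\<And>b b' a. m b = Some a \<Longrightarrow> m b' = Some a \<Longrightarrow> b = b'"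
    using mx unfolding maximum_def comatching_def by blast+
  have 1: "R b a" if "b \<in> B" "a \<in> A" "breached m par b" "par a = 0" for a b
    using mx that unfolding maximum_def by blast
  show "is_clique R Q"
    unfolding is_clique_def Q
  proof (intro ballI impI)
    fix u v assume *: "u \<in> {b\<in>B. breached m par b} \<union> {a\<in>A. par a = 0}" "v \<in> {b\<in>B. breached m par b} \<union> {a\<in>A. par a = 0}" "u \<noteq> v"
    show "R u v"
      using * 1 cl sym unfolding is_clique_def by (elim UnE CollectE conjE) metis+
  qed
  define U where "U = {b\<in>B. \<not> breached m par b}"
  define W where "W = {b\<in>B. \<exists>a. m b = Some a \<and> par a \<noteq> 0}"
  define P where "P = {a\<in>A. par a \<noteq> 0}"
  have dom: "dom m = U \<union> W" "U \<inter> W = {}"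
    unfolding U_def W_def breached_def using com(1) by (auto simp: dom_def)
  have "card W = card P"
  proof (rule bij_betw_same_card)
    show "bij_betw (\<lambda>b. the (m b)) W P"
      unfolding bij_betw_def
    proof
      show "inj_on (\<lambda>b. the (m b)) W" using com(2) by (auto simp: inj_on_def W_def)
      show "(\<lambda>b. the (m b)) ` W = P"
      proof
        show "(\<lambda>b. the (m b)) ` W \<subseteq> P" using com(1) by (auto simp: W_def P_def)
        show "P \<subseteq> (\<lambda>b. the (m b)) ` W"
        proof
          fix a assume "a \<in> P"
          then obtain b where "b \<in> B" "m b = Some a" "par a \<noteq> 0" using mx unfolding maximum_def P_def by blast
          then show "a \<in> (\<lambda>b. the (m b)) ` W" by (intro image_eqI[of _ _ b]) (auto simp: W_def)
        qed
      qed
    qed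
  qed
  moreover have "card (dom m) = card U + card W"
    unfolding dom(1) by (rule card_Un_disjoint) (use fin dom(2) in \<open>auto simp: U_def W_def\<close>)
  moreover have "card Q = card (B - U) + card (A - P)"
  proof -
    have "Q = (B - U) \<union> (A - P)" unfolding Q U_def P_def by auto
    then show ?thesis using card_Un_disjoint[of "B - U" "A - P"] fin dis by auto
  qed
  moreover have "card (B - U) = card B - card U" "card U \<le> card B" "card (A - P) = card A - card P" "card P \<le> card A"
    using fin card_Diff_subset[of U B] card_Diff_subset[of P A] card_mono[of B U] card_mono[of A P]
    by (auto simp: U_def P_def)
  ultimately show "card Q + card (dom m) = card A + card B" by linarith
qed

text \<open>Otherwise all edges between the sides lie inside the clique, and every vertex of
  \<open>B\<close> is reached. A mixed vertex of \<open>A\<close> would be unreached because of its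
  edge and reached because of its non-edge. So at least \<open>card B\<close> vertices of
  \<open>A\<close> are anticomplete to \<open>B\<close>; they are reached and hence matched into
  \<open>B\<close>, where one place stays free: too many.\<close>

lemma maximum_edge_outside:
  assumes mx: "maximum R A B m par" and fin: "finite A" "finite B" and fl: "flagged R A B"
    and mix: "\<And>b. b \<in> B \<Longrightarrow> \<exists>u\<in>A. R u b" and sym: "\<And>u v. R u v = R v u"
  shows "\<exists>u\<in>A. \<exists>b\<in>B. R u b \<and> (par u \<noteq> 0 \<or> \<not> breached m par b)"
proof (rule ccontr)
  assume "\<not> ?thesis"
  then have *: "par u = 0 \<and> breached m par b" if "u \<in> A" "b \<in> B" "R u b" for u b
    using that by blast
  have cl: "par a \<noteq> 0" if "b \<in> B" "a \<in> A" "breached m par b" "\<not> R a b" for a b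
    using mx that sym unfolding maximum_def by blast
  have br: "breached m par b" if "b \<in> B" for b using mix[OF that] * that by blast
  have "\<not> (\<exists>u\<in>A. \<exists>b\<in>B. \<exists>b'\<in>B. R u b \<and> \<not> R u b')"
    using cl br * by blast
  then have c: "B \<noteq> {}" "card B \<le> card {u\<in>A. \<forall>b\<in>B. \<not> R u b}" using fl unfolding flagged_def by blast+
  let ?X = "{u\<in>A. \<forall>b\<in>B. \<not> R u b}"
  obtain b where b: "b \<in> B" using c(1) by blast
  have X: "par u \<noteq> 0" if "u \<in> ?X" for u using cl[OF b _ br[OF b]] that b by blast
  have "card B > 0" using c(1) fin by (simp add: card_gt_0_iff)
  then have "?X \<noteq> {}" using c(2) by (metis card.empty leD)
  then obtain b0 where b0: "b0 \<in> B" "m b0 = None" using mx X unfolding maximum_def by blast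
  have exg: "\<forall>u\<in>?X. \<exists>b. b \<in> B \<and> m b = Some u" using mx X unfolding maximum_def by blast
  from bchoice[OF exg] obtain g where g: "\<forall>u\<in>?X. g u \<in> B \<and> m (g u) = Some u" ..
  have "inj_on g ?X"
  proof (rule inj_onI)
    fix u v assume uv: "u \<in> ?X" "v \<in> ?X" "g u = g v"
    have 1: "m (g u) = Some u" by (rule conjunct2[OF bspec[OF g uv(1)]])
    have 2: "m (g v) = Some v" by (rule conjunct2[OF bspec[OF g uv(2)]])
    show "u = v" by (rule option.inject[THEN iffD1]) (rule trans[OF 1[symmetric] trans[OF arg_cong[OF uv(3), of m] 2]])
  qed
  moreover have "g ` ?X \<subseteq> B - {b0}" using g b0(2) by fastforce
  ultimately have "card ?X \<le> card (B - {b0})" using fin by (intro card_inj_on_le[of g]) auto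
  also have "\<dots> < card B" using fin b0(1) by (intro psubset_card_mono) auto
  finally show False using c(2) by simp
qed

definition cut :: "('b \<Rightarrow> 'b \<Rightarrow> bool) \<Rightarrow> ('b \<times> 'b) set \<Rightarrow> 'b \<Rightarrow> 'b \<Rightarrow> bool" where
  "cut R X u v \<longleftrightarrow> R u v \<and> (u, v) \<notin> X \<and> (v, u) \<notin> X"

lemma matrix_stored_cut:
  assumes "matrix_stored n (cut R X) s" "u < n" "b < n"
  shows "matrix_stored n (cut R (insert (u, b) X)) (seta ''subadj'' (b * n + u) 0 (seta ''subadj'' (u * n + b) 0 s))"
  using assms unfolding matrix_stored_def cut_def by auto

lemma wp_delete:
  assumes ps: "pair_stored n R la lb s" and m: "matching_stored n {} m s"
  shows "wp delete_prog s (\<lambda>s' t. t \<le> length la * (6 * length lb + 5) + 2 \<and>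
     matrix_stored n (cut R {(u, b). u \<in> set la \<and> b \<in> set lb \<and> (arrays s ''par'' u \<noteq> 0 \<or> \<not> breached m (arrays s ''par'') b)}) s')"
proof -
  let ?B = "set lb"
  define D where "D u b \<longleftrightarrow> arrays s ''par'' u \<noteq> 0 \<or> \<not> breached m (arrays s ''par'') b" for u b
  define X where "X k = {(u, b). u \<in> set (take k la) \<and> b \<in> ?B \<and> D u b}" for k
  define Y where "Y u j = {(u, b) | b. b \<in> set (take j lb) \<and> D u b}" for u j
  have An: "set la \<subseteq> {..<n}" "?B \<subseteq> {..<n}" using pair_storedD[OF ps] by simp_all
  have "wp delete_prog s (\<lambda>s' t. t \<le> length la * (6 * length lb + 5) + 2 \<and> matrix_stored n (cut R (X (length la))) s')"
    unfolding delete_prog_def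
  proof (rule wp_For_bound[where N = "length la" and T = "6 * length lb + 3" and I = "\<lambda>k s'. matrix_stored n (cut R (X k)) s'"], goal_cases)
    case (2 s')
    then show ?case using pair_storedD(2)[OF ps] by (simp add: agree_def)
  next
    case 3
    have "cut R (X 0) = R" unfolding cut_def X_def by (intro ext) simp
    then show ?case using pair_storedD(12)[OF ps] by (simp add: matrix_stored_def)
  next
    case (4 k s')
    define u where "u = la ! k"
    have u: "u \<in> set la" "u < n" using nth_mem[OF 4(1)] An unfolding u_def by blast+
    have q: "arrays s' ''q'' k = u" "vars s' ''n'' = n"
      using 4(4) pair_storedD(1)[OF ps] pair_storedD(4)[OF ps 4(1)] by (simp_all add: agree_def u_def)
    have vu: "val s' (LA (V ''i'')) = u" using q 4(3) by simp
    have w: "wp (For ''j'' NB (''b'' \<longleftarrow> LB (V ''j'') ;;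
       whenever (Read ''par'' (V ''u'') \<oplus> (N 1 \<ominus> reached (V ''b'')))
         (wcell ''subadj'' (V ''u'') (V ''b'') (N 0) ;; wcell ''subadj'' (V ''b'') (V ''u'') (N 0)))) (setv ''u'' u s')
      (\<lambda>s2 t. t \<le> 6 * length lb + 2 \<and> matrix_stored n (cut R (X k \<union> Y u (length lb))) s2)"
    proof (rule wp_For_bound[where N = "length lb" and T = 4 and I = "\<lambda>j s2. matrix_stored n (cut R (X k \<union> Y u j)) s2"], goal_cases)
      case (2 s2)
      then show ?case using 4(4) pair_storedD(3)[OF ps] by (simp add: agree_def)
    next
      case 3
      have "Y u 0 = {}" by (simp add: Y_def)
      then show ?case using 4(2) by (simp add: matrix_stored_def)
    next
      case (4 j s2)
      define b where "b = lb ! j"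
      have b: "b \<in> ?B" "b < n" using nth_mem[OF 4(1)] An unfolding b_def by blast+
      have st: "vars s2 ''n'' = n" "vars s2 ''u'' = u" "arrays s2 ''q'' (n + j) = b" "arrays s2 ''par'' = arrays s ''par''"
         "arrays s2 ''mb'' = arrays s ''mb''"
        using 4(4) \<open>agree _ _ s s'\<close> pair_storedD(1)[OF ps] pair_storedD(5)[OF ps 4(1)] by (simp_all add: agree_def b_def)
      have vb: "val s2 (LB (V ''j'')) = b" using st 4(3) by simp
      let ?s3 = "setv ''b'' b s2"
      have "arrays ?s3 ''mb'' (val ?s3 (V ''b'')) = enc (m (val ?s3 (V ''b'')))"
        using m b(2) st unfolding matching_stored_def by simp
      from val_reached[of ?s3 "V ''b''" m, OF this] have vr: "val ?s3 (reached (V ''b'')) = of_bool (breached m (arrays s ''par'') b)"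
        using st by simp
      have vD: "val ?s3 (Read ''par'' (V ''u'') \<oplus> (N 1 \<ominus> reached (V ''b''))) \<noteq> 0 \<longleftrightarrow> D u b"
        unfolding val.simps(4)[of _ Plus] val.simps(4)[of _ Minus] vr D_def using st by simp
      have Yj: "X k \<union> Y u (Suc j) = (if D u b then insert (u, b) (X k \<union> Y u j) else X k \<union> Y u j)"
        unfolding Y_def b_def using 4(1) by (auto simp: take_Suc_conv_app_nth)
      have m3: "matrix_stored n (cut R (X k \<union> Y u j)) ?s3" using 4(2) by (simp add: matrix_stored_def)
      have m4: "matrix_stored n S (setv ''j'' i s4)" if "matrix_stored n S s4" for S i s4 using that by (simp add: matrix_stored_def)
      show ?case
        unfolding wp_Seq[of "_ \<longleftarrow> _"] wp_Assign vb wp_If vD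
        using matrix_stored_cut[OF m3 u(2) b(2)] m3 st m4 unfolding Yj by simp
    next
      case (5 s2 t)
      then show ?case by (simp add: mult.commute)
    qed simp_all
    have XS: "X k \<union> Y u (length lb) = X (Suc k)"
      unfolding X_def Y_def u_def using 4(1) by (auto simp: take_Suc_conv_app_nth)
    show ?case
      unfolding wp_Seq[of "_ \<longleftarrow> _"] wp_Assign vu
      by (rule wp_conseq[OF w]) (simp add: XS matrix_stored_def)
  next
    case (5 s' t)
    then show ?case by (simp add: algebra_simps)
  qed simp
  then show ?thesis unfolding X_def D_def by simp
qed

text \<open>What is kept of a run of \<open>pair_prog\<close>, without reference to parents or
  memory: the recorded lists with \<open>\<mu>\<close> aligned nonadjacent pairs, and a clique of
  the reduced relation large enough to limit the shared colours to \<open>\<mu>\<close>. The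
  colouring part and the graph-theoretic part both start from here.\<close>

definition reduction_step :: "nat \<Rightarrow> (nat \<Rightarrow> nat \<Rightarrow> bool) \<Rightarrow> (nat \<Rightarrow> nat \<Rightarrow> bool) \<Rightarrow> nat list \<Rightarrow> nat list \<Rightarrow> nat \<Rightarrow> bool" where
  "reduction_step n R R' PA PB \<mu> \<longleftrightarrow> homog {..<n} R (set PA) (set PB) \<and> distinct PA \<and> distinct PB \<and>
     \<mu> \<le> length PA \<and> \<mu> \<le> length PB \<and> (\<forall>i<\<mu>. \<not> R (PB ! i) (PA ! i)) \<and> PB \<noteq> [] \<and> PA \<noteq> [] \<and> 3 \<le> length PA + length PB \<and>
     (\<exists>a\<in>set PA. \<exists>b\<in>set PB. \<not> R a b) \<and>
     (\<exists>Q \<subseteq> set PA \<union> set PB. is_clique R' Q \<and> card Q + \<mu> = length PA + length PB) \<and>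
     is_graph n R' \<and> (\<forall>u v. R' u v \<longrightarrow> R u v) \<and> (\<exists>u v. R u v \<and> \<not> R' u v) \<and>
     (\<forall>u v. R u v \<longrightarrow> \<not> R' u v \<longrightarrow> u \<in> set PA \<and> v \<in> set PB \<or> u \<in> set PB \<and> v \<in> set PA)"

definition big_time :: "nat \<Rightarrow> nat \<Rightarrow> nat" where
  "big_time n B = match_time n B + B * (6 * B + 5) + 24 * B + 30"

definition recorded :: "nat \<Rightarrow> nat \<Rightarrow> nat list \<Rightarrow> nat list \<Rightarrow> store \<Rightarrow> bool" where
  "recorded n r PA PB s \<longleftrightarrow> arr s ''pa'' (r * n) PA \<and> arr s ''pb'' (r * n) PB \<and>
     arrays s ''rna'' r = length PA \<and> arrays s ''rnb'' r = length PB"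

definition recs_kept :: "nat \<Rightarrow> nat \<Rightarrow> store \<Rightarrow> store \<Rightarrow> bool" where
  "recs_kept n r s s' \<longleftrightarrow> low (r * n) s s' \<and>
     (\<forall>j<r. arrays s' ''rna'' j = arrays s ''rna'' j \<and> arrays s' ''rnb'' j = arrays s ''rnb'' j)"

definition stepped :: "nat \<Rightarrow> nat \<Rightarrow> (nat \<Rightarrow> nat \<Rightarrow> bool) \<Rightarrow> store \<Rightarrow> store \<Rightarrow> bool" where
  "stepped n r R s s' \<longleftrightarrow> vars s' ''rec'' = Suc r \<and> recs_kept n r s s' \<and>
     (\<exists>PA PB \<mu> R'. reduction_step n R R' PA PB \<mu> \<and> recorded n r PA PB s' \<and> matrix_stored n R' s')"

lemma wp_reduce_pair:
  assumes gr: "is_graph n R" and ps: "pair_stored n R la lb s" and B: "length la \<le> B" "length lb \<le> B" and r: "vars s ''rec'' = r"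
    and homog: "homog {..<n} R (set la) (set lb)" and mix: "\<forall>b\<in>set lb. (\<exists>u\<in>set la. R u b) \<and> (\<exists>u\<in>set la. \<not> R u b)"
    and la2: "2 \<le> length la" and fl: "flagged R (set la) (set lb)"
  shows "wp pair_prog s (\<lambda>s' t. t \<le> big_time n B \<and>
    vars s' ''go'' = 1 \<and> stepped n r R s s')"
  unfolding pair_prog_def wp_Seq
proof (rule wp_conseq[OF wp_match[OF ps B]], elim conjE exE, goal_cases)
  case (1 s1 t1 m)
  have ag1: "agree {''i'',''ch'',''b'',''j'',''w'',''fnd'',''fa'',''g''} {''par'',''ma'',''mb''} s s1"
    by (rule agree_mono[OF 1(1)]) (auto simp: match_prog_def reach_prog_def find_prog_def flip_prog_def)
  have ps1: "pair_stored n R la lb s1" by (rule pair_stored_agree[OF ag1 _ _ ps]) auto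
  have com: "comatching R (set la) (set lb) m" using 1(3) unfolding maximum_def by blast
  have r1: "vars s1 ''rec'' = r" using r ag1 by (simp add: agree_def)
  show ?case
  proof (rule wp_conseq[OF wp_record[OF ps1 com 1(4) r1]], elim conjE exE, goal_cases)
    case rec: (1 s2 t2 PA PB \<mu>)
    have ag2: "agree {''d'',''j'',''b'',''w'',''z'',''rec''} {''pa'',''pb'',''rna'',''rnb''} s1 s2"
      by (rule agree_mono[OF rec(1)]) (auto simp: record_prog_def)
    have ps2: "pair_stored n R la lb s2" by (rule pair_stored_agree[OF ag2 _ _ ps1]) auto
    have m2: "matching_stored n {} m s2" by (rule matching_stored_agree[OF ag2 _ _ 1(4)]) auto
    have par: "arrays s2 ''par'' = arrays s1 ''par''" using ag2 by (simp add: agree_def)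
    define X where "X = {(u, b). u \<in> set la \<and> b \<in> set lb \<and> (arrays s1 ''par'' u \<noteq> 0 \<or> \<not> breached m (arrays s1 ''par'') b)}"
    show ?case
    proof (rule wp_conseq[OF wp_delete[OF ps2 m2]], elim conjE, goal_cases)
      case (1 s3 t3)
      have mat3: "matrix_stored n (cut R X) s3" using 1(3) unfolding X_def par .
      have ag3: "agree {''i'',''u'',''j'',''b''} {''subadj''} s2 s3"
        by (rule agree_mono[OF 1(1)]) (auto simp: delete_prog_def)
      note sym = is_graph_sym[OF gr]
      define Q where "Q = {b\<in>set lb. breached m (arrays s1 ''par'') b} \<union> {a\<in>set la. arrays s1 ''par'' a = 0}"
      have cl: "is_clique R (set la)" "is_clique R (set lb)" "set la \<inter> set lb = {}" using homog unfolding homog_def by auto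
      have Q: "is_clique R Q" "card Q + card (dom m) = card (set la) + card (set lb)"
        using maximum_clique[OF \<open>maximum _ _ _ _ _\<close> _ _ cl sym Q_def] by simp_all
      have lens: "length PA = length la" "length PB = length lb"
        using distinct_card[of PA] distinct_card[of PB] distinct_card[of la] distinct_card[of lb] rec pair_storedD(8,9)[OF ps] by metis+
      have cla: "card (set la) = length la" "card (set lb) = length lb"
        using pair_storedD(8,9)[OF ps] distinct_card by blast+
      \<comment> \<open>Each deleted pair has an end outside \<open>Q\<close>.\<close>
      have "is_clique (cut R X) Q"
        using Q(1) cl(3) unfolding is_clique_def cut_def X_def Q_def by auto
      moreover have "Q \<subseteq> set PA \<union> set PB" unfolding Q_def using rec by auto
      moreover have "card Q + \<mu> = length PA + length PB" using Q(2) cla lens rec by simp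
      moreover have "is_graph n (cut R X)" using gr unfolding is_graph_def cut_def by blast
      moreover have "\<exists>u v. R u v \<and> \<not> cut R X u v"
        using maximum_edge_outside[OF \<open>maximum _ _ _ _ _\<close> _ _ fl _ sym] mix unfolding cut_def X_def by blast
      moreover have "lb \<noteq> []" using fl unfolding flagged_def by auto
      moreover from this have "3 \<le> length la + length lb" using la2 by (cases lb) auto
      moreover have "\<exists>a\<in>set la. \<exists>b\<in>set lb. \<not> R a b"
        using mix \<open>lb \<noteq> []\<close> by (metis list.set_intros(1) neq_Nil_conv)
      ultimately have st: "reduction_step n R (cut R X) PA PB \<mu>"
        unfolding reduction_step_def using rec homog lens la2 by (auto simp: cut_def X_def)
      have "recorded n r PA PB s3"
        unfolding recorded_def using rec ag3 by (simp add: arr_def agree_def)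
      moreover have "recs_kept n r s s3"
        unfolding recs_kept_def using rec ag1 ag3 by (simp add: low_def agree_def)
      moreover have "vars s3 ''rec'' = Suc r" using rec ag3 by (simp add: agree_def)
      ultimately have "stepped n r R s (setv ''go'' 1 s3)"
        using st mat3 unfolding stepped_def by (auto simp: recs_kept_def low_def recorded_def matrix_stored_def)
      moreover have "length la * (6 * length lb + 5) \<le> B * (6 * B + 5)"
        using B by (intro mult_le_mono) simp_all
      ultimately show ?case
        using \<open>t1 \<le> _\<close> \<open>t2 \<le> _\<close> 1(2) B unfolding big_time_def by simp
    qed
  qed
qed

section \<open>Searching for a reducible pair\<close>

text \<open>The closure of the seed \<open>x\<close>, \<open>a\<close> exhibits no reducible pair.\<close>

definition clean :: "'b set \<Rightarrow> ('b \<Rightarrow> 'b \<Rightarrow> bool) \<Rightarrow> 'b \<Rightarrow> 'b \<Rightarrow> bool" where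
  "clean X R x a \<longleftrightarrow> (\<forall>A' B'. homog X R A' B' \<longrightarrow> insert x {v. twin R a v} \<subseteq> A' \<longrightarrow>
     (\<exists>A B. A \<subseteq> A' \<and> B \<subseteq> B' \<and> insert x {v. twin R a v} \<subseteq> A \<and> homog X R A B \<and> \<not> flagged R A B))"

lemma twin_clique:
  assumes gr: "is_graph n R" and "R x a"
  shows "is_clique R (insert x {v. twin R a v})"
proof -
  note sym = is_graph_sym[OF gr]
  have 1: "R u v" if "twin R a u" "twin R a v" "u \<noteq> v" for u v
    using that sym unfolding twin_def by metis
  have 2: "R x v" if "twin R a v" "x \<noteq> v" for v
    using that sym assms(2) is_graph_irrefl[OF gr] unfolding twin_def by metis
  show ?thesis unfolding is_clique_def using 1 2 sym by auto
qed

text \<open>The closure lies below every homogeneous pair that contains the seed, so it is itself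
  the unflagged pair that is asked for.\<close>

lemma cleanI:
  assumes "closure_inv n R (insert x {v. twin R a v}) ok L" "homog {..<n} R (set (L 0)) (set (L 1))"
    "\<not> flagged R (set (L 0)) (set (L 1))"
  shows "clean {..<n} R x a"
  unfolding clean_def
proof (intro allI impI)
  fix A' B' assume "homog {..<n} R A' B'" "insert x {v. twin R a v} \<subseteq> A'"
  then have "set (L 0) \<subseteq> A'" "set (L 1) \<subseteq> B'" using assms(1) unfolding closure_inv_def by blast+
  moreover have "insert x {v. twin R a v} \<subseteq> set (L 0)" using assms(1) unfolding closure_inv_def by (rule conjunct1)
  ultimately show "\<exists>A B. A \<subseteq> A' \<and> B \<subseteq> B' \<and> insert x {v. twin R a v} \<subseteq> A \<and> homog {..<n} R A B \<and> \<not> flagged R A B"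
    using assms(2,3) by (intro exI[of _ "set (L 0)"] exI[of _ "set (L 1)"] conjI)
qed

lemma sides_stored_if:
  assumes "sides_stored n L s"
  shows "sides_stored n (\<lambda>c. if c = 0 then L 0 else L 1) s"
proof -
  have eq: "(if c = 0 then L 0 else L 1) = L c" if "c < 2" for c :: nat
    using less_2_cases'[OF that] by auto
  show ?thesis using assms unfolding sides_stored_def by (simp add: eq del: if_split)
qed

definition seed_time :: "nat \<Rightarrow> nat \<Rightarrow> nat \<Rightarrow> nat" where
  "seed_time n M B = 3 * n + 32 * M + (14 * B + 60) * B + 80"

lemma recs_kept_trans: "recs_kept n r s s' \<Longrightarrow> recs_kept n r s' s'' \<Longrightarrow> recs_kept n r s s''"
  by (simp add: recs_kept_def low_def)

lemma stepped_trans: "recs_kept n r s s' \<Longrightarrow> stepped n r R s' s'' \<Longrightarrow> stepped n r R s s''"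
  unfolding stepped_def using recs_kept_trans by blast

lemma wp_seed:
  assumes gr: "is_graph n R" and matrix_stored: "matrix_stored n R s" and lists_stored: "lists_stored n R s"
    and xa: "vars s ''x'' = x" "vars s ''a'' = a" "R x a"
    and M: "M = (\<Sum>v<n. length (nbrs n R v))" and bnd: "clique_pair_bound n R B"
    and g: "vars s ''go'' = 0" and r: "vars s ''rec'' = r"
  shows "wp seed_prog s (\<lambda>s' t.
     vars s' ''go'' = 0 \<and> t \<le> seed_time n M B \<and> clean {..<n} R x a \<and> matrix_stored n R s' \<and> lists_stored n R s' \<and> vars s' ''rec'' = r \<and> recs_kept n r s s' \<or>
     vars s' ''go'' = 1 \<and> t \<le> seed_time n M B + big_time n B \<and> stepped n r R s s')"
  unfolding seed_prog_def wp_Seq[of twins_prog] wp_Seq[of closure_prog]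
proof (rule wp_conseq[OF wp_twins[OF gr matrix_stored lists_stored xa M]], elim exE conjE, goal_cases)
  case T: (1 s1 t1 L0)
  let ?A0 = "insert x {v. twin R a v}"
  have ag1: "agree {''i'',''v'',''p'',''tw'',''j'',''w''} {''used'',''len'',''q''} s s1"
    by (rule agree_mono[OF T(1)]) (auto simp: twins_prog_def push_def)
  have mat1: "matrix_stored n R s1" and adl1: "lists_stored n R s1"
    using matrix_stored_agree[OF ag1 _ _ matrix_stored] lists_stored_agree[OF ag1 _ _ lists_stored] by simp_all
  have inv: "closure_inv n R ?A0 True L0"
    unfolding closure_inv_def using T(3,4) twin_clique[OF gr xa(3)] by (simp add: is_clique_def)
  show ?case
  proof (rule wp_conseq[OF wp_closure[OF gr mat1 adl1 T(2) bnd M inv]], elim exE conjE, goal_cases)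
    case C: (1 s2 t2 L ok)
    have ag2: "agree {''p'',''v'',''i'',''w'',''ok'',''c'',''od'',''u'',''r''} {''q'',''len'',''used'',''hd''} s1 s2"
      by (rule agree_mono[OF C(1)]) (auto simp: closure_prog_def scan_def tryadd_def push_def)
    have mat2: "matrix_stored n R s2" and adl2: "lists_stored n R s2"
      using matrix_stored_agree[OF ag2 _ _ mat1] lists_stored_agree[OF ag2 _ _ adl1] by simp_all
    have st2: "vars s2 ''go'' = 0" "vars s2 ''rec'' = r" "recs_kept n r s s2"
      using ag1 ag2 g r by (simp_all add: agree_def recs_kept_def low_def)
    have len: "length (L 0) + length (L 1) \<le> B" by (rule closure_inv_length[OF bnd C(2,4)])
    have t12: "t1 + t2 \<le> 3 * n + 32 * M + (10 * B + 40) * B + 5 * B + 50"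
      using T(5) C(6) by linarith
    have mid: "(10 * B + 40) * B + 5 * B \<le> (14 * B + 60) * B" by (simp add: algebra_simps)
    show ?case
    proof (cases ok)
      case False
      \<comment> \<open>A failed closure means that no homogeneous pair contains the seed, so
        \<open>clean\<close> holds vacuously.\<close>
      then have "clean {..<n} R x a" using C(4) unfolding clean_def closure_inv_def by blast
      moreover have "t1 + (t2 + 2) \<le> seed_time n M B" using t12 mid unfolding seed_time_def by linarith
      ultimately show ?thesis using False C(3) mat2 adl2 st2 by simp
    next
      case True
      have homog: "homog {..<n} R (set (L 0)) (set (L 1))" using C(5) True by blast
      have B: "length (L 0) \<le> B" "length (L 1) \<le> B" using len by simp_all
      have w: "wp (test_prog ;; whenever (V ''fl'') pair_prog) s2
        (\<lambda>s' t. vars s' ''go'' = 0 \<and> t \<le> B * (4 * B + 11) + 11 \<and> clean {..<n} R x a \<and> matrix_stored n R s' \<and> lists_stored n R s' \<and> vars s' ''rec'' = r \<and> recs_kept n r s s' \<or>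
          vars s' ''go'' = 1 \<and> t \<le> B * (4 * B + 11) + 11 + big_time n B \<and> stepped n r R s s')"
        unfolding wp_Seq[of test_prog]
      proof (rule wp_conseq[OF wp_test[OF mat2 C(2) B]], elim conjE, goal_cases)
        case (1 s3 t3)
        have ag3: "agree {''fl'',''z'',''i'',''u'',''d'',''j''} {} s2 s3"
          by (rule agree_mono[OF 1(1)]) (auto simp: test_prog_def)
        have mat3: "matrix_stored n R s3" and adl3: "lists_stored n R s3" and cst3: "sides_stored n L s3"
          using matrix_stored_agree[OF ag3 _ _ mat2] lists_stored_agree[OF ag3 _ _ adl2] sides_stored_agree[OF ag3 _ _ _ C(2)] by simp_all
        have st3: "vars s3 ''go'' = 0" "vars s3 ''rec'' = r" "recs_kept n r s s3"
          using ag3 st2 by (simp_all add: agree_def recs_kept_def low_def)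
        show ?case
        proof (cases "flagged R (set (L 0)) (set (L 1))")
          case False
          then have "clean {..<n} R x a" by (rule cleanI[OF C(4) homog])
          then show ?thesis using False 1 mat3 adl3 st3 by simp
        next
          case fl: True
          have "sides_stored n (\<lambda>c. if c = 0 then L 0 else L 1) s3"
            by (rule sides_stored_if[OF cst3])
          then have ps3: "pair_stored n R (L 0) (L 1) s3" unfolding pair_stored_def using mat3 by simp
          \<comment> \<open>The seed contributes the two vertices \<open>x\<close> and
            \<open>a\<close>; with the nonempty second side the pair has at least three.\<close>
          have "card {x, a} \<le> card (set (L 0))"
            by (rule card_mono) (use C(4) in \<open>auto simp: closure_inv_def twin_def\<close>)
          then have l2: "2 \<le> length (L 0)" using is_graphD(3)[OF gr xa(3)] card_length[of "L 0"] by simp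
          have mix: "\<forall>b\<in>set (L 1). (\<exists>u\<in>set (L 0). R u b) \<and> (\<exists>u\<in>set (L 0). \<not> R u b)"
            using C(4) unfolding closure_inv_def by blast
          have w3: "wp pair_prog s3 (\<lambda>s' t. t \<le> big_time n B \<and>
              vars s' ''go'' = 1 \<and> stepped n r R s3 s')"
            by (rule wp_reduce_pair[OF gr ps3 B st3(2) homog mix l2 fl])
          show ?thesis
            unfolding wp_If val.simps 1(2) using fl
            by simp (rule wp_conseq[OF w3], use 1(3) stepped_trans[OF st3(3)] in auto)
        qed
      qed
      have "(10 * B + 40) * B + 5 * B + (B * (4 * B + 11)) \<le> (14 * B + 60) * B" by (simp add: algebra_simps)
      then have tt: "t1 + (t2 + (1 + (B * (4 * B + 11) + 11))) \<le> seed_time n M B"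
        using t12 unfolding seed_time_def by linarith
      show ?thesis
        unfolding wp_If val.simps C(3) using True
        apply (simp del: wp_Seq)
        apply (rule wp_conseq[OF w])
        using tt by auto
    qed
  qed
qed

definition pass_time :: "nat \<Rightarrow> nat \<Rightarrow> nat \<Rightarrow> nat" where
  "pass_time n M B = n * (5 * n + 12) + M * (seed_time n M B + 4) + big_time n B + 10"

text \<open>\<open>P\<close> states which seeds are already known to be clean. It is claimed only
  while \<open>go\<close> is 0, since a reduction changes the relation that it speaks about.\<close>

definition passed :: "nat \<Rightarrow> nat \<Rightarrow> (nat \<Rightarrow> nat \<Rightarrow> bool) \<Rightarrow> store \<Rightarrow> bool \<Rightarrow> store \<Rightarrow> bool" where
  "passed n r R s P s' \<longleftrightarrow> vars s' ''go'' = 0 \<and> P \<and> matrix_stored n R s' \<and> lists_stored n R s' \<and> vars s' ''rec'' = r \<and> recs_kept n r s s' \<or>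
     vars s' ''go'' = 1 \<and> stepped n r R s s'"

lemma passed_setv: "passed n r R s P s' \<Longrightarrow> x \<notin> {''go'', ''n'', ''rec''} \<Longrightarrow> passed n r R s P (setv x k s')"
  unfolding passed_def matrix_stored_def lists_stored_def stepped_def recs_kept_def low_def recorded_def arr_def by auto

lemma passed_mono: "passed n r R s P s' \<Longrightarrow> (P \<Longrightarrow> Q) \<Longrightarrow> passed n r R s Q s'"
  unfolding passed_def by blast

lemma wp_pass:
  assumes gr: "is_graph n R" and matrix_stored: "matrix_stored n R s" and M: "M = (\<Sum>v<n. length (nbrs n R v))"
    and bnd: "clique_pair_bound n R B" and r: "vars s ''rec'' = r"
  shows "wp pass_prog s (\<lambda>s' t. t \<le> pass_time n M B \<and> passed n r R s (\<forall>x a. R x a \<longrightarrow> clean {..<n} R x a) s')"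
proof -
  define S where "S = seed_time n M B + 4"
  \<comment> \<open>The matching is far too expensive to be charged to every seed. This term changes
    once, together with \<open>go\<close>, so that its cost enters a pass a single time.\<close>
  define big where "big s' = (if vars s' ''go'' = 0 then 0 else big_time n B)" for s' :: store
  define body where "body = whenever (V ''go'' \<doteq> N 0) (''a'' \<longleftarrow> cell ''lst'' (V ''x'') (V ''y'') ;; seed_prog)"
  have mods: "''x'' \<notin> modv body" "''y'' \<notin> modv body" "''n'' \<notin> modv body" "''deg'' \<notin> moda body"
    by (simp_all add: body_def prog_defs)
  have one: "wp body s' (\<lambda>s'' t. passed n r R s (P \<and> clean {..<n} R x a) s'' \<and> 2 + t + big s' \<le> S + big s'')"
    if I: "passed n r R s P s'" and x: "vars s' ''x'' = x" "x < n" "vars s' ''y'' = y" "y < length (nbrs n R x)" "a = nbrs n R x ! y"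
    for s' P x y a
  proof (cases "vars s' ''go'' = 0")
    case False
    then show ?thesis using I by (auto simp: body_def passed_def S_def)
  next
    case True
    have J: "P" "matrix_stored n R s'" "lists_stored n R s'" "vars s' ''rec'' = r" "recs_kept n r s s'"
      using I True unfolding passed_def by simp_all
    let ?s1 = "setv ''a'' a s'"
    have lst: "val s' (cell ''lst'' (V ''x'') (V ''y'')) = a"
      using lists_storedD(2)[OF J(3) x(2,4)] matrix_storedD(1)[OF J(2)] x by simp
    have R: "R x a" using nbrs_nth[OF gr x(4)] x(5) by simp
    have w: "wp seed_prog ?s1 (\<lambda>s' t.
     vars s' ''go'' = 0 \<and> t \<le> seed_time n M B \<and> clean {..<n} R x a \<and> matrix_stored n R s' \<and> lists_stored n R s' \<and> vars s' ''rec'' = r \<and> recs_kept n r ?s1 s' \<or>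
     vars s' ''go'' = 1 \<and> t \<le> seed_time n M B + big_time n B \<and> stepped n r R ?s1 s')"
      by (rule wp_seed[OF gr _ _ _ _ R M bnd]) (use J True x in \<open>simp_all add: matrix_stored_def lists_stored_def\<close>)
    have k1: "recs_kept n r s ?s1" using J(5) by (simp add: recs_kept_def low_def)
    show ?thesis
      unfolding body_def wp_If val.simps True wp_Seq wp_Assign lst[unfolded val.simps]
      apply simp
      apply (rule wp_conseq[OF w])
      using J(1) True recs_kept_trans[OF k1] stepped_trans[OF k1]
      unfolding passed_def big_def S_def by auto
  qed
  have row: "wp (For ''y'' (Read ''deg'' (V ''x'')) body) s' (\<lambda>s'' t. passed n r R s (P \<and> (\<forall>a. R x a \<longrightarrow> clean {..<n} R x a)) s'' \<and>
       t + big s' \<le> length (nbrs n R x) * S + 2 + big s'')"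
    if I: "passed n r R s P s'" and x: "vars s' ''x'' = x" "x < n" and deg: "arrays s' ''deg'' x = length (nbrs n R x)" for s' P x
  proof (rule wp_For[where N = "length (nbrs n R x)" and I = "\<lambda>k s'' \<tau>. passed n r R s (P \<and> (\<forall>p<k. clean {..<n} R x (nbrs n R x ! p))) s'' \<and>
        \<tau> + big s' \<le> k * S + big s''"], goal_cases)
    case (2 s'')
    then show ?case using mods deg x by (simp add: agree_def)
  next
    case 3
    show ?case using passed_setv[OF I, of "''y''" 0] by (simp add: big_def)
  next
    case (4 k s'' \<tau>)
    have "vars s'' ''x'' = x" using 4(4) mods x by (simp add: agree_def)
    from one[OF conjunct1[OF 4(2)] this x(2) 4(3,1) refl] show ?case
    proof (rule wp_conseq, goal_cases)
      case (1 s3 t)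
      have "passed n r R s (P \<and> (\<forall>p<Suc k. clean {..<n} R x (nbrs n R x ! p))) s3"
        by (rule passed_mono[OF conjunct1[OF 1(2)]]) (auto simp: less_Suc_eq)
      from passed_setv[OF this, of "''y''" "Suc k"] show ?case
        using 1(2) 4(2) by (simp add: big_def)
    qed
  next
    case (5 s'' \<tau>)
    have "passed n r R s (P \<and> (\<forall>a. R x a \<longrightarrow> clean {..<n} R x a)) s''"
    proof (rule passed_mono[OF conjunct1[OF 5(1)]])
      assume *: "P \<and> (\<forall>p<length (nbrs n R x). clean {..<n} R x (nbrs n R x ! p))"
      then have "\<forall>a\<in>set (nbrs n R x). clean {..<n} R x a" by (simp add: all_set_conv_all_nth)
      then show "P \<and> (\<forall>a. R x a \<longrightarrow> clean {..<n} R x a)" using * set_nbrs[OF gr] by auto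
    qed
    then show ?case using 5 by simp
  qed (rule mods)
  have main: "wp (For ''x'' (V ''n'') (For ''y'' (Read ''deg'' (V ''x'')) body)) s1
     (\<lambda>s' t. t \<le> 6 * n + M * S + big_time n B + 2 \<and> passed n r R s (\<forall>x a. R x a \<longrightarrow> clean {..<n} R x a) s')"
    if s1: "matrix_stored n R s1" "lists_stored n R s1" "vars s1 ''rec'' = r" "recs_kept n r s s1" "vars s1 ''go'' = 0" for s1
  proof (rule wp_For[where N = n and I = "\<lambda>k s'' \<tau>. passed n r R s (\<forall>x<k. \<forall>a. R x a \<longrightarrow> clean {..<n} R x a) s'' \<and>
        \<tau> \<le> 6 * k + (\<Sum>i<k. length (nbrs n R i) * S) + big s''"], goal_cases)
    case (2 s'')
    then show ?case using mods matrix_storedD(1)[OF s1(1)] by (simp add: agree_def)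
  next
    case 3
    show ?case by (rule conjI, rule passed_setv) (use s1 in \<open>simp_all add: passed_def\<close>)
  next
    case (4 k s'' \<tau>)
    have "arrays s'' ''deg'' = arrays s1 ''deg''" using 4(4) mods by (simp add: agree_def)
    then have deg: "arrays s'' ''deg'' k = length (nbrs n R k)" using lists_storedD(1)[OF s1(2) 4(1)] by simp
    show ?case
    proof (rule wp_conseq[OF row[OF conjunct1[OF 4(2)] 4(3,1) deg]], goal_cases)
      case (1 s3 t)
      have "passed n r R s (\<forall>x<Suc k. \<forall>a. R x a \<longrightarrow> clean {..<n} R x a) s3"
        by (rule passed_mono[OF conjunct1[OF 1(2)]]) (auto simp: less_Suc_eq)
      from passed_setv[OF this, of "''x''" "Suc k"] show ?case
        using 1(2) 4(2) by (simp add: big_def)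
    qed
  next
    case (5 s'' \<tau>)
    have "passed n r R s (\<forall>x a. R x a \<longrightarrow> clean {..<n} R x a) s''"
      by (rule passed_mono[OF conjunct1[OF 5(1)]]) (use is_graphD(1)[OF gr] in blast)
    moreover have "(\<Sum>i<n. length (nbrs n R i) * S) = M * S" unfolding M by (simp add: sum_distrib_right)
    ultimately show ?case using 5 by (simp add: big_def split: if_splits)
  qed (simp add: mods)
  have mat0: "matrix_stored n R (setv ''go'' 0 s)" using matrix_stored by (simp add: matrix_stored_def)
  show ?thesis
    unfolding pass_prog_def body_def[symmetric] wp_Seq wp_Assign val.simps
  proof (rule wp_conseq[OF wp_lists[OF mat0]], goal_cases)
    case (1 s1 t1)
    have ag: "agree {''go'',''i'',''d'',''j''} {''lst'',''deg''} s s1"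
      by (rule agree_trans[of _ _ _ "setv ''go'' 0 s"], simp add: agree_def, rule agree_mono[OF 1(1)]) (auto simp: lists_prog_def)
    have g1: "vars s1 ''go'' = 0" using 1(1) by (simp add: agree_def lists_prog_def)
    show ?case
      by (rule wp_conseq[OF main[of s1]])
        (use 1 g1 matrix_stored_agree[OF ag _ _ matrix_stored] ag r in \<open>auto simp: pass_time_def S_def agree_def recs_kept_def low_def algebra_simps\<close>)
  qed
qed

text \<open>The intermediate relations exist in the proof only; the memory holds the last one and
  the recorded lists of every reduction.\<close>

definition chain :: "nat \<Rightarrow> (nat \<Rightarrow> nat \<Rightarrow> nat \<Rightarrow> bool) \<Rightarrow> nat \<Rightarrow> store \<Rightarrow> bool" where
  "chain n Rs r s \<longleftrightarrow> vars s ''n'' = n \<and> vars s ''rec'' = r \<and>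
     (\<forall>i<r. \<exists>PA PB \<mu>. reduction_step n (Rs i) (Rs (Suc i)) PA PB \<mu> \<and> recorded n i PA PB s)"

lemma recorded_kept:
  assumes "recorded n i PA PB s" "recs_kept n r s s'" "i < r" "length PA \<le> n" "length PB \<le> n"
  shows "recorded n i PA PB s'"
proof -
  have "i * n + p < r * n" if "p < n" for p
  proof -
    have "i * n + p < Suc i * n" using that by simp
    also have "\<dots> \<le> r * n" using assms(3) by (intro mult_le_mono1) simp
    finally show ?thesis .
  qed
  then show ?thesis using assms unfolding recorded_def recs_kept_def low_def arr_def by simp
qed

lemma reduction_step_length:
  assumes "reduction_step n R R' PA PB \<mu>"
  shows "length PA \<le> n" "length PB \<le> n"
  using assms length_le_bound unfolding reduction_step_def homog_def by blast+

lemma sum_degrees: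
  assumes "is_graph n R"
  shows "(\<Sum>v<n. length (nbrs n R v)) = card {(u, v). R u v}"
proof -
  have "{(u, v). R u v} = (SIGMA v:{..<n}. {j. R v j})" using is_graphD[OF assms] by auto
  moreover have "finite {j. R v j}" for v
    using finite_subset[of "{j. R v j}" "{..<n}"] is_graphD[OF assms] by auto
  ultimately show ?thesis by (simp add: length_nbrs[OF assms] card_SigmaI)
qed

lemma finite_edges: "is_graph n R \<Longrightarrow> finite {(u, v). R u v}"
  by (rule finite_subset[of _ "{..<n} \<times> {..<n}"]) (auto simp: is_graph_def)

lemma clique_pair_bound_mono:
  assumes "clique_pair_bound n R B" "\<And>u v. R' u v \<Longrightarrow> R u v"
  shows "clique_pair_bound n R' B"
proof -
  have "is_clique R K" if "is_clique R' K" for K using that assms(2) unfolding is_clique_def by blast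
  then show ?thesis using assms(1) unfolding clique_pair_bound_def by blast
qed

lemma pass_time_mono: "M \<le> M' \<Longrightarrow> pass_time n M B \<le> pass_time n M' B"
  unfolding pass_time_def seed_time_def by (intro add_mono mult_le_mono) simp_all

lemma wp_reduce:
  assumes gr: "is_graph n R0" and n: "vars s ''n'' = n"
    and adj: "\<And>i j. i < n \<Longrightarrow> j < n \<Longrightarrow> arrays s ''adj'' (i * n + j) = of_bool (R0 i j)"
    and bnd: "clique_pair_bound n R0 B" and M: "M = card {(u, v). R0 u v}"
  shows "wp reduce_prog s (\<lambda>s' t. t \<le> (M + 1) * (pass_time n M B + 1) + n * (3 * n + 5) + 10 \<and>
    (\<exists>Rs r. Rs 0 = R0 \<and> chain n Rs r s' \<and> matrix_stored n (Rs r) s' \<and> is_graph n (Rs r) \<and> r \<le> M \<and>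
      (\<forall>x a. Rs r x a \<longrightarrow> clean {..<n} (Rs r) x a) \<and> (\<forall>i<n. arrays s' ''subverts'' i = 1)))"
proof -
  define T where "T = pass_time n M B"
  define Em where "Em s = card {(i, j). i < n \<and> j < n \<and> arrays s ''subadj'' (i * n + j) \<noteq> 0}" for s :: store
  have Em: "Em s' = card {(u, v). R u v}" if "matrix_stored n R s'" "is_graph n R" for R s'
  proof -
    have "(i < n \<and> j < n \<and> arrays s' ''subadj'' (i * n + j) \<noteq> 0) = R i j" for i j
    proof (cases "i < n \<and> j < n")
      case True
      then show ?thesis using matrix_storedD(2)[OF that(1), of i j] by simp
    next
      case False
      then show ?thesis using is_graphD(1,2)[OF that(2)] by blast
    qed
    then show ?thesis unfolding Em_def by simp
  qed
  define J where "J s' \<longleftrightarrow> (\<exists>Rs r. Rs 0 = R0 \<and> chain n Rs r s' \<and> matrix_stored n (Rs r) s' \<and> is_graph n (Rs r) \<and>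
      (\<forall>u v. Rs r u v \<longrightarrow> R0 u v) \<and> r + card {(u, v). Rs r u v} \<le> M \<and>
      (vars s' ''go'' = 1 \<or> vars s' ''go'' = 0 \<and> (\<forall>x a. Rs r x a \<longrightarrow> clean {..<n} (Rs r) x a)) \<and>
      (\<forall>i<n. arrays s' ''subverts'' i = 1))" for s' :: store
  \<comment> \<open>A pass either deletes an edge or clears \<open>go\<close>. \<open>Em\<close>
    reads the number of ordered edges off the memory.\<close>
  define \<Phi> where "\<Phi> s' = (Em s' + vars s' ''go'') * (T + 1)" for s' :: store
  have sv: "''subverts'' \<notin> moda pass_prog" by (simp add: prog_defs)
  have loop: "wp (While (V ''go'') pass_prog) s1 (\<lambda>s' t. t \<le> (M + 1) * (T + 1) + 1 \<and> J s' \<and> vars s' ''go'' = 0)"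
    if J1: "J s1" and g1: "vars s1 ''go'' = 1" and E1: "Em s1 \<le> M" for s1
  proof (rule wp_While[where I = J and \<Phi> = \<Phi>], goal_cases)
    case (2 s2)
    obtain Rs r where I: "Rs 0 = R0" "chain n Rs r s2" "matrix_stored n (Rs r) s2" "is_graph n (Rs r)"
      "\<forall>u v. Rs r u v \<longrightarrow> R0 u v" "r + card {(u, v). Rs r u v} \<le> M" "vars s2 ''go'' = 1" "\<forall>i<n. arrays s2 ''subverts'' i = 1"
      using 2(1,2) unfolding J_def by auto
    define R where "R = Rs r"
    have bR: "clique_pair_bound n R B"
      by (rule clique_pair_bound_mono[OF bnd]) (use I(5) in \<open>simp add: R_def\<close>)
    have r2: "vars s2 ''rec'' = r" using I(2) unfolding chain_def by blast
    have TT: "pass_time n (\<Sum>v<n. length (nbrs n R v)) B \<le> T"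
      unfolding T_def by (rule pass_time_mono) (use sum_degrees[OF I(4)] I(6) in \<open>simp add: R_def\<close>)
    have E2: "Em s2 = card {(u, v). R u v}" using Em[OF I(3,4)] by (simp add: R_def)
    show ?case
    proof (rule wp_conseq[OF wp_pass[OF I(4)[folded R_def] I(3)[folded R_def] refl bR r2]], goal_cases)
      case (1 s3 t)
      have sv3: "\<forall>i<n. arrays s3 ''subverts'' i = 1" using 1(1) I(8) sv by (simp add: agree_def)
      have t: "t \<le> T" using 1(2) TT by simp
      have n3: "vars s3 ''n'' = n" if "matrix_stored n R' s3" for R' using that matrix_storedD(1) by blast
      have keep: "\<exists>PA PB \<mu>. reduction_step n (Rs i) (Rs (Suc i)) PA PB \<mu> \<and> recorded n i PA PB s3"
        if "i < r" "recs_kept n r s2 s3" for i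
      proof -
        obtain PA PB \<mu> where *: "reduction_step n (Rs i) (Rs (Suc i)) PA PB \<mu>" "recorded n i PA PB s2"
          using I(2) \<open>i < r\<close> unfolding chain_def by blast
        have "recorded n i PA PB s3" by (rule recorded_kept[OF *(2) that(2,1) reduction_step_length[OF *(1)]])
        then show ?thesis using *(1) by blast
      qed
      from conjunct2[OF 1(2), unfolded passed_def] show ?case
      proof (elim disjE conjE)
        assume a: "vars s3 ''go'' = 0" "\<forall>x a. R x a \<longrightarrow> clean {..<n} R x a" "matrix_stored n R s3" "vars s3 ''rec'' = r" "recs_kept n r s2 s3"
        have "chain n Rs r s3" unfolding chain_def using keep a n3 by blast
        then have "J s3" unfolding J_def using I(1,4,5,6) a sv3 unfolding R_def by blast
        moreover have "1 + t + \<Phi> s3 \<le> \<Phi> s2"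
          unfolding \<Phi>_def E2 Em[OF a(3) I(4)[folded R_def]] a(1) I(7) using t by (simp add: algebra_simps)
        ultimately show ?thesis by blast
      next
        assume a: "vars s3 ''go'' = 1" "stepped n r R s2 s3"
        obtain PA PB \<mu> R' where b: "reduction_step n R R' PA PB \<mu>" "recorded n r PA PB s3" "matrix_stored n R' s3" "vars s3 ''rec'' = Suc r" "recs_kept n r s2 s3"
          using a(2) unfolding stepped_def by blast
        define Rs' where "Rs' = Rs(Suc r := R')"
        have gr': "is_graph n R'" "\<forall>u v. R' u v \<longrightarrow> R u v" "\<exists>u v. R u v \<and> \<not> R' u v" using b(1) unfolding reduction_step_def by blast+
        have less: "card {(u, v). R' u v} < card {(u, v). R u v}"
          by (rule psubset_card_mono) (use gr' finite_edges[OF I(4)] in \<open>auto simp: R_def\<close>)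
        have "\<exists>PA PB \<mu>. reduction_step n (Rs' i) (Rs' (Suc i)) PA PB \<mu> \<and> recorded n i PA PB s3" if "i < Suc r" for i
        proof (cases "i = r")
          case True
          then show ?thesis using b(1,2) unfolding Rs'_def R_def by auto
        next
          case False
          then show ?thesis using keep[OF _ b(5), of i] that unfolding Rs'_def by simp
        qed
        then have "chain n Rs' (Suc r) s3" unfolding chain_def using b(4) n3[OF b(3)] by blast
        moreover have "Rs' 0 = R0" "Rs' (Suc r) = R'" using I(1) unfolding Rs'_def by simp_all
        moreover have "\<forall>u v. R' u v \<longrightarrow> R0 u v" using gr'(2) I(5) unfolding R_def by blast
        moreover have "Suc r + card {(u, v). R' u v} \<le> M" using less I(6) unfolding R_def by linarith
        ultimately have "J s3" unfolding J_def using b(3) gr'(1) a(1) sv3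
          by (intro exI[of _ Rs'] exI[of _ "Suc r"]) simp
        moreover have "1 + t + \<Phi> s3 \<le> \<Phi> s2"
        proof -
          have "\<Phi> s3 \<le> card {(u, v). R u v} * (T + 1)"
            unfolding \<Phi>_def Em[OF b(3) gr'(1)] a(1) using less by (intro mult_le_mono1) simp
          then show ?thesis unfolding \<Phi>_def E2 I(7) using t by (simp add: algebra_simps)
        qed
        ultimately show ?thesis by blast
      qed
    qed
  next
    case (3 s2 t)
    have "\<Phi> s1 \<le> (M + 1) * (T + 1)" unfolding \<Phi>_def g1 using E1 by (intro mult_le_mono1) simp
    then show ?case using 3 by simp
  qed (rule J1)
  show ?thesis
    unfolding reduce_prog_def wp_Seq wp_Assign val.simps
  proof (rule wp_conseq[OF wp_copy[OF n adj]], goal_cases)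
    case (3 s1 t1)
    let ?s2 = "setv ''go'' 1 (setv ''rec'' 0 s1)"
    have m2: "matrix_stored n R0 ?s2" using 3(2) by (simp add: matrix_stored_def)
    have J2: "J ?s2" unfolding J_def
      by (rule exI[of _ "\<lambda>_. R0"], rule exI[of _ 0]) (use 3 m2 gr M matrix_storedD(1)[OF m2] in \<open>simp add: chain_def\<close>)
    have E2: "Em ?s2 \<le> M" using Em[OF m2 gr] M by simp
    show ?case
    proof (rule wp_conseq[OF loop[OF J2 _ E2]], goal_cases)
      case (2 s3 t3)
      obtain Rs r where "Rs 0 = R0" "chain n Rs r s3" "matrix_stored n (Rs r) s3" "is_graph n (Rs r)"
        "r + card {(u, v). Rs r u v} \<le> M" "\<forall>x a. Rs r x a \<longrightarrow> clean {..<n} (Rs r) x a" "\<forall>i<n. arrays s3 ''subverts'' i = 1"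
        using 2(2) unfolding J_def by auto
      moreover from this have "r \<le> M" by simp
      moreover have "t1 + (1 + (1 + t3)) \<le> (M + 1) * (pass_time n M B + 1) + n * (3 * n + 5) + 10"
        using 2(2) 3(2) unfolding T_def by simp
      ultimately show ?case by blast
    qed simp
  qed
qed

section \<open>Extending colourings back through the recorded reductions\<close>

section \<open>Extending a colouring over one reduction\<close>

text \<open>\<open>colA\<close> and \<open>colB\<close> begin with one and the same list of shared
  colours, in the order of \<open>PA\<close>. A colour common to both sides therefore occurs at
  equal positions, and the first \<open>\<mu>\<close> positions hold nonadjacent pairs.\<close>

definition colA :: "('b \<Rightarrow> nat) \<Rightarrow> 'b list \<Rightarrow> 'b list \<Rightarrow> nat list" where
  "colA f PA PB = map f (filter (\<lambda>u. f u \<in> f ` set PB) PA) @ map f (filter (\<lambda>u. f u \<notin> f ` set PB) PA)"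

definition colB :: "('b \<Rightarrow> nat) \<Rightarrow> 'b list \<Rightarrow> 'b list \<Rightarrow> nat list" where
  "colB f PA PB = map f (filter (\<lambda>u. f u \<in> f ` set PB) PA) @ map f (filter (\<lambda>u. f u \<notin> f ` set PA) PB)"

definition recoloured :: "('b \<Rightarrow> nat) \<Rightarrow> 'b list \<Rightarrow> 'b list \<Rightarrow> ('b \<Rightarrow> nat) \<Rightarrow> bool" where
  "recoloured f PA PB f' \<longleftrightarrow> (\<forall>i<length PA. f' (PA ! i) = colA f PA PB ! i) \<and>
     (\<forall>i<length PB. f' (PB ! i) = colB f PA PB ! i) \<and> (\<forall>v. v \<notin> set PA \<union> set PB \<longrightarrow> f' v = f v)"

definition proper :: "nat \<Rightarrow> (nat \<Rightarrow> nat \<Rightarrow> bool) \<Rightarrow> nat \<Rightarrow> (nat \<Rightarrow> nat) \<Rightarrow> bool" where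
  "proper n R k f \<longleftrightarrow> (\<forall>i<n. f i < k) \<and> (\<forall>i j. R i j \<longrightarrow> f i \<noteq> f j)"

lemma length_colA: "length (colA f PA PB) = length PA"
  unfolding colA_def using sum_length_filter_compl[of "\<lambda>u. f u \<in> f ` set PB" PA] by simp

text \<open>As the size of an intersection the count is symmetric in the two sides. This is why
  \<open>colB\<close>, whose shared part is taken from \<open>PA\<close>, still has the length of
  \<open>PB\<close>.\<close>

lemma shared_card:
  assumes "distinct PA" "inj_on f (set PA)"
  shows "length (filter (\<lambda>u. f u \<in> f ` S) PA) = card (f ` set PA \<inter> f ` S)"
proof -
  have "length (filter (\<lambda>u. f u \<in> f ` S) PA) = card {u \<in> set PA. f u \<in> f ` S}"
    using assms(1) distinct_card[of "filter (\<lambda>u. f u \<in> f ` S) PA"] by simp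
  also have "\<dots> = card (f ` {u \<in> set PA. f u \<in> f ` S})"
    by (rule card_image[symmetric]) (rule inj_on_subset[OF assms(2)], auto)
  also have "f ` {u \<in> set PA. f u \<in> f ` S} = f ` set PA \<inter> f ` S" by auto
  finally show ?thesis .
qed

lemma length_colB:
  assumes "distinct PA" "inj_on f (set PA)" "distinct PB" "inj_on f (set PB)"
  shows "length (colB f PA PB) = length PB"
  unfolding colB_def
  using sum_length_filter_compl[of "\<lambda>u. f u \<in> f ` set PA" PB] shared_card[OF assms(1,2), of "set PB"]
    shared_card[OF assms(3,4), of "set PA"] by (simp add: Int_commute)

text \<open>Only edges between the sides are deleted, so both sides remain cliques of
  \<open>R'\<close>.\<close>

lemma proper_inj:
  assumes "is_graph n R" and st: "reduction_step n R R' PA PB \<mu>" and pf: "proper n R' k f"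
  shows "inj_on f (set PA)" "inj_on f (set PB)"
proof -
  have h: "set PA \<inter> set PB = {}" "is_clique R (set PA)" "is_clique R (set PB)"
    using st unfolding reduction_step_def homog_def by auto
  have cross: "u \<in> set PA \<and> v \<in> set PB \<or> u \<in> set PB \<and> v \<in> set PA" if "R u v" "\<not> R' u v" for u v
    using st that unfolding reduction_step_def by blast
  have injR: "inj_on f K" if "is_clique R' K" for K
    using that pf unfolding is_clique_def inj_on_def proper_def by blast
  show "inj_on f (set PA)"
    by (rule injR) (use h(1,2) cross in \<open>unfold is_clique_def, blast\<close>)
  show "inj_on f (set PB)"
    by (rule injR) (use h(1,3) cross in \<open>unfold is_clique_def, blast\<close>)
qed

lemma proper_recolour:
  assumes gr: "is_graph n R" and st: "reduction_step n R R' PA PB \<mu>" and pf: "proper n R' k f" and rc: "recoloured f PA PB f'"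
  shows "proper n R k f'"
proof -
  let ?A = "set PA" and ?B = "set PB"
  let ?CA = "colA f PA PB" and ?CB = "colB f PA PB"
  let ?SH = "map f (filter (\<lambda>u. f u \<in> f ` ?B) PA)"
  note sym = is_graph_sym[OF gr]
  have h: "?A \<subseteq> {..<n}" "?B \<subseteq> {..<n}" "?A \<inter> ?B = {}" "is_clique R ?A" "is_clique R ?B"
     "\<And>v. v < n \<Longrightarrow> v \<notin> ?A \<union> ?B \<Longrightarrow> uniform_to R v ?A \<and> uniform_to R v ?B"
    using st unfolding reduction_step_def homog_def by auto
  have d: "distinct PA" "distinct PB" "\<mu> \<le> length PA" "\<mu> \<le> length PB" "\<And>i. i < \<mu> \<Longrightarrow> \<not> R (PB ! i) (PA ! i)"
    using st unfolding reduction_step_def by blast+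
  have cross: "u \<in> ?A \<and> v \<in> ?B \<or> u \<in> ?B \<and> v \<in> ?A" if "R u v" "\<not> R' u v" for u v
    using st that unfolding reduction_step_def by blast
  have f: "f i \<noteq> f j" if "R' i j" for i j using pf that unfolding proper_def by blast
  have fk: "f i < k" if "i < n" for i using pf that unfolding proper_def by blast
  have injR: "inj_on f K" if "is_clique R' K" for K
    using that f unfolding is_clique_def inj_on_def by blast
  have inA: "inj_on f ?A" and inB: "inj_on f ?B" using proper_inj[OF gr st pf] .
  obtain Q where Q: "Q \<subseteq> ?A \<union> ?B" "is_clique R' Q" "card Q + \<mu> = length PA + length PB"
    using st unfolding reduction_step_def by blast
  have q: "length ?SH \<le> \<mu>"
  proof -
    have "card Q = card (f ` Q)" using injR[OF Q(2)] by (simp add: card_image)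
    also have "\<dots> \<le> card (f ` ?A \<union> f ` ?B)" using Q(1) by (intro card_mono) auto
    finally have "card Q + card (f ` ?A \<inter> f ` ?B) \<le> card (f ` ?A) + card (f ` ?B)"
      using card_Un_Int[of "f ` ?A" "f ` ?B"] by simp
    then show ?thesis
      using Q(3) inA inB d shared_card[OF d(1) inA, of ?B] by (simp add: card_image distinct_card)
  qed
  have lA: "length ?CA = length PA" by (rule length_colA)
  have lB: "length ?CB = length PB" by (rule length_colB[OF d(1) inA d(2) inB])
  have setA: "set ?CA \<subseteq> f ` ?A" unfolding colA_def by auto
  have setB: "set ?CB \<subseteq> f ` ?B" unfolding colB_def by auto
  have disA: "distinct ?CA" unfolding colA_def using d(1) inA
    by (auto simp: distinct_map intro: inj_on_subset) (metis imageI)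
  have disB: "distinct ?CB" unfolding colB_def using d(1,2) inA inB
    by (auto simp: distinct_map intro: inj_on_subset) (metis imageI)
  have f'A: "\<exists>i<length PA. u = PA ! i \<and> f' u = ?CA ! i" if "u \<in> ?A" for u
    using that rc unfolding recoloured_def in_set_conv_nth by blast
  have f'B: "\<exists>i<length PB. u = PB ! i \<and> f' u = ?CB ! i" if "u \<in> ?B" for u
    using that rc unfolding recoloured_def in_set_conv_nth by blast
  have f'mA: "f' u \<in> f ` ?A" if "u \<in> ?A" for u
    using f'A[OF that] setA nth_mem lA by (metis subsetD)
  have f'mB: "f' u \<in> f ` ?B" if "u \<in> ?B" for u
    using f'B[OF that] setB nth_mem lB by (metis subsetD)
  have f'o: "f' v = f v" if "v \<notin> ?A \<union> ?B" for v using rc that unfolding recoloured_def by blast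
  have AA: "f' u \<noteq> f' v" if "u \<in> ?A" "v \<in> ?A" "u \<noteq> v" for u v
    using f'A[OF that(1)] f'A[OF that(2)] that(3) disA lA nth_eq_iff_index_eq by metis
  have BB: "f' u \<noteq> f' v" if "u \<in> ?B" "v \<in> ?B" "u \<noteq> v" for u v
    using f'B[OF that(1)] f'B[OF that(2)] that(3) disB lB nth_eq_iff_index_eq by metis
  have AB: "f' u \<noteq> f' v" if uv: "u \<in> ?A" "v \<in> ?B" "R u v" for u v
  proof
    assume eq: "f' u = f' v"
    obtain i where i: "i < length PA" "u = PA ! i" "f' u = ?CA ! i" using f'A[OF uv(1)] by blast
    obtain j where j: "j < length PB" "v = PB ! j" "f' v = ?CB ! j" using f'B[OF uv(2)] by blast
    \<comment> \<open>Beyond the shared prefix \<open>colA\<close> holds only colours that do not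
      occur on \<open>PB\<close>, and symmetrically for \<open>colB\<close>; so a common colour sits
      in the prefix of both lists.\<close>
    have "i < length ?SH"
    proof (rule ccontr)
      assume ni: "\<not> i < length ?SH"
      then have "?CA ! i = map f (filter (\<lambda>u. f u \<notin> f ` ?B) PA) ! (i - length ?SH)"
        unfolding colA_def by (rule nth_append[THEN trans, OF if_not_P])
      moreover have "i - length ?SH < length (map f (filter (\<lambda>u. f u \<notin> f ` ?B) PA))"
        using ni i(1) lA unfolding colA_def by simp
      ultimately have "?CA ! i \<in> set (map f (filter (\<lambda>u. f u \<notin> f ` ?B) PA))" by (metis nth_mem)
      then have "?CA ! i \<notin> f ` ?B" by auto (metis imageI)
      then show False using eq i(3) f'mB[OF uv(2)] by simp
    qed
    moreover have "j < length ?SH"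
    proof (rule ccontr)
      assume nj: "\<not> j < length ?SH"
      then have "?CB ! j = map f (filter (\<lambda>u. f u \<notin> f ` ?A) PB) ! (j - length ?SH)"
        unfolding colB_def by (rule nth_append[THEN trans, OF if_not_P])
      moreover have "j - length ?SH < length (map f (filter (\<lambda>u. f u \<notin> f ` ?A) PB))"
        using nj j(1) lB unfolding colB_def by simp
      ultimately have "?CB ! j \<in> set (map f (filter (\<lambda>u. f u \<notin> f ` ?A) PB))" by (metis nth_mem)
      then have "?CB ! j \<notin> f ` ?A" by auto (metis imageI)
      then show False using eq j(3) f'mA[OF uv(1)] by simp
    qed
    ultimately have "?CA ! j = ?CB ! j" "i < length ?SH" "j < length ?SH"
      unfolding colA_def colB_def by (simp_all only: nth_append if_P)
    then have "?CA ! i = ?CA ! j" using eq i j by simp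
    moreover have "j < length PA" using \<open>j < length ?SH\<close> q d(3) by linarith
    ultimately have "i = j" using disA i(1) lA nth_eq_iff_index_eq by metis
    moreover have "i < \<mu>" using \<open>i < length ?SH\<close> q by linarith
    ultimately show False using d(5) uv(3) i j sym by metis
  qed
  have out: "f' u \<noteq> f' v" if "u \<in> ?A \<union> ?B" "v \<notin> ?A \<union> ?B" "R u v" for u v
  proof -
    have vn: "v < n" using is_graphD[OF gr that(3)] by simp
    \<comment> \<open>An outside vertex with one neighbour in \<open>K\<close> is adjacent to all of
      \<open>K\<close>, and these edges are not deleted. Its colour is thus missing from the entire
      colour set of \<open>K\<close>, which recolouring only permutes.\<close>
    have "f v \<notin> f ` K" if K: "u \<in> K" "K = ?A \<or> K = ?B" for K
    proof
      assume "f v \<in> f ` K"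
      then obtain w where w: "w \<in> K" "f v = f w" by blast
      have "uniform_to R v K" using h(6)[OF vn \<open>v \<notin> _\<close>] K(2) by blast
      then have "R v w" using K(1) w(1) \<open>R u v\<close> sym unfolding uniform_to_def by blast
      then have "R' v w" using cross \<open>v \<notin> _\<close> by blast
      then show False using f w(2) by blast
    qed
    then show ?thesis using f'mA f'mB f'o that by (metis UnE)
  qed
  show "proper n R k f'"
    unfolding proper_def
  proof (intro conjI allI impI)
    fix i assume i: "i < n"
    show "f' i < k"
    proof (cases "i \<in> ?A \<union> ?B")
      case True
      then have "f' i \<in> f ` ?A \<union> f ` ?B" using f'mA f'mB by blast
      then show ?thesis using h(1,2) fk by auto
    next
      case False
      then show ?thesis using f'o fk i by simp
    qed
  next
    fix i j assume R: "R i j"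
    have ne: "i \<noteq> j" "R j i" using is_graphD[OF gr R] by auto
    consider "i \<in> ?A" "j \<in> ?A" | "i \<in> ?B" "j \<in> ?B" | "i \<in> ?A" "j \<in> ?B" | "i \<in> ?B" "j \<in> ?A"
      | "i \<in> ?A \<union> ?B" "j \<notin> ?A \<union> ?B" | "i \<notin> ?A \<union> ?B" "j \<in> ?A \<union> ?B" | "i \<notin> ?A \<union> ?B" "j \<notin> ?A \<union> ?B"
      by blast
    then show "f' i \<noteq> f' j"
    proof cases
      case 4
      then show ?thesis using AB[of j i] ne by auto
    next
      case 6
      then show ?thesis using out[of j i] ne by auto
    next
      case 7
      then have "R' i j" using cross R by blast
      then show ?thesis using f f'o 7 by simp
    qed (use AA BB AB out R ne in blast)+
  qed
qed

lemma wp_member: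
  assumes n: "vars s ''n'' = n" and r: "vars s ''rec'' = r" and u: "vars s ''u'' = u"
    and l: "arr s b (r * n) PB" "arrays s m r = length PB"
  shows "wp (member_prog b m) s (\<lambda>s' t. vars s' ''e'' = of_bool (arrays s ''col'' u \<in> arrays s ''col'' ` set PB) \<and>
     arrays s' = arrays s \<and> t \<le> 4 * length PB + 3)"
proof -
  let ?f = "arrays s ''col''"
  define I where "I k s' \<longleftrightarrow> vars s' ''e'' = of_bool (\<exists>i<k. ?f (PB ! i) = ?f u)" for k and s' :: store
  have "wp (For ''j'' (Read m (V ''rec'')) (whenever (Read ''col'' (cell b (V ''rec'') (V ''j'')) \<doteq> Read ''col'' (V ''u'')) (''e'' \<longleftarrow> N 1)))
     (setv ''e'' 0 s) (\<lambda>s' t. I (length PB) s' \<and> arrays s' = arrays s \<and> t \<le> 4 * length PB + 2)"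
  proof (rule wp_For_bound[where N = "length PB" and T = 2 and I = I], goal_cases)
    case (2 s')
    then show ?case using r l by (simp add: agree_def)
  next
    case (4 k s')
    have "arrays s b (r * n + k) = PB ! k" using l(1) 4(1) unfolding arr_def by simp
    moreover have "vars s' ''rec'' = r" "vars s' ''n'' = n" "vars s' ''u'' = u" "arrays s' = arrays s"
      using 4(4) r n u by (auto simp: agree_def)
    ultimately show ?case using 4(2,3) unfolding I_def by (auto simp: less_Suc_eq)
  next
    case (5 s' t)
    have "arrays s' = arrays s" using 5(3) by (auto simp: agree_def)
    then show ?case using 5 by (simp add: mult.commute)
  qed (simp_all add: I_def)
  moreover have "(\<exists>i<length PB. ?f (PB ! i) = ?f u) \<longleftrightarrow> ?f u \<in> ?f ` set PB"
  proof -
    have "?f u \<in> ?f ` set PB \<longleftrightarrow> \<not> (\<forall>b\<in>set PB. ?f b \<noteq> ?f u)" unfolding image_iff by (simp add: eq_commute)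
    then show ?thesis unfolding all_set_conv_all_nth by blast
  qed
  ultimately show ?thesis
    unfolding member_prog_def wp_Seq wp_Assign val.simps by (elim wp_conseq) (simp add: I_def)
qed

lemma modv_member [simp]: "modv (member_prog b m) = {''e'', ''j''}" "moda (member_prog b m) = {}"
  by (auto simp: member_prog_def)

lemma wp_write_list:
  assumes n: "vars s ''n'' = n" and r: "vars s ''rec'' = r" and l: "arr s b (r * n) xs" "arrays s m r = length xs"
    and c: "arr s c 0 ys" "length ys = length xs" and d: "distinct xs" and ne: "b \<noteq> ''col''" "m \<noteq> ''col''" "c \<noteq> ''col''"
  shows "wp (For ''i'' (Read m (V ''rec'')) (Write ''col'' (cell b (V ''rec'') (V ''i'')) (Read c (V ''i'')))) s
    (\<lambda>s' t. (\<forall>i<length xs. arrays s' ''col'' (xs ! i) = ys ! i) \<and> (\<forall>v. v \<notin> set xs \<longrightarrow> arrays s' ''col'' v = arrays s ''col'' v) \<and>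
      t \<le> 3 * length xs + 2)"
proof (rule wp_For_bound[where N = "length xs" and T = 1 and I = "\<lambda>k s'. (\<forall>i<k. arrays s' ''col'' (xs ! i) = ys ! i) \<and>
   (\<forall>v. v \<notin> set (take k xs) \<longrightarrow> arrays s' ''col'' v = arrays s ''col'' v)"], goal_cases)
  case (2 s')
  then show ?case using r l ne by (simp add: agree_def)
next
  case (4 k s')
  have "arrays s b (r * n + k) = xs ! k" "arrays s c k = ys ! k" using l(1) c 4(1) unfolding arr_def by simp_all
  moreover have "vars s' ''rec'' = r" "vars s' ''n'' = n" "arrays s' b = arrays s b" "arrays s' c = arrays s c"
    using 4(4) r n ne by (auto simp: agree_def)
  moreover have "xs ! i \<noteq> xs ! k" if "i < k" for i using d that 4(1) by (simp add: nth_eq_iff_index_eq)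
  moreover have "set (take (Suc k) xs) = insert (xs ! k) (set (take k xs))" using 4(1) by (simp add: take_Suc_conv_app_nth)
  ultimately show ?case using 4(2,3) by (auto simp: less_Suc_eq)
next
  case (5 s' t)
  then show ?case by (simp add: mult.commute)
qed simp_all

definition extend_time :: "nat \<Rightarrow> nat" where
  "extend_time n = 15 * n * n + 50 * n + 30"

text \<open>Injectivity on each side guarantees that the colours collected in \<open>cb\<close> are
  exactly as many as the entries of \<open>PB\<close>.\<close>

lemma wp_extend_step:
  assumes n: "vars s ''n'' = n" and r: "vars s ''rec'' = r" and rec: "recorded n r PA PB s"
    and len: "length PA \<le> n" "length PB \<le> n" and d: "distinct PA" "distinct PB" "set PA \<inter> set PB = {}"
    and inj: "inj_on (arrays s ''col'') (set PA)" "inj_on (arrays s ''col'') (set PB)"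
  shows "wp extend_step s (\<lambda>s' t. recoloured (arrays s ''col'') PA PB (arrays s' ''col'') \<and> t \<le> extend_time n)"
proof -
  let ?f = "arrays s ''col''"
  let ?X = "{''d'',''z'',''i'',''u'',''e'',''j''}" and ?Y = "{''ca'',''cb''}"
  have l: "arr s ''pa'' (r * n) PA" "arr s ''pb'' (r * n) PB" "arrays s ''rna'' r = length PA" "arrays s ''rnb'' r = length PB"
    using rec unfolding recorded_def by simp_all
  have st: "vars s' ''n'' = n" "vars s' ''rec'' = r" "arr s' ''pa'' (r * n) PA" "arr s' ''pb'' (r * n) PB"
     "arrays s' ''rna'' r = length PA" "arrays s' ''rnb'' r = length PB" "arrays s' ''col'' = ?f"
     if "agree ?X ?Y s s'" for s'
    using that n r l by (simp_all add: agree_def arr_def)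
  define SA where "SA k = map ?f (filter (\<lambda>u. ?f u \<in> ?f ` set PB) (take k PA))" for k
  define OA where "OA k = map ?f (filter (\<lambda>u. ?f u \<notin> ?f ` set PB) (take k PA))" for k
  define OB where "OB k = map ?f (filter (\<lambda>u. ?f u \<notin> ?f ` set PA) (take k PB))" for k
  define T where "T = 4 * n + 8"
  have memA: "wp (member_prog ''pb'' ''rnb'') (setv ''u'' (PA ! k) s') (\<lambda>s2 t. vars s2 ''e'' = of_bool (?f (PA ! k) \<in> ?f ` set PB) \<and>
       arrays s2 = arrays s' \<and> t \<le> 4 * n + 3)" if ag: "agree ?X ?Y s s'" for s' k
  proof -
    have "wp (member_prog ''pb'' ''rnb'') (setv ''u'' (PA ! k) s') (\<lambda>s2 t. vars s2 ''e'' =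
       of_bool (arrays (setv ''u'' (PA ! k) s') ''col'' (PA ! k) \<in> arrays (setv ''u'' (PA ! k) s') ''col'' ` set PB) \<and>
       arrays s2 = arrays (setv ''u'' (PA ! k) s') \<and> t \<le> 4 * length PB + 3)"
      by (rule wp_member) (use st[OF ag] in simp_all)
    then show ?thesis by (rule wp_conseq) (use st[OF ag] len in auto)
  qed
  have memB: "wp (member_prog ''pa'' ''rna'') (setv ''u'' (PB ! k) s') (\<lambda>s2 t. vars s2 ''e'' = of_bool (?f (PB ! k) \<in> ?f ` set PA) \<and>
       arrays s2 = arrays s' \<and> t \<le> 4 * n + 3)" if ag: "agree ?X ?Y s s'" for s' k
  proof -
    have "wp (member_prog ''pa'' ''rna'') (setv ''u'' (PB ! k) s') (\<lambda>s2 t. vars s2 ''e'' =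
       of_bool (arrays (setv ''u'' (PB ! k) s') ''col'' (PB ! k) \<in> arrays (setv ''u'' (PB ! k) s') ''col'' ` set PA) \<and>
       arrays s2 = arrays (setv ''u'' (PB ! k) s') \<and> t \<le> 4 * length PA + 3)"
      by (rule wp_member) (use st[OF ag] in simp_all)
    then show ?thesis by (rule wp_conseq) (use st[OF ag] len in auto)
  qed
  have nthA: "val s' (cell ''pa'' (V ''rec'') (V ''i'')) = PA ! k" if "agree ?X ?Y s s'" "vars s' ''i'' = k" "k < length PA" for s' k
    using st(1-3)[OF that(1)] that(2,3) unfolding arr_def by simp
  have nthB: "val s' (cell ''pb'' (V ''rec'') (V ''i'')) = PB ! k" if "agree ?X ?Y s s'" "vars s' ''i'' = k" "k < length PB" for s' k
    using st(1,2,4)[OF that(1)] that(2,3) unfolding arr_def by simp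
  define c1 where "c1 = For ''i'' (Read ''rna'' (V ''rec'')) (''u'' \<longleftarrow> cell ''pa'' (V ''rec'') (V ''i'') ;; member_prog ''pb'' ''rnb'' ;;
       whenever (V ''e'') (Write ''ca'' (V ''d'') (Read ''col'' (V ''u'')) ;; Write ''cb'' (V ''d'') (Read ''col'' (V ''u'')) ;; incr ''d''))"
  define c2 where "c2 = For ''i'' (Read ''rna'' (V ''rec'')) (''u'' \<longleftarrow> cell ''pa'' (V ''rec'') (V ''i'') ;; member_prog ''pb'' ''rnb'' ;;
       whenever (V ''e'' \<doteq> N 0) (Write ''ca'' (V ''d'') (Read ''col'' (V ''u'')) ;; incr ''d''))"
  define c3 where "c3 = For ''i'' (Read ''rnb'' (V ''rec'')) (''u'' \<longleftarrow> cell ''pb'' (V ''rec'') (V ''i'') ;; member_prog ''pa'' ''rna'' ;;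
       whenever (V ''e'' \<doteq> N 0) (Write ''cb'' (V ''z'') (Read ''col'' (V ''u'')) ;; incr ''z''))"
  have tA: "length PA * (T + 2) \<le> n * (T + 2)" "length PB * (T + 2) \<le> n * (T + 2)" using len by (simp_all del: mult_Suc_right)
  have mods: "modv c1 \<subseteq> ?X" "moda c1 \<subseteq> ?Y" "modv c2 \<subseteq> ?X - {''z''}" "moda c2 \<subseteq> {''ca''}" "modv c3 \<subseteq> ?X" "moda c3 \<subseteq> {''cb''}"
    unfolding c1_def c2_def c3_def by auto
  have w1: "wp c1 s1 (\<lambda>s2 t. t \<le> n * (T + 2) + 2 \<and> vars s2 ''d'' = length (SA (length PA)) \<and> arr s2 ''ca'' 0 (SA (length PA)) \<and>
      arr s2 ''cb'' 0 (SA (length PA)))"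
    if ag: "agree ?X ?Y s s1" and d0: "vars s1 ''d'' = 0" for s1
    unfolding c1_def
  proof (rule wp_For_bound[where N = "length PA" and T = T and I = "\<lambda>k s2. vars s2 ''d'' = length (SA k) \<and> arr s2 ''ca'' 0 (SA k) \<and>
      arr s2 ''cb'' 0 (SA k)"], goal_cases)
    case (2 s')
    then show ?case using st(2,5)[OF ag] by (simp add: agree_def)
  next
    case 3
    then show ?case using d0 by (simp add: SA_def)
  next
    case (4 k s')
    have ag2: "agree ?X ?Y s s'" by (rule agree_trans[OF ag agree_mono[OF 4(4)]]) auto
    have S: "SA (Suc k) = SA k @ (if ?f (PA ! k) \<in> ?f ` set PB then [?f (PA ! k)] else [])"
      using 4(1) by (simp add: SA_def take_Suc_conv_app_nth)
    show ?case
      unfolding wp_Seq[of "_ \<longleftarrow> _"] wp_Seq[of "member_prog _ _"] wp_Assign[of "''u''"] nthA[OF ag2 4(3,1)]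
    proof (rule wp_conseq[OF memA[OF ag2]], goal_cases)
      case (1 s2 t)
      have a: "arr s2 ''ca'' 0 (SA k)" "arr s2 ''cb'' 0 (SA k)" "vars s2 ''d'' = length (SA k)" "vars s2 ''u'' = PA ! k" "arrays s2 ''col'' = ?f"
        using 1 4(2) st(7)[OF ag2] by (simp_all add: agree_def arr_def)
      show ?case
        using 1(2) a by (cases "?f (PA ! k) \<in> ?f ` set PB") (simp_all add: S T_def arr_snoc)
    qed
  next
    case (5 s' t)
    then show ?case using tA by simp
  qed simp
  have w2: "wp c2 s1 (\<lambda>s2 t. t \<le> n * (T + 2) + 2 \<and> arr s2 ''ca'' 0 (SA (length PA) @ OA (length PA)))"
    if ag: "agree ?X ?Y s s1" and d0: "vars s1 ''d'' = length (SA (length PA))" "arr s1 ''ca'' 0 (SA (length PA))" for s1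
    unfolding c2_def
  proof (rule wp_For_bound[where N = "length PA" and T = T and I = "\<lambda>k s2. vars s2 ''d'' = length (SA (length PA) @ OA k) \<and>
      arr s2 ''ca'' 0 (SA (length PA) @ OA k)"], goal_cases)
    case (2 s')
    then show ?case using st(2,5)[OF ag] by (simp add: agree_def)
  next
    case 3
    then show ?case using d0 by (simp add: OA_def)
  next
    case (4 k s')
    have ag2: "agree ?X ?Y s s'" by (rule agree_trans[OF ag agree_mono[OF 4(4)]]) auto
    have S: "SA (length PA) @ OA (Suc k) = (SA (length PA) @ OA k) @ (if ?f (PA ! k) \<in> ?f ` set PB then [] else [?f (PA ! k)])"
      using 4(1) by (simp add: OA_def take_Suc_conv_app_nth)
    show ?case
      unfolding wp_Seq[of "_ \<longleftarrow> _"] wp_Seq[of "member_prog _ _"] wp_Assign[of "''u''"] nthA[OF ag2 4(3,1)]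
    proof (rule wp_conseq[OF memA[OF ag2]], goal_cases)
      case (1 s2 t)
      have a: "arr s2 ''ca'' 0 (SA (length PA) @ OA k)" "vars s2 ''d'' = length (SA (length PA) @ OA k)" "vars s2 ''u'' = PA ! k" "arrays s2 ''col'' = ?f"
        using 1 4(2) st(7)[OF ag2] by (simp_all add: agree_def arr_def)
      show ?case
        unfolding S using 1(2) a by (cases "?f (PA ! k) \<in> ?f ` set PB") (simp_all add: T_def arr_snoc del: append_assoc)
    qed
  next
    case (5 s' t)
    then show ?case using tA by simp
  qed simp
  have w3: "wp c3 s1 (\<lambda>s2 t. t \<le> n * (T + 2) + 2 \<and> arr s2 ''cb'' 0 (SA (length PA) @ OB (length PB)))"
    if ag: "agree ?X ?Y s s1" and d0: "vars s1 ''z'' = length (SA (length PA))" "arr s1 ''cb'' 0 (SA (length PA))" for s1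
    unfolding c3_def
  proof (rule wp_For_bound[where N = "length PB" and T = T and I = "\<lambda>k s2. vars s2 ''z'' = length (SA (length PA) @ OB k) \<and>
      arr s2 ''cb'' 0 (SA (length PA) @ OB k)"], goal_cases)
    case (2 s')
    then show ?case using st(2,6)[OF ag] by (simp add: agree_def)
  next
    case 3
    then show ?case using d0 by (simp add: OB_def)
  next
    case (4 k s')
    have ag2: "agree ?X ?Y s s'" by (rule agree_trans[OF ag agree_mono[OF 4(4)]]) auto
    have S: "SA (length PA) @ OB (Suc k) = (SA (length PA) @ OB k) @ (if ?f (PB ! k) \<in> ?f ` set PA then [] else [?f (PB ! k)])"
      using 4(1) by (simp add: OB_def take_Suc_conv_app_nth)
    show ?case
      unfolding wp_Seq[of "_ \<longleftarrow> _"] wp_Seq[of "member_prog _ _"] wp_Assign[of "''u''"] nthB[OF ag2 4(3,1)]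
    proof (rule wp_conseq[OF memB[OF ag2]], goal_cases)
      case (1 s2 t)
      have a: "arr s2 ''cb'' 0 (SA (length PA) @ OB k)" "vars s2 ''z'' = length (SA (length PA) @ OB k)" "vars s2 ''u'' = PB ! k" "arrays s2 ''col'' = ?f"
        using 1 4(2) st(7)[OF ag2] by (simp_all add: agree_def arr_def)
      show ?case
        unfolding S using 1(2) a by (cases "?f (PB ! k) \<in> ?f ` set PA") (simp_all add: T_def arr_snoc del: append_assoc)
    qed
  next
    case (5 s' t)
    then show ?case using tA by simp
  qed simp
  have CA: "SA (length PA) @ OA (length PA) = colA ?f PA PB" unfolding SA_def OA_def colA_def by simp
  have CB: "SA (length PA) @ OB (length PB) = colB ?f PA PB" unfolding SA_def OB_def colB_def by simp
  have lenB: "length (colB ?f PA PB) = length PB" by (rule length_colB[OF d(1) inj(1) d(2) inj(2)])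
  have ag0: "agree ?X ?Y s (setv ''d'' 0 s)" by (simp add: agree_def)
  show ?thesis
    unfolding extend_step_def c1_def[symmetric] c2_def[symmetric] c3_def[symmetric] wp_Seq wp_Assign val.simps
  proof (rule wp_conseq[OF w1[OF ag0]], goal_cases)
    case s1: (2 s1 t1)
    let ?s1 = "setv ''z'' (vars s1 ''d'') s1"
    have ag1: "agree ?X ?Y s ?s1"
      by (rule agree_setv[OF agree_trans[OF ag0 agree_mono[OF s1(1) mods(1,2)]]]) simp
    show ?case
    proof (rule wp_conseq[OF w2[OF ag1]], goal_cases)
      case s2: (3 s2 t2)
      have ag2: "agree ?X ?Y s s2"
        by (rule agree_trans[OF ag1 agree_mono[OF s2(1)]]) (use mods in auto)
      have "''z'' \<notin> modv c2" "''cb'' \<notin> moda c2" using mods by auto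
      then have z2: "vars s2 ''z'' = length (SA (length PA))" "arr s2 ''cb'' 0 (SA (length PA))"
        using s2(1) s1(2) by (simp_all add: agree_def arr_def)
      show ?case
      proof (rule wp_conseq[OF w3[OF ag2 z2]], goal_cases)
        case s3: (1 s3 t3)
        have ag3: "agree ?X ?Y s s3"
          by (rule agree_trans[OF ag2 agree_mono[OF s3(1)]]) (use mods in auto)
        have "''ca'' \<notin> moda c3" using mods by auto
        then have ca3: "arr s3 ''ca'' 0 (colA ?f PA PB)"
          using s3(1) s2(2) by (simp add: agree_def arr_def CA)
        have cb3: "arr s3 ''cb'' 0 (colB ?f PA PB)" using s3(2) by (simp add: CB)
        note S3 = st[OF ag3]
        show ?case
        proof (rule wp_conseq[OF wp_write_list[OF S3(1,2,3,5) ca3 length_colA d(1)]], goal_cases)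
          case s4: (4 s4 t4)
          have S4: "vars s4 ''n'' = n" "vars s4 ''rec'' = r" "arr s4 ''pb'' (r * n) PB" "arrays s4 ''rnb'' r = length PB"
             "arr s4 ''cb'' 0 (colB ?f PA PB)"
            using S3 cb3 s4(1) by (simp_all add: agree_def arr_def)
          show ?case
          proof (rule wp_conseq[OF wp_write_list[OF S4(1-5) lenB d(2)]], goal_cases)
            case s5: (4 s5 t5)
            have "PA ! i \<notin> set PB" if "i < length PA" for i using d(3) nth_mem[OF that] by blast
            then have "recoloured ?f PA PB (arrays s5 ''col'')"
              unfolding recoloured_def using s5(2) s4(2) S3(7) by auto
            moreover have "1 + (t1 + (1 + (t2 + (t3 + (t4 + t5))))) \<le> extend_time n"
              using s1(2) s2(2) s3(2) s4(2) s5(2) len unfolding extend_time_def T_def by (simp add: algebra_simps)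
            ultimately show ?case by blast
          qed simp_all
        qed simp_all
      qed
    qed (use s1 in simp_all)
  qed simp
qed

text \<open>The records are undone from last to first, and \<open>rec\<close> doubles as the index
  of the relation for which the current colouring is proper.\<close>

lemma wp_extend:
  assumes ch: "chain n Rs r s" and gr: "is_graph n (Rs 0)" and f: "proper n (Rs r) k (arrays s ''subcol'')"
  shows "wp extend_prog s (\<lambda>s' t. proper n (Rs 0) k (arrays s' ''col'') \<and> t \<le> r * (extend_time n + 3) + 3 * n + 10)"
proof -
  have gri: "is_graph n (Rs i)" if "i \<le> r" for i
  proof (cases i)
    case (Suc j)
    then have "j < r" using that by simp
    then obtain PA PB \<mu> where "reduction_step n (Rs j) (Rs (Suc j)) PA PB \<mu>" using ch unfolding chain_def by blast
    then show ?thesis unfolding reduction_step_def Suc by blast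
  qed (use gr in simp)
  define J where "J s' \<longleftrightarrow> (vars s' ''rec'' \<le> r \<and> proper n (Rs (vars s' ''rec'')) k (arrays s' ''col''))" for s' :: store
  define \<Phi> where "\<Phi> s' = vars s' ''rec'' * (extend_time n + 3)" for s' :: store
  define body where "body = (''rec'' \<longleftarrow> V ''rec'' \<ominus> N 1 ;; extend_step)"
  let ?Y = "{''ca'',''cb'',''col''}"
  have mods: "moda body \<subseteq> ?Y" "''n'' \<notin> modv body" by (auto simp: body_def extend_step_def)
  have loop: "wp (While (V ''rec'') body) s1 (\<lambda>s' t. proper n (Rs 0) k (arrays s' ''col'') \<and> t \<le> r * (extend_time n + 3) + 1)"
    if J1: "J s1" "vars s1 ''rec'' = r" and n1: "vars s1 ''n'' = n" and a1: "\<And>a. a \<notin> ?Y \<Longrightarrow> arrays s1 a = arrays s a" for s1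
  proof (rule wp_While[where I = J and \<Phi> = \<Phi>], goal_cases)
    case (2 s2)
    obtain j where j: "vars s2 ''rec'' = Suc j" using 2(2) by (cases "vars s2 ''rec''") auto
    have jr: "j < r" and p: "proper n (Rs (Suc j)) k (arrays s2 ''col'')" using 2(1) j unfolding J_def by auto
    obtain PA PB \<mu> where st: "reduction_step n (Rs j) (Rs (Suc j)) PA PB \<mu>" "recorded n j PA PB s" using ch jr unfolding chain_def by blast
    let ?s = "setv ''rec'' j s2"
    have ar: "arrays s2 a = arrays s a" if "a \<notin> ?Y" for a
      using 2(3) mods a1[OF that] that by (auto simp: agree_def)
    have rec: "recorded n j PA PB ?s" using st(2) ar unfolding recorded_def by (simp add: arr_def)
    have n2: "vars ?s ''n'' = n" using 2(3) mods n1 by (simp add: agree_def)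
    have hm: "homog {..<n} (Rs j) (set PA) (set PB)" and d: "distinct PA" "distinct PB" using st(1) unfolding reduction_step_def by blast+
    have dis: "set PA \<inter> set PB = {}" using hm unfolding homog_def by blast
    have gj: "is_graph n (Rs j)" using gri jr by simp
    have inj: "inj_on (arrays s2 ''col'') (set PA)" "inj_on (arrays s2 ''col'') (set PB)"
      using proper_inj[OF gj st(1) p] by simp_all
    have w: "wp extend_step ?s (\<lambda>s' t. recoloured (arrays ?s ''col'') PA PB (arrays s' ''col'') \<and> t \<le> extend_time n)"
      by (rule wp_extend_step[OF n2 _ rec reduction_step_length[OF st(1)] d dis]) (use inj in simp_all)
    have v: "vars s2 ''rec'' - 1 = j" using j by simp
    show ?case
      unfolding body_def wp_Seq wp_Assign val.simps binop_val.simps v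
    proof (rule wp_conseq[OF w], goal_cases)
      case (1 s3 t)
      have "vars s3 ''rec'' = j" using 1(1) by (simp add: agree_def extend_step_def)
      moreover have "proper n (Rs j) k (arrays s3 ''col'')"
        by (rule proper_recolour[OF gj st(1) p]) (use 1(2) in simp)
      ultimately show ?case using 1(2) jr j unfolding J_def \<Phi>_def by simp
    qed
  next
    case (3 s2 t)
    then show ?case using J1(2) unfolding J_def \<Phi>_def by simp
  qed (rule J1)
  show ?thesis
    unfolding extend_prog_def body_def[symmetric] wp_Seq
  proof (rule wp_For_bound[where N = n and T = 1 and I = "\<lambda>k s'. \<forall>i<k. arrays s' ''col'' i = arrays s ''subcol'' i"], goal_cases)
    case (5 s1 t1)
    have a: "arrays s1 a = arrays s a" if "a \<noteq> ''col''" for a using 5(3) that by (simp add: agree_def)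
    have v: "vars s1 ''rec'' = r" "vars s1 ''n'' = n" using 5(3) ch by (simp_all add: agree_def chain_def)
    have "\<forall>i j. Rs r i j \<longrightarrow> i < n \<and> j < n" using gri[of r] unfolding is_graph_def by blast
    then have "J s1" unfolding J_def v using f 5(1) unfolding proper_def by auto
    then show ?case
      by (rule wp_conseq[OF loop]) (use v a 5(4) in auto)
  qed (use ch in \<open>auto simp: agree_def chain_def less_Suc_eq\<close>)
qed

section \<open>Every nonskeletal pair forces a seed that is not clean\<close>

section \<open>Nonskeletal pairs are found from a seed edge\<close>

text \<open>Every nonskeletal pair is of this kind. In the second case no clique that meets both sides
  is larger than the two cliques \<open>A\<close> and \<open>B\<close>.\<close>

definition bad :: "('b \<Rightarrow> 'b \<Rightarrow> bool) \<Rightarrow> 'b set \<Rightarrow> 'b set \<Rightarrow> bool" where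
  "bad R A B \<longleftrightarrow> (\<exists>a\<in>A. \<exists>a'\<in>A. \<exists>b\<in>B. \<exists>b'\<in>B. R a b \<and> R a' b' \<and> \<not> R a b') \<or>
     (\<exists>a\<in>A. \<exists>b\<in>B. R a b) \<and>
     card {a\<in>A. \<exists>b\<in>B. R a b} + card {b\<in>B. \<exists>a\<in>A. R a b} \<le> max (card A) (card B)"

text \<open>Inside \<open>A\<close> everything is adjacent, and an outside vertex is uniform to
  \<open>A\<close>; only \<open>B\<close> could tell the two vertices apart.\<close>

lemma twin_if_same_nbhd:
  assumes gr: "is_graph n R" and h: "homog {..<n} R A B" and a: "a \<in> A" "v \<in> A"
    and eq: "\<forall>b\<in>B. R a b = R v b"
  shows "twin R a v"
proof (cases "v = a")
  case False
  have "R v w = R a w" if "w \<noteq> a" "w \<noteq> v" for w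
  proof -
    have cl: "is_clique R A" using h unfolding homog_def by blast
    consider "w \<in> A" | "w \<in> B" | "w \<in> {..<n} - (A \<union> B)" | "\<not> w < n" by auto
    then show ?thesis
    proof cases
      case 1
      then show ?thesis using cl a that unfolding is_clique_def by metis
    next
      case 2
      then show ?thesis using eq by blast
    next
      case 3
      then have "uniform_to R w A" using h unfolding homog_def by blast
      then show ?thesis using a is_graph_sym[OF gr] unfolding uniform_to_def by metis
    next
      case 4
      then show ?thesis using is_graphD(2)[OF gr] by blast
    qed
  qed
  moreover have "R a v" using h a False unfolding homog_def is_clique_def by metis
  ultimately show ?thesis unfolding twin_def by blast
qed (simp add: twin_def)

lemma twin_swap:
  assumes gr: "is_graph n R" and t: "twin R a t" and v: "v \<noteq> a" "v \<noteq> t"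
  shows "R v t = R v a"
proof (cases "t = a")
  case False
  then have "R t v = R a v" using t v unfolding twin_def by blast
  then show ?thesis using is_graph_sym[OF gr, of v t] is_graph_sym[OF gr, of v a] by simp
qed simp

text \<open>Let \<open>A1\<close> be \<open>x\<close> together with the twins of \<open>a\<close>.
  The pair of \<open>A1\<close> and \<open>Y\<close> is itself homogeneous, and no smaller one
  contains the seed: each vertex of \<open>Y\<close> sees \<open>x\<close> but not \<open>a\<close>,
  so it is forced into the second side. The pair is flagged because the twins of \<open>a\<close>
  have no neighbour in \<open>Y\<close> and are at least as many.\<close>

lemma seed_domination:
  assumes gr: "is_graph n R" and h: "homog {..<n} R A B" and xa: "x \<in> A" "a \<in> A"
    and dom: "\<forall>b\<in>B. R a b \<longrightarrow> R x b" and Y: "Y = {b\<in>B. R x b \<and> \<not> R a b}" "Y \<noteq> {}"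
    and split: "\<forall>v\<in>A. v \<noteq> x \<longrightarrow> \<not> twin R a v \<longrightarrow> uniform_to R v Y" and cY: "card Y \<le> card {v. twin R a v}"
  shows "R x a \<and> \<not> clean {..<n} R x a"
proof -
  note sym = is_graph_sym[OF gr]
  have H: "A \<subseteq> {..<n}" "B \<subseteq> {..<n}" "A \<inter> B = {}" "is_clique R A" "is_clique R B"
    "\<And>v. v < n \<Longrightarrow> v \<notin> A \<union> B \<Longrightarrow> uniform_to R v A \<and> uniform_to R v B"
    using h unfolding homog_def by auto
  have "x \<noteq> a" using Y by auto
  then have Rxa: "R x a" using H(4) xa unfolding is_clique_def by blast
  let ?T = "{v. twin R a v}"
  define A1 where "A1 = insert x ?T"
  have Tn: "?T \<subseteq> {..<n}" using xa H(1) is_graphD(2)[OF gr] unfolding twin_def by auto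
  have anti: "\<not> R t y" if "twin R a t" "y \<in> Y" for t y
  proof -
    have "y \<noteq> a" using that(2) xa H(3) Y(1) by auto
    moreover have "y \<noteq> t" using that Y(1) \<open>y \<noteq> a\<close> unfolding twin_def by auto
    ultimately show ?thesis using that Y(1) unfolding twin_def by auto
  qed
  have disj: "A1 \<inter> Y = {}"
    using xa H(3) Y(1) unfolding A1_def twin_def by auto
  have xv: "R v x = R v a" if v: "v < n" "v \<notin> A1" "v \<notin> Y" for v
  proof -
    have ne: "v \<noteq> x" "v \<noteq> a" using v(2) unfolding A1_def twin_def by auto
    consider "v \<in> A" | "v \<in> B" | "v \<notin> A \<union> B" by blast
    then show ?thesis
    proof cases
      case 1
      then show ?thesis using H(4) xa ne unfolding is_clique_def by metis
    next
      case 2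
      then show ?thesis using dom v(3) Y(1) sym by auto
    next
      case 3
      then show ?thesis using H(6)[OF v(1)] xa unfolding uniform_to_def by metis
    qed
  qed
  have tv: "R v t = R v a" if "twin R a t" "v \<notin> A1" for v t
    by (rule twin_swap[OF gr that(1)]) (use that in \<open>auto simp: A1_def twin_def\<close>)
  have hom1: "homog {..<n} R A1 Y"
    unfolding homog_def
  proof (intro conjI ballI)
    show "A1 \<subseteq> {..<n}" using Tn xa H(1) unfolding A1_def by auto
    show "Y \<subseteq> {..<n}" using Y(1) H(2) by auto
    show "is_clique R A1" unfolding A1_def by (rule twin_clique[OF gr Rxa])
    show "is_clique R Y" using H(5) Y(1) unfolding is_clique_def by auto
    fix v assume v: "v \<in> {..<n} - (A1 \<union> Y)"
    then have "R v u = R v a" if "u \<in> A1" for u using that xv tv unfolding A1_def by auto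
    then show "uniform_to R v A1" unfolding uniform_to_def by metis
    have ne: "v \<noteq> x" "\<not> twin R a v" using v unfolding A1_def by auto
    consider "v \<in> A" | "v \<in> B" | "v \<notin> A \<union> B" by blast
    then show "uniform_to R v Y"
    proof cases
      case 1
      then show ?thesis using split ne by blast
    next
      case 2
      then show ?thesis using H(5) v Y(1) unfolding uniform_to_def is_clique_def by auto
    next
      case 3
      then show ?thesis using H(6) v Y(1) unfolding uniform_to_def by auto
    qed
  qed (rule disj)
  have "flagged R A1 Y"
  proof -
    have "?T \<subseteq> {u\<in>A1. \<forall>b\<in>Y. \<not> R u b}" using anti unfolding A1_def by auto
    moreover have "finite A1" using Tn finite_subset[of ?T "{..<n}"] unfolding A1_def by auto
    ultimately have "card ?T \<le> card {u\<in>A1. \<forall>b\<in>Y. \<not> R u b}" by (intro card_mono) auto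
    then show ?thesis unfolding flagged_def using cY Y(2) by linarith
  qed
  moreover have False if cl: "clean {..<n} R x a"
  proof -
    obtain A' B' where *: "A' \<subseteq> A1" "B' \<subseteq> Y" "A1 \<subseteq> A'" "homog {..<n} R A' B'" "\<not> flagged R A' B'"
      using cl[unfolded clean_def A1_def[symmetric], rule_format, OF hom1 subset_refl] by blast
    have "y \<in> B'" if "y \<in> Y" for y
    proof (rule ccontr)
      assume "y \<notin> B'"
      moreover have "y \<notin> A'" using that disj *(1) by blast
      moreover have "y < n" using that Y(1) H(2) by auto
      ultimately have "uniform_to R y A'" using *(4) unfolding homog_def by blast
      moreover have "x \<in> A'" "a \<in> A'" using *(3) unfolding A1_def twin_def by auto
      ultimately show False using that Y(1) sym unfolding uniform_to_def by blast
    qed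
    then have "B' = Y" "A' = A1" using * by auto
    then show False using *(5) \<open>flagged R A1 Y\<close> by simp
  qed
  ultimately show ?thesis using Rxa by blast
qed

text \<open>The four vertices induce a cycle. A homogeneous pair inside the given one with
  \<open>a1\<close> and \<open>a2\<close> in its first side must take \<open>b1\<close> and
  \<open>b2\<close>, which distinguish them, into the second; then \<open>a1\<close> is mixed on the
  second side.\<close>

lemma seed_four_cycle:
  assumes gr: "is_graph n R" and h: "homog {..<n} R A B" and a: "a1 \<in> A" "a2 \<in> A" and b: "b1 \<in> B" "b2 \<in> B"
    and e: "R a1 b1" "R a2 b2" "\<not> R a1 b2" "\<not> R a2 b1"
  shows "R a1 a2 \<and> \<not> clean {..<n} R a1 a2"
proof -
  note sym = is_graph_sym[OF gr]
  have H: "A \<subseteq> {..<n}" "B \<subseteq> {..<n}" "A \<inter> B = {}" "is_clique R A" "is_clique R B"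
    "\<And>v. v < n \<Longrightarrow> v \<notin> A \<union> B \<Longrightarrow> uniform_to R v A \<and> uniform_to R v B"
    using h unfolding homog_def by auto
  have "a1 \<noteq> a2" using e by auto
  then have Ra: "R a1 a2" using H(4) a unfolding is_clique_def by blast
  let ?T = "{v. twin R a2 v}"
  \<comment> \<open>Twins of \<open>a2\<close> need not lie in \<open>A\<close>, but the seed
    contains them. Adding them keeps the pair homogeneous and puts the whole seed into its first
    side.\<close>
  define A1 where "A1 = A \<union> ?T"
  have Tn: "?T \<subseteq> {..<n}" using a H(1) is_graphD(2)[OF gr] unfolding twin_def by auto
  have TB: "t \<notin> B" if t: "twin R a2 t" for t
  proof
    assume tB: "t \<in> B"
    then have "t \<noteq> a2" using a H(3) by auto
    then have "R a2 t" using t unfolding twin_def by blast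
    then have "t \<noteq> b1" using e(4) by auto
    then have "R t b1" using H(5) tB b(1) unfolding is_clique_def by auto
    moreover have "b1 \<noteq> a2" using a(2) b(1) H(3) by auto
    ultimately show False using t e(4) \<open>t \<noteq> a2\<close> \<open>t \<noteq> b1\<close> unfolding twin_def by auto
  qed
  have tA: "R t u" if t: "twin R a2 t" and u: "u \<in> A" "u \<noteq> t" for t u
  proof (cases "u = a2")
    case True
    then show ?thesis using t u sym unfolding twin_def by auto
  next
    case False
    then have "R a2 u" using H(4) a(2) u(1) unfolding is_clique_def by auto
    then show ?thesis using t u False unfolding twin_def by auto
  qed
  have tA2: "R u t" if "twin R a2 t" "u \<in> A" "u \<noteq> t" for t u
    using tA[OF that] sym by simp
  have tt: "R t u" if "twin R a2 t" "twin R a2 u" "u \<noteq> t" for t u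
    using that twin_clique[OF gr Ra] unfolding is_clique_def by auto
  have hom1: "homog {..<n} R A1 B"
    unfolding homog_def
  proof (intro conjI ballI)
    show "A1 \<subseteq> {..<n}" "B \<subseteq> {..<n}" "is_clique R B" using Tn H unfolding A1_def by auto
    show "A1 \<inter> B = {}" using TB H(3) unfolding A1_def by auto
    show "is_clique R A1" unfolding A1_def is_clique_def using H(4)[unfolded is_clique_def] tA tA2 tt by blast
    fix v assume v: "v \<in> {..<n} - (A1 \<union> B)"
    have "R v t = R v a2" if "twin R a2 t" for t
      by (rule twin_swap[OF gr that]) (use that v a(2) in \<open>auto simp: A1_def twin_def\<close>)
    moreover have "uniform_to R v A" "uniform_to R v B" using H(6) v unfolding A1_def by auto
    ultimately show "uniform_to R v A1" "uniform_to R v B" using a(2) unfolding A1_def uniform_to_def by auto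
  qed
  have False if cl: "clean {..<n} R a1 a2"
  proof -
    have "insert a1 ?T \<subseteq> A1" using a unfolding A1_def by auto
    then obtain A' B' where *: "A' \<subseteq> A1" "B' \<subseteq> B" "insert a1 ?T \<subseteq> A'" "homog {..<n} R A' B'" "\<not> flagged R A' B'"
      using cl hom1 unfolding clean_def by meson
    have aa: "a1 \<in> A'" "a2 \<in> A'" using *(3) unfolding twin_def by auto
    have "b \<in> B'" if "b \<in> B" "R b a1 \<noteq> R b a2" for b
    proof (rule ccontr)
      assume "b \<notin> B'"
      moreover have "b \<notin> A'" using that *(1) hom1 unfolding homog_def by blast
      moreover have "b < n" using that H(2) by auto
      ultimately have "uniform_to R b A'" using *(4) unfolding homog_def by blast
      then show False using aa that(2) unfolding uniform_to_def by blast
    qed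
    then have "b1 \<in> B'" "b2 \<in> B'" using b e sym by auto
    then have "flagged R A' B'" unfolding flagged_def using aa(1) e by blast
    then show False using *(5) by blast
  qed
  then show ?thesis using Ra by blast
qed

text \<open>By \<open>no\<close> the edges between the sides form a complete bipartite graph. The
  vertices of \<open>A\<close> without neighbours in \<open>B\<close> are twins of each other, and
  by \<open>c\<close> they are at least as many as the vertices of \<open>B\<close> with neighbours.
  So \<open>x\<close> and one of them are a seed for \<open>seed_domination\<close>.\<close>

lemma seed_complete_bipartite:
  assumes gr: "is_graph n R" and h: "homog {..<n} R A B"
    and no: "\<And>a a' b b'. a \<in> A \<Longrightarrow> a' \<in> A \<Longrightarrow> b \<in> B \<Longrightarrow> b' \<in> B \<Longrightarrow> R a b \<Longrightarrow> R a' b' \<Longrightarrow> R a b'"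
    and e: "x \<in> A" "y \<in> B" "R x y"
    and c: "card {a\<in>A. \<exists>b\<in>B. R a b} + card {b\<in>B. \<exists>a\<in>A. R a b} \<le> card A"
  shows "\<exists>x a. R x a \<and> \<not> clean {..<n} R x a"
proof -
  have fin: "finite A" "finite B" using h finite_subset unfolding homog_def by blast+
  let ?X = "{a\<in>A. \<exists>b\<in>B. R a b}" and ?Y = "{b\<in>B. \<exists>a\<in>A. R a b}"
  have "y \<in> ?Y" using e by blast
  then have "card ?Y > 0" using fin card_gt_0_iff[of ?Y] by auto
  then have "card ?X < card A" using c by linarith
  then have "?X \<noteq> A" by auto
  then obtain a where a: "a \<in> A" "\<forall>b\<in>B. \<not> R a b" by blast
  have Y: "?Y = {b\<in>B. R x b \<and> \<not> R a b}" using no e a by blast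
  have sub: "A - ?X \<subseteq> {v. twin R a v}"
    using twin_if_same_nbhd[OF gr h a(1)] a(2) by auto
  have "finite {v. twin R a v}"
    by (rule finite_subset[of _ "insert a {..<n}"]) (use is_graphD(2)[OF gr] in \<open>auto simp: twin_def\<close>)
  then have "card (A - ?X) \<le> card {v. twin R a v}" by (rule card_mono) (rule sub)
  moreover have "card (A - ?X) = card A - card ?X" using fin by (intro card_Diff_subset) auto
  ultimately have "card ?Y \<le> card {v. twin R a v}" using c by linarith
  moreover have "\<forall>v\<in>A. uniform_to R v ?Y" using no unfolding uniform_to_def by blast
  moreover have "\<forall>b\<in>B. R a b \<longrightarrow> R x b" using a(2) by blast
  ultimately show ?thesis
    using seed_domination[OF gr h e(1) a(1) _ Y] \<open>y \<in> ?Y\<close> by blast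
qed

text \<open>Without an induced four-cycle the neighbourhoods \<open>NB\<close> form a chain. If the
  edges are not complete bipartite, take its two lowest nonempty levels, those of \<open>a1\<close>
  and \<open>a2\<close>. The vertices at the level of \<open>a1\<close> are twins of each other, and
  so are the vertices in the difference \<open>Y\<close> of the two levels. Whichever class is the
  larger supplies the twins of a seed, on its own side.\<close>

lemma bad_not_clean:
  assumes gr: "is_graph n R" and h: "homog {..<n} R A B" and bad: "bad R A B"
  shows "\<exists>x a. R x a \<and> \<not> clean {..<n} R x a"
proof (rule ccontr)
  assume "\<not> ?thesis"
  then have no: "\<not> (R x a \<and> \<not> clean {..<n} R x a)" for x a by blast
  note sym = is_graph_sym[OF gr]
  have h': "homog {..<n} R B A" using h homog_swap by blast
  have fin: "finite A" "finite B" using h finite_subset unfolding homog_def by blast+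
  define NB where "NB a = {b\<in>B. R a b}" for a
  have finN: "finite (NB a)" for a unfolding NB_def using fin by simp
  have nested: "NB a \<subseteq> NB a' \<or> NB a' \<subseteq> NB a" if "a \<in> A" "a' \<in> A" for a a'
    using seed_four_cycle[OF gr h that] no unfolding NB_def by blast
  show False
  proof (cases "\<exists>a\<in>A. \<exists>a'\<in>A. \<exists>b\<in>B. \<exists>b'\<in>B. R a b \<and> R a' b' \<and> \<not> R a b'")
    case False
    then have nob: "\<And>a a' b b'. a \<in> A \<Longrightarrow> a' \<in> A \<Longrightarrow> b \<in> B \<Longrightarrow> b' \<in> B \<Longrightarrow> R a b \<Longrightarrow> R a' b' \<Longrightarrow> R a b'" by blast
    obtain x y where e: "x \<in> A" "y \<in> B" "R x y" using bad False unfolding bad_def by blast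
    have c: "card {a\<in>A. \<exists>b\<in>B. R a b} + card {b\<in>B. \<exists>a\<in>A. R a b} \<le> max (card A) (card B)"
      using bad False unfolding bad_def by blast
    show False
    proof (cases "card B \<le> card A")
      case True
      then show False using seed_complete_bipartite[OF gr h nob e] c no by auto
    next
      case False
      have eq: "{b\<in>B. \<exists>a\<in>A. R b a} = {b\<in>B. \<exists>a\<in>A. R a b}" "{a\<in>A. \<exists>b\<in>B. R b a} = {a\<in>A. \<exists>b\<in>B. R a b}"
        using sym by blast+
      have "card {b\<in>B. \<exists>a\<in>A. R b a} + card {a\<in>A. \<exists>b\<in>B. R b a} \<le> card B"
        unfolding eq using False c by simp
      moreover have "R b a'" if "b \<in> B" "b' \<in> B" "a \<in> A" "a' \<in> A" "R b a" "R b' a'" for a a' b b'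
        using nob[of a' a b' b] that sym by blast
      ultimately show False using seed_complete_bipartite[OF gr h' _ e(2,1)] e(3) sym no by blast
    qed
  next
    case True
    then obtain a a' b b' where p: "a \<in> A" "a' \<in> A" "b \<in> B" "b' \<in> B" "R a b" "R a' b'" "\<not> R a b'" by blast
    \<comment> \<open>The lowest nonempty level; vertices of \<open>A\<close> with empty
      neighbourhood may exist below it.\<close>
    obtain a1 where a1: "a1 \<in> A \<and> NB a1 \<noteq> {}" and min1: "\<And>v. v \<in> A \<and> NB v \<noteq> {} \<Longrightarrow> card (NB a1) \<le> card (NB v)"
      using ex_has_least_nat[of "\<lambda>v. v \<in> A \<and> NB v \<noteq> {}" a "\<lambda>v. card (NB v)"] p unfolding NB_def by blast
    have low: "NB v = {} \<or> NB a1 \<subseteq> NB v" if "v \<in> A" for v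
    proof (rule ccontr)
      assume "\<not> ?thesis"
      then have "NB v \<subset> NB a1" "NB v \<noteq> {}" using nested[of v a1] a1 that by auto
      then show False using psubset_card_mono[of "NB a1" "NB v", OF finN] min1[of v] that by simp
    qed
    have "NB a \<subset> NB a'" using nested[OF p(1,2)] p unfolding NB_def by blast
    moreover have "NB a1 \<subseteq> NB a" using low[OF p(1)] p(3,5) unfolding NB_def by blast
    ultimately have "a' \<in> A \<and> NB a1 \<subset> NB a'" using p(2) by blast
    \<comment> \<open>The next level: nothing lies strictly between \<open>NB a1\<close> and
      \<open>NB a2\<close>, so every vertex of \<open>A\<close> is uniform to their
      difference.\<close>
    then obtain a2 where a2: "a2 \<in> A \<and> NB a1 \<subset> NB a2" and min2: "\<And>v. v \<in> A \<and> NB a1 \<subset> NB v \<Longrightarrow> card (NB a2) \<le> card (NB v)"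
      using ex_has_least_nat[of "\<lambda>v. v \<in> A \<and> NB a1 \<subset> NB v" a' "\<lambda>v. card (NB v)"] by blast
    have high: "NB a2 \<subseteq> NB v" if "v \<in> A" "NB a1 \<subset> NB v" for v
    proof (rule ccontr)
      assume "\<not> ?thesis"
      then have "NB v \<subset> NB a2" using nested[of v a2] a2 that by auto
      then show False using psubset_card_mono[of "NB a2" "NB v", OF finN] min2[of v] that by simp
    qed
    define Y where "Y = {b\<in>B. R a2 b \<and> \<not> R a1 b}"
    have Yne: "Y \<noteq> {}" using a2 unfolding Y_def NB_def by auto
    define A1 where "A1 = {v\<in>A. NB v = NB a1}"
    have A1tw: "A1 \<subseteq> {v. twin R a1 v}"
      using twin_if_same_nbhd[OF gr h] a1 unfolding A1_def NB_def by blast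
    have fint: "finite {v. twin R u v}" if "u < n" for u
      by (rule finite_subset[of _ "insert u {..<n}"]) (use is_graphD(2)[OF gr] in \<open>auto simp: twin_def\<close>)
    have ABn: "A \<subseteq> {..<n}" "B \<subseteq> {..<n}" using h unfolding homog_def by auto
    have level: "NB v = {} \<or> NB v = NB a1 \<or> NB a2 \<subseteq> NB v" if "v \<in> A" for v
      using low[OF that] high[OF that] by blast
    show False
    proof (cases "card Y \<le> card A1")
      case True
      have "card A1 \<le> card {v. twin R a1 v}" by (rule card_mono[OF fint A1tw]) (use a1 ABn in auto)
      then have "card Y \<le> card {v. twin R a1 v}" using True by linarith
      moreover have "\<forall>v\<in>A. uniform_to R v Y"
      proof
        fix v assume "v \<in> A"
        from level[OF this] show "uniform_to R v Y" unfolding uniform_to_def Y_def NB_def by blast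
      qed
      moreover have "\<forall>b\<in>B. R a1 b \<longrightarrow> R a2 b" using a2 unfolding NB_def by blast
      ultimately show False using seed_domination[OF gr h _ _ _ Y_def Yne] a1 a2 no by blast
    next
      case False
      \<comment> \<open>The sides exchange their roles: \<open>b0\<close> dominates
        \<open>b1\<close>, and the vertices of \<open>A\<close> that tell the two apart are exactly
        those of \<open>A1\<close>.\<close>
      obtain b0 where b0: "b0 \<in> B" "R a1 b0" using a1 unfolding NB_def by blast
      obtain b1 where b1: "b1 \<in> B" "R a2 b1" "\<not> R a1 b1" using Yne unfolding Y_def by blast
      have char: "b0 \<in> NB v \<Longrightarrow> b1 \<notin> NB v \<Longrightarrow> NB v = NB a1" if "v \<in> A" for v
        using level[OF that] b1 unfolding NB_def by blast
      have A1eq: "A1 = {v\<in>A. R b0 v \<and> \<not> R b1 v}"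
        using char b0 b1 sym unfolding A1_def NB_def by blast
      have "a1 \<in> A1" using a1 unfolding A1_def by blast
      have Ysub: "Y \<subseteq> {v. twin R b1 v}"
      proof
        fix y assume y: "y \<in> Y"
        have "\<forall>v\<in>A. R b1 v = R y v"
        proof
          fix v assume "v \<in> A"
          from level[OF this] show "R b1 v = R y v"
            using y b1 sym unfolding Y_def NB_def by blast
        qed
        then show "y \<in> {v. twin R b1 v}" using twin_if_same_nbhd[OF gr h' b1(1)] y unfolding Y_def by blast
      qed
      have "card Y \<le> card {v. twin R b1 v}" by (rule card_mono[OF fint Ysub]) (use b1 ABn in auto)
      then have "card A1 \<le> card {v. twin R b1 v}" using False by linarith
      moreover have "\<forall>w\<in>B. uniform_to R w A1"
        using sym unfolding uniform_to_def A1_def NB_def by blast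
      moreover have "\<forall>v\<in>A. R b1 v \<longrightarrow> R b0 v"
      proof (intro ballI impI)
        fix v assume v: "v \<in> A" "R b1 v"
        then have "b1 \<in> NB v" using b1 sym unfolding NB_def by blast
        then have "NB a1 \<subseteq> NB v" using low[OF v(1)] by auto
        then show "R b0 v" using b0 sym unfolding NB_def by blast
      qed
      ultimately show False
        using seed_domination[OF gr h' b0(1) b1(1) _ A1eq] \<open>a1 \<in> A1\<close> no by blast
    qed
  qed
qed

section \<open>Nonskeletal pairs in graphs, and what a deletion between two cliques
  preserves\<close>

section \<open>Graphs\<close>

lemma adj_sym: "adj G u v = adj G v u"
  by (simp add: adj_def insert_commute)

lemma adj_verts:
  assumes "fin_graph G" "adj G u v"
  shows "u \<in> verts G" "v \<in> verts G" "u \<noteq> v"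
  using assms unfolding fin_graph_def adj_def by (metis doubleton_eq_iff)+

lemma clique_number_ge:
  assumes "finite (verts H)" "clique H K"
  shows "card K \<le> clique_number H"
proof -
  have "finite {K. clique H K}"
    by (rule finite_subset[of _ "Pow (verts H)"]) (use assms(1) in \<open>auto simp: clique_def\<close>)
  then show ?thesis unfolding clique_number_def using assms(2) by (intro Max_ge) auto
qed

lemma clique_number_witness:
  assumes "finite (verts H)"
  shows "\<exists>Q. clique H Q \<and> card Q = clique_number H"
proof -
  have "finite {K. clique H K}"
    by (rule finite_subset[of _ "Pow (verts H)"]) (use assms(1) in \<open>auto simp: clique_def\<close>)
  moreover have "clique H {}" by (simp add: clique_def)
  ultimately have "clique_number H \<in> card ` {K. clique H K}"
    unfolding clique_number_def by (intro Max_in) auto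
  then show ?thesis by auto
qed

lemma clique_induced: "clique (induced G S) K \<longleftrightarrow> clique G K \<and> K \<subseteq> S"
  unfolding clique_def induced_def adj_def by auto

lemma adj_delete_edge: "adj (delete_edge G a b) u v \<longleftrightarrow> adj G u v \<and> {u, v} \<noteq> {a, b}"
  by (auto simp: adj_def delete_edge_def)

lemma homogeneous_pair_homog:
  "homogeneous_pair G A B \<longleftrightarrow> homog (verts G) (adj G) A B \<and> A \<noteq> {} \<and> B \<noteq> {} \<and> 3 \<le> card (A \<union> B)"
  unfolding homogeneous_pair_def homog_def clique_def is_clique_def uniform_to_def by auto

text \<open>Deleting \<open>ab\<close> leaves a maximum clique \<open>Q\<close> that does not
  contain both ends. If the edges between the sides are complete bipartite, their ends form a
  clique, and a \<open>Q\<close> meeting both sides would be a proper part of it. So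
  \<open>Q\<close> lies in one side, which bounds the number of these ends.\<close>

lemma nonskeletal_bad:
  assumes fg: "fin_graph G" and h: "homogeneous_pair G A B" and ns: "\<not> skeletal_pair G A B"
  shows "bad (adj G) A B"
proof -
  obtain a b where ab: "a \<in> A" "b \<in> B" "adj G a b"
     "clique_number (induced (delete_edge G a b) (A \<union> B)) = clique_number (induced G (A \<union> B))"
    using ns unfolding skeletal_pair_def by blast
  have fin: "finite (verts G)" using fg unfolding fin_graph_def by blast
  have f1: "finite (verts (induced (delete_edge G a b) (A \<union> B)))" "finite (verts (induced G (A \<union> B)))"
    using fin by (simp_all add: induced_def delete_edge_def)
  obtain Q where Q: "clique (induced (delete_edge G a b) (A \<union> B)) Q" "card Q = clique_number (induced G (A \<union> B))"
    using clique_number_witness[OF f1(1)] ab(4) by auto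
  have hA: "A \<subseteq> verts G" "B \<subseteq> verts G" "A \<inter> B = {}" "is_clique (adj G) A" "is_clique (adj G) B"
    using h unfolding homogeneous_pair_homog homog_def by auto
  have finAB: "finite A" "finite B" using hA fin finite_subset by blast+
  have "a \<noteq> b" using ab hA(3) by blast
  have Qc: "Q \<subseteq> A \<union> B" "is_clique (adj G) Q" "\<not> (a \<in> Q \<and> b \<in> Q)"
    using Q(1)[unfolded clique_induced] \<open>a \<noteq> b\<close> unfolding clique_def is_clique_def adj_delete_edge by blast+
  have big: "card K \<le> card Q" if "K \<subseteq> A \<union> B" "is_clique (adj G) K" for K
  proof -
    have "clique G K" using that hA unfolding clique_def is_clique_def by blast
    then have "clique (induced G (A \<union> B)) K" using that(1) unfolding clique_induced by blast
    then show ?thesis unfolding Q(2) by (rule clique_number_ge[OF f1(2)])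
  qed
  show ?thesis
  proof (cases "\<exists>a\<in>A. \<exists>a'\<in>A. \<exists>b\<in>B. \<exists>b'\<in>B. adj G a b \<and> adj G a' b' \<and> \<not> adj G a b'")
    case True
    then show ?thesis unfolding bad_def by blast
  next
    case False
    then have no: "adj G a b'" if "a \<in> A" "a' \<in> A" "b \<in> B" "b' \<in> B" "adj G a b" "adj G a' b'" for a a' b b'
      using that by blast
    let ?X = "{a\<in>A. \<exists>b\<in>B. adj G a b}" and ?Y = "{b\<in>B. \<exists>a\<in>A. adj G a b}"
    have XY: "adj G u v" if "u \<in> ?X" "v \<in> ?Y" for u v using no that by blast
    have "is_clique (adj G) (?X \<union> ?Y)"
      unfolding is_clique_def
    proof (intro ballI impI)
      fix u v assume uv: "u \<in> ?X \<union> ?Y" "v \<in> ?X \<union> ?Y" "u \<noteq> v"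
      then consider "u \<in> A" "v \<in> A" | "u \<in> B" "v \<in> B" | "u \<in> ?X" "v \<in> ?Y" | "v \<in> ?X" "u \<in> ?Y" by blast
      then show "adj G u v"
      proof cases
        case 1
        then show ?thesis using hA(4) uv(3) unfolding is_clique_def by blast
      next
        case 2
        then show ?thesis using hA(5) uv(3) unfolding is_clique_def by blast
      next
        case 3
        then show ?thesis by (rule XY)
      next
        case 4
        then show ?thesis unfolding adj_sym[of G u v] by (rule XY)
      qed
    qed
    then have "card (?X \<union> ?Y) \<le> card Q" by (intro big) auto
    moreover have "card (?X \<union> ?Y) = card ?X + card ?Y"
      using finAB hA(3) by (intro card_Un_disjoint) auto
    moreover have "card Q \<le> max (card A) (card B)"
    proof (cases "Q \<subseteq> A \<or> Q \<subseteq> B")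
      case True
      then show ?thesis using card_mono[OF finAB(1), of Q] card_mono[OF finAB(2), of Q] by auto
    next
      case False
      then obtain u v where uv: "u \<in> Q" "u \<in> A" "v \<in> Q" "v \<in> B" using Qc(1) by blast
      have adj: "adj G x y" if "x \<in> Q" "y \<in> Q" "x \<in> A" "y \<in> B" for x y
      proof -
        have "x \<noteq> y" using that(3,4) hA(3) by blast
        then show ?thesis using Qc(2)[unfolded is_clique_def, rule_format, OF that(1,2)] by blast
      qed
      have "Q \<subseteq> ?X \<union> ?Y"
      proof
        fix x assume x: "x \<in> Q"
        show "x \<in> ?X \<union> ?Y"
        proof (cases "x \<in> A")
          case True
          then show ?thesis using adj[OF x uv(3) True uv(4)] uv(4) by blast
        next
          case False
          then have "x \<in> B" using Qc(1) x by blast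
          then show ?thesis using adj[OF uv(1) x uv(2)] uv(2) by blast
        qed
      qed
      moreover have "a \<in> ?X" "b \<in> ?Y" using ab by blast+
      ultimately have "Q \<subset> ?X \<union> ?Y" using Qc(3) by blast
      moreover have "finite (?X \<union> ?Y)" using finAB by simp
      ultimately have "card Q < card (?X \<union> ?Y)" by (rule psubset_card_mono[rotated])
      then show ?thesis using \<open>card (?X \<union> ?Y) \<le> card Q\<close> by simp
    qed
    ultimately show ?thesis unfolding bad_def using ab by auto
  qed
qed

section \<open>Deleting edges between the two cliques of a homogeneous pair\<close>

text \<open>The nonadjacent pair in the last clause is a common ingredient of the preservation
  proofs: it separates the two sides in a cover by cliques and completes a claw.\<close>

definition pair_step :: "'a graph \<Rightarrow> 'a graph \<Rightarrow> 'a set \<Rightarrow> 'a set \<Rightarrow> bool" where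
  "pair_step G G' A B \<longleftrightarrow> fin_graph G \<and> fin_graph G' \<and> verts G' = verts G \<and> homog (verts G) (adj G) A B \<and>
     (\<forall>u v. adj G' u v \<longrightarrow> adj G u v) \<and>
     (\<forall>u v. adj G u v \<longrightarrow> \<not> adj G' u v \<longrightarrow> u \<in> A \<and> v \<in> B \<or> u \<in> B \<and> v \<in> A) \<and> (\<exists>a\<in>A. \<exists>b\<in>B. \<not> adj G a b)"

lemma pair_step_swap: "pair_step G G' A B \<Longrightarrow> pair_step G G' B A"
  unfolding pair_step_def using homog_swap adj_sym by metis

lemma pair_stepD:
  assumes "pair_step G G' A B"
  shows "fin_graph G" "fin_graph G'" "verts G' = verts G" "A \<subseteq> verts G" "B \<subseteq> verts G" "A \<inter> B = {}"
    "u \<in> A \<Longrightarrow> v \<in> A \<Longrightarrow> u \<noteq> v \<Longrightarrow> adj G' u v" "u \<in> B \<Longrightarrow> v \<in> B \<Longrightarrow> u \<noteq> v \<Longrightarrow> adj G' u v"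
    "adj G' u v \<Longrightarrow> adj G u v" "u \<notin> A \<union> B \<Longrightarrow> adj G' u v = adj G u v" "v \<notin> A \<union> B \<Longrightarrow> adj G' u v = adj G u v"
    "u \<notin> A \<union> B \<Longrightarrow> adj G u v \<Longrightarrow> v \<in> A \<Longrightarrow> w \<in> A \<Longrightarrow> adj G u w"
    "u \<notin> A \<union> B \<Longrightarrow> adj G u v \<Longrightarrow> v \<in> B \<Longrightarrow> w \<in> B \<Longrightarrow> adj G u w"
    "\<exists>a\<in>A. \<exists>b\<in>B. \<not> adj G a b"
proof -
  note g1 = assms[unfolded pair_step_def]
  note g2 = conjunct2[OF g1] note g3 = conjunct2[OF g2] note g4 = conjunct2[OF g3] note g5 = conjunct2[OF g4]
  note g6 = conjunct2[OF g5]
  note g = conjunct1[OF g1] conjunct1[OF g2] conjunct1[OF g3] conjunct1[OF g4] conjunct2[OF g6]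
  have s: "adj G' u v \<Longrightarrow> adj G u v" for u v using conjunct1[OF g5] by blast
  have c: "u \<in> A \<and> v \<in> B \<or> u \<in> B \<and> v \<in> A" if "adj G u v" "\<not> adj G' u v" for u v
    using conjunct1[OF g6] that by blast
  have h: "A \<subseteq> verts G" "B \<subseteq> verts G" "A \<inter> B = {}" "is_clique (adj G) A" "is_clique (adj G) B"
    using g(4) unfolding homog_def by blast+
  have un: "uniform_to (adj G) u A \<and> uniform_to (adj G) u B" if "u \<notin> A \<union> B" "adj G u v" for u v
    using g(4) that adj_verts(1)[OF g(1) that(2)] unfolding homog_def by blast
  show "fin_graph G" "fin_graph G'" "verts G' = verts G" "A \<subseteq> verts G" "B \<subseteq> verts G" "A \<inter> B = {}"
    "\<exists>a\<in>A. \<exists>b\<in>B. \<not> adj G a b" by fact+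
  show "adj G' u v \<Longrightarrow> adj G u v" by (rule s)
  show "u \<in> A \<Longrightarrow> v \<in> A \<Longrightarrow> u \<noteq> v \<Longrightarrow> adj G' u v" using h(3,4) c[of u v] unfolding is_clique_def by blast
  show "u \<in> B \<Longrightarrow> v \<in> B \<Longrightarrow> u \<noteq> v \<Longrightarrow> adj G' u v" using h(3,5) c[of u v] unfolding is_clique_def by blast
  show "u \<notin> A \<union> B \<Longrightarrow> adj G' u v = adj G u v" "v \<notin> A \<union> B \<Longrightarrow> adj G' u v = adj G u v"
    using s[of u v] c[of u v] by blast+
  show "u \<notin> A \<union> B \<Longrightarrow> adj G u v \<Longrightarrow> v \<in> A \<Longrightarrow> w \<in> A \<Longrightarrow> adj G u w"
    "u \<notin> A \<union> B \<Longrightarrow> adj G u v \<Longrightarrow> v \<in> B \<Longrightarrow> w \<in> B \<Longrightarrow> adj G u w"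
    using un[of u v] unfolding uniform_to_def by blast+
qed

text \<open>Being nonadjacent, \<open>a\<close> and \<open>b\<close> lie in different cliques of the
  cover. The rest of the first clique outside the pair is adjacent to \<open>a\<close> and by
  uniformity to all of \<open>A\<close>, so all of \<open>A\<close> can be gathered there, and
  likewise \<open>B\<close> with \<open>b\<close>.\<close>

lemma quasi_line_outside:
  assumes g: "pair_step G G' A B" and v: "v \<notin> A \<union> B" and KL: "clique G K" "clique G L" "nbhd G v = K \<union> L"
    and ab: "a \<in> A" "b \<in> B" "\<not> adj G a b" "a \<in> K" "b \<in> L" and full: "A \<union> B \<subseteq> nbhd G v"
  shows "clique G' ((K - B) \<union> A) \<and> clique G' ((L - A) \<union> B) \<and> nbhd G' v = ((K - B) \<union> A) \<union> ((L - A) \<union> B)"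
proof -
  note D = pair_stepD[OF g]
  have K: "K \<subseteq> verts G" "L \<subseteq> verts G" "\<And>x y. x \<in> K \<Longrightarrow> y \<in> K \<Longrightarrow> x \<noteq> y \<Longrightarrow> adj G x y" "\<And>x y. x \<in> L \<Longrightarrow> y \<in> L \<Longrightarrow> x \<noteq> y \<Longrightarrow> adj G x y"
    using KL unfolding clique_def by blast+
  have o1: "adj G' x y" if "x \<in> K - B" "x \<notin> A" "y \<in> A" for x y
  proof -
    have "adj G x a" using K(3)[of x a] that ab by blast
    then have "adj G x y" using D(12)[of x a y] that ab by blast
    then show ?thesis using D(10)[of x y] that by blast
  qed
  have o2: "adj G' x y" if "x \<in> L - A" "x \<notin> B" "y \<in> B" for x y
  proof -
    have "adj G x b" using K(4)[of x b] that ab by blast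
    then have "adj G x y" using D(13)[of x b y] that ab by blast
    then show ?thesis using D(10)[of x y] that by blast
  qed
  have "clique G' ((K - B) \<union> A)"
    unfolding clique_def
  proof (intro conjI ballI impI)
    fix x y assume xy: "x \<in> K - B \<union> A" "y \<in> K - B \<union> A" "x \<noteq> y"
    consider "x \<in> A" "y \<in> A" | "x \<in> A" "y \<notin> A" | "x \<notin> A" "y \<in> A" | "x \<notin> A" "y \<notin> A" by blast
    then show "adj G' x y"
    proof cases
      case 2
      then show ?thesis using o1[of y x] xy adj_sym[of G' x y] by blast
    next
      case 4
      then show ?thesis using K(3)[of x y] D(10)[of x y] xy by blast
    qed (use o1 D(7) xy in blast)+
  qed (use K(1) D(3,4) in blast)
  moreover have "clique G' ((L - A) \<union> B)"
    unfolding clique_def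
  proof (intro conjI ballI impI)
    fix x y assume xy: "x \<in> L - A \<union> B" "y \<in> L - A \<union> B" "x \<noteq> y"
    consider "x \<in> B" "y \<in> B" | "x \<in> B" "y \<notin> B" | "x \<notin> B" "y \<in> B" | "x \<notin> B" "y \<notin> B" by blast
    then show "adj G' x y"
    proof cases
      case 2
      then show ?thesis using o2[of y x] 2 xy adj_sym[of G' x y] by blast
    next
      case 4
      then show ?thesis using K(4)[of x y] D(10)[of x y] xy by blast
    qed (use o2 D(8) xy in blast)+
  qed (use K(2) D(3,5) in blast)
  moreover have "nbhd G' v = nbhd G v" unfolding nbhd_def using D(3) D(10)[OF v] by simp
  ultimately show ?thesis using KL(3) full by blast
qed

text \<open>Outside neighbours of \<open>v\<close> are complete to \<open>A\<close>, so the rest of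
  \<open>A\<close> can join \<open>L\<close>. The vertex \<open>b0\<close> shows that the outside
  part of \<open>K\<close> is complete to \<open>B\<close>, so the remaining neighbours in
  \<open>B\<close> can join \<open>K\<close>; if there are none, \<open>b0\<close> is
  arbitrary.\<close>

lemma quasi_line_inside:
  assumes g: "pair_step G G' A B" and v: "v \<in> A" and KL: "clique G K" "clique G L" "nbhd G v = K \<union> L"
    and b: "\<And>b. b \<in> B \<Longrightarrow> adj G' v b \<Longrightarrow> b0 \<in> K \<inter> B"
  shows "\<exists>K' L'. clique G' K' \<and> clique G' L' \<and> nbhd G' v = K' \<union> L'"
proof -
  note D = pair_stepD[OF g]
  have K: "K \<subseteq> verts G" "L \<subseteq> verts G" "\<And>x y. x \<in> K \<Longrightarrow> y \<in> K \<Longrightarrow> x \<noteq> y \<Longrightarrow> adj G x y" "\<And>x y. x \<in> L \<Longrightarrow> y \<in> L \<Longrightarrow> x \<noteq> y \<Longrightarrow> adj G x y"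
    using KL unfolding clique_def by blast+
  define NB where "NB = {b\<in>B. adj G' v b}"
  define K' where "K' = (K - (A \<union> B)) \<union> NB"
  define L' where "L' = (L - (A \<union> B)) \<union> (A - {v})"
  have nv: "adj G x v" if "x \<in> K \<union> L" for x
  proof -
    have "adj G v x" using that KL(3) unfolding nbhd_def by blast
    then show ?thesis by (simp add: adj_sym)
  qed
  have o1: "adj G' x y" if "x \<in> K - (A \<union> B)" "y \<in> NB" for x y
  proof -
    have "b0 \<in> K \<inter> B" "y \<in> B" using b that(2) unfolding NB_def by blast+
    then have "adj G x b0" using K(3)[of x b0] that by blast
    then have "adj G x y" using D(13)[of x b0 y] that \<open>b0 \<in> K \<inter> B\<close> \<open>y \<in> B\<close> by blast
    then show ?thesis using D(10)[of x y] that by blast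
  qed
  have o2: "adj G' x y" if "x \<in> (K \<union> L) - (A \<union> B)" "y \<in> A" for x y
  proof -
    have "adj G x v" using nv that by blast
    then have "adj G x y" using D(12)[of x v y] that v by blast
    then show ?thesis using D(10)[of x y] that by blast
  qed
  have "clique G' K'"
    unfolding clique_def
  proof (intro conjI ballI impI)
    fix x y assume xy: "x \<in> K'" "y \<in> K'" "x \<noteq> y"
    consider "x \<in> NB" "y \<in> NB" | "x \<in> NB" "y \<in> K - (A \<union> B)" | "x \<in> K - (A \<union> B)" "y \<in> NB" | "x \<in> K - (A \<union> B)" "y \<in> K - (A \<union> B)"
      using xy unfolding K'_def by blast
    then show "adj G' x y"
    proof cases
      case 1
      then show ?thesis using D(8) xy unfolding NB_def by blast
    next
      case 2
      then show ?thesis using o1[of y x] adj_sym[of G' x y] by blast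
    next
      case 4
      then show ?thesis using K(3)[of x y] D(10)[of x y] xy by blast
    qed (use o1 in blast)
  qed (use K(1) D(3,5) in \<open>auto simp: K'_def NB_def\<close>)
  moreover have "clique G' L'"
    unfolding clique_def
  proof (intro conjI ballI impI)
    fix x y assume xy: "x \<in> L'" "y \<in> L'" "x \<noteq> y"
    consider "x \<in> A" "y \<in> A" | "x \<in> A" "y \<in> L - (A \<union> B)" | "x \<in> L - (A \<union> B)" "y \<in> A" | "x \<in> L - (A \<union> B)" "y \<in> L - (A \<union> B)"
      using xy unfolding L'_def by blast
    then show "adj G' x y"
    proof cases
      case 1
      then show ?thesis using D(7) xy by blast
    next
      case 2
      then show ?thesis using o2[of y x] 2 adj_sym[of G' x y] by blast
    next
      case 3
      then show ?thesis using o2 by blast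
    next
      case 4
      then show ?thesis using K(4)[of x y] D(10)[of x y] xy by blast
    qed
  qed (use K(2) D(3,4) in \<open>auto simp: L'_def\<close>)
  moreover have KL2: "K - (A \<union> B) \<subseteq> nbhd G' v" "L - (A \<union> B) \<subseteq> nbhd G' v"
    using KL(3) D(3) D(11)[of _ v] unfolding nbhd_def by auto
  moreover have "nbhd G' v = K' \<union> L'"
  proof
    show "nbhd G' v \<subseteq> K' \<union> L'"
    proof
      fix x assume x: "x \<in> nbhd G' v"
      then have "x \<in> K \<union> L" "adj G' v x" using KL(3) D(3) D(9)[of v x] unfolding nbhd_def by auto
      moreover have "x \<noteq> v" using adj_verts(3)[OF D(2)] \<open>adj G' v x\<close> by blast
      ultimately show "x \<in> K' \<union> L'" unfolding K'_def L'_def NB_def by blast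
    qed
    show "K' \<union> L' \<subseteq> nbhd G' v"
    proof
      fix x assume x: "x \<in> K' \<union> L'"
      then consider "x \<in> NB" | "x \<in> A - {v}" | "x \<in> nbhd G' v" using KL2 unfolding K'_def L'_def by blast
      then show "x \<in> nbhd G' v"
      proof cases
        case 1
        then show ?thesis using D(3,5) unfolding NB_def nbhd_def by auto
      next
        case 2
        then show ?thesis using D(3,4) D(7)[of v x] v unfolding nbhd_def by auto
      qed
    qed
  qed
  ultimately show ?thesis by blast
qed

lemma quasi_line_inside':
  assumes g: "pair_step G G' A B" and v: "v \<in> A" and KL: "clique G K" "clique G L" "nbhd G v = K \<union> L"
  shows "\<exists>K' L'. clique G' K' \<and> clique G' L' \<and> nbhd G' v = K' \<union> L'"
proof (cases "\<exists>b\<in>B. adj G' v b")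
  case False
  then show ?thesis using quasi_line_inside[OF g v KL] by blast
next
  case True
  then obtain b where b: "b \<in> B" "adj G' v b" by blast
  then have "b \<in> K \<union> L" using KL(3) pair_stepD(5)[OF g] pair_stepD(9)[OF g] unfolding nbhd_def by blast
  then show ?thesis
  proof
    assume "b \<in> K"
    then show ?thesis using quasi_line_inside[OF g v KL, of b] b by blast
  next
    assume "b \<in> L"
    moreover have "nbhd G v = L \<union> K" using KL(3) by blast
    ultimately show ?thesis using quasi_line_inside[OF g v KL(2,1), of b] b by blast
  qed
qed

lemma pair_step_quasi_line:
  assumes g: "pair_step G G' A B" and q: "quasi_line G"
  shows "quasi_line G'"
  unfolding quasi_line_def
proof
  note D = pair_stepD[OF g]
  fix v assume "v \<in> verts G'"
  then obtain K L where KL: "clique G K" "clique G L" "nbhd G v = K \<union> L"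
    using q D(3) unfolding quasi_line_def by auto
  consider "v \<in> A" | "v \<in> B" | "v \<notin> A \<union> B" by blast
  then show "\<exists>K L. clique G' K \<and> clique G' L \<and> nbhd G' v = K \<union> L"
  proof cases
    case 1
    then show ?thesis using quasi_line_inside'[OF g _ KL] by blast
  next
    case 2
    then show ?thesis using quasi_line_inside'[OF pair_step_swap[OF g] _ KL] by blast
  next
    case 3
    have nb: "nbhd G' v = nbhd G v" unfolding nbhd_def using D(3) D(10)[OF 3] by simp
    show ?thesis
    proof (cases "A \<union> B \<subseteq> nbhd G v")
      case True
      obtain a b where ab: "a \<in> A" "b \<in> B" "\<not> adj G a b" using D(14) by blast
      have ne: "a \<noteq> b" using ab D(6) by blast
      have "a \<in> K \<union> L" "b \<in> K \<union> L" using True KL(3) ab by blast+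
      moreover have "\<not> (a \<in> K \<and> b \<in> K)" "\<not> (a \<in> L \<and> b \<in> L)" using KL(1,2) ab(3) ne unfolding clique_def by blast+
      ultimately consider "a \<in> K" "b \<in> L" | "a \<in> L" "b \<in> K" by blast
      then show ?thesis
      proof cases
        case 1
        show ?thesis using quasi_line_outside[OF g 3 KL ab 1 True] by blast
      next
        case 2
        have "nbhd G v = L \<union> K" using KL(3) by blast
        then show ?thesis using quasi_line_outside[OF g 3 KL(2,1) _ ab 2 True] by blast
      qed
    next
      case False
      \<comment> \<open>A deleted edge inside the neighbourhood would, by uniformity, pull both
        sides into it. So the old cover stays valid.\<close>
      have "adj G' x y" if xy: "x \<in> nbhd G v" "y \<in> nbhd G v" "adj G x y" for x y
      proof (rule ccontr)
        assume "\<not> adj G' x y"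
        then have "x \<in> A \<and> y \<in> B \<or> x \<in> B \<and> y \<in> A" using g xy(3) unfolding pair_step_def by blast
        then obtain a b where ab: "a \<in> A" "b \<in> B" "adj G v a" "adj G v b" using xy(1,2) unfolding nbhd_def by blast
        have "A \<union> B \<subseteq> nbhd G v"
          using D(12)[OF 3 ab(3,1)] D(13)[OF 3 ab(4,2)] D(4,5) unfolding nbhd_def by blast
        then show False using False by blast
      qed
      then have "clique G' K" "clique G' L" using KL D(3) unfolding clique_def by blast+
      then show ?thesis using KL(3) nb by blast
    qed
  qed
qed

text \<open>A new claw has a deleted edge \<open>ab\<close> between two of its leaves. Its third
  leaf and its centre then lie outside the pair, so \<open>a\<close> and \<open>b\<close> may be
  exchanged for any \<open>a'\<close> and \<open>b'\<close> of the same sides; a nonadjacent choice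
  yields a claw of the old graph.\<close>

lemma pair_step_claw_free:
  assumes g: "pair_step G G' A B" and q: "claw_free G"
  shows "claw_free G'"
  unfolding claw_free_def
proof
  note D = pair_stepD[OF g]
  assume "\<exists>v\<in>verts G'. \<exists>S\<subseteq>nbhd G' v. card S = 3 \<and> stable G' S"
  then obtain v S where v: "v \<in> verts G'" "S \<subseteq> nbhd G' v" "card S = 3" "stable G' S" by blast
  have nb: "nbhd G' v \<subseteq> nbhd G v" unfolding nbhd_def using D(3) D(9) by auto
  have st: "\<not> adj G' x y" if "x \<in> S" "y \<in> S" for x y using v(4) that unfolding stable_def by blast
  have no: "\<not> stable G T" if "T \<subseteq> nbhd G v" "card T = 3" for T
    using q that v(1) D(3) unfolding claw_free_def by auto
  have "\<not> stable G S" using no v nb by blast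
  moreover have "S \<subseteq> verts G" using v(4) D(3) unfolding stable_def by simp
  ultimately obtain x y where xy: "x \<in> S" "y \<in> S" "adj G x y" unfolding stable_def by blast
  then have "x \<in> A \<and> y \<in> B \<or> x \<in> B \<and> y \<in> A" using g st unfolding pair_step_def by blast
  then obtain a b where ab: "a \<in> A" "b \<in> B" "a \<in> S" "b \<in> S" using xy by blast
  have "a \<noteq> b" using ab D(6) by blast
  have "S - {a, b} \<noteq> {}"
  proof
    assume "S - {a, b} = {}"
    then have "card S \<le> card {a, b}" by (intro card_mono) auto
    then show False using v(3) \<open>a \<noteq> b\<close> by simp
  qed
  then obtain r where r: "r \<in> S" "r \<noteq> a" "r \<noteq> b" by blast
  have rAB: "r \<notin> A \<union> B" using st D(7)[of a r] D(8)[of b r] r ab by blast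
  have av: "adj G' v a" "adj G' v b" "adj G' v r" using v(2) ab r unfolding nbhd_def by auto
  have ra: "\<not> adj G r a" "\<not> adj G r b" using st[of r a] st[of r b] r ab D(10)[OF rAB] by blast+
  have vAB: "v \<notin> A \<union> B"
  proof
    assume "v \<in> A \<union> B"
    then show False
    proof
      assume "v \<in> A"
      have "adj G r v" using av(3) D(9)[of v r] adj_sym by metis
      then show False using D(12)[OF rAB _ \<open>v \<in> A\<close> ab(1)] ra(1) by blast
    next
      assume "v \<in> B"
      have "adj G r v" using av(3) D(9)[of v r] adj_sym by metis
      then show False using D(13)[OF rAB _ \<open>v \<in> B\<close> ab(2)] ra(2) by blast
    qed
  qed
  obtain a' b' where ab': "a' \<in> A" "b' \<in> B" "\<not> adj G a' b'" using D(14) by blast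
  have n': "\<not> adj G r a'" "\<not> adj G r b'"
    using D(12)[OF rAB _ ab'(1) ab(1)] D(13)[OF rAB _ ab'(2) ab(2)] ra by blast+
  have v': "adj G v a'" "adj G v b'" "adj G v r"
    using D(12)[OF vAB D(9)[OF av(1)] ab(1) ab'(1)] D(13)[OF vAB D(9)[OF av(2)] ab(2) ab'(2)] D(9)[OF av(3)] by blast+
  let ?T = "{a', b', r}"
  have "a' \<noteq> b'" "a' \<noteq> r" "b' \<noteq> r" using ab' D(6) rAB by blast+
  then have "card ?T = 3" by simp
  moreover have sub: "?T \<subseteq> nbhd G v" using v' adj_verts[OF D(1)] unfolding nbhd_def by blast
  moreover have "stable G ?T"
    unfolding stable_def
  proof (intro conjI ballI)
    show "?T \<subseteq> verts G" using sub unfolding nbhd_def by blast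
    fix x y assume "x \<in> ?T" "y \<in> ?T"
    then show "\<not> adj G x y" using ab'(3) n' adj_sym[of G] adj_verts(3)[OF D(1), of x x] by auto
  qed
  ultimately show False using no by blast
qed

lemma adj_complement: "adj (complement G) u v \<longleftrightarrow> u \<in> verts G \<and> v \<in> verts G \<and> u \<noteq> v \<and> \<not> adj G u v"
proof
  assume "adj (complement G) u v"
  then obtain x y where "{u, v} = {x, y}" "x \<in> verts G" "y \<in> verts G" "x \<noteq> y" "\<not> adj G x y"
    unfolding complement_def adj_def[of "complement G"] by (auto simp: adj_def)
  then show "u \<in> verts G \<and> v \<in> verts G \<and> u \<noteq> v \<and> \<not> adj G u v"
    using adj_sym[of G x y] by (auto simp: doubleton_eq_iff)
next
  assume "u \<in> verts G \<and> v \<in> verts G \<and> u \<noteq> v \<and> \<not> adj G u v"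
  then show "adj (complement G) u v" unfolding complement_def adj_def by auto
qed

text \<open>A colouring of the complement is a cover by cliques. Put all of \<open>A\<close> into
  the clique of \<open>a\<close> and all of \<open>B\<close> into that of \<open>b\<close>, for
  nonadjacent \<open>a\<close> and \<open>b\<close>: uniformity keeps the classes cliques, and as
  the sides now have different colours no deleted edge lies inside a class.\<close>

lemma pair_step_complement:
  assumes g: "pair_step G G' A B"
  shows "chromatic_number (complement G') = chromatic_number (complement G)"
proof -
  note D = pair_stepD[OF g]
  have vc: "verts (complement H) = verts H" for H :: "'a graph" by (simp add: complement_def)
  have 1: "k_colouring (complement G) k f" if "k_colouring (complement G') k f" for k f
    using that D(9) unfolding k_colouring_def adj_complement vc D(3) by blast
  have 2: "\<exists>f'. k_colouring (complement G') k f'" if f: "k_colouring (complement G) k f" for k f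
  proof -
    obtain a b where ab: "a \<in> A" "b \<in> B" "\<not> adj G a b" using D(14) by blast
    have c: "f x \<noteq> f y" if "x \<in> verts G" "y \<in> verts G" "x \<noteq> y" "\<not> adj G x y" for x y
      using f that unfolding k_colouring_def adj_complement vc by blast
    have fab: "f a \<noteq> f b" using c[of a b] ab D(4,5,6) by blast
    define f' where "f' u = (if u \<in> A then f a else if u \<in> B then f b else f u)" for u
    have 3: "f v \<noteq> f a" if "u \<in> A" "v \<notin> A \<union> B" "v \<in> verts G" "\<not> adj G' v u" for u v
    proof -
      have "\<not> adj G v u" using D(10)[of v u] that by blast
      then have "\<not> adj G v a" using D(12)[of v a u] that ab by blast
      then show ?thesis using c[of v a] that ab D(4) by blast
    qed
    have 4: "f v \<noteq> f b" if "u \<in> B" "v \<notin> A \<union> B" "v \<in> verts G" "\<not> adj G' v u" for u v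
    proof -
      have "\<not> adj G v u" using D(10)[of v u] that by blast
      then have "\<not> adj G v b" using D(13)[of v b u] that ab by blast
      then show ?thesis using c[of v b] that ab D(5) by blast
    qed
    have "f' u \<noteq> f' v" if uv: "u \<in> verts G" "v \<in> verts G" "u \<noteq> v" "\<not> adj G' u v" for u v
    proof -
      have nvu: "\<not> adj G' v u" using uv(4) adj_sym by metis
      consider "u \<in> A" "v \<in> A" | "u \<in> B" "v \<in> B" | "u \<in> A" "v \<in> B" | "u \<in> B" "v \<in> A"
        | "u \<in> A" "v \<notin> A \<union> B" | "u \<in> B" "v \<notin> A \<union> B" | "u \<notin> A \<union> B" "v \<in> A" | "u \<notin> A \<union> B" "v \<in> B" | "u \<notin> A \<union> B" "v \<notin> A \<union> B"
        by blast
      then show ?thesis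
      proof cases
        case 1
        then show ?thesis using D(7) uv by blast
      next
        case 2
        then show ?thesis using D(8) uv by blast
      next
        case 3
        then have "v \<notin> A" using D(6) by blast
        then show ?thesis using 3 fab unfolding f'_def by simp
      next
        case 4
        then have "u \<notin> A" using D(6) by blast
        then show ?thesis using 4 fab unfolding f'_def by simp
      next
        case 5
        then show ?thesis using 3[of u v] uv nvu unfolding f'_def by simp
      next
        case 6
        then have "u \<notin> A" using D(6) by blast
        then show ?thesis using 6 4[of u v] uv nvu unfolding f'_def by simp
      next
        case 7
        then show ?thesis using 3[of v u] uv unfolding f'_def by simp
      next
        case 8
        then have "v \<notin> A" using D(6) by blast
        then show ?thesis using 8 4[of v u] uv unfolding f'_def by simp
      next
        case 9
        then have "\<not> adj G u v" using D(10)[of u v] uv by blast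
        then show ?thesis using 9 c uv unfolding f'_def by simp
      qed
    qed
    moreover have "f' u < k" if "u \<in> verts G" for u
    proof -
      have "f w < k" if "w \<in> verts G" for w using f that unfolding k_colouring_def vc by blast
      then show ?thesis using that ab D(4,5) unfolding f'_def by auto
    qed
    ultimately show ?thesis unfolding k_colouring_def adj_complement vc D(3) by blast
  qed
  have "(\<exists>f. k_colouring (complement G') k f) = (\<exists>f. k_colouring (complement G) k f)" for k
    using 1 2 by blast
  then show ?thesis unfolding chromatic_number_def by simp
qed

section \<open>Redistributing the weights of a fractional colouring\<close>

section \<open>The fractional chromatic number\<close>

lemma finite_stable: "fin_graph G \<Longrightarrow> finite {S. stable G S}"
  by (rule finite_subset[of _ "Pow (verts G)"]) (auto simp: stable_def fin_graph_def)

text \<open>A stable set \<open>S\<close> of \<open>G'\<close> is replaced by the stable sets \<open>g S j\<close> of \<open>G\<close>, with probability \<open>\<kappa> S j\<close>.\<close>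

lemma fractional_transform:
  fixes \<kappa> :: "'a set \<Rightarrow> 'j \<Rightarrow> real"
  assumes fg: "fin_graph G" "fin_graph G'" and w: "fractional_colouring G' w" and J: "finite J"
    and nn: "\<And>S j. stable G' S \<Longrightarrow> j \<in> J \<Longrightarrow> \<kappa> S j \<ge> 0"
    and st: "\<And>S j. stable G' S \<Longrightarrow> j \<in> J \<Longrightarrow> \<kappa> S j \<noteq> 0 \<Longrightarrow> stable G (g S j)"
    and one: "\<And>S. stable G' S \<Longrightarrow> (\<Sum>j\<in>J. \<kappa> S j) = 1"
    and cov: "\<And>v. v \<in> verts G \<Longrightarrow> 1 \<le> (\<Sum>S | stable G' S. w S * (\<Sum>j | j \<in> J \<and> v \<in> g S j. \<kappa> S j))"
  shows "\<exists>w'. fractional_colouring G w' \<and> (\<Sum>S | stable G S. w' S) = (\<Sum>S | stable G' S. w S)"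
proof -
  define w' where "w' S = (\<Sum>S' | stable G' S'. \<Sum>j\<in>J. if g S' j = S then w S' * \<kappa> S' j else 0)" for S
  have fin: "finite {S. stable G S}" "finite {S. stable G' S}" using finite_stable fg by blast+
  have wn: "w S \<ge> 0" if "stable G' S" for S using w that unfolding fractional_colouring_def by blast
  \<comment> \<open>One identity for two uses: membership of a vertex for the covering constraints,
    and the trivial predicate for the total weight.\<close>
  have key: "(\<Sum>S | stable G S \<and> P S. w' S) = (\<Sum>S' | stable G' S'. w S' * (\<Sum>j | j \<in> J \<and> P (g S' j). \<kappa> S' j))" for P
  proof -
    have finP: "finite {S. stable G S \<and> P S}" by (rule finite_subset[OF _ fin(1)]) auto
    have "(\<Sum>S | stable G S \<and> P S. w' S) =
        (\<Sum>S' | stable G' S'. \<Sum>j\<in>J. \<Sum>S | stable G S \<and> P S. if g S' j = S then w S' * \<kappa> S' j else 0)"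
      unfolding w'_def by (subst sum.swap, rule sum.cong[OF refl], rule sum.swap)
    also have "\<dots> = (\<Sum>S' | stable G' S'. w S' * (\<Sum>j | j \<in> J \<and> P (g S' j). \<kappa> S' j))"
    proof (rule sum.cong[OF refl])
      fix S' assume "S' \<in> {S'. stable G' S'}"
      then have S': "stable G' S'" by blast
      have "(\<Sum>j\<in>J. \<Sum>S | stable G S \<and> P S. if g S' j = S then w S' * \<kappa> S' j else 0) =
          (\<Sum>j\<in>J. if P (g S' j) then w S' * \<kappa> S' j else 0)"
      proof (rule sum.cong[OF refl])
        fix j assume j: "j \<in> J"
        have "(\<Sum>S | stable G S \<and> P S. if g S' j = S then w S' * \<kappa> S' j else 0) =
            (if g S' j \<in> {S. stable G S \<and> P S} then w S' * \<kappa> S' j else 0)"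
          using finP by (rule sum.delta')
        also have "\<dots> = (if P (g S' j) then w S' * \<kappa> S' j else 0)"
          using st[OF S' j] by auto
        finally show "(\<Sum>S | stable G S \<and> P S. if g S' j = S then w S' * \<kappa> S' j else 0) =
            (if P (g S' j) then w S' * \<kappa> S' j else 0)" .
      qed
      also have "\<dots> = (\<Sum>j | j \<in> J \<and> P (g S' j). w S' * \<kappa> S' j)"
        using J by (simp add: sum.inter_filter)
      also have "\<dots> = w S' * (\<Sum>j | j \<in> J \<and> P (g S' j). \<kappa> S' j)" by (simp add: sum_distrib_left)
      finally show "(\<Sum>j\<in>J. \<Sum>S | stable G S \<and> P S. if g S' j = S then w S' * \<kappa> S' j else 0) =
          w S' * (\<Sum>j | j \<in> J \<and> P (g S' j). \<kappa> S' j)" .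
    qed
    finally show ?thesis .
  qed
  have "fractional_colouring G w'"
    unfolding fractional_colouring_def
  proof (intro conjI allI impI ballI)
    fix S
    show "w' S \<ge> 0" unfolding w'_def using wn nn by (intro sum_nonneg) auto
  next
    fix v assume "v \<in> verts G"
    then show "1 \<le> (\<Sum>S | stable G S \<and> v \<in> S. w' S)" unfolding key by (rule cov)
  qed
  moreover have "(\<Sum>S | stable G S. w' S) = (\<Sum>S | stable G' S. w S)"
    using key[of "\<lambda>_. True"] one by simp
  ultimately show ?thesis by blast
qed

text \<open>A stable set meets a clique at most once, so summing the covering constraints over
  \<open>K\<close> counts every set that meets \<open>K\<close> exactly once.\<close>

lemma clique_weight:
  assumes fg: "fin_graph G" and w: "fractional_colouring G w" and K: "K \<subseteq> verts G" "is_clique (adj G) K"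
  shows "real (card K) \<le> (\<Sum>S | stable G S \<and> S \<inter> K \<noteq> {}. w S)"
proof -
  have fin: "finite {S. stable G S}" by (rule finite_stable[OF fg])
  have finK: "finite K" using K(1) fg finite_subset unfolding fin_graph_def by blast
  have "real (card K) = (\<Sum>v\<in>K. 1)" by simp
  also have "\<dots> \<le> (\<Sum>v\<in>K. \<Sum>S | stable G S \<and> v \<in> S. w S)"
    using w K(1) unfolding fractional_colouring_def by (intro sum_mono) auto
  also have "\<dots> = (\<Sum>v\<in>K. \<Sum>S | stable G S. if v \<in> S then w S else 0)"
  proof (rule sum.cong[OF refl])
    fix v
    have "{S. stable G S \<and> v \<in> S} = {S \<in> {S. stable G S}. v \<in> S}" by blast
    then show "(\<Sum>S | stable G S \<and> v \<in> S. w S) = (\<Sum>S | stable G S. if v \<in> S then w S else 0)"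
      using sum.inter_filter[OF fin, of w "\<lambda>S. v \<in> S"] by simp
  qed
  also have "\<dots> = (\<Sum>S | stable G S. \<Sum>v\<in>K. if v \<in> S then w S else 0)" by (rule sum.swap)
  also have "\<dots> \<le> (\<Sum>S | stable G S. if S \<inter> K \<noteq> {} then w S else 0)"
  proof (rule sum_mono)
    fix S assume "S \<in> {S. stable G S}"
    then have S: "stable G S" by blast
    have wn: "w S \<ge> 0" using w S unfolding fractional_colouring_def by blast
    have eq: "(\<Sum>v\<in>K. if v \<in> S then w S else 0) = real (card (S \<inter> K)) * w S"
      using finK by (simp add: sum.inter_filter[symmetric] Int_def conj_commute)
    have "card (S \<inter> K) \<le> (if S \<inter> K \<noteq> {} then 1 else 0)"
    proof -
      have "u = v" if "u \<in> S \<inter> K" "v \<in> S \<inter> K" for u v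
        using S K(2) that unfolding stable_def is_clique_def by blast
      then have "is_singleton (S \<inter> K) \<or> S \<inter> K = {}" unfolding is_singleton_def by blast
      then show ?thesis by (auto simp: is_singleton_altdef)
    qed
    then have "real (card (S \<inter> K)) * w S \<le> (if S \<inter> K \<noteq> {} then 1 else 0) * w S"
      using wn by (cases "S \<inter> K = {}") (auto intro!: mult_left_le_one_le simp del: card_0_eq)
    then show "(\<Sum>v\<in>K. if v \<in> S then w S else 0) \<le> (if S \<inter> K \<noteq> {} then w S else 0)"
      unfolding eq by (cases "S \<inter> K = {}") simp_all
  qed
  also have "\<dots> = (\<Sum>S | stable G S \<and> S \<inter> K \<noteq> {}. w S)"
  proof -
    have "{S. stable G S \<and> S \<inter> K \<noteq> {}} = {S \<in> {S. stable G S}. S \<inter> K \<noteq> {}}" by blast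
    then show ?thesis using sum.inter_filter[OF fin, of w "\<lambda>S. S \<inter> K \<noteq> {}"] by simp
  qed
  finally show ?thesis .
qed

text \<open>Here \<open>p\<close>, \<open>q\<close> and \<open>r\<close> are the weights of the stable sets meeting both cliques, only the first and only the
  second one. Every matched pair receives the weight \<open>\<pi>\<close>.\<close>

lemma kernel_weights:
  fixes p q r \<alpha> \<beta> \<mu> :: real
  assumes "0 \<le> p" "0 \<le> q" "0 \<le> r" "0 \<le> \<mu>" "\<mu> \<le> \<alpha>" "\<mu> \<le> \<beta>"
    and "\<alpha> \<le> p + q" "\<beta> \<le> p + r" "\<alpha> + \<beta> - \<mu> \<le> p + q + r"
  shows "\<exists>\<pi> c eA eB dA dB. 0 \<le> \<pi> \<and> \<pi> \<le> 1 \<and> 0 \<le> c \<and> 0 \<le> eA \<and> 0 \<le> eB \<and> 0 \<le> dA \<and> 0 \<le> dB \<and>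
     \<pi> \<le> p * c \<and> \<mu> * c + eA * (\<alpha> - \<mu> * \<pi>) + eB * (\<beta> - \<mu> * \<pi>) \<le> 1 \<and>
     dA * (\<alpha> - \<mu> * \<pi>) \<le> 1 \<and> dB * (\<beta> - \<mu> * \<pi>) \<le> 1 \<and>
     (\<alpha> - \<mu> * \<pi> = 0 \<or> 1 \<le> p * eA + q * dA) \<and> (\<beta> - \<mu> * \<pi> = 0 \<or> 1 \<le> p * eB + r * dB)"
proof (cases "p \<le> \<mu>")
  case True
  \<comment> \<open>The shared weight does not exceed the number of matched pairs. All of it is
    spread evenly over them, and what is then missing, \<open>\<alpha> - p\<close> and
    \<open>\<beta> - p\<close>, is supplied by the sets that meet one side only. For
    \<open>\<mu>\<close> equal to 0 the shared weight is 0.\<close>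
  define \<pi> where "\<pi> = (if \<mu> = 0 then 0 else p / \<mu>)"
  define c where "c = (if \<mu> = 0 then 0 else 1 / \<mu>)"
  have mp: "\<mu> * \<pi> = p" using True assms(1,4) unfolding \<pi>_def by auto
  have n: "0 \<le> \<alpha> - p" "0 \<le> \<beta> - p" "\<alpha> - p \<le> q" "\<beta> - p \<le> r" using True assms by linarith+
  have pi: "0 \<le> \<pi>" "\<pi> \<le> 1" "\<pi> \<le> p * c" "\<mu> * c \<le> 1" "0 \<le> c"
    using True assms unfolding \<pi>_def c_def by (auto simp: divide_le_eq)
  \<comment> \<open>Division by zero gives 0, which is the right rate when nothing is
    missing.\<close>
  have A: "1 / (\<alpha> - p) * (\<alpha> - p) \<le> 1" "1 / (\<beta> - p) * (\<beta> - p) \<le> 1" by simp_all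
  have B: "\<alpha> - p = 0 \<or> 1 \<le> q * (1 / (\<alpha> - p))" "\<beta> - p = 0 \<or> 1 \<le> r * (1 / (\<beta> - p))"
    using n by (auto simp: le_divide_eq)
  show ?thesis
    by (rule exI[of _ \<pi>], rule exI[of _ c], rule exI[of _ 0], rule exI[of _ 0],
        rule exI[of _ "1 / (\<alpha> - p)"], rule exI[of _ "1 / (\<beta> - p)"])
      (use pi A B n in \<open>simp add: mp\<close>)
next
  case False
  then have p: "0 < p" "\<mu> < p" using assms by linarith+
  define a where "a = \<alpha> - \<mu>"
  define b where "b = \<beta> - \<mu>"
  \<comment> \<open>The matched pairs are fully covered, at the price \<open>\<mu>\<close> of shared
    weight. Of the remainder the first side gets just what its private sets cannot supply and the
    second side all that is left; the bounds on \<open>\<beta>\<close> and on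
    \<open>\<alpha> + \<beta> - \<mu>\<close> say that this is enough.\<close>
  define x where "x = max 0 (a - q)"
  define y where "y = p - \<mu> - x"
  have n: "0 \<le> a" "0 \<le> b" "0 \<le> x" "0 \<le> y" "a \<le> x + q" "b \<le> y + r"
    using assms p unfolding x_def y_def a_def b_def by auto
  have A: "x / p / a * a \<le> x / p" "y / p / b * b \<le> y / p" using n p by simp_all
  have s: "\<mu> * (1 / p) + x / p + y / p = 1" using p unfolding y_def by (simp add: field_simps)
  have tot: "\<mu> * (1 / p) + x / p / a * a + y / p / b * b \<le> 1" using A s by linarith
  have B: "a = 0 \<or> 1 \<le> p * (x / p / a) + q * (1 / a)"
  proof (cases "a = 0")
    case False
    then have "p * (x / p / a) + q * (1 / a) = (x + q) / a" using p by (simp add: field_simps)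
    then show ?thesis using n False by (simp add: le_divide_eq)
  qed simp
  have C: "b = 0 \<or> 1 \<le> p * (y / p / b) + r * (1 / b)"
  proof (cases "b = 0")
    case False
    then have "p * (y / p / b) + r * (1 / b) = (y + r) / b" using p by (simp add: field_simps)
    then show ?thesis using n False by (simp add: le_divide_eq)
  qed simp
  have D: "1 / a * a \<le> 1" "1 / b * b \<le> 1" by simp_all
  have ab: "\<alpha> - \<mu> * 1 = a" "\<beta> - \<mu> * 1 = b" by (simp_all add: a_def b_def)
  show ?thesis
    by (rule exI[of _ 1], rule exI[of _ "1 / p"], rule exI[of _ "x / p / a"], rule exI[of _ "y / p / b"],
        rule exI[of _ "1 / a"], rule exI[of _ "1 / b"], unfold ab)
      (use n p tot B C D in simp)
qed

lemma sum_take_distinct: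
  assumes "distinct xs" "k \<le> length xs"
  shows "(\<Sum>v\<in>set xs. if v \<in> set (take k xs) then s else (t::real)) = real k * s + real (length xs - k) * t"
proof -
  have "(\<Sum>v\<in>set xs. if v \<in> set (take k xs) then s else t) = (\<Sum>v\<leftarrow>xs. if v \<in> set (take k xs) then s else t)"
    using assms(1) by (simp add: sum_list_distinct_conv_sum_set)
  also have "\<dots> = (\<Sum>v\<leftarrow>take k xs @ drop k xs. if v \<in> set (take k xs) then s else t)" by simp
  also have "\<dots> = (\<Sum>v\<leftarrow>take k xs. s) + (\<Sum>v\<leftarrow>drop k xs. t)"
    unfolding map_append sum_list_append
  proof (intro arg_cong2[of _ _ _ _ "(+)"] arg_cong[of _ _ sum_list])
    show "map (\<lambda>v. if v \<in> set (take k xs) then s else t) (take k xs) = map (\<lambda>_. s) (take k xs)" by simp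
    have "set (take k xs) \<inter> set (drop k xs) = {}" using assms(1) by (rule set_take_disj_set_drop_if_distinct) simp
    then show "map (\<lambda>v. if v \<in> set (take k xs) then s else t) (drop k xs) = map (\<lambda>_. t) (drop k xs)" by auto
  qed
  also have "\<dots> = real k * s + real (length xs - k) * t"
    using assms(2) by (simp add: sum_list_triv)
  finally show ?thesis .
qed

text \<open>Each stable set loses its part in the pair and gets back a matched pair, a single vertex
  or nothing, but only on sides that it met before; uniformity then keeps it stable. As nothing
  changes outside the pair, only the total weights \<open>p\<close>, \<open>q\<close>,
  \<open>r\<close> by the sides met matter, and \<open>kernel_weights\<close> solves the resulting
  small system.\<close>

lemma pair_step_fractional:
  assumes g: "pair_step G G' A B" and P: "set PA = A" "set PB = B" "distinct PA" "distinct PB"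
    and mu: "\<mu> \<le> length PA" "\<mu> \<le> length PB" "\<And>i. i < \<mu> \<Longrightarrow> \<not> adj G (PA ! i) (PB ! i)"
    and Q: "Q \<subseteq> A \<union> B" "is_clique (adj G') Q" "card Q + \<mu> = length PA + length PB"
    and w: "fractional_colouring G' w"
  shows "\<exists>w'. fractional_colouring G w' \<and> (\<Sum>S | stable G S. w' S) = (\<Sum>S | stable G' S. w S)"
proof -
  note D = pair_stepD[OF g]
  let ?S = "{S. stable G' S}"
  define mA where "mA S \<longleftrightarrow> S \<inter> A \<noteq> {}" for S
  define mB where "mB S \<longleftrightarrow> S \<inter> B \<noteq> {}" for S
  define p where "p = (\<Sum>S | stable G' S \<and> mA S \<and> mB S. w S)"
  define q where "q = (\<Sum>S | stable G' S \<and> mA S \<and> \<not> mB S. w S)"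
  define r where "r = (\<Sum>S | stable G' S \<and> mB S \<and> \<not> mA S. w S)"
  have fin: "finite ?S" by (rule finite_stable[OF D(2)])
  have wn: "w S \<ge> 0" if "stable G' S" for S using w that unfolding fractional_colouring_def by blast
  have finP: "finite {S. stable G' S \<and> R S}" for R by (rule finite_subset[OF _ fin]) auto
  have nn: "0 \<le> p" "0 \<le> q" "0 \<le> r" unfolding p_def q_def r_def using wn by (auto intro: sum_nonneg)
  have cA: "card A = length PA" "card B = length PB" using P distinct_card by blast+
  have split: "(\<Sum>S | stable G' S \<and> mA S. w S) = p + q" "(\<Sum>S | stable G' S \<and> mB S. w S) = p + r"
     "(\<Sum>S | stable G' S \<and> (mA S \<or> mB S). w S) = p + q + r"
  proof -
    have "{S. stable G' S \<and> mA S} = {S. stable G' S \<and> mA S \<and> mB S} \<union> {S. stable G' S \<and> mA S \<and> \<not> mB S}" by blast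
    then show 1: "(\<Sum>S | stable G' S \<and> mA S. w S) = p + q"
      unfolding p_def q_def using finP by (simp only:) (rule sum.union_disjoint, auto)
    have "{S. stable G' S \<and> mB S} = {S. stable G' S \<and> mA S \<and> mB S} \<union> {S. stable G' S \<and> mB S \<and> \<not> mA S}" by blast
    then show "(\<Sum>S | stable G' S \<and> mB S. w S) = p + r"
      unfolding p_def r_def using finP by (simp only:) (rule sum.union_disjoint, auto)
    have "{S. stable G' S \<and> (mA S \<or> mB S)} = {S. stable G' S \<and> mA S} \<union> {S. stable G' S \<and> mB S \<and> \<not> mA S}" by blast
    then show "(\<Sum>S | stable G' S \<and> (mA S \<or> mB S). w S) = p + q + r"
      unfolding 1[symmetric] r_def using finP by (simp only:) (rule sum.union_disjoint, auto)
  qed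
  \<comment> \<open>Both sides and \<open>Q\<close> are cliques of \<open>G'\<close>;
    \<open>clique_weight\<close> turns them into the three inequalities that
    \<open>kernel_weights\<close> asks for.\<close>
  have "is_clique (adj G') A" "is_clique (adj G') B" using D(7,8) unfolding is_clique_def by blast+
  then have ineq1: "real (card A) \<le> p + q" "real (card B) \<le> p + r"
    using clique_weight[OF D(2) w, of A] clique_weight[OF D(2) w, of B] D(3,4,5) split
    unfolding mA_def mB_def by simp_all
  have "real (card Q) \<le> (\<Sum>S | stable G' S \<and> S \<inter> Q \<noteq> {}. w S)"
    by (rule clique_weight[OF D(2) w]) (use Q D(3,4,5) in auto)
  also have "\<dots> \<le> (\<Sum>S | stable G' S \<and> (mA S \<or> mB S). w S)"
    by (rule sum_mono2[OF finP]) (use Q(1) wn in \<open>auto simp: mA_def mB_def\<close>)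
  finally have "real (card Q) \<le> p + q + r" unfolding split .
  have ineq2: "real (card A) + real (card B) - real \<mu> \<le> p + q + r"
  proof -
    have "real (card Q) + real \<mu> = real (card A) + real (card B)"
      unfolding cA using Q(3) by (simp flip: of_nat_add)
    then show ?thesis using \<open>real (card Q) \<le> p + q + r\<close> by linarith
  qed
  obtain \<pi> c eA eB dA dB where k: "0 \<le> \<pi>" "\<pi> \<le> 1" "0 \<le> c" "0 \<le> eA" "0 \<le> eB" "0 \<le> dA" "0 \<le> dB"
     "\<pi> \<le> p * c" "real \<mu> * c + eA * (real (card A) - real \<mu> * \<pi>) + eB * (real (card B) - real \<mu> * \<pi>) \<le> 1"
     "dA * (real (card A) - real \<mu> * \<pi>) \<le> 1" "dB * (real (card B) - real \<mu> * \<pi>) \<le> 1"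
     "real (card A) - real \<mu> * \<pi> = 0 \<or> 1 \<le> p * eA + q * dA" "real (card B) - real \<mu> * \<pi> = 0 \<or> 1 \<le> p * eB + r * dB"
    using kernel_weights[OF nn _ _ _ ineq1 ineq2] mu cA by auto
  define NA where "NA = real (card A) - real \<mu> * \<pi>"
  define NBt where "NBt = real (card B) - real \<mu> * \<pi>"
  \<comment> \<open>What a vertex still has to receive as a single vertex: a matched one already
    gets at least \<open>\<pi>\<close> through its pair.\<close>
  define need where "need v = (if v \<in> set (take \<mu> PA) \<union> set (take \<mu> PB) then 1 - \<pi> else 1)" for v
  have need0: "0 \<le> need v" for v using k(2) unfolding need_def by simp
  have tA: "v \<in> set (take \<mu> PA) \<Longrightarrow> v \<in> A" "v \<in> set (take \<mu> PB) \<Longrightarrow> v \<in> B" for v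
    using P(1,2) set_take_subset by fast+
  have sumA: "(\<Sum>v\<in>A. need v) = NA"
  proof -
    have "(\<Sum>v\<in>A. need v) = (\<Sum>v\<in>set PA. if v \<in> set (take \<mu> PA) then 1 - \<pi> else 1)"
      unfolding P(1) by (rule sum.cong[OF refl]) (use tA D(6) in \<open>auto simp: need_def\<close>)
    also have "\<dots> = NA" unfolding sum_take_distinct[OF P(3) mu(1)] NA_def cA
      using mu(1) by (simp add: of_nat_diff algebra_simps)
    finally show ?thesis .
  qed
  have sumB: "(\<Sum>v\<in>B. need v) = NBt"
  proof -
    have "(\<Sum>v\<in>B. need v) = (\<Sum>v\<in>set PB. if v \<in> set (take \<mu> PB) then 1 - \<pi> else 1)"
      unfolding P(2) by (rule sum.cong[OF refl]) (use tA D(6) in \<open>auto simp: need_def\<close>)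
    also have "\<dots> = NBt" unfolding sum_take_distinct[OF P(4) mu(2)] NBt_def cA
      using mu(2) by (simp add: of_nat_diff algebra_simps)
    finally show ?thesis .
  qed
  \<comment> \<open>Rates per unit of \<open>need\<close>: the \<open>e\<close> values apply to sets
    that met both sides, the \<open>d\<close> values to sets that met one side only.\<close>
  define cf where "cf S v = (if v \<in> A then (if mA S \<and> mB S then eA else if mA S then dA else 0)
     else (if mA S \<and> mB S then eB else if mB S then dB else 0))" for S v
  define kap where "kap S j = (case j of Inl (i::nat) \<Rightarrow> if mA S \<and> mB S then c else 0 | Inr v \<Rightarrow> need v * cf S v)" for S j
  define I where "I = {..<\<mu>} <+> (A \<union> B)"
  \<comment> \<open>\<open>None\<close> takes the remaining probability and merely drops the part
    inside the pair.\<close>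
  define \<kappa> where "\<kappa> S jo = (case jo of None \<Rightarrow> 1 - (\<Sum>j\<in>I. kap S j) | Some j \<Rightarrow> kap S j)" for S jo
  define gg where "gg S jo = (S - (A \<union> B)) \<union> (case jo of None \<Rightarrow> {} | Some (Inl i) \<Rightarrow> {PA ! i, PB ! i} | Some (Inr v) \<Rightarrow> {v})" for S jo
  define J where "J = insert None (Some ` I)"
  have finAB: "finite A" "finite B" using P by auto
  have finI: "finite I" unfolding I_def using finAB by simp
  have finJ: "finite J" unfolding J_def using finI by simp
  have cf0: "0 \<le> cf S v" for S v unfolding cf_def using k by simp
  have kap0: "0 \<le> kap S j" for S j unfolding kap_def using k(3) need0 cf0 by (auto split: sum.splits)
  have sumI: "(\<Sum>j\<in>I. kap S j) = real \<mu> * (if mA S \<and> mB S then c else 0) + (\<Sum>v\<in>A. need v * cf S v) + (\<Sum>v\<in>B. need v * cf S v)" for S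
  proof -
    have "(\<Sum>j\<in>I. kap S j) = (\<Sum>i<\<mu>. kap S (Inl i)) + (\<Sum>v\<in>A \<union> B. kap S (Inr v))"
      unfolding I_def using finAB by (simp add: sum.Plus)
    also have "(\<Sum>v\<in>A \<union> B. kap S (Inr v)) = (\<Sum>v\<in>A. need v * cf S v) + (\<Sum>v\<in>B. need v * cf S v)"
      unfolding kap_def using finAB D(6) by (simp add: sum.union_disjoint)
    finally show ?thesis unfolding kap_def by simp
  qed
  have cfA: "(\<Sum>v\<in>A. need v * cf S v) = (if mA S \<and> mB S then eA else if mA S then dA else 0) * NA" for S
    unfolding sumA[symmetric] sum_distrib_left by (rule sum.cong[OF refl]) (simp add: cf_def mult.commute)
  have cfB: "(\<Sum>v\<in>B. need v * cf S v) = (if mA S \<and> mB S then eB else if mB S then dB else 0) * NBt" for S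
    unfolding sumB[symmetric] sum_distrib_left by (rule sum.cong[OF refl]) (use D(6) in \<open>auto simp: cf_def mult.commute\<close>)
  have le1: "(\<Sum>j\<in>I. kap S j) \<le> 1" for S
    unfolding sumI cfA cfB using k(9,10,11) unfolding NA_def[symmetric] NBt_def[symmetric] by auto
  have \<kappa>0: "0 \<le> \<kappa> S j" for S j unfolding \<kappa>_def using kap0 le1 by (auto split: option.splits)
  have one: "(\<Sum>j\<in>J. \<kappa> S j) = 1" for S
  proof -
    have "(\<Sum>j\<in>J. \<kappa> S j) = \<kappa> S None + (\<Sum>j\<in>Some ` I. \<kappa> S j)" unfolding J_def using finI by (subst sum.insert) auto
    also have "(\<Sum>j\<in>Some ` I. \<kappa> S j) = (\<Sum>j\<in>I. kap S j)" by (simp add: sum.reindex \<kappa>_def)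
    finally show ?thesis unfolding \<kappa>_def by simp
  qed
  have stab: "stable G (gg S jo)" if S: "stable G' S" and jo: "jo \<in> J" "\<kappa> S jo \<noteq> 0" for S jo
  proof -
    define T where "T = (case jo of None \<Rightarrow> {} | Some (Inl i) \<Rightarrow> {PA ! i, PB ! i} | Some (Inr v) \<Rightarrow> {v})"
    have Sst: "\<not> adj G' u v" if "u \<in> S" "v \<in> S" for u v using S that unfolding stable_def by blast
    have T: "T \<subseteq> A \<union> B" "T \<inter> A \<noteq> {} \<longrightarrow> mA S" "T \<inter> B \<noteq> {} \<longrightarrow> mB S" "\<forall>u\<in>T. \<forall>v\<in>T. \<not> adj G u v"
    proof -
      have irr: "\<not> adj G v v" for v using adj_verts(3)[OF D(1)] by blast
      consider "jo = None" | i where "jo = Some (Inl i)" "i < \<mu>" "mA S \<and> mB S"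
        | v where "jo = Some (Inr v)" "v \<in> A" "mA S" | v where "jo = Some (Inr v)" "v \<in> B" "v \<notin> A" "mB S"
        using jo unfolding J_def I_def \<kappa>_def kap_def cf_def by (auto split: if_splits)
      then have "T \<subseteq> A \<union> B \<and> (T \<inter> A \<noteq> {} \<longrightarrow> mA S) \<and> (T \<inter> B \<noteq> {} \<longrightarrow> mB S) \<and> (\<forall>u\<in>T. \<forall>v\<in>T. \<not> adj G u v)"
      proof cases
        case (2 i)
        have "PA ! i \<in> A" "PB ! i \<in> B" using 2(2) mu P(1,2) by auto
        moreover have "\<not> adj G (PA ! i) (PB ! i)" "\<not> adj G (PB ! i) (PA ! i)" using mu(3)[OF 2(2)] adj_sym by metis+
        ultimately show ?thesis unfolding T_def 2(1) using 2(3) irr by simp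
      qed (use irr D(6) in \<open>auto simp: T_def\<close>)
      then show "T \<subseteq> A \<union> B" "T \<inter> A \<noteq> {} \<longrightarrow> mA S" "T \<inter> B \<noteq> {} \<longrightarrow> mB S" "\<forall>u\<in>T. \<forall>v\<in>T. \<not> adj G u v" by blast+
    qed
    have out: "\<not> adj G u v" if "u \<in> S - (A \<union> B)" "v \<in> T" for u v
    proof
      assume a: "adj G u v"
      have u: "u \<notin> A \<union> B" "u \<in> S" using that(1) by auto
      note vT = that(2)
      have "v \<in> A \<or> v \<in> B" using T(1) that(2) by blast
      then show False
      proof
        assume v: "v \<in> A"
        then obtain a' where a': "a' \<in> A" "a' \<in> S" using T(2) vT v unfolding mA_def by blast
        have "adj G u a'" by (rule D(12)[OF u(1) a v a'(1)])
        then show False using D(10)[OF u(1)] Sst[OF u(2) a'(2)] by blast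
      next
        assume v: "v \<in> B"
        then obtain a' where a': "a' \<in> B" "a' \<in> S" using T(3) vT v unfolding mB_def by blast
        have "adj G u a'" by (rule D(13)[OF u(1) a v a'(1)])
        then show False using D(10)[OF u(1)] Sst[OF u(2) a'(2)] by blast
      qed
    qed
    have in1: "\<not> adj G u v" if "u \<in> S - (A \<union> B)" "v \<in> S - (A \<union> B)" for u v
      using D(10)[of u v] Sst[of u v] that by blast
    have "gg S jo = (S - (A \<union> B)) \<union> T" unfolding gg_def T_def ..
    moreover have "(S - (A \<union> B)) \<union> T \<subseteq> verts G" using S T(1) D(3,4,5) unfolding stable_def by blast
    moreover have "\<not> adj G u v" if "u \<in> (S - (A \<union> B)) \<union> T" "v \<in> (S - (A \<union> B)) \<union> T" for u v
      using that out[of u v] out[of v u] in1[of u v] T(4) adj_sym[of G u v] by blast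
    ultimately show ?thesis unfolding stable_def by simp
  qed
  have inner_ge: "(\<Sum>j | j \<in> J \<and> v \<in> gg S j. \<kappa> S j) \<ge> (if mA S \<and> mB S \<and> v \<in> set (take \<mu> PA) \<union> set (take \<mu> PB) then c else 0) + need v * cf S v"
    if v: "v \<in> A \<union> B" for S v
  proof (cases "v \<in> set (take \<mu> PA) \<union> set (take \<mu> PB)")
    case False
    have "need v * cf S v = (\<Sum>j\<in>{Some (Inr v)}. \<kappa> S j)" by (simp add: \<kappa>_def kap_def)
    also have "\<dots> \<le> (\<Sum>j | j \<in> J \<and> v \<in> gg S j. \<kappa> S j)"
      by (rule sum_mono2) (use finJ v \<kappa>0 in \<open>auto simp: J_def I_def gg_def\<close>)
    finally show ?thesis using False by simp
  next
    case True
    then obtain i where i: "i < \<mu>" "v = PA ! i \<or> v = PB ! i" using mu by (auto simp: in_set_conv_nth)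
    have "(if mA S \<and> mB S then c else 0) + need v * cf S v = (\<Sum>j\<in>{Some (Inl i), Some (Inr v)}. \<kappa> S j)"
      by (simp add: \<kappa>_def kap_def)
    also have "\<dots> \<le> (\<Sum>j | j \<in> J \<and> v \<in> gg S j. \<kappa> S j)"
      by (rule sum_mono2) (use finJ v \<kappa>0 i in \<open>auto simp: J_def I_def gg_def\<close>)
    finally show ?thesis using True by simp
  qed
  have total: "(\<Sum>S\<in>?S. w S * ((if mA S \<and> mB S then x else 0) + (if mX S \<and> \<not> (mA S \<and> mB S) then y else 0)))
      = p * x + (\<Sum>S | stable G' S \<and> mX S \<and> \<not> (mA S \<and> mB S). w S) * y" for x y mX
  proof -
    have "(\<Sum>S\<in>?S. w S * ((if mA S \<and> mB S then x else 0) + (if mX S \<and> \<not> (mA S \<and> mB S) then y else 0))) =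
       (\<Sum>S\<in>?S. if mA S \<and> mB S then w S * x else 0) + (\<Sum>S\<in>?S. if mX S \<and> \<not> (mA S \<and> mB S) then w S * y else 0)"
      unfolding sum.distrib[symmetric] by (rule sum.cong[OF refl]) auto
    also have "\<dots> = (\<Sum>S | S \<in> ?S \<and> mA S \<and> mB S. w S * x) + (\<Sum>S | S \<in> ?S \<and> mX S \<and> \<not> (mA S \<and> mB S). w S * y)"
      unfolding sum.inter_filter[OF fin] ..
    finally show ?thesis unfolding p_def by (simp add: sum_distrib_right)
  qed
  \<comment> \<open>Stated with parameters for the rates and for the private weight
    \<open>t\<close>, so that both sides are instances.\<close>
  have cover: "1 \<le> (\<Sum>S\<in>?S. w S * (\<Sum>j | j \<in> J \<and> v \<in> gg S j. \<kappa> S j))"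
    if v: "v \<in> A \<union> B" and cfv: "\<And>S. cf S v = (if mA S \<and> mB S then e else if mX S \<and> \<not> (mA S \<and> mB S) then d else 0)"
      and pX: "(\<Sum>S | stable G' S \<and> mX S \<and> \<not> (mA S \<and> mB S). w S) = t"
      and ed: "need v = 0 \<or> 1 \<le> p * e + t * d" for v e d mX t
  proof -
    let ?m = "v \<in> set (take \<mu> PA) \<union> set (take \<mu> PB)"
    have "1 \<le> p * ((if ?m then c else 0) + need v * e) + t * (need v * d)"
    proof -
      have "need v \<le> need v * (p * e + t * d)"
        using ed need0[of v] mult_left_mono[of 1 "p * e + t * d" "need v"] by auto
      moreover have "1 \<le> p * (if ?m then c else 0) + need v" using k(8) unfolding need_def by simp
      ultimately show ?thesis by (simp add: algebra_simps)
    qed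
    also have "\<dots> = (\<Sum>S\<in>?S. w S * ((if mA S \<and> mB S then (if ?m then c else 0) + need v * e else 0) +
         (if mX S \<and> \<not> (mA S \<and> mB S) then need v * d else 0)))"
      unfolding total pX ..
    also have "\<dots> \<le> (\<Sum>S\<in>?S. w S * (\<Sum>j | j \<in> J \<and> v \<in> gg S j. \<kappa> S j))"
    proof (intro sum_mono mult_left_mono)
      fix S assume "S \<in> ?S"
      then show "0 \<le> w S" using wn by blast
      show "(if mA S \<and> mB S then (if ?m then c else 0) + need v * e else 0) +
         (if mX S \<and> \<not> (mA S \<and> mB S) then need v * d else 0) \<le> (\<Sum>j | j \<in> J \<and> v \<in> gg S j. \<kappa> S j)"
        using inner_ge[OF v, of S] unfolding cfv by (auto split: if_splits)
    qed
    finally show ?thesis .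
  qed
  have needA: "need v = 0" if "v \<in> A" "NA = 0" for v
    using sumA that finAB need0 by (simp add: sum_nonneg_eq_0_iff)
  have needB: "need v = 0" if "v \<in> B" "NBt = 0" for v
    using sumB that finAB need0 by (simp add: sum_nonneg_eq_0_iff)
  have "1 \<le> (\<Sum>S\<in>?S. w S * (\<Sum>j | j \<in> J \<and> v \<in> gg S j. \<kappa> S j))" if v: "v \<in> verts G" for v
  proof -
    consider "v \<in> A" | "v \<in> B" "v \<notin> A" | "v \<notin> A \<union> B" by blast
    then show ?thesis
    proof cases
      case 1
      show ?thesis
      proof (rule cover[where mX = mA and e = eA and d = dA and t = q])
        show "(\<Sum>S | stable G' S \<and> mA S \<and> \<not> (mA S \<and> mB S). w S) = q" unfolding q_def by (rule sum.cong) auto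
        show "need v = 0 \<or> 1 \<le> p * eA + q * dA" using k(12) needA[OF 1] unfolding NA_def by blast
      qed (use 1 in \<open>auto simp: cf_def\<close>)
    next
      case 2
      show ?thesis
      proof (rule cover[where mX = mB and e = eB and d = dB and t = r])
        show "(\<Sum>S | stable G' S \<and> mB S \<and> \<not> (mA S \<and> mB S). w S) = r" unfolding r_def by (rule sum.cong) auto
        show "need v = 0 \<or> 1 \<le> p * eB + r * dB" using k(13) needB[OF 2(1)] unfolding NBt_def by blast
      qed (use 2 in \<open>auto simp: cf_def\<close>)
    next
      case 3
      have vg: "v \<in> gg S jo \<longleftrightarrow> v \<in> S" if "jo \<in> J" for S jo
      proof -
        have "(case jo of None \<Rightarrow> {} | Some (Inl i) \<Rightarrow> {PA ! i, PB ! i} | Some (Inr v) \<Rightarrow> {v}) \<subseteq> A \<union> B"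
          using that mu P(1,2) unfolding J_def I_def by auto
        then show ?thesis using 3 unfolding gg_def by blast
      qed
      have "(\<Sum>j | j \<in> J \<and> v \<in> gg S j. \<kappa> S j) = (if v \<in> S then 1 else 0)" for S
      proof -
        have "{j. j \<in> J \<and> v \<in> gg S j} = (if v \<in> S then J else {})" using vg by auto
        then show ?thesis using one by simp
      qed
      then have "(\<Sum>S\<in>?S. w S * (\<Sum>j | j \<in> J \<and> v \<in> gg S j. \<kappa> S j)) = (\<Sum>S\<in>?S. if v \<in> S then w S else 0)"
        by (intro sum.cong) auto
      also have "\<dots> = (\<Sum>S | S \<in> ?S \<and> v \<in> S. w S)" by (rule sum.inter_filter[OF fin, symmetric])
      also have "\<dots> = (\<Sum>S | stable G' S \<and> v \<in> S. w S)" by simp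
      finally show ?thesis using w v D(3) unfolding fractional_colouring_def by simp
    qed
  qed
  then show ?thesis
    by (intro fractional_transform[OF D(1,2) w finJ, of \<kappa> gg]) (use \<kappa>0 stab one in auto)
qed

text \<open>Weights can be carried over in both directions with the same total, so both infima range
  over one set. From \<open>G\<close> to \<open>G'\<close> it suffices to extend by zero, since
  \<open>G'\<close> has only more stable sets.\<close>

lemma pair_step_fractional_number:
  assumes g: "pair_step G G' A B" and P: "set PA = A" "set PB = B" "distinct PA" "distinct PB"
    and mu: "\<mu> \<le> length PA" "\<mu> \<le> length PB" "\<And>i. i < \<mu> \<Longrightarrow> \<not> adj G (PA ! i) (PB ! i)"
    and Q: "Q \<subseteq> A \<union> B" "is_clique (adj G') Q" "card Q + \<mu> = length PA + length PB"
  shows "fractional_chromatic_number G' = fractional_chromatic_number G"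
proof -
  note D = pair_stepD[OF g]
  have fin: "finite {S. stable G S}" "finite {S. stable G' S}" using finite_stable D(1,2) by blast+
  have sub: "stable G' S" if "stable G S" for S using that D(3) D(9) unfolding stable_def by blast
  have 1: "\<exists>w'. fractional_colouring G' w' \<and> (\<Sum>S | stable G' S. w' S) = (\<Sum>S | stable G S. w S)"
    if w: "fractional_colouring G w" for w
  proof -
    define w' where "w' S = (if stable G S then w S else 0)" for S
    have eq: "(\<Sum>S | stable G' S \<and> R S. w' S) = (\<Sum>S | stable G S \<and> R S. w S)" for R
    proof -
      have f: "finite {S. stable G' S \<and> R S}" by (rule finite_subset[OF _ fin(2)]) auto
      have "{S. S \<in> {S. stable G' S \<and> R S} \<and> stable G S} = {S. stable G S \<and> R S}" using sub by blast
      then show ?thesis unfolding w'_def using sum.inter_filter[OF f, of w "stable G"] by simp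
    qed
    have "fractional_colouring G' w'"
      unfolding fractional_colouring_def eq using w D(3) unfolding fractional_colouring_def w'_def by auto
    then show ?thesis using eq[of "\<lambda>_. True"] by auto
  qed
  have "{(\<Sum>S | stable G' S. w S) | w. fractional_colouring G' w} = {(\<Sum>S | stable G S. w S) | w. fractional_colouring G w}"
    (is "?X = ?Y")
  proof
    show "?X \<subseteq> ?Y"
    proof
      fix x assume "x \<in> ?X"
      then obtain w where w: "fractional_colouring G' w" "x = (\<Sum>S | stable G' S. w S)" by blast
      obtain w' where "fractional_colouring G w'" "(\<Sum>S | stable G S. w' S) = (\<Sum>S | stable G' S. w S)"
        using pair_step_fractional[OF g P mu Q w(1)] by blast
      then show "x \<in> ?Y" using w(2) by (intro CollectI exI[of _ w']) simp
    qed
    show "?Y \<subseteq> ?X"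
    proof
      fix x assume "x \<in> ?Y"
      then obtain w where w: "fractional_colouring G w" "x = (\<Sum>S | stable G S. w S)" by blast
      obtain w' where "fractional_colouring G' w'" "(\<Sum>S | stable G' S. w' S) = (\<Sum>S | stable G S. w S)"
        using 1[OF w(1)] by blast
      then show "x \<in> ?X" using w(2) by (intro CollectI exI[of _ w']) simp
    qed
  qed
  then show ?thesis unfolding fractional_chromatic_number_def by simp
qed

section \<open>Transfer from relations on indices to graphs on vertices\<close>

section \<open>Graphs given by relations on indices\<close>

definition graph_of :: "'a list \<Rightarrow> (nat \<Rightarrow> nat \<Rightarrow> bool) \<Rightarrow> 'a graph" where
  "graph_of vs R = \<lparr>verts = set vs, edges = {{vs ! i, vs ! j} | i j. R i j}\<rparr>"

lemma is_clique_image: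
  assumes "inj_on f X" "\<And>i j. i \<in> X \<Longrightarrow> j \<in> X \<Longrightarrow> S (f i) (f j) = R i j" "A \<subseteq> X"
  shows "is_clique S (f ` A) \<longleftrightarrow> is_clique R A"
proof -
  have "f i = f j \<longleftrightarrow> i = j" "S (f i) (f j) = R i j" if "i \<in> A" "j \<in> A" for i j
    using that assms inj_on_eq_iff[OF assms(1)] by blast+
  then show ?thesis unfolding is_clique_def by auto
qed

lemma uniform_to_image:
  assumes "\<And>i j. i \<in> X \<Longrightarrow> j \<in> X \<Longrightarrow> S (f i) (f j) = R i j" "A \<subseteq> X" "v \<in> X"
  shows "uniform_to S (f v) (f ` A) \<longleftrightarrow> uniform_to R v A"
proof -
  have "S (f v) (f j) = R v j" if "j \<in> A" for j using that assms by blast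
  then show ?thesis unfolding uniform_to_def by auto
qed

lemma homog_image:
  assumes inj: "inj_on f X" and S: "\<And>i j. i \<in> X \<Longrightarrow> j \<in> X \<Longrightarrow> S (f i) (f j) = R i j" and sub: "A \<subseteq> X" "B \<subseteq> X"
  shows "homog (f ` X) S (f ` A) (f ` B) \<longleftrightarrow> homog X R A B"
proof -
  have 1: "f ` A \<subseteq> f ` X \<longleftrightarrow> A \<subseteq> X" "f ` B \<subseteq> f ` X \<longleftrightarrow> B \<subseteq> X" using sub by blast+
  have 2: "f ` A \<inter> f ` B = {} \<longleftrightarrow> A \<inter> B = {}"
    using inj_on_image_Int[OF inj sub] by (metis image_is_empty)
  have "f ` X - (f ` A \<union> f ` B) = f ` (X - (A \<union> B))"
    using inj_on_image_set_diff[OF inj, of X "A \<union> B"] sub by (simp add: image_Un)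
  then have 3: "(\<forall>v\<in>f ` X - (f ` A \<union> f ` B). uniform_to S v (f ` A) \<and> uniform_to S v (f ` B)) \<longleftrightarrow>
      (\<forall>v\<in>X - (A \<union> B). uniform_to R v A \<and> uniform_to R v B)"
    using uniform_to_image[where S = S and R = R and f = f, OF S] sub by simp
  note c = is_clique_image[where S = S and R = R and f = f, OF inj S]
  have "is_clique S (f ` A) \<longleftrightarrow> is_clique R A" "is_clique S (f ` B) \<longleftrightarrow> is_clique R B" by (rule c; use sub in simp)+
  then show ?thesis unfolding homog_def 1 2 3 by simp
qed

lemma bad_image:
  assumes inj: "inj_on f X" and S: "\<And>i j. i \<in> X \<Longrightarrow> j \<in> X \<Longrightarrow> S (f i) (f j) = R i j" and sub: "A \<subseteq> X" "B \<subseteq> X"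
  shows "bad S (f ` A) (f ` B) \<longleftrightarrow> bad R A B"
proof -
  have Sf: "S (f i) (f j) = R i j" if "i \<in> A" "j \<in> B" for i j using that sub S by blast
  have eq: "{a \<in> f ` A. \<exists>b\<in>f ` B. S a b} = f ` {a \<in> A. \<exists>b\<in>B. R a b}"
    "{b \<in> f ` B. \<exists>a\<in>f ` A. S a b} = f ` {b \<in> B. \<exists>a\<in>A. R a b}"
    using Sf by auto
  have card: "card (f ` C) = card C" if "C \<subseteq> X" for C using card_image inj_on_subset[OF inj that] by blast
  have "{a \<in> A. \<exists>b\<in>B. R a b} \<subseteq> X" "{b \<in> B. \<exists>a\<in>A. R a b} \<subseteq> X" using sub by blast+
  then show ?thesis unfolding bad_def eq using Sf by (simp add: card sub)
qed

text \<open>The properties that are carried along a chain of reductions one step at a time. The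
  chromatic number is obtained for the whole chain at once, from the extension program.\<close>

definition reduct :: "'a graph \<Rightarrow> 'a graph \<Rightarrow> bool" where
  "reduct G' G \<longleftrightarrow> subgraph G' G \<and> (quasi_line G \<longrightarrow> quasi_line G') \<and> (claw_free G \<longrightarrow> claw_free G') \<and>
     fractional_chromatic_number G' = fractional_chromatic_number G \<and>
     chromatic_number (complement G') = chromatic_number (complement G)"

context
  fixes vs :: "'a list" and n :: nat
  assumes vs: "distinct vs" "length vs = n"
begin

lemma inj_nth: "inj_on ((!) vs) {..<n}" and nth_image: "(!) vs ` {..<n} = set vs"
  using vs inj_on_nth[of vs "{..<n}"] by (auto simp: in_set_conv_nth)

lemma verts_graph_of [simp]: "verts (graph_of vs R) = set vs"
  by (simp add: graph_of_def)

lemma adj_graph_ofE: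
  assumes "is_graph n R" "adj (graph_of vs R) u v"
  obtains i j where "i < n" "j < n" "u = vs ! i" "v = vs ! j" "R i j"
  using assms unfolding adj_def graph_of_def is_graph_def by (auto simp: doubleton_eq_iff)

lemma adj_graph_of:
  assumes gr: "is_graph n R" and ij: "i < n" "j < n"
  shows "adj (graph_of vs R) (vs ! i) (vs ! j) \<longleftrightarrow> R i j"
proof
  assume "adj (graph_of vs R) (vs ! i) (vs ! j)"
  then obtain i' j' where "i' < n" "j' < n" "vs ! i = vs ! i'" "vs ! j = vs ! j'" "R i' j'"
    using adj_graph_ofE[OF gr] by metis
  then show "R i j" using ij inj_nth unfolding inj_on_def by auto
qed (auto simp: adj_def graph_of_def)

lemma fin_graph_graph_of:
  assumes gr: "is_graph n R"
  shows "fin_graph (graph_of vs R)"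
  unfolding fin_graph_def
proof (intro conjI ballI)
  fix e assume "e \<in> edges (graph_of vs R)"
  then obtain i j where ij: "e = {vs ! i, vs ! j}" "R i j" by (auto simp: graph_of_def)
  then have "i < n" "j < n" "i \<noteq> j" using gr unfolding is_graph_def by blast+
  then have "vs ! i \<in> set vs" "vs ! j \<in> set vs" "vs ! i \<noteq> vs ! j"
    using vs nth_eq_iff_index_eq by auto
  then show "\<exists>u\<in>verts (graph_of vs R). \<exists>v\<in>verts (graph_of vs R). u \<noteq> v \<and> e = {u, v}" using ij(1) by auto
qed simp

lemma graph_of_index:
  assumes fg: "fin_graph G" and "set vs = verts G" and R: "R = (\<lambda>i j. i < n \<and> j < n \<and> adj G (vs ! i) (vs ! j))"
  shows "graph_of vs R = G" "is_graph n R"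
proof -
  show "is_graph n R" unfolding is_graph_def R using adj_sym[of G] adj_verts(3)[OF fg] by metis
  have "e \<in> edges (graph_of vs R) \<longleftrightarrow> e \<in> edges G" for e
  proof
    assume "e \<in> edges G"
    then obtain u v where uv: "u \<in> set vs" "v \<in> set vs" "e = {u, v}"
      using fg assms(2) unfolding fin_graph_def by metis
    then obtain i j where "i < n" "j < n" "u = vs ! i" "v = vs ! j" using vs(2) by (metis in_set_conv_nth)
    then show "e \<in> edges (graph_of vs R)" using uv(3) \<open>e \<in> edges G\<close> unfolding graph_of_def R adj_def by auto
  qed (auto simp: graph_of_def R adj_def)
  then show "graph_of vs R = G" using assms(2) by (intro graph.equality) auto
qed

lemma k_colouring_graph_of:
  assumes gr: "is_graph n R"
  shows "k_colouring (graph_of vs R) k f \<longleftrightarrow> proper n R k (\<lambda>i. f (vs ! i))"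
proof -
  have "(\<forall>v\<in>set vs. P v) \<longleftrightarrow> (\<forall>i<n. P (vs ! i))" for P using vs(2) all_set_conv_all_nth by blast
  then have "k_colouring (graph_of vs R) k f \<longleftrightarrow> (\<forall>i<n. f (vs ! i) < k) \<and> (\<forall>i<n. \<forall>j<n. R i j \<longrightarrow> f (vs ! i) \<noteq> f (vs ! j))"
    unfolding k_colouring_def verts_graph_of by (simp add: adj_graph_of[OF gr])
  then show ?thesis using gr unfolding proper_def is_graph_def by blast
qed

lemma skeletal_graph_of:
  assumes gr: "is_graph n R" and clean: "\<And>x a. R x a \<Longrightarrow> clean {..<n} R x a"
  shows "skeletal (graph_of vs R)"
  unfolding skeletal_def
proof (intro allI impI, rule ccontr)
  let ?G = "graph_of vs R"
  fix A B assume h: "homogeneous_pair ?G A B" and ns: "\<not> skeletal_pair ?G A B"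
  have bad: "bad (adj ?G) A B" by (rule nonskeletal_bad[OF fin_graph_graph_of[OF gr] h ns])
  have homog: "homog (set vs) (adj ?G) A B" using h unfolding homogeneous_pair_homog by simp
  define A0 where "A0 = {i. i < n \<and> vs ! i \<in> A}"
  define B0 where "B0 = {i. i < n \<and> vs ! i \<in> B}"
  have sub: "A0 \<subseteq> {..<n}" "B0 \<subseteq> {..<n}" unfolding A0_def B0_def by auto
  have "A \<subseteq> set vs" "B \<subseteq> set vs" using homog unfolding homog_def by blast+
  then have eq: "A = (!) vs ` A0" "B = (!) vs ` B0"
    unfolding A0_def B0_def using vs(2) by (auto simp: in_set_conv_nth image_iff subset_iff)
  have S: "adj ?G (vs ! i) (vs ! j) = R i j" if "i \<in> {..<n}" "j \<in> {..<n}" for i j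
    using adj_graph_of[OF gr] that by simp
  have "bad R A0 B0" using bad bad_image[where S = "adj ?G" and R = R, OF inj_nth S sub] unfolding eq by simp
  moreover have "homog {..<n} R A0 B0"
    using homog homog_image[where S = "adj ?G" and R = R, OF inj_nth S sub] unfolding eq nth_image by simp
  ultimately show False using bad_not_clean[OF gr] clean by blast
qed

lemma reduct_reduction_step:
  assumes gr: "is_graph n R" and st: "reduction_step n R R' PA PB \<mu>"
  shows "reduct (graph_of vs R') (graph_of vs R)"
proof -
  let ?G = "graph_of vs R" and ?G' = "graph_of vs R'"
  let ?A = "(!) vs ` set PA" and ?B = "(!) vs ` set PB"
  obtain Q where I: "homog {..<n} R (set PA) (set PB)" "distinct PA" "distinct PB" "\<mu> \<le> length PA" "\<mu> \<le> length PB"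
      "\<forall>i<\<mu>. \<not> R (PB ! i) (PA ! i)" "\<exists>a\<in>set PA. \<exists>b\<in>set PB. \<not> R a b"
    and Q: "Q \<subseteq> set PA \<union> set PB" "is_clique R' Q" "card Q + \<mu> = length PA + length PB"
    and R': "is_graph n R'" "\<forall>u v. R' u v \<longrightarrow> R u v"
      "\<forall>u v. R u v \<longrightarrow> \<not> R' u v \<longrightarrow> u \<in> set PA \<and> v \<in> set PB \<or> u \<in> set PB \<and> v \<in> set PA"
    using st unfolding reduction_step_def by blast
  have sub: "set PA \<subseteq> {..<n}" "set PB \<subseteq> {..<n}" using I(1) unfolding homog_def by blast+
  have lt: "x < n" if "x \<in> set PA \<union> set PB" for x using that sub by blast
  note fg = fin_graph_graph_of[OF gr] fin_graph_graph_of[OF R'(1)]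
  have sube: "edges ?G' \<subseteq> edges ?G" using R'(2) by (auto simp: graph_of_def)
  have S: "adj ?G (vs ! i) (vs ! j) = R i j" "adj ?G' (vs ! i) (vs ! j) = R' i j"
    if "i \<in> {..<n}" "j \<in> {..<n}" for i j
    using adj_graph_of[OF gr] adj_graph_of[OF R'(1)] that by simp_all
  have g: "pair_step ?G ?G' ?A ?B"
    unfolding pair_step_def
  proof (intro conjI allI impI)
    show "homog (verts ?G) (adj ?G) ?A ?B"
      using I(1) homog_image[where S = "adj ?G" and R = R, OF inj_nth S(1) sub] unfolding nth_image by simp
    show "adj ?G u v" if "adj ?G' u v" for u v using that sube unfolding adj_def by blast
    show "u \<in> ?A \<and> v \<in> ?B \<or> u \<in> ?B \<and> v \<in> ?A" if uv: "adj ?G u v" "\<not> adj ?G' u v" for u v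
    proof -
      obtain i j where ij: "i < n" "j < n" "u = vs ! i" "v = vs ! j" "R i j" using adj_graph_ofE[OF gr uv(1)] by metis
      then have "\<not> R' i j" using uv(2) S(2)[of i j] by simp
      then show ?thesis using R'(3) ij by blast
    qed
    obtain a b where ab: "a \<in> set PA" "b \<in> set PB" "\<not> R a b" using I(7) by blast
    then have "\<not> adj ?G (vs ! a) (vs ! b)" using S(1)[of a b] lt by simp
    then show "\<exists>a\<in>?A. \<exists>b\<in>?B. \<not> adj ?G a b" using ab by blast
  qed (use fg in simp_all)
  have "fractional_chromatic_number ?G' = fractional_chromatic_number ?G"
  proof (rule pair_step_fractional_number[OF g, of "map ((!) vs) PA" "map ((!) vs) PB" \<mu> "(!) vs ` Q"])
    show "distinct (map ((!) vs) PA)" "distinct (map ((!) vs) PB)"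
      using I(2,3) inj_on_subset[OF inj_nth] sub by (simp_all add: distinct_map)
    show "\<not> adj ?G (map ((!) vs) PA ! i) (map ((!) vs) PB ! i)" if "i < \<mu>" for i
    proof -
      have i: "i < length PA" "i < length PB" using that I(4,5) by auto
      then have "PA ! i < n" "PB ! i < n" using lt by auto
      moreover have "\<not> R (PA ! i) (PB ! i)" using I(6) that is_graph_sym[OF gr] by blast
      ultimately show ?thesis using S(1) i by simp
    qed
    have Qn: "Q \<subseteq> {..<n}" using Q(1) sub by blast
    show "is_clique (adj ?G') ((!) vs ` Q)"
      using Q(2) is_clique_image[where S = "adj ?G'" and R = R', OF inj_nth S(2) Qn] by simp
    show "card ((!) vs ` Q) + \<mu> = length (map ((!) vs) PA) + length (map ((!) vs) PB)"
      using Q(3) card_image[OF inj_on_subset[OF inj_nth Qn]] by simp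
  qed (use I Q in auto)
  then show ?thesis
    unfolding reduct_def subgraph_def
    using fg sube pair_step_quasi_line[OF g] pair_step_claw_free[OF g] pair_step_complement[OF g] by simp
qed

lemma reduct_chain:
  assumes gr: "is_graph n (Rs 0)" and ch: "chain n Rs r s" and i: "i \<le> r"
  shows "is_graph n (Rs i) \<and> reduct (graph_of vs (Rs i)) (graph_of vs (Rs 0))"
  using i
proof (induction i)
  case 0
  then show ?case using gr fin_graph_graph_of[OF gr] unfolding reduct_def subgraph_def by simp
next
  case (Suc i)
  then have IH: "is_graph n (Rs i)" "reduct (graph_of vs (Rs i)) (graph_of vs (Rs 0))" by simp_all
  obtain PA PB \<mu> where st: "reduction_step n (Rs i) (Rs (Suc i)) PA PB \<mu>"
    using ch Suc.prems unfolding chain_def by (meson Suc_le_lessD)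
  have "is_graph n (Rs (Suc i))" using st unfolding reduction_step_def by blast
  moreover have "reduct (graph_of vs (Rs (Suc i))) (graph_of vs (Rs 0))"
    using reduct_reduction_step[OF IH(1) st] IH(2) unfolding reduct_def subgraph_def by auto
  ultimately show ?case ..
qed

lemma extend_colouring:
  assumes ch: "chain n Rs r s" and gr: "is_graph n (Rs 0)" and f: "k_colouring (graph_of vs (Rs r)) k f"
  shows "\<exists>f' s' t'. run extend_prog (load_colouring vs (graph_of vs (Rs r)) k f s) t' s' \<and>
    colouring_output vs f' s' \<and> k_colouring (graph_of vs (Rs 0)) k f' \<and> t' \<le> r * (extend_time n + 3) + 3 * n + 10"
proof -
  let ?s = "load_colouring vs (graph_of vs (Rs r)) k f s"
  have ch': "chain n Rs r ?s" using ch unfolding chain_def recorded_def arr_def load_colouring_def by simp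
  have gr': "is_graph n (Rs r)" using reduct_chain[OF gr ch, of r] by simp
  have col: "arrays ?s ''subcol'' i = f (vs ! i)" if "i < n" for i
    using that vs(2) by (simp add: load_colouring_def)
  have "proper n (Rs r) k (\<lambda>i. f (vs ! i))" using f unfolding k_colouring_graph_of[OF gr'] .
  then have "proper n (Rs r) k (arrays ?s ''subcol'')"
    using gr' col unfolding proper_def is_graph_def by metis
  from wp_extend[OF ch' gr this] obtain t' s' where run: "run extend_prog ?s t' s'"
    and p: "proper n (Rs 0) k (arrays s' ''col'')" "t' \<le> r * (extend_time n + 3) + 3 * n + 10"
    unfolding wp_def by blast
  \<comment> \<open>Colours are stored by index; inverting the enumeration gives a function on
    vertices.\<close>
  define f' where "f' v = arrays s' ''col'' (inv_into {..<n} ((!) vs) v)" for v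
  have f': "f' (vs ! i) = arrays s' ''col'' i" if "i < n" for i
    unfolding f'_def using inv_into_f_f[OF inj_nth, of i] that by simp
  have "proper n (Rs 0) k (\<lambda>i. f' (vs ! i))" using p(1) gr f' unfolding proper_def is_graph_def by metis
  then have "k_colouring (graph_of vs (Rs 0)) k f'" unfolding k_colouring_graph_of[OF gr] .
  moreover have "colouring_output vs f' s'" using f' vs(2) unfolding colouring_output_def by simp
  ultimately show ?thesis using run p(2) by blast
qed

text \<open>Colourings restrict to a subgraph. Conversely, the verified program that extends
  colourings is itself the proof that the subgraph cannot do with fewer colours.\<close>

lemma chain_chromatic:
  assumes ch: "chain n Rs r s" and gr: "is_graph n (Rs 0)"
  shows "chromatic_number (graph_of vs (Rs r)) = chromatic_number (graph_of vs (Rs 0))"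
proof -
  have "subgraph (graph_of vs (Rs r)) (graph_of vs (Rs 0))" using reduct_chain[OF gr ch, of r] unfolding reduct_def by simp
  then have "k_colouring (graph_of vs (Rs r)) k f" if "k_colouring (graph_of vs (Rs 0)) k f" for k f
    using that unfolding subgraph_def k_colouring_def adj_def by auto
  then have "(\<exists>f. k_colouring (graph_of vs (Rs r)) k f) = (\<exists>f. k_colouring (graph_of vs (Rs 0)) k f)" for k
    using extend_colouring[OF ch gr] by blast
  then show ?thesis unfolding chromatic_number_def by simp
qed

end

section \<open>Arithmetic of the running times, and the final assembly\<close>

section \<open>Bounds on the running times\<close>

lemma clique_card:
  assumes gr: "is_graph n R" and K: "K \<subseteq> {..<n}" "is_clique R K"
  shows "card K * card K \<le> card {(u, v). R u v} + card K"
proof -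
  have fin: "finite K" "finite {(u, v). R u v}" using K(1) finite_subset finite_edges[OF gr] by auto
  have "K \<times> K \<subseteq> {(u, v). R u v} \<union> (\<lambda>x. (x, x)) ` K" using K(2) unfolding is_clique_def by auto
  then have "card (K \<times> K) \<le> card ({(u, v). R u v} \<union> (\<lambda>x. (x, x)) ` K)" using fin by (intro card_mono) auto
  also have "\<dots> \<le> card {(u, v). R u v} + card ((\<lambda>x. (x, x)) ` K)" by (rule card_Un_le)
  also have "card ((\<lambda>x. (x, x)) ` K) = card K" by (rule card_image) (simp add: inj_on_def)
  finally show ?thesis by (simp add: card_cartesian_product)
qed

text \<open>By \<open>clique_card\<close> a clique of size \<open>x\<close> satisfies
  \<open>x * x \<le> M + x\<close>. The greatest solution \<open>q\<close> bounds both cliques, and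
  \<open>2 * q\<close> serves as \<open>B\<close>.\<close>

lemma clique_pair_bound_exists:
  assumes gr: "is_graph n R"
  shows "\<exists>B. clique_pair_bound n R B \<and> B * B \<le> 8 * card {(u, v). R u v} + 4"
proof -
  define M where "M = card {(u, v). R u v}"
  define q where "q = (GREATEST q. q * q \<le> M + q)"
  have le: "x \<le> M + 1" if "x * x \<le> M + x" for x
  proof (rule ccontr)
    assume "\<not> x \<le> M + 1"
    then have "(M + 2) * x \<le> x * x" by (intro mult_le_mono1) simp
    then show False using that \<open>\<not> x \<le> M + 1\<close> by (simp add: algebra_simps)
  qed
  have q: "q * q \<le> M + q" unfolding q_def by (rule GreatestI_nat[of _ 0 "M + 1"]) (use le in auto)
  have qmax: "x \<le> q" if "x * x \<le> M + x" for x
    unfolding q_def by (rule Greatest_le_nat[where b = "M + 1"]) (use that le in auto)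
  have "clique_pair_bound n R (2 * q)"
    unfolding clique_pair_bound_def
  proof (intro allI impI)
    fix K K' assume "K \<subseteq> {..<n}" "K' \<subseteq> {..<n}" "is_clique R K" "is_clique R K'"
    then have "card K \<le> q" "card K' \<le> q" using qmax clique_card[OF gr] unfolding M_def by blast+
    then show "card K + card K' \<le> 2 * q" by simp
  qed
  \<comment> \<open>For \<open>q\<close> at least 2 the defining inequality gives
    \<open>q \<le> M\<close>; the summand 4 is for \<open>q\<close> equal to 1.\<close>
  moreover have "2 * q * (2 * q) \<le> 8 * M + 4"
  proof (cases "q \<le> 1")
    case True
    then have "q = 0 \<or> q = 1" by auto
    then show ?thesis by auto
  next
    case False
    then have "2 * q \<le> q * q" by (intro mult_le_mono1) simp
    moreover have "2 * q * (2 * q) = 4 * (q * q)" by simp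
    ultimately show ?thesis using q by linarith
  qed
  ultimately show ?thesis unfolding M_def by blast
qed

text \<open>There are at most \<open>M + 1\<close> passes. Within a pass, \<open>M\<close> seeds
  cost O(n + M) each, and the only matching has O(B) rounds of O(n + B^3). As B^2 is O(M), both
  contributions are O(n M + M^2) and hence O(n^2 + M^2).\<close>

lemma reduce_time_bound:
  assumes M: "1 \<le> M" and n: "1 \<le> n" and B: "B * B \<le> 8 * M + 4"
  shows "(M + 1) * (pass_time n M B + 1) + n * (3 * n + 5) + 10 \<le> 20000 * (M * (M * M + n * n))"
proof -
  have X: "B * B \<le> 12 * M" using B M by simp
  have BX: "B \<le> 12 * M" using le_square[of B] X by linarith
  have MM: "M \<le> M * M" and nn: "n \<le> n * n" by (rule le_square)+
  have nM: "n * M \<le> n * n + M * M"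
  proof (cases "n \<le> M")
    case True
    then show ?thesis using mult_le_mono1[OF True, of M] by linarith
  next
    case False
    then show ?thesis using mult_le_mono2[of M n n] by linarith
  qed
  have MMn: "n \<le> n * M" using M by simp
  have b1: "B * (6 * B + 5) \<le> 132 * M"
  proof -
    have "B * (6 * B + 5) = 6 * (B * B) + 5 * B" by (simp add: algebra_simps)
    then show ?thesis using X BX by linarith
  qed
  have sq: "(B + 1) * (B + 1) \<le> 37 * M"
  proof -
    have "(B + 1) * (B + 1) = B * B + 2 * B + 1" by (simp add: algebra_simps)
    then show ?thesis using X BX M by linarith
  qed
  have b2: "B + 1 \<le> 37 * M" using le_square[of "B + 1"] sq by linarith
  have seed: "seed_time n M B \<le> 3 * n + 2000 * M"
  proof -
    have "(14 * B + 60) * B = 14 * (B * B) + 60 * B" by (simp add: algebra_simps)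
    then show ?thesis unfolding seed_time_def using X BX M by linarith
  qed
  have round: "round_time n B \<le> 3 * n + (B + 1) * (178 * M)"
  proof -
    have "(B + 1) * (B * (6 * B + 5) + 6) \<le> (B + 1) * (138 * M)" using b1 M by (intro mult_le_mono2) linarith
    moreover have "14 * B + 40 \<le> (B + 1) * (40 * M)"
    proof -
      have "(B + 1) * 40 \<le> (B + 1) * (40 * M)" using M by (intro mult_le_mono2) simp
      moreover have "14 * B + 40 \<le> (B + 1) * 40" by simp
      ultimately show ?thesis by (rule order_trans[rotated])
    qed
    moreover have "(B + 1) * (178 * M) = (B + 1) * (138 * M) + (B + 1) * (40 * M)" by (simp add: algebra_simps)
    ultimately show ?thesis unfolding round_time_def by linarith
  qed
  have match: "match_time n B \<le> 125 * (n * M) + 6600 * (M * M)"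
  proof -
    have "(B + 1) * round_time n B \<le> (B + 1) * (3 * n + (B + 1) * (178 * M))" using round by (rule mult_le_mono2)
    also have "\<dots> = (B + 1) * (3 * n) + (B + 1) * (B + 1) * (178 * M)" by (simp add: algebra_simps)
    also have "\<dots> \<le> 37 * M * (3 * n) + 37 * M * (178 * M)" by (intro add_mono mult_le_mono1 b2 sq)
    also have "\<dots> = 111 * (n * M) + 6586 * (M * M)" by simp
    finally show ?thesis unfolding match_time_def using MMn MM M by linarith
  qed
  have big: "big_time n B \<le> 125 * (n * M) + 7100 * (M * M)"
    unfolding big_time_def using match b1 BX MM M by linarith
  have pass: "pass_time n M B + 1 \<le> 150 * (n * n) + 9300 * (M * M)"
  proof -
    have "M * (seed_time n M B + 4) \<le> M * (3 * n + 2004 * M)" using seed M by (intro mult_le_mono2) linarith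
    also have "\<dots> = 3 * (n * M) + 2004 * (M * M)" by (simp add: algebra_simps)
    finally have 1: "M * (seed_time n M B + 4) \<le> 3 * (n * M) + 2004 * (M * M)" .
    have "n * (5 * n + 12) = 5 * (n * n) + 12 * n" by (simp add: algebra_simps)
    then show ?thesis unfolding pass_time_def using 1 big nM nn MM M by linarith
  qed
  have "(M + 1) * (pass_time n M B + 1) \<le> 2 * M * (150 * (n * n) + 9300 * (M * M))"
    using M pass by (intro mult_le_mono) linarith+
  also have "\<dots> = 300 * (M * (n * n)) + 18600 * (M * (M * M))" by (simp add: algebra_simps)
  finally have 1: "(M + 1) * (pass_time n M B + 1) \<le> 300 * (M * (n * n)) + 18600 * (M * (M * M))" .
  have 2: "n * (3 * n + 5) = 3 * (n * n) + 5 * n" by (simp add: algebra_simps)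
  have 3: "n * n \<le> M * (n * n)" using M by simp
  have 4: "20000 * (M * (M * M + n * n)) = 20000 * (M * (M * M)) + 20000 * (M * (n * n))"
    by (simp add: algebra_simps)
  show ?thesis using 1 2 3 4 nn n by linarith
qed

lemma extend_time_bound:
  assumes n: "1 \<le> n" and m: "1 \<le> m" and r: "r \<le> 2 * m"
  shows "r * (extend_time n + 3) + 3 * n + 10 \<le> 300 * (m * (n * n))"
proof -
  have nn: "n \<le> n * n" by (rule le_square)
  have e: "extend_time n + 3 \<le> 98 * (n * n)" unfolding extend_time_def using nn n by (simp only: mult.assoc)
  have "r * (extend_time n + 3) \<le> 2 * m * (98 * (n * n))" by (rule mult_le_mono[OF r e])
  also have "\<dots> = 196 * (m * (n * n))" by simp
  finally have 1: "r * (extend_time n + 3) \<le> 196 * (m * (n * n))" .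
  have "n * n \<le> m * (n * n)" using m by simp
  then show ?thesis using 1 nn n by linarith
qed

text \<open>The bounds proved so far are in terms of \<open>n * n\<close>; this is where the
  exponent 5/2 of the claim comes in.\<close>

lemma square_le_powr: "real (n * n) \<le> real n powr (5 / 2)"
proof (cases "n = 0")
  case False
  have "real (n * n) = real n powr 2" using False by (simp add: powr_numeral power2_eq_square)
  also have "\<dots> \<le> real n powr (5 / 2)" using False by (intro powr_mono) auto
  finally show ?thesis .
qed simp

text \<open>As \<open>y\<close> is at least 2, a constant factor \<open>D\<close> is dominated by
  \<open>y ^ D\<close>. This is how the constants of the running times vanish into the exponent of
  the word bound.\<close>

lemma power_word_bound:
  fixes x y D K :: nat
  assumes "x \<le> D * y ^ 6" "2 \<le> y"
  shows "x ^ K \<le> y ^ ((D + 6) * K)"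
proof -
  have "D \<le> 2 ^ D" by (rule less_imp_le) (rule less_exp)
  also have "(2::nat) ^ D \<le> y ^ D" by (rule power_mono) (use assms(2) in auto)
  finally have "x \<le> y ^ D * y ^ 6" using assms(1) order_trans mult_le_mono1 by blast
  then have "x ^ K \<le> (y ^ (D + 6)) ^ K" by (intro power_mono) (simp_all add: power_add)
  then show ?thesis by (simp add: power_mult)
qed

text \<open>The bit \<open>u < v\<close> tells the two orientations of an edge apart.\<close>

lemma card_index_edges:
  assumes fg: "fin_graph G" and vs: "distinct vs" and R: "R = (\<lambda>i j. i < length vs \<and> j < length vs \<and> adj G (vs ! i) (vs ! j))"
  shows "card {(u, v). R u v} \<le> 2 * card (edges G)"
proof -
  define h where "h = (\<lambda>(u, v). ({vs ! u, vs ! v}, (u::nat) < v))"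
  have "edges G \<subseteq> Pow (verts G)" using fg unfolding fin_graph_def by auto
  then have fin: "finite (edges G)" using fg unfolding fin_graph_def by (meson finite_Pow_iff finite_subset)
  have "inj_on h {(u, v). R u v}"
  proof (rule inj_onI, clarify)
    fix u v u' v' assume r: "R u v" "R u' v'" and eq: "h (u, v) = h (u', v')"
    have "adj G (vs ! u) (vs ! v)" using r(1) unfolding R by blast
    then have "u \<noteq> v" using adj_verts(3)[OF fg] by blast
    moreover have "vs ! x = vs ! y \<longleftrightarrow> x = y" if "x < length vs" "y < length vs" for x y
      using vs that nth_eq_iff_index_eq by blast
    ultimately show "u = u' \<and> v = v'" using r eq unfolding R h_def by (auto simp: doubleton_eq_iff)
  qed
  moreover have "h ` {(u, v). R u v} \<subseteq> edges G \<times> UNIV" unfolding h_def R adj_def by auto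
  ultimately have "card {(u, v). R u v} \<le> card (edges G \<times> (UNIV :: bool set))"
    using fin by (intro card_inj_on_le) auto
  then show ?thesis by (simp add: card_cartesian_product)
qed

lemma card_edges_le:
  assumes fg: "fin_graph G"
  shows "card (edges G) \<le> card (verts G) * card (verts G)"
proof -
  have fin: "finite (verts G \<times> verts G)" using fg unfolding fin_graph_def by blast
  have "edges G \<subseteq> (\<lambda>(u, v). {u, v}) ` (verts G \<times> verts G)" using fg unfolding fin_graph_def by force
  then have "card (edges G) \<le> card (verts G \<times> verts G)" using fin surj_card_le by blast
  then show ?thesis by (simp add: card_cartesian_product)
qed

lemma nonskeletal_edge:
  assumes "\<not> skeletal G"
  shows "\<exists>u v. adj G u v"
  using assms unfolding skeletal_def skeletal_pair_def by blast

theorem theorem2p1: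
  shows "\<exists>(reduce :: com) (extend :: com) (c :: nat).
    \<forall>(G :: 'a graph) (vs :: 'a list) (n :: nat) (m :: nat).
      fin_graph G \<longrightarrow> \<not> skeletal G \<longrightarrow> distinct vs \<longrightarrow> set vs = verts G \<longrightarrow>
      n = card (verts G) \<longrightarrow> m = card (edges G) \<longrightarrow>
      (\<exists>(G' :: 'a graph) (s :: store) (t :: nat).
        subgraph G' G \<and> skeletal G' \<and>
        (quasi_line G \<longrightarrow> quasi_line G') \<and>
        (claw_free G \<longrightarrow> claw_free G') \<and>
        chromatic_number G' = chromatic_number G \<and>
        fractional_chromatic_number G' = fractional_chromatic_number G \<and>
        (chromatic_number (complement G) = 3 \<longrightarrow> chromatic_number (complement G') = 3) \<and>
        exec ((n + 2) ^ c) reduce (graph_input vs G) t s \<and>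
        subgraph_output vs G' s \<and>
        real t \<le> real c * (real m * (real m ^ 2 + real n powr (5 / 2))) \<and>
        (\<forall>(k :: nat) (f :: 'a \<Rightarrow> nat). k_colouring G' k f \<longrightarrow>
          (\<exists>(f' :: 'a \<Rightarrow> nat) (s' :: store) (t' :: nat).
            exec ((n + k + 2) ^ c) extend (load_colouring vs G' k f s) t' s' \<and>
            colouring_output vs f' s' \<and>
            k_colouring G k f' \<and>
            real t' \<le> real c * (real m * real n powr (5 / 2)))))"
proof -
  \<comment> \<open>One \<open>K\<close> covers both programs, since the extension starts in the
    memory that the reduction leaves behind. \<open>D\<close> dominates \<open>K\<close> times the
    running times plus the initial values, measured in sixth powers of the input size.
    \<open>c\<close> is the exponent of the word bounds and at the same time the constant of the
    time bounds.\<close>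
  define K where "K = Suc (com_size reduce_prog + com_size extend_prog)"
  define D where "D = 400000 * K"
  define c where "c = (D + 6) * K"
  have cK: "com_size reduce_prog \<le> K" "com_size extend_prog \<le> K" "1 \<le> K" unfolding K_def by simp_all
  have D4: "400000 \<le> D" using cK(3) unfolding D_def by simp
  have "D + 6 \<le> c" using mult_le_mono2[OF cK(3), of "D + 6"] unfolding c_def by simp
  then have c4: "400000 \<le> c" using D4 by linarith
  show ?thesis
  proof (rule exI[of _ reduce_prog], rule exI[of _ extend_prog], rule exI[of _ c], intro allI impI)
    fix G :: "'a graph" and vs :: "'a list" and n m :: nat
    assume fg: "fin_graph G" and ns: "\<not> skeletal G" and dv: "distinct vs" and sv: "set vs = verts G"
      and n_def: "n = card (verts G)" and m_def: "m = card (edges G)"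
    have len: "length vs = n" using dv sv n_def distinct_card by metis
    define R0 where "R0 = (\<lambda>i j. i < n \<and> j < n \<and> adj G (vs ! i) (vs ! j))"
    define M where "M = card {(u, v). R0 u v}"
    note gi = graph_of_index[OF dv len fg sv R0_def]
    obtain u v where uv: "adj G u v" using nonskeletal_edge[OF ns] by blast
    then have "u \<in> set vs" "v \<in> set vs" using adj_verts[OF fg] sv by blast+
    then obtain i j where ij: "i < n" "j < n" "u = vs ! i" "v = vs ! j" using len by (metis in_set_conv_nth)
    then have n1: "1 \<le> n" by simp
    have "(i, j) \<in> {(u, v). R0 u v}" using ij uv unfolding R0_def by simp
    then have M1: "1 \<le> M" using finite_edges[OF gi(2)] unfolding M_def
      by (metis One_nat_def Suc_leI card_gt_0_iff empty_iff)
    have Mm: "M \<le> 2 * m" unfolding M_def m_def by (rule card_index_edges[OF fg dv]) (simp add: R0_def len)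
    then have m1: "1 \<le> m" using M1 by linarith
    have mn: "m \<le> n * n" using card_edges_le[OF fg] unfolding m_def n_def .
    obtain B where B: "clique_pair_bound n R0 B" "B * B \<le> 8 * M + 4"
      using clique_pair_bound_exists[OF gi(2)] unfolding M_def by blast
    let ?s0 = "graph_input vs G"
    have s0n: "vars ?s0 ''n'' = n" by (simp add: graph_input_def len)
    have s0a: "arrays ?s0 ''adj'' (i * n + j) = of_bool (R0 i j)" if "i < n" "j < n" for i j
    proof -
      have "i * n + j < Suc i * n" using that by simp
      also have "\<dots> \<le> n * n" using that(1) by (intro mult_le_mono1) simp
      finally show ?thesis using that by (simp add: graph_input_def len R0_def)
    qed
    \<comment> \<open>The entries of the adjacency matrix are at most 1, hence
      \<open>n + 1\<close>.\<close>
    have s0b: "bounded (n + 1) ?s0" unfolding bounded_def graph_input_def by (simp add: len)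
    from wp_reduce[OF gi(2) s0n s0a B(1) M_def] obtain t s Rs r where run: "run reduce_prog ?s0 t s"
      and t: "t \<le> (M + 1) * (pass_time n M B + 1) + n * (3 * n + 5) + 10"
      and ch: "Rs 0 = R0" "chain n Rs r s" "matrix_stored n (Rs r) s" "is_graph n (Rs r)" "r \<le> M"
        "\<forall>x a. Rs r x a \<longrightarrow> clean {..<n} (Rs r) x a" "\<forall>i<n. arrays s ''subverts'' i = 1"
      unfolding wp_def by blast
    have gr0: "is_graph n (Rs 0)" using gi(2) ch(1) by simp
    let ?G' = "graph_of vs (Rs r)"
    have G0: "graph_of vs (Rs 0) = G" using gi(1) ch(1) by simp
    have red: "reduct ?G' G" using reduct_chain[OF dv len gr0 ch(2), of r] G0 by simp
    \<comment> \<open>\<open>M\<close> counts each edge in both orientations; replacing it by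
      \<open>2 * m\<close> costs a factor of 8.\<close>
    have t1: "t \<le> 160000 * (m * (m * m + n * n))"
    proof -
      have "t \<le> 20000 * (M * (M * M + n * n))" using t reduce_time_bound[OF M1 n1 B(2)] by linarith
      also have "\<dots> \<le> 20000 * (2 * m * (2 * m * (2 * m) + 4 * (n * n)))"
      proof (intro mult_le_mono2 mult_le_mono[OF Mm])
        show "M * M + n * n \<le> 2 * m * (2 * m) + 4 * (n * n)" using mult_le_mono[OF Mm Mm] by linarith
      qed
      also have "\<dots> = 160000 * (m * (m * m + n * n))" by (simp add: algebra_simps)
      finally show ?thesis .
    qed
    \<comment> \<open>With at most \<open>n * n\<close> edges both time bounds are of order
      \<open>y ^ 6\<close> for every \<open>y\<close> above \<open>n\<close>. The values
      \<open>n + 2\<close> and \<open>n + k + 2\<close> are the bases of the two word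
      bounds.\<close>
    have y6: "m * (m * m + n * n) \<le> 2 * y ^ 6" "m * (n * n) \<le> y ^ 6" if "n \<le> y" "1 \<le> y" for y
    proof -
      have ny2: "n * n \<le> y ^ 2" unfolding power2_eq_square by (rule mult_le_mono[OF that(1,1)])
      also have "y ^ 2 \<le> y ^ 4" by (rule power_increasing) (use that(2) in auto)
      finally have ny: "n * n \<le> y ^ 2" "n * n \<le> y ^ 4" using ny2 by blast+
      have my: "m \<le> y ^ 2" using mn ny by linarith
      have mm: "m * m \<le> y ^ 4" using mult_le_mono[OF my my] by (simp flip: power_add)
      have p6: "y ^ 2 * y ^ 4 = y ^ 6" by (simp flip: power_add)
      have "m * (m * m + n * n) \<le> y ^ 2 * (2 * y ^ 4)" using mm ny by (intro mult_le_mono[OF my]) linarith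
      then show "m * (m * m + n * n) \<le> 2 * y ^ 6"
        unfolding p6[symmetric] by (simp only: mult.left_commute[of "y ^ 2" 2])
      show "m * (n * n) \<le> y ^ 6" using mult_le_mono[OF my ny(2)] p6 by simp
    qed
    have Kt: "K * t \<le> 320000 * K * y ^ 6" if "n \<le> y" "1 \<le> y" for y
    proof -
      have "t \<le> 320000 * y ^ 6" using t1 y6(1)[OF that] by linarith
      then show ?thesis using mult_le_mono2[of t _ K] by (simp add: ac_simps)
    qed
    have W1: "(n + 1 + K * t + 2) ^ K \<le> (n + 2) ^ c"
      unfolding c_def
    proof (rule power_word_bound)
      have "n + 2 \<le> (n + 2) ^ 6" by (rule self_le_power) auto
      moreover have "(n + 2) ^ 6 \<le> K * (n + 2) ^ 6" using cK(3) by simp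
      moreover have "K * t \<le> 320000 * (K * (n + 2) ^ 6)" using Kt[of "n + 2"] by (simp add: ac_simps)
      moreover have "D * (n + 2) ^ 6 = 400000 * (K * (n + 2) ^ 6)" unfolding D_def by simp
      ultimately show "n + 1 + K * t + 2 \<le> D * (n + 2) ^ 6" by linarith
    qed simp
    have ex: "exec ((n + 2) ^ c) reduce_prog ?s0 t s" "bounded (n + 1 + K * t) s"
      using run_exec[OF run tame_reduce cK(1) s0b W1] by simp_all
    have out: "subgraph_output vs ?G' s"
      unfolding subgraph_output_def len using ch(3,7) adj_graph_of[OF dv len ch(4)] matrix_storedD(2)[OF ch(3)]
      by (simp add: graph_of_def len)
    have tr: "real t \<le> real c * (real m * (real m ^ 2 + real n powr (5 / 2)))"
    proof -
      have "real t \<le> real (160000 * (m * (m * m + n * n)))" using t1 by (simp only: of_nat_le_iff)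
      also have "\<dots> = 160000 * (real m * (real m ^ 2 + real (n * n)))" by (simp add: power2_eq_square)
      also have "\<dots> \<le> real c * (real m * (real m ^ 2 + real n powr (5 / 2)))"
        using c4 square_le_powr[of n] by (intro mult_mono add_mono order_refl) auto
      finally show ?thesis .
    qed
    have ext: "\<exists>f' s' t'. exec ((n + k + 2) ^ c) extend_prog (load_colouring vs ?G' k f s) t' s' \<and>
        colouring_output vs f' s' \<and> k_colouring G k f' \<and> real t' \<le> real c * (real m * real n powr (5 / 2))"
      if f: "k_colouring ?G' k f" for k f
    proof -
      let ?s = "load_colouring vs ?G' k f s"
      from extend_colouring[OF dv len ch(2) gr0 f] obtain f' s' t' where e: "run extend_prog ?s t' s'"
        "colouring_output vs f' s'" "k_colouring G k f'" "t' \<le> r * (extend_time n + 3) + 3 * n + 10"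
        unfolding G0 by blast
      have "r \<le> 2 * m" using ch(5) Mm by linarith
      then have t2: "t' \<le> 300 * (m * (n * n))" using e(4) extend_time_bound[OF n1 m1] order_trans by blast
      have "f v \<le> k" if "v \<in> verts ?G'" for v using f that unfolding k_colouring_def by (simp add: less_imp_le)
      then have fk: "f v \<le> n + 1 + K * t + k" if "v \<in> verts ?G'" for v using that trans_le_add2 by blast
      \<comment> \<open>The extension inherits all values that the reduction has left in memory;
        loading a colouring adds \<open>k\<close> and colours below it.\<close>
      have "bounded (n + 1 + K * t + k) s" by (rule bounded_mono[OF ex(2)]) simp
      then have bd: "bounded (n + 1 + K * t + k) ?s"
        using fk unfolding bounded_def load_colouring_def by simp
      have W2: "(n + 1 + K * t + k + K * t' + 2) ^ K \<le> (n + k + 2) ^ c"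
        unfolding c_def
      proof (rule power_word_bound)
        let ?y = "n + k + 2"
        have "?y \<le> ?y ^ 6" by (rule self_le_power) auto
        moreover have "?y ^ 6 \<le> K * ?y ^ 6" using cK(3) by simp
        moreover have "K * t \<le> 320000 * (K * ?y ^ 6)" using Kt[of ?y] by (simp add: ac_simps)
        moreover have "K * t' \<le> 300 * (K * ?y ^ 6)"
        proof -
          have "t' \<le> 300 * ?y ^ 6" using t2 y6(2)[of ?y] by linarith
          then show ?thesis using mult_le_mono2[of t' _ K] by (simp add: ac_simps)
        qed
        moreover have "D * ?y ^ 6 = 400000 * (K * ?y ^ 6)" unfolding D_def by simp
        ultimately show "n + 1 + K * t + k + K * t' + 2 \<le> D * ?y ^ 6" by linarith
      qed simp
      have "exec ((n + k + 2) ^ c) extend_prog ?s t' s'"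
        using run_exec[OF e(1) tame_extend cK(2) bd W2] by simp
      moreover have "real t' \<le> real c * (real m * real n powr (5 / 2))"
      proof -
        have "real t' \<le> real (300 * (m * (n * n)))" using t2 by (simp only: of_nat_le_iff)
        also have "\<dots> = 300 * (real m * real (n * n))" by simp
        also have "\<dots> \<le> real c * (real m * real n powr (5 / 2))"
          using c4 square_le_powr[of n] by (intro mult_mono order_refl) auto
        finally show ?thesis .
      qed
      ultimately show ?thesis using e(2,3) by blast
    qed
    have sk: "skeletal ?G'" using skeletal_graph_of[OF dv len ch(4)] ch(6) by blast
    have chi: "chromatic_number ?G' = chromatic_number G" using chain_chromatic[OF dv len ch(2) gr0] unfolding G0 .
    show "\<exists>(G' :: 'a graph) (s :: store) (t :: nat).
        subgraph G' G \<and> skeletal G' \<and>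
        (quasi_line G \<longrightarrow> quasi_line G') \<and>
        (claw_free G \<longrightarrow> claw_free G') \<and>
        chromatic_number G' = chromatic_number G \<and>
        fractional_chromatic_number G' = fractional_chromatic_number G \<and>
        (chromatic_number (complement G) = 3 \<longrightarrow> chromatic_number (complement G') = 3) \<and>
        exec ((n + 2) ^ c) reduce_prog (graph_input vs G) t s \<and>
        subgraph_output vs G' s \<and>
        real t \<le> real c * (real m * (real m ^ 2 + real n powr (5 / 2))) \<and>
        (\<forall>(k :: nat) (f :: 'a \<Rightarrow> nat). k_colouring G' k f \<longrightarrow>
          (\<exists>(f' :: 'a \<Rightarrow> nat) (s' :: store) (t' :: nat).
            exec ((n + k + 2) ^ c) extend_prog (load_colouring vs G' k f s) t' s' \<and>
            colouring_output vs f' s' \<and>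
            k_colouring G k f' \<and>
            real t' \<le> real c * (real m * real n powr (5 / 2))))"
      by (rule exI[of _ ?G'], rule exI[of _ s], rule exI[of _ t])
        (use red sk chi ex(1) out tr ext in \<open>simp add: reduct_def\<close>)
  qed
qed

end
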